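(* Let $\beta>\beta_c$. There exists a constant $C=C(\beta)>0$ such that the following holds for every integer $\ell\ge1$ and all integers $0\le a<b\le\ell+1$. Let $\bar S=\bar S(a,b)$ be the infinite strip $\{1,\dots,\ell\}\times\mathbb Z$ with the horizontal slits $\{1,\dots,a\}\times\{0,1\}$ and $\{b,\dots,\ell\}\times\{0,1\}$ removed, with boundary conditions $\eta\in\{\pm1\}^{\mathbb Z^2\setminus\bar S}$ given by $\eta(x,y)=-1$ if $y>0$ and $\eta(x,y)=+1$ if $y\le0$. For an Ising configuration $\sigma$ on $\bar S$ let $\lambda=\lambda(\sigma)$ be its unique open contour in the dual $\bar S^*$, and for $i\in\mathbb Z$ let $H^*_i=\{\frac12,\dots,\ell+\frac12\}\times\{i+\frac12\}$. Then $$\pi^\eta_{\bar S}\bigl(\sigma:\ \lambda(\sigma)\text{ reaches }H^*_{x\sqrt\ell}\bigr)\le C\exp(-\kappa_\beta x^2)\qquad\text{for all }0\le x\le\sqrt\ell,$$ $$\pi^\eta_{\bar S}\bigl(\sigma:\ \lambda(\sigma)\text{ reaches }H^*_{h}\bigr)\le C\exp(-\kappa_\beta h)\qquad\text{for all }h\ge\ell,$$ where $\kappa_\beta>0$ is the constant in the sharp triangle inequality for the surface tension $\tau_\beta$.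
   Context: $\beta_c=\frac12\log(1+\sqrt2)$. $\pi^\eta_{\bar S}$ is the (unique) Gibbs measure on $\{\pm1\}^{\bar S}$ of the nearest-neighbour Ising model at inverse temperature $\beta$ (weights $e^{-\beta H}$, $H=-\sum_{x\sim y}\sigma_x\sigma_y$, no field) with spins outside $\bar S$ frozen to $\eta$. Contours: the dual lattice is $\mathbb Z^{2*}=\mathbb Z^2+(\frac12,\frac12)$; each edge $e$ of $\mathbb Z^2$ is crossed by a unique dual edge $e^*$. Given $\sigma$ on $\bar S$ extended by $\eta$, consider the dual edges $e^*$ of all edges $e=(x,y)$ with $\{x,y\}\cap\bar S\ne\emptyset$ and $\sigma_x\neq\sigma_y$. They are decomposed into edge-disjoint simple lines (contours) by the South-East splitting rule: at each dual site where four such dual edges meet, the North edge is joined to the East edge and the South edge to the West edge. A contour is closed if it is a loop, open otherwise. With b.c. $\eta$ there is almost surely a unique open contour, with endpoints $(a+\frac12,\frac12)$ and $(b-\frac12,\frac12)$ (trivial when $b=a+1$). "Reaches $H^*_h$" means containing a vertex of $H^*_h$; non-integer levels are understood up to rounding. Surface tension: for $\theta\in[-\pi/4,\pi/4]$ let $\vec n_\theta=(\cos\theta,\sin\theta)$, $\Lambda_L=\{-\lfloor L/2\rfloor,\dots,\lfloor L/2\rfloor\}^2$, and let $\eta_\theta(v)=+1$ if $\langle v,\vec n_\theta\rangle>0$ and $-1$ otherwise. With $Z^{\eta_\theta}_{\beta,\Lambda_L}$, $Z^+_{\beta,\Lambda_L}$ the Ising partition functions on $\Lambda_L$ with b.c.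 $\eta_\theta$ and all-plus, set $\tau_\beta(\theta)=-\lim_{L\to\infty}\frac{\cos\theta}{L}\log\frac{Z^{\eta_\theta}_{\beta,\Lambda_L}}{Z^+_{\beta,\Lambda_L}}$; this extends to an even function of period $\pi/2$ on $\mathbb R$. Extend to $x\in\mathbb R^2$ by $\tau_\beta(x)=\tau_\beta(\theta_x)|x|$, with $|x|$ the Euclidean norm and $\theta_x$ the angle of $x$ with $(1,0)$. It is known that for $\beta>\beta_c$ there is a constant $\kappa_\beta>0$ with (sharp triangle inequality) $\tau_\beta(x)+\tau_\beta(y)-\tau_\beta(x+y)\ge\kappa_\beta(|x|+|y|-|x+y|)$ for all $x,y\in\mathbb R^2$; fix such a $\kappa_\beta$. *)

theory Defs
  imports "HOL-Probability.Probability"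
begin

type_synonym site = "int \<times> int"
type_synonym config = "site \<Rightarrow> real"

section \<open>The Ising model\<close>

definition beta_c :: real where
  "beta_c = ln (1 + sqrt 2) / 2"

definition nn :: "site \<Rightarrow> site \<Rightarrow> bool" where
  "nn u v \<longleftrightarrow> \<bar>fst u - fst v\<bar> + \<bar>snd u - snd v\<bar> = 1"

definition lattice_edges :: "site set set" where
  "lattice_edges = {{u, v} | u v. nn u v}"

text \<open>Energy of the edges with at least one endpoint in the finite set \<open>\<Lambda>\<close>. The product over
  an edge \<open>{u, v}\<close> is \<open>\<sigma> u * \<sigma> v\<close>, and each unordered edge is counted once.\<close>

definition hamiltonian :: "site set \<Rightarrow> config \<Rightarrow> real" where
  "hamiltonian \<Lambda> \<sigma> = - (\<Sum>e | e \<in> lattice_edges \<and> e \<inter> \<Lambda> \<noteq> {}. \<Prod>v\<in>e. \<sigma> v)"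

definition boltzmann :: "real \<Rightarrow> site set \<Rightarrow> config \<Rightarrow> real" where
  "boltzmann \<beta> \<Lambda> \<sigma> = exp (- \<beta> * hamiltonian \<Lambda> \<sigma>)"

definition configs :: "site set \<Rightarrow> config \<Rightarrow> config set" where
  "configs \<Lambda> \<eta> = {\<sigma>. (\<forall>v\<in>\<Lambda>. \<sigma> v \<in> {-1, 1}) \<and> (\<forall>v. v \<notin> \<Lambda> \<longrightarrow> \<sigma> v = \<eta> v)}"

definition partition_function :: "real \<Rightarrow> site set \<Rightarrow> config \<Rightarrow> real" where
  "partition_function \<beta> \<Lambda> \<eta> = (\<Sum>\<sigma>\<in>configs \<Lambda> \<eta>. boltzmann \<beta> \<Lambda> \<sigma>)"

definition finite_gibbs_prob :: "real \<Rightarrow> site set \<Rightarrow> config \<Rightarrow> config set \<Rightarrow> real" where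
  "finite_gibbs_prob \<beta> \<Lambda> \<eta> A =
     (\<Sum>\<sigma>\<in>configs \<Lambda> \<eta> \<inter> A. boltzmann \<beta> \<Lambda> \<sigma>) / partition_function \<beta> \<Lambda> \<eta>"

definition spin_space :: "site set \<Rightarrow> config measure" where
  "spin_space S = (\<Pi>\<^sub>M v\<in>S. count_space {-1, 1})"

text \<open>Gibbs measures on \<open>{-1, 1}\<^sup>S\<close> with the spins outside \<open>S\<close> frozen to \<open>\<eta>\<close>, by the
  Dobrushin-Lanford-Ruelle equations. Here \<open>override_on \<eta> \<sigma> S\<close> is \<open>\<sigma>\<close> on \<open>S\<close> and \<open>\<eta>\<close> outside;
  \<open>restrict \<omega> S\<close> passes from a configuration on the whole lattice back to a point of
  \<^term>\<open>space (spin_space S)\<close>.\<close>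

definition gibbs_measure :: "real \<Rightarrow> site set \<Rightarrow> config \<Rightarrow> config measure \<Rightarrow> bool" where
  "gibbs_measure \<beta> S \<eta> \<mu> \<longleftrightarrow>
     prob_space \<mu> \<and> sets \<mu> = sets (spin_space S) \<and>
     (\<forall>\<Lambda> A. finite \<Lambda> \<longrightarrow> \<Lambda> \<subseteq> S \<longrightarrow> A \<in> sets \<mu> \<longrightarrow>
        measure \<mu> A =
          (\<integral>\<sigma>. finite_gibbs_prob \<beta> \<Lambda> (override_on \<eta> \<sigma> S) {\<omega>. restrict \<omega> S \<in> A} \<partial>\<mu>))"

section \<open>Surface tension\<close>

definition box :: "nat \<Rightarrow> site set" where
  "box L = {- int (L div 2)..int (L div 2)} \<times> {- int (L div 2)..int (L div 2)}"

definition eta_angle :: "real \<Rightarrow> config" where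
  "eta_angle \<theta> v = (if of_int (fst v) * cos \<theta> + of_int (snd v) * sin \<theta> > 0 then 1 else -1)"

definition tau_base :: "real \<Rightarrow> real \<Rightarrow> real" where
  "tau_base \<beta> \<theta> =
     - lim (\<lambda>L::nat. cos \<theta> / real L *
              ln (partition_function \<beta> (box L) (eta_angle \<theta>) /
                  partition_function \<beta> (box L) (\<lambda>_. 1)))"

text \<open>\<^const>\<open>tau_base\<close> is the surface tension for angles in \<open>[-pi/4, pi/4]\<close>; \<open>tau_angle\<close> is its
  extension with period \<open>pi/2\<close>. At \<open>\<theta> = pi/4\<close> the rounding selects the representative \<open>-pi/4\<close>,
  which is harmless because \<open>tau_base\<close> is even (reflect the box in the horizontal axis).\<close>

definition tau_angle :: "real \<Rightarrow> real \<Rightarrow> real" where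
  "tau_angle \<beta> \<theta> = tau_base \<beta> (\<theta> - of_int (round (\<theta> / (pi / 2))) * (pi / 2))"

definition surface_tension :: "real \<Rightarrow> real \<times> real \<Rightarrow> real" where
  "surface_tension \<beta> x = tau_angle \<beta> (Arg (Complex (fst x) (snd x))) * norm x"

definition sharp_triangle_constant :: "real \<Rightarrow> real \<Rightarrow> bool" where
  "sharp_triangle_constant \<beta> \<kappa> \<longleftrightarrow> \<kappa> > 0 \<and>
     (\<forall>x y. surface_tension \<beta> x + surface_tension \<beta> y - surface_tension \<beta> (x + y)
              \<ge> \<kappa> * (norm x + norm y - norm (x + y)))"

section \<open>Contours\<close>

text \<open>The dual site \<open>(i + 1/2, j + 1/2)\<close> is encoded by the pair of integers \<open>(i, j)\<close>. It is the
  centre of the unit square with corners \<open>plaquette (i, j)\<close>, so the two ends of the dual edge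
  crossing \<open>{u, v}\<close> are the centres of the two unit squares having \<open>{u, v}\<close> as a side.\<close>

type_synonym dual_site = "int \<times> int"
type_synonym dual_edge = "dual_site set"

definition plaquette :: "dual_site \<Rightarrow> site set" where
  "plaquette w = {fst w, fst w + 1} \<times> {snd w, snd w + 1}"

definition dual :: "site \<Rightarrow> site \<Rightarrow> dual_edge" where
  "dual u v = {w. {u, v} \<subseteq> plaquette w}"

lemma dual_horizontal: "dual (x, y) (x + 1, y) = {(x, y - 1), (x, y)}"
  by (auto simp: dual_def plaquette_def)

lemma dual_vertical: "dual (x, y) (x, y + 1) = {(x - 1, y), (x, y)}"
  by (auto simp: dual_def plaquette_def)

definition disagreement_edges :: "site set \<Rightarrow> config \<Rightarrow> dual_edge set" where
  "disagreement_edges S \<sigma> = {dual u v | u v. nn u v \<and> {u, v} \<inter> S \<noteq> {} \<and> \<sigma> u \<noteq> \<sigma> v}"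

definition north :: "dual_site \<Rightarrow> dual_edge" where "north w = {w, (fst w, snd w + 1)}"
definition south :: "dual_site \<Rightarrow> dual_edge" where "south w = {w, (fst w, snd w - 1)}"
definition east :: "dual_site \<Rightarrow> dual_edge" where "east w = {w, (fst w + 1, snd w)}"
definition west :: "dual_site \<Rightarrow> dual_edge" where "west w = {w, (fst w - 1, snd w)}"

text \<open>If exactly two edges of \<open>E\<close> meet at \<open>w\<close>, they are joined; if more meet, the splitting rule
  applies. Three edges can meet only at an endpoint of the open contour, where the disagreement
  between the two frozen spins beyond the endpoint is not recorded; the rule then joins the
  complete one of the two pairs and the third edge is an end of the open contour.\<close>

definition joined_at :: "dual_edge set \<Rightarrow> dual_site \<Rightarrow> dual_edge \<Rightarrow> dual_edge \<Rightarrow> bool" where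
  "joined_at E w e f \<longleftrightarrow>
     e \<in> E \<and> f \<in> E \<and> e \<noteq> f \<and> w \<in> e \<and> w \<in> f \<and>
     (card {g \<in> E. w \<in> g} = 2 \<or> {e, f} = {north w, east w} \<or> {e, f} = {south w, west w})"

definition joined :: "dual_edge set \<Rightarrow> dual_edge \<Rightarrow> dual_edge \<Rightarrow> bool" where
  "joined E e f \<longleftrightarrow> (\<exists>w. joined_at E w e f)"

definition contours :: "dual_edge set \<Rightarrow> dual_edge set set" where
  "contours E = {{f. (joined E)\<^sup>*\<^sup>* e f} | e. e \<in> E}"

definition is_loop :: "dual_edge set \<Rightarrow> dual_edge set \<Rightarrow> bool" where
  "is_loop E C \<longleftrightarrow> (\<exists>es. length es \<ge> 3 \<and> distinct es \<and> set es = C \<and>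
     (\<forall>i<length es. joined E (es ! i) (es ! (Suc i mod length es))))"

definition open_contours :: "dual_edge set \<Rightarrow> dual_edge set set" where
  "open_contours E = {C \<in> contours E. \<not> is_loop E C}"

section \<open>The slit strip\<close>

definition slit_strip :: "int \<Rightarrow> int \<Rightarrow> int \<Rightarrow> site set" where
  "slit_strip l a b = {1..l} \<times> UNIV - {1..a} \<times> {0, 1} - {b..l} \<times> {0, 1}"

definition eta_strip :: config where
  "eta_strip v = (if snd v > 0 then -1 else 1)"

text \<open>The dual sites of the open contour \<open>\<lambda>(\<sigma>)\<close>. For \<open>b = a + 1\<close> its two endpoints
  \<open>(a + 1/2, 1/2)\<close> and \<open>(b - 1/2, 1/2)\<close> coincide and it is reduced to that point. The value \<open>{}\<close>
  is used only on the null event that there is no unique open contour.\<close>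

definition lambda_sites :: "int \<Rightarrow> int \<Rightarrow> int \<Rightarrow> config \<Rightarrow> dual_site set" where
  "lambda_sites l a b \<sigma> =
     (let S = slit_strip l a b;
          E = disagreement_edges S (override_on eta_strip \<sigma> S)
      in if b = a + 1 then {(a, 0)}
         else if \<exists>!C. C \<in> open_contours E then \<Union> (THE C. C \<in> open_contours E)
         else {})"

definition H_star :: "int \<Rightarrow> int \<Rightarrow> dual_site set" where
  "H_star l i = {0..l} \<times> {i}"

text \<open>The event that \<open>\<lambda>\<close> reaches level \<open>h\<close>, non-integer levels being rounded down.\<close>

definition reaches_event :: "int \<Rightarrow> int \<Rightarrow> int \<Rightarrow> real \<Rightarrow> config set" where
  "reaches_event l a b h =
     {\<sigma> \<in> space (spin_space (slit_strip l a b)). lambda_sites l a b \<sigma> \<inter> H_star l \<lfloor>h\<rfloor> \<noteq> {}}"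

section \<open>Measurability of the event\<close>

text \<open>The final lemma shows that \<open>measure \<mu> (reaches_event l a b h)\<close> is a genuine probability
  (\<^const>\<open>measure\<close> is \<open>0\<close> on non-measurable sets).\<close>

definition dual_edges :: "dual_edge set" where "dual_edges = range (\<lambda>(u, v). dual u v)"

lemma countable_dual_edges: "countable dual_edges"
  unfolding dual_edges_def by simp

lemma disagreement_edges_subset: "disagreement_edges S \<sigma> \<subseteq> dual_edges"
  by (auto simp: disagreement_edges_def dual_edges_def)

lemma joined_in: "joined E e f \<Longrightarrow> e \<in> E \<and> f \<in> E"
  by (auto simp: joined_def joined_at_def)

lemma connected_in: "(joined E)\<^sup>*\<^sup>* e f \<Longrightarrow> e \<in> E \<Longrightarrow> f \<in> E"
  by (induction rule: rtranclp_induct) (auto dest: joined_in)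

lemma measurable_spin:
  "(\<lambda>\<sigma>. override_on \<eta> \<sigma> S v) \<in> borel_measurable (spin_space S)"
proof (cases "v \<in> S")
  case True
  have "(\<lambda>\<sigma>. \<sigma> v) \<in> spin_space S \<rightarrow>\<^sub>M count_space {-1, 1::real}"
    unfolding spin_space_def using True by (rule measurable_component_singleton)
  then have "(\<lambda>x::real. x) \<circ> (\<lambda>\<sigma>. \<sigma> v) \<in> borel_measurable (spin_space S)"
    by (rule measurable_comp) simp
  then show ?thesis using True by (simp add: override_on_def comp_def)
qed (simp add: override_on_def)

lemma pred_bex:
  assumes "countable I" "\<And>i. i \<in> I \<Longrightarrow> Measurable.pred M (P i)"
  shows "Measurable.pred M (\<lambda>\<sigma>. \<exists>i\<in>I. P i \<sigma>)"
proof -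
  have "{\<sigma> \<in> space M. \<exists>i\<in>I. P i \<sigma>} = (\<Union>i\<in>I. {\<sigma> \<in> space M. P i \<sigma>})" by auto
  moreover have "\<dots> \<in> sets M"
    using assms by (intro sets.countable_UN') (auto simp: pred_def)
  ultimately show ?thesis by (simp add: pred_def)
qed

lemma pred_ball:
  assumes "countable I" "\<And>i. i \<in> I \<Longrightarrow> Measurable.pred M (P i)"
  shows "Measurable.pred M (\<lambda>\<sigma>. \<forall>i\<in>I. P i \<sigma>)"
proof -
  have "Measurable.pred M (\<lambda>\<sigma>. \<not> (\<exists>i\<in>I. \<not> P i \<sigma>))"
    by (intro pred_intros_logic pred_bex assms)
  then show ?thesis by simp
qed

lemma pred_const: "Measurable.pred M (\<lambda>_. c)" by simp

lemma unique_member: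
  assumes U: "U = {{f. K e f} | e. P e}"
    and P: "\<And>e. P e \<Longrightarrow> e \<in> D" and K: "\<And>e f. P e \<Longrightarrow> K e f \<Longrightarrow> f \<in> D"
  shows "((\<exists>!C. C \<in> U) \<and> w \<in> \<Union> (THE C. C \<in> U)) \<longleftrightarrow>
    (\<exists>e\<in>D. P e \<and> (\<forall>e'\<in>D. P e' \<longrightarrow> (\<forall>f\<in>D. K e' f = K e f)) \<and> (\<exists>f\<in>D. w \<in> f \<and> K e f))"
    (is "?L = ?R")
proof -
  have ex: "(\<exists>C. C \<in> U \<and> Q C) = (\<exists>e. P e \<and> Q {f. K e f})" for Q
    unfolding U by auto
  have all: "(\<forall>D\<in>U. D = C) = (\<forall>e. P e \<longrightarrow> {f. K e f} = C)" for C
    unfolding U by auto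
  have coll: "(\<forall>f\<in>D. K e' f = K e f) \<longleftrightarrow> {f. K e' f} = {f. K e f}" if "P e" "P e'" for e e'
    using K[OF that(1)] K[OF that(2)] by blast
  have "?L \<longleftrightarrow> (\<exists>C. C \<in> U \<and> (\<forall>D\<in>U. D = C) \<and> w \<in> \<Union> C)"
  proof
    assume ?L
    then obtain C where "C \<in> U" "\<forall>D\<in>U. D = C" by (elim conjE ex1E) blast
    moreover from this have "(THE C. C \<in> U) = C" by (intro the_equality) blast+
    ultimately show "\<exists>C. C \<in> U \<and> (\<forall>D\<in>U. D = C) \<and> w \<in> \<Union> C" using \<open>?L\<close> by metis
  next
    assume "\<exists>C. C \<in> U \<and> (\<forall>D\<in>U. D = C) \<and> w \<in> \<Union> C"
    then obtain C where C: "C \<in> U" "\<forall>D\<in>U. D = C" "w \<in> \<Union> C" by blast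
    from C(1,2) have "(THE C. C \<in> U) = C" by (intro the_equality) blast+
    then show ?L using C by metis
  qed
  also have "\<dots> \<longleftrightarrow> (\<exists>e. P e \<and> (\<forall>D\<in>U. D = {f. K e f}) \<and> w \<in> \<Union> {f. K e f})"
    unfolding ex by (rule refl)
  also have "\<dots> \<longleftrightarrow> (\<exists>e. P e \<and> (\<forall>e'. P e' \<longrightarrow> {f. K e' f} = {f. K e f}) \<and> (\<exists>f. w \<in> f \<and> K e f))"
    unfolding all by (intro arg_cong[where f=Ex] HOL.ext) auto
  also have "\<dots> \<longleftrightarrow> (\<exists>e\<in>D. P e \<and> (\<forall>e'\<in>D. P e' \<longrightarrow> {f. K e' f} = {f. K e f}) \<and> (\<exists>f\<in>D. w \<in> f \<and> K e f))"
    unfolding Bex_def Ball_def using P K by (intro arg_cong[where f=Ex] HOL.ext) blast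
  also have "\<dots> \<longleftrightarrow> ?R"
    by (intro bex_cong ball_cong conj_cong imp_cong refl) (auto simp: coll)
  finally show ?thesis .
qed

context
  fixes M :: "config measure" and E :: "config \<Rightarrow> dual_edge set"
  assumes sub: "\<And>\<sigma>. E \<sigma> \<subseteq> dual_edges"
    and edge: "\<And>e. Measurable.pred M (\<lambda>\<sigma>. e \<in> E \<sigma>)"
begin

lemma pred_joined: "Measurable.pred M (\<lambda>\<sigma>. joined (E \<sigma>) e f)"
proof -
  have *: "card {g \<in> E \<sigma>. w \<in> g} = 2 \<longleftrightarrow>
      (\<exists>x\<in>dual_edges. \<exists>y\<in>dual_edges. x \<noteq> y \<and> (\<forall>z\<in>dual_edges. (z \<in> E \<sigma> \<and> w \<in> z) = (z = x \<or> z = y)))"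
    for \<sigma> w
  proof -
    have "card {g \<in> E \<sigma>. w \<in> g} = 2 \<longleftrightarrow> (\<exists>x y. {g \<in> E \<sigma>. w \<in> g} = {x, y} \<and> x \<noteq> y)"
      by (rule card_2_iff)
    also have "\<dots> \<longleftrightarrow> (\<exists>x\<in>dual_edges. \<exists>y\<in>dual_edges. x \<noteq> y \<and>
        (\<forall>z\<in>dual_edges. (z \<in> E \<sigma> \<and> w \<in> z) = (z = x \<or> z = y)))" (is "?L = ?R")
    proof
      assume ?L
      then obtain x y where xy: "{g \<in> E \<sigma>. w \<in> g} = {x, y}" "x \<noteq> y" by blast
      then have "x \<in> dual_edges" "y \<in> dual_edges" using sub[of \<sigma>] by blast+
      then show ?R using xy by blast
    next
      assume ?R
      then obtain x y where "x \<in> dual_edges" "y \<in> dual_edges" "x \<noteq> y"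
        "\<And>z. z \<in> dual_edges \<Longrightarrow> (z \<in> E \<sigma> \<and> w \<in> z) = (z = x \<or> z = y)" by blast
      then have "{g \<in> E \<sigma>. w \<in> g} = {x, y}" using sub[of \<sigma>] by blast
      with \<open>x \<noteq> y\<close> show ?L by blast
    qed
    finally show ?thesis .
  qed
  show ?thesis unfolding joined_def joined_at_def *
    by (intro pred_intros_countable pred_intros_logic pred_bex pred_ball pred_const
        countable_dual_edges edge)
qed

lemma pred_connected: "Measurable.pred M (\<lambda>\<sigma>. (joined (E \<sigma>))\<^sup>*\<^sup>* e f)"
proof -
  have "Measurable.pred M (\<lambda>\<sigma>. ((joined (E \<sigma>)) ^^ n) e f)" for n
  proof (induction n arbitrary: f)
    case 0
    then show ?case by simp
  next
    case (Suc n)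
    have *: "((joined (E \<sigma>)) ^^ Suc n) e f \<longleftrightarrow>
       (\<exists>g\<in>dual_edges. ((joined (E \<sigma>)) ^^ n) e g \<and> joined (E \<sigma>) g f)" for \<sigma>
      using sub[of \<sigma>] joined_in[of "E \<sigma>"] by (auto simp: relcompp_apply)
    show ?case unfolding *
      by (intro pred_bex pred_ball pred_const pred_intros_logic
          countable_dual_edges Suc.IH pred_joined)
  qed
  then show ?thesis by (auto simp: rtranclp_power intro!: pred_intros_countable)
qed

lemma pred_open:
  "Measurable.pred M (\<lambda>\<sigma>. e \<in> E \<sigma> \<and> \<not> is_loop (E \<sigma>) {f. (joined (E \<sigma>))\<^sup>*\<^sup>* e f})"
proof -
  have *: "(e \<in> E \<sigma> \<and> \<not> is_loop (E \<sigma>) {f. (joined (E \<sigma>))\<^sup>*\<^sup>* e f}) \<longleftrightarrow>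
     e \<in> E \<sigma> \<and> \<not> (\<exists>es\<in>lists dual_edges. length es \<ge> 3 \<and> distinct es \<and>
       (\<forall>f\<in>dual_edges. (f \<in> set es) = (joined (E \<sigma>))\<^sup>*\<^sup>* e f) \<and>
       (\<forall>i\<in>{..<length es}. joined (E \<sigma>) (es ! i) (es ! (Suc i mod length es))))" for \<sigma>
  proof (rule conj_cong[OF refl], rule arg_cong[where f=Not])
    assume e: "e \<in> E \<sigma>"
    have s: "f \<in> dual_edges" if "(joined (E \<sigma>))\<^sup>*\<^sup>* e f" for f
      using connected_in[OF that e] sub[of \<sigma>] by auto
    have "(set es = {f. (joined (E \<sigma>))\<^sup>*\<^sup>* e f}) \<longleftrightarrow> es \<in> lists dual_edges \<and>
      (\<forall>f\<in>dual_edges. (f \<in> set es) = (joined (E \<sigma>))\<^sup>*\<^sup>* e f)" for es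
      using s by auto
    then show "is_loop (E \<sigma>) {f. (joined (E \<sigma>))\<^sup>*\<^sup>* e f} \<longleftrightarrow>
      (\<exists>es\<in>lists dual_edges. length es \<ge> 3 \<and> distinct es \<and>
       (\<forall>f\<in>dual_edges. (f \<in> set es) = (joined (E \<sigma>))\<^sup>*\<^sup>* e f) \<and>
       (\<forall>i\<in>{..<length es}. joined (E \<sigma>) (es ! i) (es ! (Suc i mod length es))))"
      unfolding is_loop_def by blast
  qed
  show ?thesis unfolding *
    by (intro pred_intros_logic pred_bex pred_ball pred_const countable_lists countable_dual_edges
        edge pred_connected pred_joined countable_finite finite_lessThan)
qed

lemma pred_open_contour:
  "Measurable.pred M (\<lambda>\<sigma>. (\<exists>!C. C \<in> open_contours (E \<sigma>)) \<and>
     w \<in> \<Union> (THE C. C \<in> open_contours (E \<sigma>)))"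
proof -
  let ?c = "\<lambda>\<sigma> e. {f. (joined (E \<sigma>))\<^sup>*\<^sup>* e f}"
  let ?o = "\<lambda>\<sigma> e. e \<in> E \<sigma> \<and> \<not> is_loop (E \<sigma>) (?c \<sigma> e)"
  have *: "((\<exists>!C. C \<in> open_contours (E \<sigma>)) \<and> w \<in> \<Union> (THE C. C \<in> open_contours (E \<sigma>))) \<longleftrightarrow>
    (\<exists>e\<in>dual_edges. ?o \<sigma> e \<and>
       (\<forall>e'\<in>dual_edges. ?o \<sigma> e' \<longrightarrow>
          (\<forall>f\<in>dual_edges. (joined (E \<sigma>))\<^sup>*\<^sup>* e' f = (joined (E \<sigma>))\<^sup>*\<^sup>* e f)) \<and>
       (\<exists>f\<in>dual_edges. w \<in> f \<and> (joined (E \<sigma>))\<^sup>*\<^sup>* e f))" (is "?L = ?R") for \<sigma>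
  proof (rule unique_member)
    show "open_contours (E \<sigma>) = {?c \<sigma> e | e. ?o \<sigma> e}"
      unfolding open_contours_def contours_def by blast
    show "e \<in> dual_edges" if "?o \<sigma> e" for e
      using that sub[of \<sigma>] by blast
    show "f \<in> dual_edges" if "?o \<sigma> e" "(joined (E \<sigma>))\<^sup>*\<^sup>* e f" for e f
      using connected_in[OF that(2)] that(1) sub[of \<sigma>] by blast
  qed
  show ?thesis unfolding *
    by (intro pred_intros_logic pred_bex pred_ball pred_const countable_dual_edges
        pred_open pred_connected)
qed

end

lemma reaches_event_sets: "reaches_event l a b h \<in> sets (spin_space (slit_strip l a b))"
proof -
  let ?S = "slit_strip l a b"
  let ?E = "\<lambda>\<sigma>. disagreement_edges ?S (override_on eta_strip \<sigma> ?S)"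
  have edge: "Measurable.pred (spin_space ?S) (\<lambda>\<sigma>. e \<in> ?E \<sigma>)" for e
  proof -
    have *: "e \<in> ?E \<sigma> \<longleftrightarrow> (\<exists>u v. e = dual u v \<and> nn u v \<and> {u, v} \<inter> ?S \<noteq> {} \<and>
        \<not> (override_on eta_strip \<sigma> ?S u = override_on eta_strip \<sigma> ?S v))" for \<sigma>
      by (auto simp: disagreement_edges_def)
    have eq: "Measurable.pred (spin_space ?S)
        (\<lambda>\<sigma>. override_on eta_strip \<sigma> ?S u = override_on eta_strip \<sigma> ?S v)" for u v
      unfolding pred_def by (rule borel_measurable_eq[OF measurable_spin measurable_spin])
    show ?thesis unfolding *
      by (intro pred_intros_countable pred_intros_logic pred_const eq)
  qed
  have *: "lambda_sites l a b \<sigma> \<inter> H_star l i \<noteq> {} \<longleftrightarrow>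
     (\<exists>w\<in>H_star l i. if b = a + 1 then w = (a, 0)
        else (\<exists>!C. C \<in> open_contours (?E \<sigma>)) \<and> w \<in> \<Union> (THE C. C \<in> open_contours (?E \<sigma>)))"
    for i \<sigma> unfolding lambda_sites_def Let_def by (cases "b = a + 1") auto
  have "Measurable.pred (spin_space ?S) (\<lambda>\<sigma>. lambda_sites l a b \<sigma> \<inter> H_star l \<lfloor>h\<rfloor> \<noteq> {})"
    unfolding *
  proof (rule pred_bex)
    fix w
    show "Measurable.pred (spin_space ?S) (\<lambda>\<sigma>. if b = a + 1 then w = (a, 0)
        else (\<exists>!C. C \<in> open_contours (?E \<sigma>)) \<and> w \<in> \<Union> (THE C. C \<in> open_contours (?E \<sigma>)))"
      by (cases "b = a + 1")
        (simp, simp only: if_False, rule pred_open_contour[OF disagreement_edges_subset edge])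
  qed simp
  then show ?thesis unfolding reaches_event_def by (rule predE)
qed

end

theory Submission
  imports Defs "HOL-Real_Asymp.Real_Asymp"
begin

text \<open>By duality the contours are the edges of subgraphs \<open>F\<close> of the dual graph with prescribed odd
  vertices and weight \<open>t ^ card F\<close>, \<open>t = exp (- 2 \<beta>)\<close>, so that ratios of partition functions are
  spin correlations at the dual temperature. The open contour is contained in the cluster of its
  left endpoint \<open>u\<close>; if it reaches level \<open>h\<close>, reflecting in that level turns the even subgraphs with
  odd vertices \<open>u\<close>, \<open>v\<close> into ones with odd vertices \<open>u'\<close>, \<open>v\<close>, where \<open>u'\<close> is the mirror image of \<open>u\<close>.
  Since the part of the slit strip above the level contains the mirror image of the part below, the
  probability is at most the ratio of the correlations of \<open>u', v\<close> and of \<open>u, v\<close>.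

  The denominator is bounded below by the correlation across a strip of width \<open>m = b - 1 - a\<close>. The
  generating function of the correlations across a strip is computed from the transfer matrix by
  free fermions; together with the monotonicity under reflections this gives the order
  \<open>m powr (- 1/2) * lam0 powr (- m)\<close> of the denominator. For the numerator, subadditivity bounds each
  finite-volume correlation by the exponential of minus the surface tension, and the sharp
  triangle inequality for \<open>(m, k)\<close> and \<open>(m, -k)\<close>, \<open>k = 2 h\<close>, gives the decay
  \<open>exp (- \<kappa> (sqrt (m\<^sup>2 + k\<^sup>2) - m))\<close>. This suffices for \<open>k\<close> of order \<open>m\<close> or larger. For smaller \<open>k\<close> the
  polynomial prefactor is removed by the tilted generating function, transferred from the strip to
  the plane by the Simon-Lieb inequality. The infinite volume is reduced to a finite one by
  conditioning on a frozen row far above and one far below, which exist almost surely.\<close>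

section \<open>Sums over even subgraphs and spins\<close>

text \<open>Comparing the surface tension bound, of order \<open>exp (- m * tau0)\<close>, with a
  denominator of order \<open>m powr (- 1/2) * lam0 powr (- m)\<close> loses a factor
  \<open>sqrt m\<close>. This is fatal for \<open>k\<close> of order \<open>sqrt m\<close>, where
  the claimed factor \<open>exp (- \<kappa> * x^2)\<close> is of order 1; hence the explicit
  computation of the strip correlations. The constant \<open>\<kappa>\<close> is reached because the
  reflection doubles the height: for small \<open>h / m\<close>, \<open>sqrt (m^2 + k^2) - m\<close>
  with \<open>k = 2 * h\<close> is about \<open>2 * h^2 / m\<close>, twice what is claimed. This
  surplus pays for the integer part of \<open>h\<close>, for the polynomial factors and for the
  coarse constants 3/4 and 1/3 in the tilted estimates, so that the inequality
  \<open>ln lam0 \<le> tau0\<close> and a quadratic lower bound on \<open>ln (lam s / lam0)\<close>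
  suffice. Uniformity in \<open>a\<close> and \<open>b\<close> comes from the fact that the final
  bounds see only the width \<open>m = b - 1 - a\<close>, and the excess
  \<open>sqrt (m^2 + k^2) - m\<close> decreases in \<open>m\<close>. The correlation inequalities
  (Griffiths, Simon-Lieb, Messager-Miracle-Sole) and the reflection principle share one source, the
  expansion of a pair of replicas by \<open>link\<close>.\<close>

definition spins :: "'v set \<Rightarrow> ('v \<Rightarrow> real) set" where
  "spins V = {s. (\<forall>v\<in>V. s v = 1 \<or> s v = -1) \<and> (\<forall>v. v \<notin> V \<longrightarrow> s v = 1)}"

definition flip :: "'v set \<Rightarrow> ('v \<Rightarrow> real) \<Rightarrow> 'v \<Rightarrow> real" where
  "flip U s = (\<lambda>v. if v \<in> U then - s v else s v)"

definition bond :: "('v \<Rightarrow> real) \<Rightarrow> 'v set \<Rightarrow> real" where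
  "bond s e = (\<Prod>v\<in>e. s v)"

text \<open>The boundary of an edge set modulo 2. The edge sets to which it is applied have finite
  degrees, so the value 0 of \<open>card\<close> on infinite sets does no harm.\<close>

definition bd :: "'v set set \<Rightarrow> 'v set" where
  "bd F = {v. odd (card {e\<in>F. v \<in> e})}"

definition graph :: "'v set set \<Rightarrow> bool" where
  "graph E \<longleftrightarrow> finite E \<and> (\<forall>e\<in>E. card e = 2)"

text \<open>High-temperature expansion: up to \<open>2 ^ card V\<close> and the hyperbolic cosines
  of the couplings, the unnormalised expectation of the product of the spins in \<open>A\<close> in
  the Ising model on \<open>E\<close> whose couplings have hyperbolic tangent \<open>t\<close>. With
  \<open>t = exp (- 2 * \<beta>)\<close> it is also the low-temperature expansion in
  contours.\<close>

definition Hsum :: "real \<Rightarrow> 'v set set \<Rightarrow> 'v set \<Rightarrow> real" where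
  "Hsum t E A = (\<Sum>F\<in>{F\<in>Pow E. bd F = A}. t ^ card F)"

lemma spin_sq: "s \<in> spins V \<Longrightarrow> s v * s v = 1"
  unfolding spins_def by (cases "v \<in> V") auto

lemma spin_cases: "s \<in> spins V \<Longrightarrow> s v = 1 \<or> s v = -1"
  unfolding spins_def by (cases "v \<in> V") auto

lemma flip_in: "U \<subseteq> V \<Longrightarrow> s \<in> spins V \<Longrightarrow> flip U s \<in> spins V"
  unfolding spins_def flip_def by auto

lemma flip_flip [simp]: "flip U (flip U s) = s"
  unfolding flip_def by auto

lemma spins_empty: "spins {} = {\<lambda>_. 1}"
  unfolding spins_def by auto

lemma spins_insert:
  assumes "v \<notin> V"
  shows "spins (insert v V) = spins V \<union> flip {v} ` spins V" "spins V \<inter> flip {v} ` spins V = {}"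
proof -
  have "s \<in> spins V \<union> flip {v} ` spins V" if s: "s \<in> spins (insert v V)" for s
  proof (cases "s v = 1")
    case True
    then have "s \<in> spins V" using s unfolding spins_def by auto
    then show ?thesis by blast
  next
    case False
    then have "s v = -1" using spin_cases[OF s] by blast
    then have "flip {v} s \<in> spins V" using s unfolding spins_def flip_def by auto
    then have "flip {v} (flip {v} s) \<in> flip {v} ` spins V" by blast
    then show ?thesis by simp
  qed
  moreover have "s \<in> spins (insert v V)" if "s \<in> spins V" for s
    using that unfolding spins_def by auto
  moreover from this have "flip {v} s \<in> spins (insert v V)" if "s \<in> spins V" for s
    using that by (intro flip_in) auto
  ultimately show "spins (insert v V) = spins V \<union> flip {v} ` spins V" by blast
  show "spins V \<inter> flip {v} ` spins V = {}"
  proof -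
    have "s v = 1" "flip {v} s v = -1" if "s \<in> spins V" for s
      using that assms unfolding spins_def flip_def by auto
    then show ?thesis by fastforce
  qed
qed

lemma inj_flip: "inj_on (flip U) A"
  by (metis flip_flip inj_onI)

lemma finite_card_spins: "finite V \<Longrightarrow> finite (spins V) \<and> card (spins V) = 2 ^ card V"
proof (induction V rule: finite_induct)
  case empty
  then show ?case by (simp add: spins_empty)
next
  case (insert v V)
  have "card (flip {v} ` spins V) = card (spins V)" by (rule card_image[OF inj_flip])
  then show ?case using insert spins_insert[OF insert.hyps(2)]
    by (simp add: card_Un_disjoint)
qed

lemma finite_spins [simp]: "finite V \<Longrightarrow> finite (spins V)"
  using finite_card_spins by blast

lemma sum_flip: "U \<subseteq> V \<Longrightarrow> (\<Sum>s\<in>spins V. f (flip U s)) = (\<Sum>s\<in>spins V. f s)"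
  by (rule sum.reindex_bij_witness[where i="flip U" and j="flip U"]) (auto intro: flip_in)

lemma sum_flip_zero:
  assumes "U \<subseteq> V" "\<And>s. s \<in> spins V \<Longrightarrow> f (flip U s) = - f s"
  shows "(\<Sum>s\<in>spins V. f s) = (0::real)"
proof -
  have "(\<Sum>s\<in>spins V. f s) = (\<Sum>s\<in>spins V. f (flip U s))"
    using sum_flip[OF assms(1), of f] by simp
  also have "\<dots> = - (\<Sum>s\<in>spins V. f s)" using assms(2) by (simp add: sum_negf)
  finally show ?thesis by simp
qed

text \<open>Flipping a spin with odd exponent reverses the sign of the sum, which therefore
  vanishes.\<close>

lemma sum_monomial:
  assumes "finite V"
  shows "(\<Sum>s\<in>spins V. \<Prod>v\<in>V. s v ^ k v) = (if \<forall>v\<in>V. even (k v) then 2 ^ card V else (0::real))"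
proof (cases "\<forall>v\<in>V. even (k v)")
  case True
  have "s v ^ k v = 1" if "s \<in> spins V" "v \<in> V" for s v
  proof -
    have "even (k v)" using True that by blast
    then show ?thesis using spin_cases[OF that(1), of v] by auto
  qed
  then have "(\<Sum>s\<in>spins V. \<Prod>v\<in>V. s v ^ k v) = (\<Sum>s\<in>spins V. 1)"
    by (intro sum.cong prod.neutral) auto
  then show ?thesis using True finite_card_spins[OF assms] by simp
next
  case False
  then obtain v where v: "v \<in> V" "odd (k v)" by blast
  have "(\<Prod>w\<in>V. flip {v} s w ^ k w) = - (\<Prod>w\<in>V. s w ^ k w)" for s
  proof -
    have "(\<Prod>w\<in>V. flip {v} s w ^ k w) = flip {v} s v ^ k v * (\<Prod>w\<in>V-{v}. flip {v} s w ^ k w)"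
      using v assms by (simp add: prod.remove)
    also have "(\<Prod>w\<in>V-{v}. flip {v} s w ^ k w) = (\<Prod>w\<in>V-{v}. s w ^ k w)"
      by (rule prod.cong) (auto simp: flip_def)
    also have "flip {v} s v ^ k v * \<dots> = - (s v ^ k v * \<dots>)"
      using v by (simp add: flip_def)
    also have "s v ^ k v * (\<Prod>w\<in>V-{v}. s w ^ k w) = (\<Prod>w\<in>V. s w ^ k w)"
      using v assms by (simp add: prod.remove)
    finally show ?thesis .
  qed
  then have "(\<Sum>s\<in>spins V. \<Prod>v\<in>V. s v ^ k v) = 0"
    using v by (intro sum_flip_zero[of "{v}"]) auto
  then show ?thesis using False by auto
qed

text \<open>The cone of polynomials in the spins with nonnegative coefficients. Their sums over all
  configurations are nonnegative; the correlation inequalities are all reduced to this.\<close>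

inductive pos :: "(('v \<Rightarrow> real) \<Rightarrow> real) \<Rightarrow> bool" where
  pos_const: "0 \<le> c \<Longrightarrow> pos (\<lambda>_. c)"
| pos_var: "pos (\<lambda>s. s v)"
| pos_add: "pos f \<Longrightarrow> pos g \<Longrightarrow> pos (\<lambda>s. f s + g s)"
| pos_mult: "pos f \<Longrightarrow> pos g \<Longrightarrow> pos (\<lambda>s. f s * g s)"

lemma pos_prod: "(\<And>i. i \<in> I \<Longrightarrow> pos (f i)) \<Longrightarrow> pos (\<lambda>s. \<Prod>i\<in>I. f i s)"
proof (induction I rule: infinite_finite_induct)
  case (insert i I)
  then show ?case by (simp add: pos_mult)
qed (auto intro: pos_const)

lemma pos_bond: "pos (\<lambda>s. bond s e)"
  unfolding bond_def by (intro pos_prod pos_var)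

lemma prod_list_monomial:
  assumes "s \<in> spins V" "finite V"
  shows "prod_list (map s xs) = (\<Prod>v\<in>V. s v ^ count_list xs v)"
proof (induction xs)
  case Nil
  then show ?case by simp
next
  case (Cons x xs)
  have "(\<Prod>v\<in>V. s v ^ count_list (x # xs) v) = (\<Prod>v\<in>V. (if v = x then s v else 1) * s v ^ count_list xs v)"
    by (rule prod.cong) auto
  also have "\<dots> = (\<Prod>v\<in>V. if v = x then s v else 1) * (\<Prod>v\<in>V. s v ^ count_list xs v)"
    by (rule prod.distrib)
  also have "(\<Prod>v\<in>V. if v = x then s v else 1) = s x"
    using assms by (auto simp: prod.delta' spins_def)
  finally show ?case using Cons by simp
qed

text \<open>Lists of monomials avoid collecting equal terms: a sum is a concatenation, and a product
  pairs all entries.\<close>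

lemma pos_polynomial:
  "pos f \<Longrightarrow> \<exists>ms::(real \<times> 'v list) list. (\<forall>m\<in>set ms. 0 \<le> fst m) \<and>
     (\<forall>s. f s = (\<Sum>m\<leftarrow>ms. fst m * prod_list (map s (snd m))))"
proof (induction rule: pos.induct)
  case (pos_const c)
  then show ?case by (intro exI[of _ "[(c, [])]"]) auto
next
  case (pos_var v)
  then show ?case by (intro exI[of _ "[(1, [v])]"]) auto
next
  case (pos_add f g)
  then obtain ms ns where "\<forall>m\<in>set ms. 0 \<le> fst m" "\<forall>m\<in>set ns. 0 \<le> fst m"
    "\<forall>s. f s = (\<Sum>m\<leftarrow>ms. fst m * prod_list (map s (snd m)))"
    "\<forall>s. g s = (\<Sum>m\<leftarrow>ns. fst m * prod_list (map s (snd m)))" by blast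
  then show ?case by (intro exI[of _ "ms @ ns"]) auto
next
  case (pos_mult f g)
  then obtain ms ns where *: "\<forall>m\<in>set ms. 0 \<le> fst m" "\<forall>m\<in>set ns. 0 \<le> fst m"
    "\<forall>s. f s = (\<Sum>m\<leftarrow>ms. fst m * prod_list (map s (snd m)))"
    "\<forall>s. g s = (\<Sum>m\<leftarrow>ns. fst m * prod_list (map s (snd m)))" by blast
  let ?p = "\<lambda>m n. (fst m * fst n :: real, snd m @ snd n)"
  let ?ps = "concat (map (\<lambda>m. map (?p m) ns) ms)"
  have "(\<Sum>m\<leftarrow>?ps. fst m * prod_list (map s (snd m))) = f s * g s" for s
  proof -
    have "(\<Sum>m\<leftarrow>concat (map (\<lambda>m. map (?p m) ns) ms'). fst m * prod_list (map s (snd m))) =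
      (\<Sum>m\<leftarrow>ms'. fst m * prod_list (map s (snd m))) * g s" for ms'
    proof (induction ms')
      case (Cons m ms')
      have "(\<Sum>x\<leftarrow>map (?p m) ns'. fst x * prod_list (map s (snd x))) =
        fst m * prod_list (map s (snd m)) * (\<Sum>m\<leftarrow>ns'. fst m * prod_list (map s (snd m)))" for ns'
        by (induction ns') (auto simp: algebra_simps)
      then show ?case using Cons *(4) by (simp add: algebra_simps)
    qed simp
    then show ?thesis using *(3) by simp
  qed
  moreover have "\<forall>m\<in>set ?ps. 0 \<le> fst m" using *(1,2) by auto
  ultimately show ?case by (intro exI[of _ ?ps]) auto
qed

text \<open>Each monomial sums to 0 or to its coefficient times \<open>2 ^ card V\<close>.\<close>

lemma pos_sum_nonneg:
  assumes "pos f" "finite V"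
  shows "0 \<le> (\<Sum>s\<in>spins V. f s)"
proof -
  obtain ms :: "(real \<times> 'a list) list" where ms: "\<forall>m\<in>set ms. 0 \<le> fst m"
    "\<forall>s. f s = (\<Sum>m\<leftarrow>ms. fst m * prod_list (map s (snd m)))" using pos_polynomial[OF assms(1)] by blast
  have "0 \<le> (\<Sum>s\<in>spins V. \<Sum>m\<leftarrow>ms'. fst m * prod_list (map s (snd m)))" if "\<forall>m\<in>set ms'. 0 \<le> fst m"
    for ms' :: "(real \<times> 'a list) list"
    using that
  proof (induction ms')
    case (Cons m ms')
    have "(\<Sum>s\<in>spins V. fst m * prod_list (map s (snd m))) =
       fst m * (\<Sum>s\<in>spins V. \<Prod>v\<in>V. s v ^ count_list (snd m) v)"
      using prod_list_monomial[OF _ assms(2)] by (simp add: sum_distrib_left)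
    also have "\<dots> \<ge> 0" using Cons.prems by (subst sum_monomial[OF assms(2)]) auto
    finally show ?case using Cons by (simp add: sum.distrib)
  qed simp
  then show ?thesis using ms by simp
qed

section \<open>High-temperature expansion of spin sums\<close>

lemma bond_prod:
  assumes "finite V" "finite F" "\<And>e. e \<in> F \<Longrightarrow> e \<subseteq> V"
  shows "(\<Prod>e\<in>F. bond s e) = (\<Prod>v\<in>V. s v ^ card {e\<in>F. v \<in> e})"
proof -
  have "(\<Prod>e\<in>F. bond s e) = (\<Prod>e\<in>F. \<Prod>v\<in>V. if v \<in> e then s v else 1)"
  proof (rule prod.cong[OF refl])
    fix e assume "e \<in> F"
    then have "V \<inter> e = e" using assms(3) by blast
    then show "bond s e = (\<Prod>v\<in>V. if v \<in> e then s v else 1)"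
      unfolding bond_def using prod.inter_restrict[OF assms(1), of s e] by simp
  qed
  also have "\<dots> = (\<Prod>v\<in>V. \<Prod>e\<in>F. if v \<in> e then s v else 1)" by (rule prod.swap)
  also have "\<dots> = (\<Prod>v\<in>V. s v ^ card {e\<in>F. v \<in> e})"
  proof (rule prod.cong[OF refl])
    fix v
    show "(\<Prod>e\<in>F. if v \<in> e then s v else 1) = s v ^ card {e\<in>F. v \<in> e}"
      using prod.inter_filter[OF assms(2), of "\<lambda>_. s v" "\<lambda>e. v \<in> e"] by simp
  qed
  finally show ?thesis .
qed

text \<open>The exponent of the spin at \<open>v\<close> is its degree in \<open>F\<close>, plus 1
  if \<open>v\<close> lies in \<open>A\<close>; all exponents are even exactly when
  \<open>bd F = A\<close>.\<close>

lemma sum_char: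
  assumes "finite V" "finite F" "\<And>e. e \<in> F \<Longrightarrow> e \<subseteq> V" "A \<subseteq> V"
  shows "(\<Sum>s\<in>spins V. (\<Prod>v\<in>A. s v) * (\<Prod>e\<in>F. bond s e)) = (if bd F = A then 2 ^ card V else 0)"
proof -
  let ?k = "\<lambda>v. card {e\<in>F. v \<in> e} + (if v \<in> A then 1 else 0)"
  have "(\<Prod>v\<in>A. s v) * (\<Prod>e\<in>F. bond s e) = (\<Prod>v\<in>V. s v ^ ?k v)" for s :: "'a \<Rightarrow> real"
  proof -
    have "V \<inter> A = A" using assms(4) by blast
    then have "(\<Prod>v\<in>A. s v) = (\<Prod>v\<in>V. s v ^ (if v \<in> A then 1 else 0))"
      using prod.inter_restrict[OF assms(1), of s A] by (simp add: if_distrib cong: if_cong)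
    moreover have "(\<Prod>e\<in>F. bond s e) = (\<Prod>v\<in>V. s v ^ card {e\<in>F. v \<in> e})"
      by (rule bond_prod[OF assms(1-3)])
    ultimately show ?thesis by (simp add: power_add prod.distrib)
  qed
  then have "(\<Sum>s\<in>spins V. (\<Prod>v\<in>A. s v) * (\<Prod>e\<in>F. bond s e)) = (if \<forall>v\<in>V. even (?k v) then 2 ^ card V else 0)"
    by (simp only: sum_monomial[OF assms(1)])
  also have "(\<forall>v\<in>V. even (?k v)) \<longleftrightarrow> bd F = A"
  proof -
    have "card {e\<in>F. v \<in> e} = 0" if "v \<notin> V" for v
      using that assms(3) by (auto simp: card_eq_0_iff)
    then have "v \<notin> bd F" if "v \<notin> V" for v using that unfolding bd_def by simp
    then have "bd F \<subseteq> V" by blast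
    then show ?thesis using assms(4) unfolding bd_def by (auto split: if_splits)
  qed
  finally show ?thesis .
qed

lemma graph_subset: "graph E \<Longrightarrow> F \<subseteq> E \<Longrightarrow> graph F"
  unfolding graph_def by (auto intro: finite_subset)

lemma expand_one:
  assumes "finite E"
  shows "(\<Prod>e\<in>E. 1 + t * bond s e) = (\<Sum>F\<in>Pow E. t ^ card F * (\<Prod>e\<in>F. bond s e))"
proof -
  have "(\<Prod>e\<in>E. t * bond s e + 1) = (\<Sum>F\<in>Pow E. (\<Prod>e\<in>F. t * bond s e) * (\<Prod>e\<in>E-F. 1))"
    by (rule prod_add[OF assms])
  then show ?thesis by (simp add: prod.distrib add.commute)
qed

text \<open>The factors of \<open>E1\<close> alone are expanded, so that an event on
  \<open>F \<inter> E1\<close> can be imposed on the spin side while \<open>E2\<close> stays a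
  product. \<open>E1 = {}\<close> gives the plain expansion.\<close>

lemma sum_event:
  assumes "finite V" "finite E1" "finite E2" "E1 \<inter> E2 = {}" "\<And>e. e \<in> E1 \<union> E2 \<Longrightarrow> e \<subseteq> V" "A \<subseteq> V"
  shows "(\<Sum>s\<in>spins V. (\<Prod>v\<in>A. s v) * (\<Sum>F\<in>{F\<in>Pow E1. P F}. t ^ card F * (\<Prod>e\<in>F. bond s e)) *
            (\<Prod>e\<in>E2. 1 + t * bond s e)) =
         2 ^ card V * (\<Sum>F\<in>{F\<in>Pow (E1 \<union> E2). P (F \<inter> E1) \<and> bd F = A}. t ^ card F)"
proof -
  let ?c = "\<lambda>F s. t ^ card F * ((\<Prod>v\<in>A. s v) * (\<Prod>e\<in>F. bond s e))"
  let ?S1 = "{F\<in>Pow E1. P F}"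
  have "(\<Sum>s\<in>spins V. (\<Prod>v\<in>A. s v) * (\<Sum>F\<in>?S1. t ^ card F * (\<Prod>e\<in>F. bond s e)) *
            (\<Prod>e\<in>E2. 1 + t * bond s e)) =
        (\<Sum>s\<in>spins V. \<Sum>(F,G)\<in>?S1 \<times> Pow E2. ?c (F \<union> G) s)"
  proof (rule sum.cong[OF refl])
    fix s :: "'a \<Rightarrow> real"
    have "t ^ card F * (\<Prod>e\<in>F. bond s e) * (t ^ card G * (\<Prod>e\<in>G. bond s e)) =
       t ^ card (F \<union> G) * (\<Prod>e\<in>F \<union> G. bond s e)" if "F \<subseteq> E1" "G \<subseteq> E2" for F G
    proof -
      have "finite F" "finite G" "F \<inter> G = {}" using that assms finite_subset by blast+
      then show ?thesis by (simp add: card_Un_disjoint prod.union_disjoint power_add)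
    qed
    note * = this
    have "(\<Prod>v\<in>A. s v) * (\<Sum>F\<in>?S1. t ^ card F * (\<Prod>e\<in>F. bond s e)) * (\<Prod>e\<in>E2. 1 + t * bond s e)
       = (\<Prod>v\<in>A. s v) * (\<Sum>(F,G)\<in>?S1 \<times> Pow E2.
             t ^ card F * (\<Prod>e\<in>F. bond s e) * (t ^ card G * (\<Prod>e\<in>G. bond s e)))"
      unfolding expand_one[OF assms(3)] mult.assoc[of "prod s A"] sum_product sum.cartesian_product ..
    also have "\<dots> = (\<Prod>v\<in>A. s v) * (\<Sum>(F,G)\<in>?S1 \<times> Pow E2. t ^ card (F \<union> G) * (\<Prod>e\<in>F \<union> G. bond s e))"
      by (intro arg_cong[where f="(*) (\<Prod>v\<in>A. s v)"] sum.cong) (auto simp: *)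
    also have "\<dots> = (\<Sum>(F,G)\<in>?S1 \<times> Pow E2. ?c (F \<union> G) s)"
      by (simp add: sum_distrib_left case_prod_beta mult.left_commute)
    finally show "(\<Prod>v\<in>A. s v) * (\<Sum>F\<in>?S1. t ^ card F * (\<Prod>e\<in>F. bond s e)) * (\<Prod>e\<in>E2. 1 + t * bond s e)
       = (\<Sum>(F,G)\<in>?S1 \<times> Pow E2. ?c (F \<union> G) s)" .
  qed
  also have "\<dots> = (\<Sum>(F,G)\<in>?S1 \<times> Pow E2. \<Sum>s\<in>spins V. ?c (F \<union> G) s)"
    by (subst sum.swap) (simp add: case_prod_beta)
  also have "\<dots> = (\<Sum>F\<in>{F\<in>Pow (E1 \<union> E2). P (F \<inter> E1)}. \<Sum>s\<in>spins V. ?c F s)"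
  proof -
    have "(F \<union> G) \<inter> E1 = F" "(F \<union> G) \<inter> E2 = G" if "F \<subseteq> E1" "G \<subseteq> E2" for F G
      using that assms(4) by blast+
    then show ?thesis using assms(4)
      by (intro sum.reindex_bij_witness[where i="\<lambda>F. (F \<inter> E1, F \<inter> E2)" and j="\<lambda>(F,G). F \<union> G"])
        (auto split: prod.splits)
  qed
  also have "\<dots> = (\<Sum>F\<in>{F\<in>Pow (E1 \<union> E2). P (F \<inter> E1)}. if bd F = A then t ^ card F * 2 ^ card V else 0)"
  proof (rule sum.cong[OF refl])
    fix F assume "F \<in> {F\<in>Pow (E1 \<union> E2). P (F \<inter> E1)}"
    then have F: "finite F" "\<And>e. e \<in> F \<Longrightarrow> e \<subseteq> V"
      using assms by (auto intro: finite_subset[where B="E1 \<union> E2"])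
    show "(\<Sum>s\<in>spins V. ?c F s) = (if bd F = A then t ^ card F * 2 ^ card V else 0)"
      using sum_char[OF assms(1) F assms(6)] by (simp add: sum_distrib_left[symmetric])
  qed
  also have "\<dots> = (\<Sum>F\<in>{F\<in>{F\<in>Pow (E1 \<union> E2). P (F \<inter> E1)}. bd F = A}. t ^ card F * 2 ^ card V)"
    using assms by (intro sum.inter_filter[symmetric]) auto
  also have "{F\<in>{F\<in>Pow (E1 \<union> E2). P (F \<inter> E1)}. bd F = A} = {F\<in>Pow (E1 \<union> E2). P (F \<inter> E1) \<and> bd F = A}"
    by blast
  finally show ?thesis by (simp add: sum_distrib_left mult.commute)
qed

lemma sum_spins:
  assumes "finite V" "finite E" "\<And>e. e \<in> E \<Longrightarrow> e \<subseteq> V" "A \<subseteq> V"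
  shows "(\<Sum>s\<in>spins V. (\<Prod>v\<in>A. s v) * (\<Prod>e\<in>E. 1 + t * bond s e)) = 2 ^ card V * Hsum t E A"
  using sum_event[of V "{}" E A t "\<lambda>_. True"] assms by (simp add: Hsum_def Pow_def)

section \<open>Correlation inequalities\<close>

text \<open>Empty on the diagonal because a spin squares to 1; this makes
  \<open>cor t E u u = 1\<close>.\<close>

definition pr :: "'v \<Rightarrow> 'v \<Rightarrow> 'v set" where
  "pr u v = (if u = v then {} else {u, v})"

definition cor :: "real \<Rightarrow> 'v set set \<Rightarrow> 'v \<Rightarrow> 'v \<Rightarrow> real" where
  "cor t E u v = Hsum t E (pr u v) / Hsum t E {}"

definition conn :: "'v set set \<Rightarrow> 'v \<Rightarrow> 'v \<Rightarrow> bool" where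
  "conn F = (\<lambda>u v. {u, v} \<in> F)\<^sup>*\<^sup>*"

lemma pr_commute: "pr u v = pr v u"
  unfolding pr_def by auto

lemma cor_commute: "cor t E u v = cor t E v u"
  unfolding cor_def by (simp add: pr_commute)

lemma prod_pr: "s \<in> spins V \<Longrightarrow> (\<Prod>w\<in>pr u v. s w) = s u * s v"
  unfolding pr_def by (auto simp: spin_sq)

lemma pr_subset: "u \<in> V \<Longrightarrow> v \<in> V \<Longrightarrow> pr u v \<subseteq> V"
  unfolding pr_def by auto

lemma Hsum_nonneg: "0 \<le> t \<Longrightarrow> 0 \<le> Hsum t E A"
  unfolding Hsum_def by (intro sum_nonneg) auto

lemma bd_empty [simp]: "bd {} = {}"
  unfolding bd_def by simp

lemma Hsum_empty_ge:
  fixes E :: "'v set set"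
  shows "graph E \<Longrightarrow> 0 \<le> t \<Longrightarrow> 1 \<le> Hsum t E {}"
proof -
  assume *: "graph E" "0 \<le> t"
  have "(\<Sum>F\<in>{{}::'v set set}. t ^ card F) \<le> Hsum t E {}"
    unfolding Hsum_def by (rule sum_mono2) (use * in \<open>auto simp: graph_def\<close>)
  then show ?thesis by simp
qed

lemma cor_nonneg: "0 \<le> t \<Longrightarrow> 0 \<le> cor t E u v"
  unfolding cor_def by (intro divide_nonneg_nonneg Hsum_nonneg)

lemma cor_self: "graph E \<Longrightarrow> 0 \<le> t \<Longrightarrow> cor t E u u = 1"
  using Hsum_empty_ge[of E t] unfolding cor_def pr_def by simp

lemma conn_refl [simp]: "conn F u u"
  unfolding conn_def by simp

lemma conn_trans: "conn F u v \<Longrightarrow> conn F v w \<Longrightarrow> conn F u w"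
  unfolding conn_def by (rule rtranclp_trans)

lemma conn_edge: "{u, v} \<in> F \<Longrightarrow> conn F u v"
  unfolding conn_def by (rule r_into_rtranclp)

lemma conn_step: "conn F u v \<Longrightarrow> {v, w} \<in> F \<Longrightarrow> conn F u w"
  by (blast intro: conn_trans conn_edge)

lemma conn_mono: "conn F u v \<Longrightarrow> F \<subseteq> G \<Longrightarrow> conn G u v"
  unfolding conn_def by (erule rtranclp_mono[THEN predicate2D, rotated]) blast

lemma conn_induct [consumes 1, case_names base step]:
  assumes "conn F u v" "P u" "\<And>v w. conn F u v \<Longrightarrow> {v, w} \<in> F \<Longrightarrow> P v \<Longrightarrow> P w"
  shows "P v"
  using assms(1) unfolding conn_def
  by (induction rule: rtranclp_induct) (use assms(2,3) in \<open>auto simp: conn_def\<close>)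

text \<open>An edge of \<open>F\<close> has both endpoints in the cluster or neither, so flipping a
  cluster leaves every bond of \<open>F\<close> unchanged. The cancellations in the replica
  arguments rest on this.\<close>

lemma edge_even_cluster:
  assumes "card e = 2" "e \<in> F"
  shows "even (card (e \<inter> {w. conn F u w}))"
proof -
  obtain x y where e: "e = {x, y}" "x \<noteq> y" using assms(1) by (auto simp: card_2_iff)
  have "conn F u x \<longleftrightarrow> conn F u y"
    using assms(2) e conn_step[of F u x y] conn_step[of F u y x] by (auto simp: insert_commute)
  then have "e \<inter> {w. conn F u w} = e \<or> e \<inter> {w. conn F u w} = {}" using e by auto
  then show ?thesis using assms(1) by auto
qed

lemma cluster_subset:
  assumes "u \<in> V" "\<And>e. e \<in> F \<Longrightarrow> e \<subseteq> V"
  shows "{w. conn F u w} \<subseteq> V"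
proof
  fix w assume "w \<in> {w. conn F u w}"
  then have "conn F u w" by simp
  then show "w \<in> V" by (induction rule: conn_induct) (use assms in auto)
qed

lemma bond_cases: "s \<in> spins V \<Longrightarrow> bond s e = 1 \<or> bond s e = -1"
proof (cases "finite e")
  case True
  show "s \<in> spins V \<Longrightarrow> bond s e = 1 \<or> bond s e = -1" using True
  proof (induction e rule: finite_induct)
    case (insert x e)
    then show ?case using spin_cases[OF insert.prems, of x] by (auto simp: bond_def)
  qed (simp add: bond_def)
qed (simp add: bond_def)

lemma bond_flip:
  assumes "finite e" "even (card (e \<inter> U))"
  shows "bond (flip U s) e = bond s e"
proof -
  have "bond (flip U s) e = (\<Prod>v\<in>e. (if v \<in> U then -1 else 1) * s v)"
    unfolding bond_def flip_def by (rule prod.cong) auto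
  also have "\<dots> = (\<Prod>v\<in>e. if v \<in> U then -1 else 1) * bond s e"
    by (simp add: prod.distrib bond_def)
  also have "(\<Prod>v\<in>e. if v \<in> U then -1 else (1::real)) = (-1) ^ card (e \<inter> U)"
    using prod.inter_restrict[OF assms(1), of "\<lambda>_. -1::real" U] by simp
  finally show ?thesis using assms(2) by simp
qed

text \<open>The remainder in \<open>(1 + t x) (1 + t y) = (1 - t\<^sup>2) + link t x y\<close>. It vanishes unless the two
  signs agree.\<close>

definition link :: "real \<Rightarrow> real \<Rightarrow> real \<Rightarrow> real" where
  "link t x y = t^2 + t * x + t * y + t^2 * x * y"

lemma link_zero: "x = 1 \<or> x = -1 \<Longrightarrow> y = 1 \<or> y = -1 \<Longrightarrow> link t x y \<noteq> 0 \<Longrightarrow> x = y"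
  unfolding link_def by (auto simp: power2_eq_square)

text \<open>\<open>Q\<close> collects the edges at which the remainder \<open>link\<close> is
  chosen. Where the product does not vanish, the two bonds agree along \<open>Q\<close>, so
  \<open>Q\<close> acts like a percolation configuration for the pair.\<close>

lemma expand_two:
  assumes "finite E"
  shows "(\<Prod>e\<in>E. (1 + t * b e) * (1 + t * c e)) =
    (\<Sum>Q\<in>Pow E. (1 - t^2) ^ card (E - Q) * (\<Prod>e\<in>Q. link t (b e) (c e)))"
proof -
  have "(\<Prod>e\<in>E. (1 + t * b e) * (1 + t * c e)) = (\<Prod>e\<in>E. link t (b e) (c e) + (1 - t^2))"
    by (rule prod.cong) (auto simp: link_def power2_eq_square algebra_simps)
  also have "\<dots> = (\<Sum>Q\<in>Pow E. (\<Prod>e\<in>Q. link t (b e) (c e)) * (\<Prod>e\<in>E-Q. 1 - t^2))"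
    by (rule prod_add[OF assms])
  finally show ?thesis by (simp add: mult.commute)
qed

lemma sum_expand_two:
  assumes "finite E"
  shows "(\<Sum>s\<in>S. f s * (\<Prod>e\<in>E. (1 + t * b s e) * (1 + t * c s e)) * R s) =
    (\<Sum>Q\<in>Pow E. (1 - t^2) ^ card (E - Q) * (\<Sum>s\<in>S. f s * (\<Prod>e\<in>Q. link t (b s e) (c s e)) * R s))"
  unfolding expand_two[OF assms] sum_distrib_left sum_distrib_right
  by (subst sum.swap) (simp add: mult_ac)

text \<open>The weight \<open>(1 - t^2) ^ card (E - Q)\<close> is nonnegative, so it is enough to
  compare the two sums for each fixed \<open>Q\<close>.\<close>

lemma compare_two:
  assumes "finite E" "0 \<le> t" "t \<le> 1"
    "\<And>Q. Q \<subseteq> E \<Longrightarrow> (\<Sum>s\<in>S. f s * (\<Prod>e\<in>Q. link t (b s e) (c s e)) * R s) \<le>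
                    (\<Sum>s\<in>S. g s * (\<Prod>e\<in>Q. link t (b s e) (c s e)) * R s)"
  shows "(\<Sum>s\<in>S. f s * (\<Prod>e\<in>E. (1 + t * b s e) * (1 + t * c s e)) * R s) \<le>
         (\<Sum>s\<in>S. g s * (\<Prod>e\<in>E. (1 + t * b s e) * (1 + t * c s e)) * R s)"
  unfolding sum_expand_two[OF assms(1)]
  by (rule sum_mono, rule mult_left_mono[OF assms(4)]) (use assms(2,3) in \<open>auto simp: power_le_one\<close>)

text \<open>Across an edge with equal bonds the product \<open>s v * r v\<close> does not
  change.\<close>

lemma conn_support:
  assumes "conn Q u v" "s \<in> spins V" "r \<in> spins V'" "\<And>e. e \<in> Q \<Longrightarrow> card e = 2"
    "\<And>e. e \<in> Q \<Longrightarrow> bond s e = bond r e"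
  shows "s u * r u = s v * r v"
  using assms(1)
proof (induction rule: conn_induct)
  case (step v w)
  have "v \<noteq> w" using assms(4)[OF step(2)] by auto
  then have *: "s v * s w = r v * r w" using assms(5)[OF step(2)] by (simp add: bond_def)
  have "s v * r v = s w * r w"
    using * spin_cases[OF assms(2), of v] spin_cases[OF assms(2), of w]
      spin_cases[OF assms(3), of v] spin_cases[OF assms(3), of w] by auto
  then show ?case using step by simp
qed simp

text \<open>A pair of replicas is encoded as one configuration on \<open>V \<times> bool\<close>.\<close>

abbreviation (input) "lft s \<equiv> (\<lambda>v. s (v, False))"
abbreviation (input) "rgt s \<equiv> (\<lambda>v. s (v, True))"

lemma spins_pair: "s \<in> spins (V \<times> UNIV) \<Longrightarrow> lft s \<in> spins V" "s \<in> spins (V \<times> UNIV) \<Longrightarrow> rgt s \<in> spins V"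
  unfolding spins_def by auto

lemma pair_sum:
  fixes f g :: "('v \<Rightarrow> real) \<Rightarrow> real"
  shows "(\<Sum>s\<in>spins (V \<times> (UNIV::bool set)). f (lft s) * g (rgt s)) = (\<Sum>s\<in>spins V. f s) * (\<Sum>s\<in>spins V. g s)"
proof -
  have "(\<Sum>s\<in>spins V. f s) * (\<Sum>s\<in>spins V. g s) = (\<Sum>(s,r)\<in>spins V \<times> spins V. f s * g r)"
    by (simp add: sum_product sum.cartesian_product)
  also have "\<dots> = (\<Sum>s\<in>spins (V \<times> (UNIV::bool set)). f (lft s) * g (rgt s))"
    by (rule sum.reindex_bij_witness[where i="\<lambda>s. (lft s, rgt s)" and j="\<lambda>(s,r) (v,b). if b then r v else s v"])
      (auto simp: spins_def fun_eq_iff split: if_splits)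
  finally show ?thesis by simp
qed

lemma pair_Hsum:
  assumes "finite V" "finite E1" "finite E2" "\<And>e. e \<in> E1 \<union> E2 \<Longrightarrow> e \<subseteq> V" "A \<subseteq> V" "B \<subseteq> V" "E1 \<subseteq> E2"
  shows "2 ^ card V * 2 ^ card V * (Hsum t E1 A * Hsum t E2 B) =
    (\<Sum>s\<in>spins (V \<times> (UNIV::bool set)). (\<Prod>v\<in>A. lft s v) * (\<Prod>v\<in>B. rgt s v) *
      (\<Prod>e\<in>E1. (1 + t * bond (lft s) e) * (1 + t * bond (rgt s) e)) * (\<Prod>e\<in>E2-E1. 1 + t * bond (rgt s) e))"
proof -
  have "2 ^ card V * 2 ^ card V * (Hsum t E1 A * Hsum t E2 B) =
     (\<Sum>s\<in>spins V. (\<Prod>v\<in>A. s v) * (\<Prod>e\<in>E1. 1 + t * bond s e)) *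
     (\<Sum>s\<in>spins V. (\<Prod>v\<in>B. s v) * (\<Prod>e\<in>E2. 1 + t * bond s e))"
    using assms by (subst (1 2) sum_spins) auto
  also have "\<dots> = (\<Sum>s\<in>spins (V \<times> (UNIV::bool set)).
      ((\<Prod>v\<in>A. lft s v) * (\<Prod>e\<in>E1. 1 + t * bond (lft s) e)) *
      ((\<Prod>v\<in>B. rgt s v) * (\<Prod>e\<in>E2. 1 + t * bond (rgt s) e)))"
    by (subst pair_sum) simp
  finally show ?thesis
    by (simp add: prod.subset_diff[OF assms(7,3)] prod.distrib mult_ac)
qed

lemma finite_V2 [simp]: "finite V \<Longrightarrow> finite (V \<times> (UNIV::bool set))" by simp

lemma pos_pair:
  "pos (\<lambda>s::'v \<times> bool \<Rightarrow> real. bond (lft s) e)" "pos (\<lambda>s::'v \<times> bool \<Rightarrow> real. bond (rgt s) e)"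
  unfolding bond_def by (intro pos_prod pos_var)+

lemma pos_link: "0 \<le> t \<Longrightarrow> pos f \<Longrightarrow> pos g \<Longrightarrow> pos (\<lambda>s. link t (f s) (g s))"
  unfolding link_def by (intro pos_add pos_mult pos_const) auto

lemma pos_one: "0 \<le> t \<Longrightarrow> pos f \<Longrightarrow> pos (\<lambda>s. 1 + t * f s)"
  by (intro pos_add pos_mult pos_const) auto

text \<open>The left replica lives on \<open>E1\<close>, the right one on the larger
  \<open>E2\<close>. The edges of \<open>E2 - E1\<close> are seen by the right replica alone and
  stay unexpanded in \<open>RR\<close>.\<close>

locale two_graphs =
  fixes t :: real and E1 E2 :: "'v set set" and V :: "'v set"
  assumes t: "0 \<le> t" "t \<le> 1" and G: "graph E2" "E1 \<subseteq> E2" and V: "finite V" "\<And>e. e \<in> E2 \<Longrightarrow> e \<subseteq> V"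
begin

lemma fin: "finite E1" "finite E2" using G finite_subset unfolding graph_def by auto
lemma c2: "e \<in> E2 \<Longrightarrow> card e = 2" using G unfolding graph_def by auto
lemma fe: "e \<in> E2 \<Longrightarrow> finite e" using c2 by (metis card.infinite zero_neq_numeral)

abbreviation "XO Q s \<equiv> (\<Prod>e\<in>Q. link t (bond (\<lambda>v. s (v, False)) e) (bond (\<lambda>v. s (v, True)) e))"
abbreviation "RR s \<equiv> (\<Prod>e\<in>E2-E1. 1 + t * bond (\<lambda>v. s (v, True)) e)"
abbreviation "SV \<equiv> spins (V \<times> (UNIV::bool set))"

lemma support:
  assumes "s \<in> SV" "Q \<subseteq> E1" "XO Q s \<noteq> 0" "conn Q u v"
  shows "s (u, False) * s (u, True) = s (v, False) * s (v, True)"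
proof -
  have Q: "finite Q" "\<And>e. e \<in> Q \<Longrightarrow> card e = 2" using assms(2) fin(1) finite_subset G(2) c2 by blast+
  have "bond (lft s) e = bond (rgt s) e" if "e \<in> Q" for e
  proof -
    have "link t (bond (lft s) e) (bond (rgt s) e) \<noteq> 0" using assms(3) that Q(1) by (meson prod_zero_iff)
    then show ?thesis
      using link_zero bond_cases[OF spins_pair(1)[OF assms(1)]] bond_cases[OF spins_pair(2)[OF assms(1)]] by blast
  qed
  then show ?thesis
    using conn_support[OF assms(4) spins_pair(1)[OF assms(1)] spins_pair(2)[OF assms(1)] Q(2)] by simp
qed

lemma pos_XR: "Q \<subseteq> E1 \<Longrightarrow> pos f \<Longrightarrow> pos (\<lambda>s. f s * XO Q s * RR s)"
  by (intro pos_mult pos_prod pos_link pos_one pos_pair t)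

text \<open>Reduces an inequality between products of \<open>Hsum\<close> to one for each fixed
  \<open>Q\<close>. The sum over \<open>i\<close> is there for the Simon-Lieb inequality; elsewhere
  \<open>I\<close> is a singleton.\<close>

lemma compare:
  assumes "A \<subseteq> V" "B \<subseteq> V" "finite I" "\<And>i. i \<in> I \<Longrightarrow> C i \<subseteq> V" "\<And>i. i \<in> I \<Longrightarrow> D i \<subseteq> V"
    and le: "\<And>Q. Q \<subseteq> E1 \<Longrightarrow>
      (\<Sum>s\<in>SV. ((\<Prod>v\<in>A. s (v, False)) * (\<Prod>v\<in>B. s (v, True))) * XO Q s * RR s) \<le>
      (\<Sum>s\<in>SV. (\<Sum>i\<in>I. (\<Prod>v\<in>C i. s (v, False)) * (\<Prod>v\<in>D i. s (v, True))) * XO Q s * RR s)"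
  shows "Hsum t E1 A * Hsum t E2 B \<le> (\<Sum>i\<in>I. Hsum t E1 (C i) * Hsum t E2 (D i))"
proof -
  have *: "2 ^ card V * 2 ^ card V * (Hsum t E1 A * Hsum t E2 B) =
    (\<Sum>s\<in>SV. ((\<Prod>v\<in>A. s (v, False)) * (\<Prod>v\<in>B. s (v, True))) *
      (\<Prod>e\<in>E1. (1 + t * bond (lft s) e) * (1 + t * bond (rgt s) e)) * RR s)"
    if "A \<subseteq> V" "B \<subseteq> V" for A B
  proof -
    have "e \<subseteq> V" if "e \<in> E1 \<union> E2" for e using that G(2) V(2) by blast
    from pair_Hsum[OF V(1) fin this that G(2)] show ?thesis by simp
  qed
  have "2 ^ card V * 2 ^ card V * (Hsum t E1 A * Hsum t E2 B) \<le> (\<Sum>s\<in>SV. (\<Sum>i\<in>I. (\<Prod>v\<in>C i. s (v, False)) * (\<Prod>v\<in>D i. s (v, True))) *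
      (\<Prod>e\<in>E1. (1 + t * bond (lft s) e) * (1 + t * bond (rgt s) e)) * RR s)"
    unfolding *[OF assms(1,2)] by (rule compare_two[OF fin(1) t le])
  also have "\<dots> = (\<Sum>i\<in>I. 2 ^ card V * 2 ^ card V * (Hsum t E1 (C i) * Hsum t E2 (D i)))"
    using * assms(4,5) by (simp add: sum_distrib_right sum.swap[of _ SV])
  finally show ?thesis by (simp add: sum_distrib_left[symmetric])
qed

text \<open>\<open>RR\<close> does not involve the left replica and no edge of \<open>Q\<close>
  leaves the cluster, so flipping the left copy of the cluster changes only the sign of
  \<open>f\<close>.\<close>

lemma zero_left:
  assumes "Q \<subseteq> E1" "u \<in> V" "\<And>s. s \<in> SV \<Longrightarrow> f (flip ({w. conn Q u w} \<times> {False}) s) = - f s"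
  shows "(\<Sum>s\<in>SV. f s * XO Q s * RR s) = 0"
proof (rule sum_flip_zero)
  let ?U = "{w. conn Q u w}"
  have Q: "e \<in> E2" if "e \<in> Q" for e using that assms(1) G(2) by blast
  show "?U \<times> {False} \<subseteq> V \<times> UNIV" using cluster_subset[OF assms(2), of Q] Q V(2) by blast
  fix s assume s: "s \<in> SV"
  have *: "lft (flip (?U \<times> {False}) s) = flip ?U (lft s)" "rgt (flip (?U \<times> {False}) s) = rgt s"
    by (auto simp: flip_def)
  have "bond (flip ?U (lft s)) e = bond (lft s) e" if "e \<in> Q" for e
    using that by (intro bond_flip fe edge_even_cluster c2 Q)
  then have "XO Q (flip (?U \<times> {False}) s) = XO Q s" unfolding * by (intro prod.cong) auto
  then show "f (flip (?U \<times> {False}) s) * XO Q (flip (?U \<times> {False}) s) * RR (flip (?U \<times> {False}) s) = - (f s * XO Q s * RR s)"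
    using assms(3)[OF s] unfolding * by simp
qed

text \<open>Second Griffiths inequality as monotonicity in the graph. If \<open>Q\<close> connects
  \<open>u\<close> and \<open>v\<close>, the two-spin products of both replicas agree on the
  support; otherwise the left side cancels and the right side is the sum of a member of the positive
  cone.\<close>

lemma mono:
  assumes "u \<in> V" "v \<in> V"
  shows "Hsum t E1 (pr u v) * Hsum t E2 {} \<le> Hsum t E1 {} * Hsum t E2 (pr u v)"
proof -
  have "Hsum t E1 (pr u v) * Hsum t E2 {} \<le> (\<Sum>i\<in>{()}. Hsum t E1 {} * Hsum t E2 (pr u v))"
  proof (rule compare)
    fix Q assume Q: "Q \<subseteq> E1"
    have "(\<Sum>s\<in>SV. (s (u, False) * s (v, False)) * XO Q s * RR s) \<le>
      (\<Sum>s\<in>SV. (s (u, True) * s (v, True)) * XO Q s * RR s)" (is "sum ?f SV \<le> sum ?g SV")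
    proof (cases "conn Q u v")
      case True
      have "?f s \<le> ?g s" if s: "s \<in> SV" for s
      proof (cases "XO Q s = 0")
        case False
        have "s (u, False) * s (u, True) = s (v, False) * s (v, True)"
          using support[OF s Q False True] .
        then have "s (u, False) * s (v, False) = s (u, True) * s (v, True)"
          using spin_cases[OF s, of "(u,True)"] spin_cases[OF s, of "(v,True)"]
            spin_cases[OF s, of "(u,False)"] spin_cases[OF s, of "(v,False)"] by auto
        then show ?thesis by (simp only: order_refl)
      qed (simp only: mult_zero_left mult_zero_right order_refl)
      then show ?thesis by (rule sum_mono)
    next
      case False
      have "sum ?f SV = 0" using False by (intro zero_left[OF Q assms(1)]) (auto simp: flip_def)
      also have "0 \<le> sum ?g SV" using V(1)
        by (intro pos_sum_nonneg pos_XR[OF Q] pos_mult pos_var) auto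
      finally show ?thesis .
    qed
    then show "(\<Sum>s\<in>SV. ((\<Prod>v\<in>pr u v. s (v, False)) * (\<Prod>v\<in>{}. s (v, True))) * XO Q s * RR s) \<le>
      (\<Sum>s\<in>SV. (\<Sum>i\<in>{()}. (\<Prod>v\<in>{}. s (v, False)) * (\<Prod>v\<in>pr u v. s (v, True))) * XO Q s * RR s)"
      by (simp add: prod_pr[OF spins_pair(1)] prod_pr[OF spins_pair(2)] cong: sum.cong)
  qed (use assms in \<open>auto simp: pr_def split: if_splits\<close>)
  then show ?thesis by simp
qed

text \<open>\<open>B\<close> separates the inside of \<open>T\<close> from the edges of
  \<open>E2 - E1\<close>. If \<open>y\<close> and \<open>a\<close> are connected by \<open>Q\<close>
  and \<open>E2 - E1\<close> together, then \<open>Q\<close> alone connects \<open>y\<close> to some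
  \<open>p\<close> in \<open>B\<close>, and on the support the product of the right spins at
  \<open>a\<close> and \<open>y\<close> splits at \<open>p\<close>; if they are not connected, the
  left side cancels.\<close>

lemma simon_lieb:
  assumes "a \<in> V" "y \<in> V" "finite B" "B \<subseteq> V" "y \<in> T" "a \<in> T \<Longrightarrow> a \<in> B"
    "\<And>e. e \<in> E1 \<Longrightarrow> e \<subseteq> T" "\<And>e. e \<in> E2 - E1 \<Longrightarrow> e \<inter> T \<subseteq> B"
  shows "Hsum t E1 {} * Hsum t E2 (pr a y) \<le> (\<Sum>p\<in>B. Hsum t E1 (pr p y) * Hsum t E2 (pr a p))"
proof (rule compare)
  fix Q assume Q: "Q \<subseteq> E1"
  have Q2: "e \<in> E2" if "e \<in> Q" for e using that Q G(2) by blast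
  have pq: "pos (\<lambda>s. (s (p, False) * s (y, False)) * (s (a, True) * s (p, True)) * XO Q s * RR s)" for p
    by (intro pos_XR[OF Q] pos_mult pos_var)
  have "(\<Sum>s\<in>SV. (s (a, True) * s (y, True)) * XO Q s * RR s) \<le>
     (\<Sum>p\<in>B. \<Sum>s\<in>SV. (s (p, False) * s (y, False)) * (s (a, True) * s (p, True)) * XO Q s * RR s)"
    (is "sum ?f SV \<le> (\<Sum>p\<in>B. sum (?g p) SV)")
  proof (cases "conn (Q \<union> (E2 - E1)) y a")
    case True
    have "(\<exists>p\<in>B. conn Q y p) \<or> conn Q y a"
      using True
    proof (induction rule: conn_induct)
      case (step v w)
      consider "\<exists>p\<in>B. conn Q y p" | "conn Q y v" "{v, w} \<in> Q" | "conn Q y v" "{v, w} \<in> E2 - E1"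
        using step by blast
      then show ?case
      proof cases
        case 2
        then show ?thesis using conn_step by metis
      next
        case 3
        have "v \<in> T" using 3(1)
          by (induction rule: conn_induct) (use assms(5,7) Q in auto)
        then have "v \<in> B" using assms(8)[OF 3(2)] by auto
        then show ?thesis using 3(1) by blast
      qed blast
    qed simp
    moreover have "a \<in> B" if "conn Q y a"
    proof -
      have "a \<in> T" using that
        by (induction rule: conn_induct) (use assms(5,7) Q in auto)
      then show ?thesis using assms(6) by blast
    qed
    ultimately obtain p where p: "p \<in> B" "conn Q y p" by blast
    have "sum ?f SV \<le> sum (?g p) SV"
    proof (rule sum_mono)
      fix s assume s: "s \<in> SV"
      show "?f s \<le> ?g p s"
      proof (cases "XO Q s = 0")
        case False
        have "s (y, False) * s (y, True) = s (p, False) * s (p, True)"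
          using support[OF s Q False p(2)] .
        then have "s (a, True) * s (y, True) = (s (p, False) * s (y, False)) * (s (a, True) * s (p, True))"
          using spin_cases[OF s, of "(p,True)"] spin_cases[OF s, of "(y,True)"]
            spin_cases[OF s, of "(p,False)"] spin_cases[OF s, of "(y,False)"] by auto
        then show ?thesis by (simp only: order_refl)
      qed (simp only: mult_zero_left mult_zero_right order_refl)
    qed
    also have "\<dots> \<le> (\<Sum>p\<in>B. sum (?g p) SV)"
      using V(1) p(1) assms(3) by (intro member_le_sum pos_sum_nonneg pq) auto
    finally show ?thesis .
  next
    case False
    \<comment> \<open>Here the right replica is flipped. It enters both \<open>link\<close> and
      \<open>RR\<close>, so the cluster has to be closed under the edges of \<open>Q\<close> and of
      \<open>E2 - E1\<close>.\<close>
    let ?F = "Q \<union> (E2 - E1)"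
    let ?U = "{w. conn ?F y w}"
    have "sum ?f SV = 0"
    proof (rule sum_flip_zero)
      show "?U \<times> {True} \<subseteq> V \<times> UNIV" using cluster_subset[OF assms(2), of ?F] Q2 V(2) by blast
      fix s assume s: "s \<in> SV"
      have *: "rgt (flip (?U \<times> {True}) s) = flip ?U (rgt s)" "lft (flip (?U \<times> {True}) s) = lft s"
        by (auto simp: flip_def)
      have b: "bond (flip ?U (rgt s)) e = bond (rgt s) e" if "e \<in> ?F" for e
        using that Q2 c2 fe edge_even_cluster[of e ?F] by (intro bond_flip) auto
      have "XO Q (flip (?U \<times> {True}) s) = XO Q s" "RR (flip (?U \<times> {True}) s) = RR s"
        unfolding * using b by (auto intro!: prod.cong)
      then show "?f (flip (?U \<times> {True}) s) = - ?f s" using False by (simp add: flip_def)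
    qed
    also have "0 \<le> (\<Sum>p\<in>B. sum (?g p) SV)"
      using V(1) by (intro sum_nonneg pos_sum_nonneg pq) auto
    finally show ?thesis .
  qed
  then show "(\<Sum>s\<in>SV. ((\<Prod>v\<in>{}. s (v, False)) * (\<Prod>v\<in>pr a y. s (v, True))) * XO Q s * RR s) \<le>
      (\<Sum>s\<in>SV. (\<Sum>p\<in>B. (\<Prod>v\<in>pr p y. s (v, False)) * (\<Prod>v\<in>pr a p. s (v, True))) * XO Q s * RR s)"
    by (subst (asm) sum.swap)
      (simp add: prod_pr[OF spins_pair(1)] prod_pr[OF spins_pair(2)] sum_distrib_right cong: sum.cong)
qed (use assms in \<open>auto simp: pr_def split: if_splits\<close>)

end

lemma graph_vertices: "graph E \<Longrightarrow> finite (\<Union>E)"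
  unfolding graph_def by (metis card.infinite finite_Union zero_neq_numeral)

text \<open>With \<open>E1 = E2\<close>, the pair \<open>u, v\<close> in the left replica and
  \<open>v, w\<close> in the right one combine into \<open>u, w\<close> in the right one if
  \<open>Q\<close> connects \<open>u\<close> and \<open>v\<close>; otherwise the left replica
  cancels.\<close>

lemma griffiths:
  assumes "graph E" "0 \<le> t" "t \<le> 1"
  shows "Hsum t E (pr u v) * Hsum t E (pr v w) \<le> Hsum t E {} * Hsum t E (pr u w)"
proof -
  define V where "V = \<Union>E \<union> {u, v, w}"
  have "finite V" using graph_vertices[OF assms(1)] unfolding V_def by simp
  then interpret two_graphs t E E V
    by unfold_locales (use assms in \<open>auto simp: V_def\<close>)
  have uvw: "u \<in> V" "v \<in> V" "w \<in> V" unfolding V_def by auto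
  have "Hsum t E (pr u v) * Hsum t E (pr v w) \<le> (\<Sum>i\<in>{()}. Hsum t E {} * Hsum t E (pr u w))"
  proof (rule compare)
    fix Q assume Q: "Q \<subseteq> E"
    have "(\<Sum>s\<in>SV. ((s (u, False) * s (v, False)) * (s (v, True) * s (w, True))) * XO Q s * RR s) \<le>
      (\<Sum>s\<in>SV. (s (u, True) * s (w, True)) * XO Q s * RR s)" (is "sum ?f SV \<le> sum ?g SV")
    proof (cases "conn Q u v")
      case True
      have "?f s \<le> ?g s" if s: "s \<in> SV" for s
      proof (cases "XO Q s = 0")
        case False
        have "s (u, False) * s (u, True) = s (v, False) * s (v, True)"
          using support[OF s Q False True] .
        then have "(s (u, False) * s (v, False)) * (s (v, True) * s (w, True)) = s (u, True) * s (w, True)"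
          using spin_cases[OF s, of "(u,True)"] spin_cases[OF s, of "(v,True)"]
            spin_cases[OF s, of "(u,False)"] spin_cases[OF s, of "(v,False)"] by auto
        then show ?thesis by (simp only: order_refl)
      qed (simp only: mult_zero_left mult_zero_right order_refl)
      then show ?thesis by (rule sum_mono)
    next
      case False
      have "sum ?f SV = 0" using False by (intro zero_left[OF Q uvw(1)]) (auto simp: flip_def)
      also have "0 \<le> sum ?g SV" using V(1)
        by (intro pos_sum_nonneg pos_XR[OF Q] pos_mult pos_var) auto
      finally show ?thesis .
    qed
    then show "(\<Sum>s\<in>SV. ((\<Prod>v\<in>pr u v. s (v, False)) * (\<Prod>v\<in>pr v w. s (v, True))) * XO Q s * RR s) \<le>
      (\<Sum>s\<in>SV. (\<Sum>i\<in>{()}. (\<Prod>v\<in>{}. s (v, False)) * (\<Prod>v\<in>pr u w. s (v, True))) * XO Q s * RR s)"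
      by (simp add: prod_pr[OF spins_pair(1)] prod_pr[OF spins_pair(2)] cong: sum.cong)
  qed (use uvw in \<open>auto simp: pr_def split: if_splits\<close>)
  then show ?thesis by simp
qed

lemma cor_triangle:
  assumes "graph E" "0 \<le> t" "t \<le> 1"
  shows "cor t E u v * cor t E v w \<le> cor t E u w"
  using griffiths[OF assms, of u v w] Hsum_empty_ge[OF assms(1,2)]
  unfolding cor_def by (simp add: field_simps)


lemma cor_mono:
  assumes "graph E2" "E1 \<subseteq> E2" "0 \<le> t" "t \<le> 1"
  shows "cor t E1 u v \<le> cor t E2 u v"
proof -
  interpret two_graphs t E1 E2 "\<Union>E2 \<union> {u, v}"
    by unfold_locales (use assms graph_vertices in auto)
  show ?thesis using mono[of u v] Hsum_empty_ge[OF assms(1,3)] Hsum_empty_ge[OF graph_subset[OF assms(1,2)] assms(3)]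
    unfolding cor_def by (simp add: field_simps)
qed

lemma cor_simon_lieb:
  assumes "graph E2" "E1 \<subseteq> E2" "0 \<le> t" "t \<le> 1" "finite B" "y \<in> T" "a \<in> T \<Longrightarrow> a \<in> B"
    "\<And>e. e \<in> E1 \<Longrightarrow> e \<subseteq> T" "\<And>e. e \<in> E2 - E1 \<Longrightarrow> e \<inter> T \<subseteq> B"
  shows "cor t E2 a y \<le> (\<Sum>p\<in>B. cor t E2 a p * cor t E1 p y)"
proof -
  interpret two_graphs t E1 E2 "\<Union>E2 \<union> {a, y} \<union> B"
    by unfold_locales (use assms graph_vertices in auto)
  have *: "Hsum t E1 {} * Hsum t E2 (pr a y) \<le> (\<Sum>p\<in>B. Hsum t E1 (pr p y) * Hsum t E2 (pr a p))"
    using assms by (intro simon_lieb[where T=T]) auto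
  have z: "1 \<le> Hsum t E2 {}" "1 \<le> Hsum t E1 {}"
    using Hsum_empty_ge[OF assms(1,3)] Hsum_empty_ge[OF graph_subset[OF assms(1,2)] assms(3)] by auto
  have "cor t E2 a y = Hsum t E1 {} * Hsum t E2 (pr a y) / (Hsum t E1 {} * Hsum t E2 {})"
    using z unfolding cor_def by simp
  also have "\<dots> \<le> (\<Sum>p\<in>B. Hsum t E1 (pr p y) * Hsum t E2 (pr a p)) / (Hsum t E1 {} * Hsum t E2 {})"
    using z by (intro divide_right_mono *) auto
  also have "\<dots> = (\<Sum>p\<in>B. cor t E2 a p * cor t E1 p y)"
    unfolding cor_def sum_divide_distrib by (intro sum.cong) (auto simp: mult.commute)
  finally show ?thesis .
qed

text \<open>On the graph consisting of this single edge the correlation is exactly \<open>t\<close>;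
  adding edges increases it.\<close>

lemma cor_edge:
  assumes "graph E" "0 \<le> t" "t \<le> 1" "{u, v} \<in> E" "u \<noteq> v"
  shows "t \<le> cor t E u v"
proof -
  have s: "Pow {{u, v}} = {{}, {{u, v}}}" by auto
  have "{e \<in> {{u, v}}. w \<in> e} = (if w \<in> {u, v} then {{u, v}} else {})" for w by auto
  then have "bd {{u, v}} = {u, v}" unfolding bd_def by (auto split: if_splits)
  then have "{F \<in> Pow {{u, v}}. bd F = {u, v}} = {{{u, v}}}" "{F \<in> Pow {{u, v}}. bd F = {}} = {{}}"
    unfolding s by auto
  then have "cor t {{u, v}} u v = t" using assms(5) unfolding cor_def Hsum_def pr_def by simp
  moreover have "cor t {{u, v}} u v \<le> cor t E u v" using assms by (intro cor_mono) auto
  ultimately show ?thesis by simp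
qed

section \<open>Invariance of correlations under relabelling of the vertices\<close>

lemma bd_image:
  assumes "inj f"
  shows "bd ((`) f ` F) = f ` bd F"
proof -
  have i: "inj ((`) f)" using assms by (simp add: inj_image_eq_iff inj_def)
  have 1: "card {e \<in> (`) f ` F. f v \<in> e} = card {e\<in>F. v \<in> e}" for v
  proof -
    have "{e \<in> (`) f ` F. f v \<in> e} = (`) f ` {e\<in>F. v \<in> e}" using assms by (auto simp: inj_eq intro!: imageI)
    then show ?thesis using i by (metis card_image inj_on_subset subset_UNIV)
  qed
  have 2: "w \<in> range f" if "w \<in> bd ((`) f ` F)" for w
  proof (rule ccontr)
    assume "w \<notin> range f"
    then have "{e \<in> (`) f ` F. w \<in> e} = {}" by auto
    then have "card {e \<in> (`) f ` F. w \<in> e} = 0" by (simp only: card.empty)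
    then show False using that unfolding bd_def by simp
  qed
  show ?thesis
  proof (intro equalityI subsetI)
    fix w assume w: "w \<in> bd ((`) f ` F)"
    then obtain v where v: "w = f v" using 2 by blast
    then have "v \<in> bd F" using w 1[of v] unfolding bd_def by simp
    then show "w \<in> f ` bd F" using v by blast
  next
    fix w assume "w \<in> f ` bd F"
    then show "w \<in> bd ((`) f ` F)" using 1 unfolding bd_def by auto
  qed
qed

lemma Hsum_image:
  assumes "inj f"
  shows "Hsum t ((`) f ` E) (f ` A) = Hsum t E A"
proof -
  have i: "inj ((`) f)" using assms by (simp add: inj_image_eq_iff inj_def)
  have "{F\<in>Pow ((`) f ` E). bd F = f ` A} = (`) ((`) f) ` {F\<in>Pow E. bd F = A}"
    using assms by (auto simp: bd_image inj_image_eq_iff subset_image_iff intro!: imageI)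
  moreover have "inj_on ((`) ((`) f)) B" for B using i by (simp add: inj_image_eq_iff inj_on_def)
  moreover have "card ((`) f ` F) = card F" for F using i by (metis card_image inj_on_subset subset_UNIV)
  ultimately show ?thesis unfolding Hsum_def by (simp add: sum.reindex)
qed

lemma cor_image:
  assumes "inj f"
  shows "cor t ((`) f ` E) (f u) (f v) = cor t E u v"
proof -
  have "pr (f u) (f v) = f ` pr u v" using assms by (auto simp: pr_def inj_eq)
  then show ?thesis using Hsum_image[OF assms, of t E "{}"] Hsum_image[OF assms, of t E "pr u v"] unfolding cor_def by simp
qed

section \<open>Reflection symmetry\<close>

text \<open>\<open>E1\<close> lies in the half \<open>D\<close> and is disjoint from its mirror
  image. \<open>E3\<close>, disjoint from both, may be asymmetric: surplus edges of the other half
  go there, which is what the slit strip requires.\<close>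

locale mirror =
  fixes t :: real and E1 E3 :: "'v set set" and V D :: "'v set" and \<rho> :: "'v \<Rightarrow> 'v"
  assumes t: "0 \<le> t" "t \<le> 1" and fin: "finite E1" "finite E3" "finite V"
    and c2: "\<And>e. e \<in> E1 \<union> E3 \<Longrightarrow> card e = 2"
    and sub: "\<And>e. e \<in> E1 \<Longrightarrow> e \<subseteq> D" "\<And>e. e \<in> E3 \<Longrightarrow> e \<subseteq> V" "D \<subseteq> V"
    and rho: "\<And>v. \<rho> (\<rho> v) = v" "\<rho> ` V \<subseteq> V"
    and disj: "E1 \<inter> (`) \<rho> ` E1 = {}" "E1 \<inter> E3 = {}" "(`) \<rho> ` E1 \<inter> E3 = {}"
begin

lemma inj_rho: "inj_on \<rho> A" by (metis rho(1) inj_onI)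

lemma rho_edge: "card (\<rho> ` e) = card e" by (rule card_image[OF inj_rho])

lemma fe: "e \<in> E1 \<union> E3 \<Longrightarrow> finite e" using c2 by (metis card.infinite zero_neq_numeral)

lemma inj_rho_edges: "inj_on ((`) \<rho>) A"
  using inj_rho by (simp add: inj_on_image_eq_iff inj_on_def) (metis inj_on_image_eq_iff inj_rho subset_UNIV)

definition "Etot = E1 \<union> ((`) \<rho> ` E1 \<union> E3)"

abbreviation "XM Q s \<equiv> (\<Prod>e\<in>Q. link t (bond s e) (bond s (\<rho> ` e)))"
abbreviation "RM s \<equiv> (\<Prod>e\<in>E3. 1 + t * bond s e)"

lemma prod_rest: "(\<Prod>e\<in>(`) \<rho> ` E1 \<union> E3. 1 + t * bond s e) = (\<Prod>e\<in>E1. 1 + t * bond s (\<rho> ` e)) * RM s"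
  using disj fin by (simp add: prod.union_disjoint prod.reindex[OF inj_rho_edges])

lemma Etot_sub: "e \<in> Etot \<Longrightarrow> e \<subseteq> V"
  using sub rho(2) unfolding Etot_def by blast

text \<open>A single configuration plays both replicas: the second one is its composition with
  \<open>\<rho>\<close>.\<close>

lemma Hsum_mirror:
  assumes "A \<subseteq> V"
  shows "2 ^ card V * Hsum t Etot A =
    (\<Sum>s\<in>spins V. (\<Prod>v\<in>A. s v) * (\<Prod>e\<in>E1. (1 + t * bond s e) * (1 + t * bond s (\<rho> ` e))) * RM s)"
proof -
  have "2 ^ card V * Hsum t Etot A = (\<Sum>s\<in>spins V. (\<Prod>v\<in>A. s v) * (\<Prod>e\<in>Etot. 1 + t * bond s e))"
    using fin Etot_sub assms by (subst sum_spins) (auto simp: Etot_def)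
  moreover have "(\<Prod>e\<in>Etot. 1 + t * bond s e) = (\<Prod>e\<in>E1. 1 + t * bond s e) * ((\<Prod>e\<in>E1. 1 + t * bond s (\<rho> ` e)) * RM s)" for s
    unfolding Etot_def prod_rest[symmetric] using disj fin by (intro prod.union_disjoint) auto
  ultimately show ?thesis by (simp add: prod.distrib mult_ac)
qed

lemma supportM:
  assumes "s \<in> spins V" "Q \<subseteq> E1" "XM Q s \<noteq> 0" "conn Q u v"
  shows "s u * s (\<rho> u) = s v * s (\<rho> v)"
proof -
  have Q: "finite Q" "\<And>e. e \<in> Q \<Longrightarrow> card e = 2" using assms(2) fin(1) finite_subset c2 by blast+
  have r: "(\<lambda>v. s (\<rho> v)) \<in> spins (\<rho> ` V)" using assms(1) rho unfolding spins_def
    by simp (metis image_eqI)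
  have "bond s e = bond (\<lambda>v. s (\<rho> v)) e" if "e \<in> Q" for e
  proof -
    have "link t (bond s e) (bond s (\<rho> ` e)) \<noteq> 0" using assms(3) that Q(1) by (meson prod_zero_iff)
    then have "bond s e = bond s (\<rho> ` e)"
      using link_zero bond_cases[OF assms(1)] by blast
    also have "\<dots> = bond (\<lambda>v. s (\<rho> v)) e" unfolding bond_def by (simp add: prod.reindex[OF inj_rho])
    finally show ?thesis .
  qed
  then show ?thesis
    using conn_support[OF assms(4) assms(1) r Q(2)] by simp
qed

text \<open>At a fixed point the product \<open>s p * s (\<rho> p)\<close> is 1, and it is constant
  along clusters of \<open>Q\<close>.\<close>

lemma support_line:
  assumes "s \<in> spins V" "Q \<subseteq> E1" "XM Q s \<noteq> 0" "conn Q b p" "\<rho> p = p"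
  shows "s b = s (\<rho> b)"
proof -
  have "s b * s (\<rho> b) = 1"
    using supportM[OF assms(1-4)] assms(5) spin_sq[OF assms(1)] by simp
  then show ?thesis using spin_cases[OF assms(1), of b] spin_cases[OF assms(1), of "\<rho> b"] by auto
qed

lemma pos_XM: "pos f \<Longrightarrow> pos (\<lambda>s. f s * XM Q s * RM s)"
  by (intro pos_mult pos_prod pos_link pos_one pos_bond t)

text \<open>An increasing event \<open>P\<close> that connects \<open>b\<close> to the mirror line
  allows \<open>b\<close> to be replaced by its mirror image, as in the reflection principle for
  random walks. The bonds of \<open>E1\<close> are expanded into \<open>F\<close>; the mirror bonds
  then enlarge \<open>F\<close> to a set \<open>Q\<close> on which \<open>link\<close> is recovered,
  and \<open>P\<close> passes from \<open>F\<close> to \<open>Q\<close>.\<close>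

lemma reflection_principle:
  assumes ab: "a \<in> V" "b \<in> V"
    and P: "\<And>F Q. P F \<Longrightarrow> F \<subseteq> Q \<Longrightarrow> P Q" "\<And>Q. Q \<subseteq> E1 \<Longrightarrow> P Q \<Longrightarrow> \<exists>p. \<rho> p = p \<and> conn Q b p"
  shows "(\<Sum>F\<in>{F\<in>Pow Etot. P (F \<inter> E1) \<and> bd F = pr a b}. t ^ card F) \<le> Hsum t Etot (pr a (\<rho> b))"
proof -
  let ?w = "\<lambda>s e. bond s e" and ?w' = "\<lambda>s e. bond s (\<rho> ` e)"
  let ?T = "\<lambda>F Q s. (s a * s b) * ((\<Prod>e\<in>F. t * ?w s e * (1 + t * ?w' s e)) * (\<Prod>e\<in>Q-F. t^2 + t * ?w' s e)) * RM s"
  have *: "(\<Sum>F\<in>{F\<in>Pow E1. P F}. t ^ card F * (\<Prod>e\<in>F. ?w s e)) * (\<Prod>e\<in>E1. 1 + t * ?w' s e) =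
     (\<Sum>F\<in>{F\<in>Pow E1. P F}. \<Sum>Q\<in>{Q\<in>Pow E1. F \<subseteq> Q}. (1 - t^2) ^ card (E1 - Q) *
       ((\<Prod>e\<in>F. t * ?w s e * (1 + t * ?w' s e)) * (\<Prod>e\<in>Q-F. t^2 + t * ?w' s e)))" for s
    unfolding sum_distrib_right
  proof (rule sum.cong[OF refl])
    fix F assume "F \<in> {F\<in>Pow E1. P F}"
    then have F: "F \<subseteq> E1" by blast
    \<comment> \<open>Summed over \<open>F\<close> below \<open>Q\<close>, the factors
      \<open>t * w * (1 + t * w')\<close> on \<open>F\<close> and \<open>t^2 + t * w'\<close> off
      \<open>F\<close> add up to \<open>link t w w'\<close>; this dictates the splitting of
      \<open>1 + t * w'\<close>.\<close>
    have "(\<Prod>e\<in>E1-F. 1 + t * ?w' s e) = (\<Prod>e\<in>E1-F. (t^2 + t * ?w' s e) + (1 - t^2))"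
      by (rule prod.cong) auto
    also have "\<dots> = (\<Sum>Y\<in>Pow (E1-F). (\<Prod>e\<in>Y. t^2 + t * ?w' s e) * (\<Prod>e\<in>(E1-F)-Y. 1 - t^2))"
      using fin by (intro prod_add) auto
    also have "\<dots> = (\<Sum>Q\<in>{Q\<in>Pow E1. F \<subseteq> Q}. (\<Prod>e\<in>Q-F. t^2 + t * ?w' s e) * (1 - t^2) ^ card (E1 - Q))"
    proof -
      have "E1 - F - (Q - F) = E1 - Q" if "F \<subseteq> Q" for Q using that by blast
      then show ?thesis using F
        by (intro sum.reindex_bij_witness[where i="\<lambda>Q. Q - F" and j="\<lambda>Y. Y \<union> F"])
          (auto simp: Un_Diff Diff_triv Diff_eq Int_assoc intro!: arg_cong[where f=card] arg_cong2[where f="(*)"]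
            arg_cong[where f="power (1 - t^2)"] prod.cong)
    qed
    finally have 1: "(\<Prod>e\<in>E1-F. 1 + t * ?w' s e) =
       (\<Sum>Q\<in>{Q\<in>Pow E1. F \<subseteq> Q}. (\<Prod>e\<in>Q-F. t^2 + t * ?w' s e) * (1 - t^2) ^ card (E1 - Q))" .
    have "t ^ card F * (\<Prod>e\<in>F. ?w s e) * (\<Prod>e\<in>E1. 1 + t * ?w' s e) =
       (\<Prod>e\<in>F. t * ?w s e * (1 + t * ?w' s e)) * (\<Prod>e\<in>E1-F. 1 + t * ?w' s e)"
      by (simp add: prod.subset_diff[OF F fin(1)] prod.distrib mult_ac)
    then show "t ^ card F * (\<Prod>e\<in>F. ?w s e) * (\<Prod>e\<in>E1. 1 + t * ?w' s e) =
      (\<Sum>Q\<in>{Q\<in>Pow E1. F \<subseteq> Q}. (1 - t^2) ^ card (E1 - Q) *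
       ((\<Prod>e\<in>F. t * ?w s e * (1 + t * ?w' s e)) * (\<Prod>e\<in>Q-F. t^2 + t * ?w' s e)))"
      unfolding 1 by (simp add: sum_distrib_left mult_ac)
  qed
  \<comment> \<open>Each summand is nonnegative by itself, which permits dropping the condition
    \<open>P F\<close> while keeping \<open>P Q\<close>.\<close>
  have T0: "0 \<le> (1 - t^2) ^ card (E1 - Q) * (\<Sum>s\<in>spins V. ?T F Q s)" for F Q
  proof -
    have "pos (\<lambda>s. ?T F Q s)"
      using t by (intro pos_mult pos_prod pos_add pos_one pos_bond pos_const pos_var) auto
    from pos_sum_nonneg[OF this fin(3)] show ?thesis
      using t by (intro mult_nonneg_nonneg zero_le_power) (auto simp: power_le_one)
  qed
  let ?ev = "{F\<in>Pow Etot. P (F \<inter> E1) \<and> bd F = pr a b}"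
  have "2 ^ card V * (\<Sum>F\<in>?ev. t ^ card F) =
    (\<Sum>s\<in>spins V. (\<Prod>v\<in>pr a b. s v) * (\<Sum>F\<in>{F\<in>Pow E1. P F}. t ^ card F * (\<Prod>e\<in>F. ?w s e)) *
            (\<Prod>e\<in>(`) \<rho> ` E1 \<union> E3. 1 + t * bond s e))"
    unfolding Etot_def using fin disj Etot_sub[unfolded Etot_def] ab
    by (intro sum_event[symmetric]) (auto simp: pr_def)
  also have "\<dots> = (\<Sum>s\<in>spins V. (s a * s b) * ((\<Sum>F\<in>{F\<in>Pow E1. P F}. t ^ card F * (\<Prod>e\<in>F. ?w s e)) *
            (\<Prod>e\<in>E1. 1 + t * ?w' s e)) * RM s)"
    by (intro sum.cong) (auto simp: prod_pr prod_rest)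
  also have "\<dots> = (\<Sum>F\<in>{F\<in>Pow E1. P F}. \<Sum>Q\<in>{Q\<in>Pow E1. F \<subseteq> Q}. (1 - t^2) ^ card (E1 - Q) * (\<Sum>s\<in>spins V. ?T F Q s))"
    unfolding * unfolding sum_distrib_left sum_distrib_right
    by (subst sum.swap, rule sum.cong[OF refl], subst sum.swap) (simp add: mult_ac)
  also have "\<dots> \<le> (\<Sum>F\<in>Pow E1. \<Sum>Q\<in>{Q\<in>Pow E1. F \<subseteq> Q \<and> P Q}. (1 - t^2) ^ card (E1 - Q) * (\<Sum>s\<in>spins V. ?T F Q s))"
  proof -
    have "{Q\<in>Pow E1. F \<subseteq> Q} = {Q\<in>Pow E1. F \<subseteq> Q \<and> P Q}" if "P F" for F using P(1)[OF that] by blast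
    then have "(\<Sum>F\<in>{F\<in>Pow E1. P F}. \<Sum>Q\<in>{Q\<in>Pow E1. F \<subseteq> Q}. (1 - t^2) ^ card (E1 - Q) * (\<Sum>s\<in>spins V. ?T F Q s)) =
      (\<Sum>F\<in>{F\<in>Pow E1. P F}. \<Sum>Q\<in>{Q\<in>Pow E1. F \<subseteq> Q \<and> P Q}. (1 - t^2) ^ card (E1 - Q) * (\<Sum>s\<in>spins V. ?T F Q s))"
      by (intro sum.cong) auto
    also have "\<dots> \<le> (\<Sum>F\<in>Pow E1. \<Sum>Q\<in>{Q\<in>Pow E1. F \<subseteq> Q \<and> P Q}. (1 - t^2) ^ card (E1 - Q) * (\<Sum>s\<in>spins V. ?T F Q s))"
      using fin by (intro sum_mono2 sum_nonneg T0) auto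
    finally show ?thesis .
  qed
  also have "\<dots> = (\<Sum>Q\<in>{Q\<in>Pow E1. P Q}. \<Sum>F\<in>Pow Q. (1 - t^2) ^ card (E1 - Q) * (\<Sum>s\<in>spins V. ?T F Q s))"
    unfolding sum.Sigma[OF finite_Pow_iff[THEN iffD2, OF fin(1)]]
    using fin by (subst (1 2) sum.Sigma) (auto intro: finite_subset
      intro!: sum.reindex_bij_witness[where i="\<lambda>(Q,F). (F,Q)" and j="\<lambda>(F,Q). (Q,F)"])
  also have "\<dots> = (\<Sum>Q\<in>{Q\<in>Pow E1. P Q}. (1 - t^2) ^ card (E1 - Q) * (\<Sum>s\<in>spins V. (s a * s b) * XM Q s * RM s))"
  proof (rule sum.cong[OF refl])
    fix Q assume "Q \<in> {Q\<in>Pow E1. P Q}"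
    then have Q: "finite Q" using fin finite_subset by blast
    have "XM Q s = (\<Sum>F\<in>Pow Q. (\<Prod>e\<in>F. t * ?w s e * (1 + t * ?w' s e)) * (\<Prod>e\<in>Q-F. t^2 + t * ?w' s e))" for s
      by (subst prod_add[OF Q, symmetric], rule prod.cong) (auto simp: link_def power2_eq_square algebra_simps)
    then show "(\<Sum>F\<in>Pow Q. (1 - t^2) ^ card (E1 - Q) * (\<Sum>s\<in>spins V. ?T F Q s)) =
      (1 - t^2) ^ card (E1 - Q) * (\<Sum>s\<in>spins V. (s a * s b) * XM Q s * RM s)"
      by (simp add: sum_distrib_left sum_distrib_right sum.swap[of _ "spins V"])
  qed
  also have "\<dots> = (\<Sum>Q\<in>{Q\<in>Pow E1. P Q}. (1 - t^2) ^ card (E1 - Q) * (\<Sum>s\<in>spins V. (s a * s (\<rho> b)) * XM Q s * RM s))"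
  proof (intro sum.cong[OF refl] arg_cong[where f="(*) _"])
    fix Q s assume Q: "Q \<in> {Q\<in>Pow E1. P Q}" and s: "s \<in> spins V"
    obtain p where p: "\<rho> p = p" "conn Q b p" using P(2) Q by blast
    show "(s a * s b) * XM Q s * RM s = (s a * s (\<rho> b)) * XM Q s * RM s"
    proof (cases "XM Q s = 0")
      case False
      then show ?thesis using support_line[OF s _ False p(2,1)] Q by auto
    qed (simp only: mult_zero_left mult_zero_right)
  qed
  \<comment> \<open>With the mirror image in place of \<open>b\<close>, the sets \<open>Q\<close>
    that violate \<open>P\<close> contribute nonnegative terms.\<close>
  also have "\<dots> \<le> (\<Sum>Q\<in>Pow E1. (1 - t^2) ^ card (E1 - Q) * (\<Sum>s\<in>spins V. (s a * s (\<rho> b)) * XM Q s * RM s))"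
    using fin t by (intro sum_mono2 mult_nonneg_nonneg zero_le_power pos_sum_nonneg pos_XM pos_mult pos_var) (auto simp: power_le_one)
  also have "\<dots> = (\<Sum>s\<in>spins V. (s a * s (\<rho> b)) * (\<Prod>e\<in>E1. (1 + t * bond s e) * (1 + t * bond s (\<rho> ` e))) * RM s)"
    by (rule sum_expand_two[OF fin(1), symmetric])
  also have "\<dots> = 2 ^ card V * Hsum t Etot (pr a (\<rho> b))"
    using ab rho(2) by (subst Hsum_mirror) (auto simp: pr_def prod_pr[unfolded pr_def] split: if_splits cong: sum.cong)
  finally show ?thesis by simp
qed

text \<open>Messager-Miracle-Sole inequality. If the cluster of \<open>b\<close> in \<open>Q\<close>
  meets the mirror line, \<open>s b\<close> and \<open>s (\<rho> b)\<close> agree on the support.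
  Otherwise the mirror image of the cluster can be flipped, which reverses only
  \<open>s (\<rho> b)\<close>: neither \<open>a\<close> nor the edges \<open>E3\<close> on the
  mirror line meet that image.\<close>

lemma messager_miracle:
  assumes ab: "a \<in> D" "b \<in> D"
    and D: "\<And>v. v \<in> D \<Longrightarrow> \<rho> v \<in> D \<Longrightarrow> \<rho> v = v" and E3: "\<And>e v. e \<in> E3 \<Longrightarrow> v \<in> e \<Longrightarrow> \<rho> v = v"
  shows "Hsum t Etot (pr a (\<rho> b)) \<le> Hsum t Etot (pr a b)"
proof -
  have abV: "a \<in> V" "b \<in> V" "\<rho> b \<in> V" using ab sub rho(2) by blast+
  have "(\<Sum>s\<in>spins V. (s a * s (\<rho> b)) * (\<Prod>e\<in>E1. (1 + t * bond s e) * (1 + t * bond s (\<rho> ` e))) * RM s) \<le>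
     (\<Sum>s\<in>spins V. (s a * s b) * (\<Prod>e\<in>E1. (1 + t * bond s e) * (1 + t * bond s (\<rho> ` e))) * RM s)"
  proof (rule compare_two[OF fin(1) t])
    fix Q assume Q: "Q \<subseteq> E1"
    show "(\<Sum>s\<in>spins V. (s a * s (\<rho> b)) * XM Q s * RM s) \<le> (\<Sum>s\<in>spins V. (s a * s b) * XM Q s * RM s)"
      (is "sum ?f _ \<le> sum ?g _")
    proof (cases "\<exists>p. conn Q b p \<and> \<rho> p = p")
      case True
      then obtain p where p: "conn Q b p" "\<rho> p = p" by blast
      show ?thesis
      proof (rule sum_mono)
        fix s assume s: "s \<in> spins V"
        show "?f s \<le> ?g s"
        proof (cases "XM Q s = 0")
          case False
          then show ?thesis using support_line[OF s Q False p] by simp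
        qed (simp only: mult_zero_left mult_zero_right order_refl)
      qed
    next
      case False
      let ?C = "{w. conn Q b w}"
      let ?U = "\<rho> ` ?C"
      have C: "?C \<subseteq> D" using cluster_subset[OF ab(2), of Q] sub(1) Q by blast
      have UD: "w \<notin> D" if "w \<in> ?U" for w using that C D False by force
      have UF: "\<rho> w \<noteq> w" if "w \<in> ?U" for w using that False rho(1) by force
      have "sum ?f (spins V) = 0"
      proof (rule sum_flip_zero)
        show "?U \<subseteq> V" using C sub(3) rho(2) by blast
        fix s assume s: "s \<in> spins V"
        have "bond (flip ?U s) e = bond s e" "bond (flip ?U s) (\<rho> ` e) = bond s (\<rho> ` e)" if "e \<in> Q" for e
        proof -
          have e: "e \<in> E1" "finite e" "card e = 2" "e \<subseteq> D" using that Q fe c2 sub(1) by blast+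
          have "e \<inter> ?U = {}" using UD e(4) by blast
          then show "bond (flip ?U s) e = bond s e" using e by (intro bond_flip) auto
          have "\<rho> ` e \<inter> ?U = \<rho> ` (e \<inter> ?C)" using inj_rho[of UNIV] by (simp add: image_Int)
          then have "card (\<rho> ` e \<inter> ?U) = card (e \<inter> ?C)" using rho_edge by simp
          then show "bond (flip ?U s) (\<rho> ` e) = bond s (\<rho> ` e)"
            using e edge_even_cluster[OF e(3) that] by (intro bond_flip) auto
        qed
        then have x: "XM Q (flip ?U s) = XM Q s" by (intro prod.cong) auto
        have "bond (flip ?U s) e = bond s e" if "e \<in> E3" for e
        proof -
          have "e \<inter> ?U = {}" using UF E3[OF that] by blast
          then show ?thesis using that fe by (intro bond_flip) auto
        qed
        then have "RM (flip ?U s) = RM s" by (intro prod.cong) auto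
        moreover have "a \<notin> ?U" using UD ab by blast
        ultimately show "?f (flip ?U s) = - ?f s" unfolding x by (simp add: flip_def)
      qed
      also have "0 \<le> sum ?g (spins V)"
        by (intro pos_sum_nonneg pos_XM pos_mult pos_var fin)
      finally show ?thesis .
    qed
  qed
  then have "2 ^ card V * Hsum t Etot (pr a (\<rho> b)) \<le> 2 ^ card V * Hsum t Etot (pr a b)"
    using abV by (subst (1 2) Hsum_mirror) (auto simp: pr_def prod_pr[unfolded pr_def] split: if_splits cong: sum.cong)
  then show ?thesis by simp
qed

end

section \<open>Fermions in a strip\<close>

definition gridE :: "site set \<Rightarrow> site set set" where
  "gridE S = {{u, v} | u v. nn u v \<and> u \<in> S \<and> v \<in> S}"

text \<open>\<open>l\<close> counts steps of the transfer matrix, which runs across the strip and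
  acts on the spins of one column; the height parameter \<open>N\<close> will tend to
  infinity.\<close>

definition strip :: "nat \<Rightarrow> nat \<Rightarrow> site set" where
  "strip l N = {0..int l} \<times> {- int N..int N}"

context
  fixes t :: real and N :: nat
begin

abbreviation (input) "J \<equiv> {- int N..int N}"

definition Dg :: "(int \<Rightarrow> real) \<Rightarrow> real" where
  "Dg \<sigma> = (\<Prod>i\<in>{- int N..<int N}. 1 + t * (\<sigma> i * \<sigma> (i + 1)))"

definition Wg :: "(int \<Rightarrow> real) \<Rightarrow> (int \<Rightarrow> real) \<Rightarrow> real" where
  "Wg \<sigma> \<tau> = (\<Prod>j\<in>J. 1 + t * (\<sigma> j * \<tau> j))"

definition Dop :: "((int \<Rightarrow> real) \<Rightarrow> real) \<Rightarrow> (int \<Rightarrow> real) \<Rightarrow> real" where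
  "Dop f \<sigma> = Dg \<sigma> * f \<sigma>"

definition Wop :: "((int \<Rightarrow> real) \<Rightarrow> real) \<Rightarrow> (int \<Rightarrow> real) \<Rightarrow> real" where
  "Wop f \<sigma> = (\<Sum>\<tau>\<in>spins J. Wg \<sigma> \<tau> * f \<tau>)"

text \<open>The two kinds of Majorana operators of the transfer matrix formalism: a spin and the
  Jordan-Wigner string of spin flips below it, without and with the site itself.\<close>

definition Gam :: "int \<Rightarrow> ((int \<Rightarrow> real) \<Rightarrow> real) \<Rightarrow> (int \<Rightarrow> real) \<Rightarrow> real" where
  "Gam j f \<sigma> = \<sigma> j * f (flip {- int N..<j} \<sigma>)"

definition Gam' :: "int \<Rightarrow> ((int \<Rightarrow> real) \<Rightarrow> real) \<Rightarrow> (int \<Rightarrow> real) \<Rightarrow> real" where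
  "Gam' j f \<sigma> = \<sigma> j * f (flip {- int N..j} \<sigma>)"

text \<open>With \<open>tanh K = t\<close> and \<open>exp (- 2 * L) = t\<close>, the four constants
  are \<open>cosh (2 * K)\<close>, \<open>sinh (2 * K)\<close>, \<open>cosh (2 * L)\<close> and
  \<open>sinh (2 * L)\<close>.\<close>

definition "cC = (1 + t^2) / (1 - t^2)"
definition "cS = 2 * t / (1 - t^2)"
definition "cc = (1 / t + t) / 2"
definition "cd = (1 / t - t) / 2"

fun hf :: "((int \<Rightarrow> real) \<Rightarrow> real) \<Rightarrow> nat \<Rightarrow> (int \<Rightarrow> real) \<Rightarrow> real" where
  "hf f 0 = Dop f"
| "hf f (Suc k) = Dop (Wop (hf f k))"

text \<open>The left functional summing out \<open>i\<close> more columns, adjoint to the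
  construction of \<open>hf\<close>. Thus \<open>xx i k j\<close> below has a fermion acting in
  column \<open>k\<close>, with \<open>i\<close> columns still to come.\<close>

fun Gf :: "nat \<Rightarrow> ((int \<Rightarrow> real) \<Rightarrow> real) \<Rightarrow> real" where
  "Gf 0 f = (\<Sum>\<sigma>\<in>spins J. f \<sigma>)"
| "Gf (Suc i) f = Gf i (Dop (Wop f))"

definition "s0 \<sigma> = (\<sigma> 0 :: real)"

definition "xx i k j = Gf i (Gam j (hf s0 k))"
definition "xx' i k j = Gf i (Gam' j (hf s0 k))"
definition "yy l j = Gf l (Dop (Gam j s0))"
definition "yy' l j = Gf l (Dop (Gam' j s0))"

context
  assumes t: "0 < t" "t < 1"
begin

lemma CS: "cC - cS = (1 - t) / (1 + t)" "cC + cS = (1 + t) / (1 - t)"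
proof -
  have *: "1 - t^2 = (1 - t) * (1 + t)" by (simp add: power2_eq_square algebra_simps)
  have "cC - cS = ((1 - t) * (1 - t)) / ((1 - t) * (1 + t))" "cC + cS = ((1 + t) * (1 + t)) / ((1 - t) * (1 + t))"
    unfolding cC_def cS_def * by (simp_all add: diff_divide_distrib[symmetric] add_divide_distrib[symmetric]
        power2_eq_square algebra_simps)
  then show "cC - cS = (1 - t) / (1 + t)" "cC + cS = (1 + t) / (1 - t)" using t by auto
qed

text \<open>Only the bond between \<open>j - 1\<close> and \<open>j\<close> changes sign, and
  \<open>(1 - t * x) / (1 + t * x) = cC - cS * x\<close> for both signs \<open>x\<close>.\<close>

lemma Dg_flip:
  assumes "\<sigma> \<in> spins J" "- int N < j" "j \<le> int N"
  shows "Dg (flip {- int N..<j} \<sigma>) = Dg \<sigma> * (cC - cS * (\<sigma> (j - 1) * \<sigma> j))"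
proof -
  let ?I = "{- int N..<int N}"
  let ?f = "flip {- int N..<j} \<sigma>"
  have j: "j - 1 \<in> ?I" using assms by auto
  have "(\<Prod>i\<in>?I-{j-1}. 1 + t * (?f i * ?f (i + 1))) = (\<Prod>i\<in>?I-{j-1}. 1 + t * (\<sigma> i * \<sigma> (i + 1)))"
    by (rule prod.cong) (auto simp: flip_def)
  moreover have "1 + t * (?f (j - 1) * ?f j) = (1 + t * (\<sigma> (j - 1) * \<sigma> j)) * (cC - cS * (\<sigma> (j - 1) * \<sigma> j))"
  proof -
    have "?f (j - 1) * ?f j = - (\<sigma> (j - 1) * \<sigma> j)" using assms by (auto simp: flip_def)
    moreover have "\<sigma> (j - 1) * \<sigma> j = 1 \<or> \<sigma> (j - 1) * \<sigma> j = -1"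
      using spin_cases[OF assms(1), of j] spin_cases[OF assms(1), of "j - 1"] by auto
    moreover have "1 - t = (1 + t) * (cC - cS)" "1 + t = (1 - t) * (cC + cS)"
      using t unfolding CS by auto
    ultimately show ?thesis by auto
  qed
  ultimately show ?thesis
    unfolding Dg_def using j by (simp add: prod.remove[OF _ j])
qed

text \<open>Conjugation by the diagonal factor acts linearly on the pair \<open>Gam j\<close>,
  \<open>Gam' (j - 1)\<close>. This linearity, shared by \<open>Wop\<close>, is what makes the strip
  solvable.\<close>

lemma Gam_D:
  assumes "\<sigma> \<in> spins J" "- int N < j" "j \<le> int N"
  shows "Gam j (Dop f) \<sigma> = Dop (\<lambda>\<sigma>. cC * Gam j f \<sigma> - cS * Gam' (j - 1) f \<sigma>) \<sigma>"
proof -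
  have *: "{- int N..j - 1} = {- int N..<j}" by auto
  have "\<sigma> j * (Dg \<sigma> * (cC - cS * (\<sigma> (j - 1) * \<sigma> j))) = Dg \<sigma> * (cC * \<sigma> j - cS * \<sigma> (j - 1))"
    using spin_cases[OF assms(1), of j] by (auto simp: algebra_simps)
  note e = this
  have "Gam j (Dop f) \<sigma> = (\<sigma> j * (Dg \<sigma> * (cC - cS * (\<sigma> (j - 1) * \<sigma> j)))) * f (flip {- int N..<j} \<sigma>)"
    unfolding Gam_def Dop_def Dg_flip[OF assms] by (simp only: mult.assoc)
  also have "\<dots> = Dop (\<lambda>\<sigma>. cC * Gam j f \<sigma> - cS * Gam' (j - 1) f \<sigma>) \<sigma>"
    unfolding e Gam_def Gam'_def Dop_def * by (simp add: algebra_simps)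
  finally show ?thesis .
qed

lemma Gam'_D:
  assumes "\<sigma> \<in> spins J" "- int N \<le> j" "j < int N"
  shows "Gam' j (Dop f) \<sigma> = Dop (\<lambda>\<sigma>. cC * Gam' j f \<sigma> - cS * Gam (j + 1) f \<sigma>) \<sigma>"
proof -
  have *: "{- int N..j} = {- int N..<j + 1}" by auto
  have "\<sigma> j * (Dg \<sigma> * (cC - cS * (\<sigma> j * \<sigma> (j + 1)))) = Dg \<sigma> * (cC * \<sigma> j - cS * \<sigma> (j + 1))"
    using spin_cases[OF assms(1), of j] by (auto simp: algebra_simps)
  note e = this
  have d: "Dg (flip {- int N..j} \<sigma>) = Dg \<sigma> * (cC - cS * (\<sigma> j * \<sigma> (j + 1)))"
    using Dg_flip[OF assms(1), of "j + 1"] assms unfolding * by simp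
  have "Gam' j (Dop f) \<sigma> = (\<sigma> j * (Dg \<sigma> * (cC - cS * (\<sigma> j * \<sigma> (j + 1))))) * f (flip {- int N..j} \<sigma>)"
    unfolding Gam'_def Dop_def d by (simp only: mult.assoc)
  also have "\<dots> = Dop (\<lambda>\<sigma>. cC * Gam' j f \<sigma> - cS * Gam (j + 1) f \<sigma>) \<sigma>"
    unfolding e Gam_def Gam'_def Dop_def * by (simp add: algebra_simps)
  finally show ?thesis .
qed

lemma Wg_flip:
  assumes "j \<in> J" "\<sigma> \<in> spins J" "\<tau> \<in> spins J"
  shows "Wg \<sigma> (flip {j} \<tau>) * (1 + t * (\<sigma> j * \<tau> j)) = Wg \<sigma> \<tau> * (1 - t * (\<sigma> j * \<tau> j))"
proof -
  have "(\<Prod>i\<in>J-{j}. 1 + t * (\<sigma> i * flip {j} \<tau> i)) = (\<Prod>i\<in>J-{j}. 1 + t * (\<sigma> i * \<tau> i))"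
    by (rule prod.cong) (auto simp: flip_def)
  then show ?thesis unfolding Wg_def using assms(1) by (simp add: prod.remove[OF _ assms(1)] flip_def)
qed

lemma Wg_flip_both: "Wg (flip U \<sigma>) (flip U \<tau>) = Wg \<sigma> \<tau>"
  unfolding Wg_def flip_def by (rule prod.cong) auto

text \<open>For a sign \<open>x\<close>, \<open>x = cc - cd * (1 - t * x) / (1 + t * x)\<close>.
  With \<open>x = \<sigma> j * \<tau> j\<close>, a spin of the new column becomes a combination of
  the spin of the old column without and with a flip at that site.\<close>

lemma Wg_exchange:
  assumes "j \<in> J" "\<sigma> \<in> spins J" "\<tau> \<in> spins J"
  shows "Wg \<sigma> \<tau> * \<sigma> j = cc * (Wg \<sigma> \<tau> * \<tau> j) + cd * (Wg \<sigma> (flip {j} \<tau>) * (- \<tau> j))"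
proof -
  let ?u = "\<sigma> j * \<tau> j"
  have u: "?u = 1 \<or> ?u = -1" using spin_cases[OF assms(2), of j] spin_cases[OF assms(3), of j] by auto
  have p: "1 + t * ?u > 0" using u t by auto
  have "x * (1 + t * x) = cc * (1 + t * x) - cd * (1 - t * x)" if "x = 1 \<or> x = -1" for x
    using that t unfolding cc_def cd_def by (auto simp: field_simps)
  note e = this[OF u]
  have "Wg \<sigma> \<tau> * ?u * (1 + t * ?u) = Wg \<sigma> \<tau> * (?u * (1 + t * ?u))" by (simp only: mult.assoc)
  also have "\<dots> = Wg \<sigma> \<tau> * (cc * (1 + t * ?u) - cd * (1 - t * ?u))" unfolding e ..
  finally have "Wg \<sigma> \<tau> * ?u * (1 + t * ?u) = cc * Wg \<sigma> \<tau> * (1 + t * ?u) - cd * (Wg \<sigma> \<tau> * (1 - t * ?u))"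
    by (simp add: algebra_simps)
  also have "\<dots> = (cc * Wg \<sigma> \<tau> - cd * Wg \<sigma> (flip {j} \<tau>)) * (1 + t * ?u)"
    unfolding Wg_flip[OF assms, symmetric] by (simp add: algebra_simps)
  finally have "Wg \<sigma> \<tau> * ?u = cc * Wg \<sigma> \<tau> - cd * Wg \<sigma> (flip {j} \<tau>)"
    using p by simp
  note e' = this
  have "Wg \<sigma> \<tau> * (\<sigma> j * (\<tau> j * \<tau> j)) = (Wg \<sigma> \<tau> * ?u) * \<tau> j" by (simp only: mult.assoc)
  also have "\<dots> = cc * (Wg \<sigma> \<tau> * \<tau> j) + cd * (Wg \<sigma> (flip {j} \<tau>) * (- \<tau> j))"
    unfolding e' by (simp add: left_diff_distrib)
  finally show ?thesis unfolding spin_sq[OF assms(3)] by simp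
qed

text \<open>Moving \<open>\<sigma> j\<close> through \<open>Wop\<close> toggles site
  \<open>j\<close> in the string \<open>U\<close>, which exchanges \<open>Gam\<close> and
  \<open>Gam'\<close>.\<close>

lemma W_aux:
  assumes "j \<in> J" "\<sigma> \<in> spins J" "U \<subseteq> J" "U' = U - {j} \<or> U' = insert j U" "U \<noteq> U'"
  shows "\<sigma> j * Wop f (flip U \<sigma>) =
    cc * (\<Sum>\<tau>\<in>spins J. Wg \<sigma> \<tau> * (\<tau> j * f (flip U \<tau>))) + cd * (\<Sum>\<tau>\<in>spins J. Wg \<sigma> \<tau> * (\<tau> j * f (flip U' \<tau>)))"
proof -
  have "\<sigma> j * Wop f (flip U \<sigma>) = (\<Sum>\<tau>\<in>spins J. (Wg \<sigma> \<tau> * \<sigma> j) * f (flip U \<tau>))"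
    unfolding Wop_def sum_flip[OF assms(3), of "\<lambda>\<tau>. Wg (flip U \<sigma>) \<tau> * f \<tau>", symmetric] Wg_flip_both
    by (simp add: sum_distrib_left mult_ac)
  also have "\<dots> = cc * (\<Sum>\<tau>\<in>spins J. Wg \<sigma> \<tau> * (\<tau> j * f (flip U \<tau>))) +
      cd * (\<Sum>\<tau>\<in>spins J. Wg \<sigma> (flip {j} \<tau>) * ((- \<tau> j) * f (flip U \<tau>)))"
    unfolding sum_distrib_left sum.distrib[symmetric]
    by (rule sum.cong[OF refl], subst Wg_exchange[OF assms(1,2)]) (auto simp: algebra_simps)
  also have "(\<Sum>\<tau>\<in>spins J. Wg \<sigma> (flip {j} \<tau>) * ((- \<tau> j) * f (flip U \<tau>))) =
     (\<Sum>\<tau>\<in>spins J. Wg \<sigma> (flip {j} \<tau>) * (flip {j} \<tau> j * f (flip U' (flip {j} \<tau>))))"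
  proof -
    have "flip U' (flip {j} \<tau>) = flip U \<tau>" for \<tau> using assms(4,5) by (auto simp: flip_def fun_eq_iff)
    then show ?thesis by (simp add: flip_def)
  qed
  also have "\<dots> = (\<Sum>\<tau>\<in>spins J. Wg \<sigma> \<tau> * (\<tau> j * f (flip U' \<tau>)))"
    using assms(1) by (intro sum_flip[of "{j}" J "\<lambda>\<tau>. Wg \<sigma> \<tau> * (\<tau> j * f (flip U' \<tau>))"]) auto
  finally show ?thesis .
qed

lemma Gam_W:
  assumes "\<sigma> \<in> spins J" "j \<in> J"
  shows "Gam j (Wop f) \<sigma> = Wop (\<lambda>\<sigma>. cc * Gam j f \<sigma> + cd * Gam' j f \<sigma>) \<sigma>"
    "Gam' j (Wop f) \<sigma> = Wop (\<lambda>\<sigma>. cc * Gam' j f \<sigma> + cd * Gam j f \<sigma>) \<sigma>"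
proof -
  have j: "j \<in> {- int N..j}" "j \<notin> {- int N..<j}" "{- int N..j} = insert j {- int N..<j}" using assms by auto
  have "Gam j (Wop f) \<sigma> = cc * (\<Sum>\<tau>\<in>spins J. Wg \<sigma> \<tau> * (\<tau> j * f (flip {- int N..<j} \<tau>))) +
      cd * (\<Sum>\<tau>\<in>spins J. Wg \<sigma> \<tau> * (\<tau> j * f (flip {- int N..j} \<tau>)))"
    unfolding Gam_def using assms j by (intro W_aux) auto
  then show "Gam j (Wop f) \<sigma> = Wop (\<lambda>\<sigma>. cc * Gam j f \<sigma> + cd * Gam' j f \<sigma>) \<sigma>"
    unfolding Wop_def Gam_def Gam'_def by (simp add: sum_distrib_left sum.distrib[symmetric] algebra_simps)
  have "Gam' j (Wop f) \<sigma> = cc * (\<Sum>\<tau>\<in>spins J. Wg \<sigma> \<tau> * (\<tau> j * f (flip {- int N..j} \<tau>))) +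
      cd * (\<Sum>\<tau>\<in>spins J. Wg \<sigma> \<tau> * (\<tau> j * f (flip {- int N..<j} \<tau>)))"
    unfolding Gam'_def using assms j by (intro W_aux) auto
  then show "Gam' j (Wop f) \<sigma> = Wop (\<lambda>\<sigma>. cc * Gam' j f \<sigma> + cd * Gam j f \<sigma>) \<sigma>"
    unfolding Wop_def Gam_def Gam'_def by (simp add: sum_distrib_left sum.distrib[symmetric] algebra_simps)
qed

lemma D_cong: "f \<sigma> = g \<sigma> \<Longrightarrow> Dop f \<sigma> = Dop g \<sigma>" unfolding Dop_def by simp

lemma W_cong: "(\<And>\<tau>. \<tau> \<in> spins J \<Longrightarrow> f \<tau> = g \<tau>) \<Longrightarrow> Wop f \<sigma> = Wop g \<sigma>"
  unfolding Wop_def by (intro sum.cong) auto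

lemma Gf_cong: "(\<And>\<sigma>. \<sigma> \<in> spins J \<Longrightarrow> f \<sigma> = g \<sigma>) \<Longrightarrow> Gf i f = Gf i g"
proof (induction i arbitrary: f g)
  case (Suc i)
  have "Dop (Wop f) \<sigma> = Dop (Wop g) \<sigma>" for \<sigma> by (intro D_cong W_cong Suc.prems)
  then show ?case unfolding Gf.simps by (rule Suc.IH)
qed (auto intro: sum.cong)

lemma D_lin: "Dop (\<lambda>\<sigma>. a * f \<sigma> + b * g \<sigma>) = (\<lambda>\<sigma>. a * Dop f \<sigma> + b * Dop g \<sigma>)"
  unfolding Dop_def by (auto simp: algebra_simps)

lemma W_lin: "Wop (\<lambda>\<sigma>. a * f \<sigma> + b * g \<sigma>) = (\<lambda>\<sigma>. a * Wop f \<sigma> + b * Wop g \<sigma>)"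
  unfolding Wop_def by (rule ext) (simp add: sum_distrib_left sum.distrib[symmetric] algebra_simps)

lemma Gf_lin: "Gf i (\<lambda>\<sigma>. a * f \<sigma> + b * g \<sigma>) = a * Gf i f + b * Gf i g"
proof (induction i arbitrary: f g)
  case (Suc i)
  then show ?case by (simp add: W_lin D_lin)
qed (simp add: sum_distrib_left sum.distrib)

lemma Gf_lin_D: "Gf i (Dop (\<lambda>\<sigma>. a * f \<sigma> - b * g \<sigma>)) = a * Gf i (Dop f) - b * Gf i (Dop g)"
  using Gf_lin[of i a "Dop f" "- b" "Dop g"] by (simp add: D_lin[of a f "- b" g, simplified])

lemma Gf_lin_DW: "Gf i (Dop (Wop (\<lambda>\<sigma>. a * f \<sigma> + b * g \<sigma>))) = a * Gf (Suc i) f + b * Gf (Suc i) g"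
  using Gf_lin[of "Suc i" a f b g] by simp

lemma xx_end:
  assumes "\<bar>j\<bar> < int N"
  shows "xx l 0 j = cC * yy l j - cS * yy' l (j - 1)" "xx' l 0 j = cC * yy' l j - cS * yy l (j + 1)"
proof -
  have "xx l 0 j = Gf l (Dop (\<lambda>\<sigma>. cC * Gam j s0 \<sigma> - cS * Gam' (j - 1) s0 \<sigma>))"
    unfolding xx_def using assms by (intro Gf_cong) (simp add: Gam_D)
  then show "xx l 0 j = cC * yy l j - cS * yy' l (j - 1)" unfolding yy_def yy'_def by (simp add: Gf_lin_D)
  have "xx' l 0 j = Gf l (Dop (\<lambda>\<sigma>. cC * Gam' j s0 \<sigma> - cS * Gam (j + 1) s0 \<sigma>))"
    unfolding xx'_def using assms by (intro Gf_cong) (simp add: Gam'_D)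
  then show "xx' l 0 j = cC * yy' l j - cS * yy l (j + 1)" unfolding yy_def yy'_def by (simp add: Gf_lin_D)
qed

lemma DW_push:
  assumes "j \<in> J"
  shows "Gf i (Dop (Gam j (Wop f))) = cc * Gf (Suc i) (Gam j f) + cd * Gf (Suc i) (Gam' j f)"
    "Gf i (Dop (Gam' j (Wop f))) = cc * Gf (Suc i) (Gam' j f) + cd * Gf (Suc i) (Gam j f)"
proof -
  have "Gf i (Dop (Gam j (Wop f))) = Gf i (Dop (Wop (\<lambda>\<sigma>. cc * Gam j f \<sigma> + cd * Gam' j f \<sigma>)))"
    using assms by (intro Gf_cong D_cong Gam_W)
  then show "Gf i (Dop (Gam j (Wop f))) = cc * Gf (Suc i) (Gam j f) + cd * Gf (Suc i) (Gam' j f)"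
    by (simp only: Gf_lin_DW)
  have "Gf i (Dop (Gam' j (Wop f))) = Gf i (Dop (Wop (\<lambda>\<sigma>. cc * Gam' j f \<sigma> + cd * Gam j f \<sigma>)))"
    using assms by (intro Gf_cong D_cong Gam_W)
  then show "Gf i (Dop (Gam' j (Wop f))) = cc * Gf (Suc i) (Gam' j f) + cd * Gf (Suc i) (Gam j f)"
    by (simp only: Gf_lin_DW)
qed

text \<open>One full transfer step pushes the fermion one column back towards the source. The bound
  on \<open>j\<close> keeps the neighbours \<open>j - 1\<close> and \<open>j + 1\<close> inside the
  column.\<close>

lemma xx_step:
  assumes "\<bar>j\<bar> < int N"
  shows "xx i (Suc k) j = cC * (cc * xx (Suc i) k j + cd * xx' (Suc i) k j)
      - cS * (cc * xx' (Suc i) k (j - 1) + cd * xx (Suc i) k (j - 1))"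
    "xx' i (Suc k) j = cC * (cc * xx' (Suc i) k j + cd * xx (Suc i) k j)
      - cS * (cc * xx (Suc i) k (j + 1) + cd * xx' (Suc i) k (j + 1))"
proof -
  let ?f = "Wop (hf s0 k)"
  have jj: "j \<in> J" "j - 1 \<in> J" "j + 1 \<in> J" using assms by auto
  have "xx i (Suc k) j = Gf i (Dop (\<lambda>\<sigma>. cC * Gam j ?f \<sigma> - cS * Gam' (j - 1) ?f \<sigma>))"
    unfolding xx_def using assms by (intro Gf_cong) (simp add: Gam_D)
  also have "\<dots> = cC * Gf i (Dop (Gam j ?f)) - cS * Gf i (Dop (Gam' (j - 1) ?f))" by (rule Gf_lin_D)
  finally show "xx i (Suc k) j = cC * (cc * xx (Suc i) k j + cd * xx' (Suc i) k j)
      - cS * (cc * xx' (Suc i) k (j - 1) + cd * xx (Suc i) k (j - 1))"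
    unfolding xx_def xx'_def by (simp only: DW_push[OF jj(1)] DW_push[OF jj(2)] DW_push[OF jj(3)])
  have "xx' i (Suc k) j = Gf i (Dop (\<lambda>\<sigma>. cC * Gam' j ?f \<sigma> - cS * Gam (j + 1) ?f \<sigma>))"
    unfolding xx'_def using assms by (intro Gf_cong) (simp add: Gam'_D)
  also have "\<dots> = cC * Gf i (Dop (Gam' j ?f)) - cS * Gf i (Dop (Gam (j + 1) ?f))" by (rule Gf_lin_D)
  finally show "xx' i (Suc k) j = cC * (cc * xx' (Suc i) k j + cd * xx (Suc i) k j)
      - cS * (cc * xx (Suc i) k (j + 1) + cd * xx' (Suc i) k (j + 1))"
    unfolding xx_def xx'_def by (simp only: DW_push[OF jj(1)] DW_push[OF jj(2)] DW_push[OF jj(3)])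
qed

lemma Gf_hf: "Gf i (hf f k) = (\<Sum>\<sigma>\<in>spins J. hf f (i + k) \<sigma>)"
proof (induction i arbitrary: k)
  case (Suc i)
  have "Gf (Suc i) (hf f k) = Gf i (hf f (Suc k))" by simp
  then show ?case using Suc[of "Suc k"] by simp
qed simp

end

end

section \<open>Grid graphs, and spin sums on a strip as iterated transfer operators\<close>

lemma gridE_iff: "e \<in> gridE S \<longleftrightarrow> (\<exists>x y. (x, y) \<in> S \<and>
   ((x + 1, y) \<in> S \<and> e = {(x, y), (x + 1, y)} \<or> (x, y + 1) \<in> S \<and> e = {(x, y), (x, y + 1)}))"
proof
  assume "e \<in> gridE S"
  then obtain u v where e: "e = {u, v}" "nn u v" "u \<in> S" "v \<in> S" unfolding gridE_def by blast
  obtain a b c d where uv: "u = (a, b)" "v = (c, d)" by (cases u, cases v)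
  consider "c = a + 1" "d = b" | "a = c + 1" "d = b" | "c = a" "d = b + 1" | "c = a" "b = d + 1"
    using e(2) unfolding uv nn_def by fastforce
  then show "\<exists>x y. (x, y) \<in> S \<and>
   ((x + 1, y) \<in> S \<and> e = {(x, y), (x + 1, y)} \<or> (x, y + 1) \<in> S \<and> e = {(x, y), (x, y + 1)})"
  proof cases
    case 1 then show ?thesis using e unfolding uv by (intro exI[of _ a] exI[of _ b]) simp
  next
    case 2 then show ?thesis using e unfolding uv by (intro exI[of _ c] exI[of _ d]) (simp add: insert_commute)
  next
    case 3 then show ?thesis using e unfolding uv by (intro exI[of _ a] exI[of _ b]) simp
  next
    case 4 then show ?thesis using e unfolding uv by (intro exI[of _ c] exI[of _ d]) (simp add: insert_commute)
  qed
next
  assume "\<exists>x y. (x, y) \<in> S \<and>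
   ((x + 1, y) \<in> S \<and> e = {(x, y), (x + 1, y)} \<or> (x, y + 1) \<in> S \<and> e = {(x, y), (x, y + 1)})"
  then show "e \<in> gridE S" unfolding gridE_def nn_def by fastforce
qed

lemma gridE_h: "(x, y) \<in> S \<Longrightarrow> (x + 1, y) \<in> S \<Longrightarrow> {(x, y), (x + 1, y)} \<in> gridE S"
  and gridE_v: "(x, y) \<in> S \<Longrightarrow> (x, y + 1) \<in> S \<Longrightarrow> {(x, y), (x, y + 1)} \<in> gridE S"
  unfolding gridE_iff by blast+

lemma gridE_graph: "finite S \<Longrightarrow> graph (gridE S)"
proof -
  assume S: "finite S"
  have "gridE S \<subseteq> Pow S" unfolding gridE_def by auto
  moreover have "card e = 2" if "e \<in> gridE S" for e
    using that unfolding gridE_def nn_def by (force simp: card_2_iff)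
  ultimately show ?thesis unfolding graph_def using S by (auto intro: finite_subset)
qed

lemma gridE_mono: "S \<subseteq> T \<Longrightarrow> gridE S \<subseteq> gridE T"
  unfolding gridE_def by blast

lemma gridE_sub: "e \<in> gridE S \<Longrightarrow> e \<subseteq> S"
  unfolding gridE_def by auto

lemma finite_strip [simp]: "finite (strip l N)" unfolding strip_def by simp

lemma gridE_strip_0: "gridE (strip 0 N) = (\<lambda>j. {(0, j), (0, j + 1)}) ` {- int N..<int N}"
proof (intro equalityI subsetI)
  fix e assume "e \<in> gridE (strip 0 N)"
  then obtain y where "- int N \<le> y" "y + 1 \<le> int N" "e = {(0, y), (0, y + 1)}"
    unfolding gridE_iff strip_def by auto
  then show "e \<in> (\<lambda>j. {(0, j), (0, j + 1)}) ` {- int N..<int N}" by (intro image_eqI[of _ _ y]) auto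
next
  fix e :: "site set" assume "e \<in> (\<lambda>j. {(0, j), (0, j + 1)}) ` {- int N..<int N}"
  then obtain y where "y \<in> {- int N..<int N}" "e = {(0, y), (0, y + 1)}" by blast
  then show "e \<in> gridE (strip 0 N)" unfolding strip_def using gridE_v[of 0 y] by auto
qed

lemma gridE_strip_Suc: "gridE (strip (Suc l) N) = gridE (strip l N) \<union>
   ((\<lambda>j. {(int l, j), (int l + 1, j)}) ` {- int N..int N} \<union>
    (\<lambda>j. {(int l + 1, j), (int l + 1, j + 1)}) ` {- int N..<int N})" (is "_ = ?A \<union> (?B \<union> ?C)")
proof (intro equalityI subsetI)
  fix e assume "e \<in> gridE (strip (Suc l) N)"
  then obtain x y where "0 \<le> x" "x \<le> int l + 1" "- int N \<le> y" "y \<le> int N" and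
    e: "x + 1 \<le> int l + 1 \<and> e = {(x, y), (x + 1, y)} \<or> y + 1 \<le> int N \<and> e = {(x, y), (x, y + 1)}"
    unfolding gridE_iff strip_def by auto
  then consider "x + 1 \<le> int l" "e = {(x, y), (x + 1, y)}" | "x = int l" "e = {(x, y), (x + 1, y)}"
    | "x \<le> int l" "y + 1 \<le> int N" "e = {(x, y), (x, y + 1)}" | "x = int l + 1" "y + 1 \<le> int N" "e = {(x, y), (x, y + 1)}"
    by linarith
  then show "e \<in> ?A \<union> (?B \<union> ?C)"
  proof cases
    case 1
    then have "e \<in> ?A" unfolding 1(2) strip_def using \<open>0 \<le> x\<close> \<open>- int N \<le> y\<close> \<open>y \<le> int N\<close>
      by (intro gridE_h) auto
    then show ?thesis by blast
  next
    case 3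
    then have "e \<in> ?A" unfolding 3(3) strip_def using \<open>0 \<le> x\<close> \<open>- int N \<le> y\<close> \<open>y \<le> int N\<close>
      by (intro gridE_v) auto
    then show ?thesis by blast
  next
    case 2
    then have "e \<in> ?B" using \<open>- int N \<le> y\<close> \<open>y \<le> int N\<close> by (intro image_eqI[of _ _ y]) auto
    then show ?thesis by blast
  next
    case 4
    then have "e \<in> ?C" using \<open>- int N \<le> y\<close> by (intro image_eqI[of _ _ y]) auto
    then show ?thesis by blast
  qed
next
  fix e assume "e \<in> ?A \<union> (?B \<union> ?C)"
  moreover have "?A \<subseteq> gridE (strip (Suc l) N)" by (rule gridE_mono) (auto simp: strip_def)
  moreover have "{(int l, j), (int l + 1, j)} \<in> gridE (strip (Suc l) N)" if "j \<in> {- int N..int N}" for j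
    using that unfolding strip_def by (intro gridE_h) auto
  moreover have "{(int l + 1, j), (int l + 1, j + 1)} \<in> gridE (strip (Suc l) N)" if "j \<in> {- int N..<int N}" for j
    using that unfolding strip_def by (intro gridE_v) auto
  ultimately show "e \<in> gridE (strip (Suc l) N)" by blast
qed

lemma bond_pair: "u \<noteq> v \<Longrightarrow> bond s {u, v} = s u * s v"
  unfolding bond_def by simp

lemma strip_prod_0:
  "(\<Prod>e\<in>gridE (strip 0 N). 1 + t * bond \<omega> e) = Dg t N (\<lambda>j. \<omega> (0, j))"
proof -
  have "inj_on (\<lambda>j. {(0::int, j), (0, j + 1)}) {- int N..<int N}"
    by (rule inj_onI) (auto simp: doubleton_eq_iff)
  then show ?thesis unfolding gridE_strip_0 Dg_def by (simp add: prod.reindex bond_pair)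
qed

lemma strip_prod_Suc:
  "(\<Prod>e\<in>gridE (strip (Suc l) N). 1 + t * bond \<omega> e) = (\<Prod>e\<in>gridE (strip l N). 1 + t * bond \<omega> e) *
     (Wg t N (\<lambda>j. \<omega> (int l + 1, j)) (\<lambda>j. \<omega> (int l, j)) * Dg t N (\<lambda>j. \<omega> (int l + 1, j)))"
proof -
  let ?b = "\<lambda>j. {(int l, j), (int l + 1, j)}" and ?c = "\<lambda>j. {(int l + 1, j), (int l + 1, j + 1)}"
  have i: "inj_on ?b {- int N..int N}" "inj_on ?c {- int N..<int N}"
    by (rule inj_onI, auto simp: doubleton_eq_iff)+
  have d1: "?b ` {- int N..int N} \<inter> ?c ` {- int N..<int N} = {}" by (auto simp: doubleton_eq_iff)
  have d2: "gridE (strip l N) \<inter> (?b ` {- int N..int N} \<union> ?c ` {- int N..<int N}) = {}"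
  proof -
    have "(int l + 1, j) \<notin> e" if "e \<in> gridE (strip l N)" for e j
      using gridE_sub[OF that] unfolding strip_def by auto
    then show ?thesis by blast
  qed
  have "finite (gridE (strip l N))" using gridE_graph[of "strip l N"] unfolding graph_def by simp
  then have "(\<Prod>e\<in>gridE (strip (Suc l) N). 1 + t * bond \<omega> e) = (\<Prod>e\<in>gridE (strip l N). 1 + t * bond \<omega> e) *
     ((\<Prod>e\<in>?b ` {- int N..int N}. 1 + t * bond \<omega> e) * (\<Prod>e\<in>?c ` {- int N..<int N}. 1 + t * bond \<omega> e))"
    unfolding gridE_strip_Suc using d1 d2 by (simp add: prod.union_disjoint)
  then show ?thesis
    by (simp add: prod.reindex[OF i(1)] prod.reindex[OF i(2)] bond_pair Wg_def Dg_def mult.commute)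
qed

text \<open>The last column is peeled off; \<open>g\<close> is arbitrary because the weight between
  columns is absorbed into it for the induction hypothesis.\<close>

lemma grid_sum:
  assumes t: "0 < t" "t < 1"
  shows "(\<Sum>\<omega>\<in>spins (strip l N). g (\<lambda>j. \<omega> (int l, j)) * f (\<lambda>j. \<omega> (0, j)) * (\<Prod>e\<in>gridE (strip l N). 1 + t * bond \<omega> e))
    = (\<Sum>\<sigma>\<in>spins {- int N..int N}. g \<sigma> * hf t N f l \<sigma>)"
proof (induction l arbitrary: g)
  case 0
  have "(\<Sum>\<omega>\<in>spins (strip 0 N). g (\<lambda>j. \<omega> (0, j)) * f (\<lambda>j. \<omega> (0, j)) * Dg t N (\<lambda>j. \<omega> (0, j)))
    = (\<Sum>\<sigma>\<in>spins {- int N..int N}. g \<sigma> * f \<sigma> * Dg t N \<sigma>)"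
    by (rule sum.reindex_bij_witness[where i="\<lambda>\<sigma> (x, y). if x = 0 then \<sigma> y else 1" and j="\<lambda>\<omega> j. \<omega> (0, j)"])
      (auto simp: spins_def strip_def fun_eq_iff)
  then show ?case using t by (simp add: strip_prod_0 hf.simps Dop_def mult_ac)
next
  case (Suc l)
  let ?J = "{- int N..int N}"
  let ?P = "\<lambda>\<omega>. \<Prod>e\<in>gridE (strip l N). 1 + t * bond \<omega> e"
  let ?c = "\<lambda>(\<omega>::site \<Rightarrow> real) (\<sigma>::int \<Rightarrow> real) (x, y). if x = int l + 1 then \<sigma> y else \<omega> (x, y)"
  have P: "?P (?c \<omega> \<sigma>) = ?P \<omega>" for \<omega> \<sigma>
  proof (rule prod.cong[OF refl])
    fix e assume "e \<in> gridE (strip l N)"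
    then have "e \<subseteq> strip l N" by (rule gridE_sub)
    then have "bond (?c \<omega> \<sigma>) e = bond \<omega> e" unfolding bond_def
      by (intro prod.cong) (auto simp: strip_def)
    then show "1 + t * bond (?c \<omega> \<sigma>) e = 1 + t * bond \<omega> e" by simp
  qed
  have "(\<Sum>\<omega>\<in>spins (strip (Suc l) N). g (\<lambda>j. \<omega> (int (Suc l), j)) * f (\<lambda>j. \<omega> (0, j)) *
     (\<Prod>e\<in>gridE (strip (Suc l) N). 1 + t * bond \<omega> e)) =
    (\<Sum>\<omega>\<in>spins (strip (Suc l) N). g (\<lambda>j. \<omega> (int l + 1, j)) * f (\<lambda>j. \<omega> (0, j)) * (?P \<omega> *
      (Wg t N (\<lambda>j. \<omega> (int l + 1, j)) (\<lambda>j. \<omega> (int l, j)) * Dg t N (\<lambda>j. \<omega> (int l + 1, j)))))"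
    unfolding strip_prod_Suc by (simp add: add.commute)
  also have "\<dots> = (\<Sum>(\<sigma>, \<omega>)\<in>spins ?J \<times> spins (strip l N). g \<sigma> * f (\<lambda>j. \<omega> (0, j)) * (?P \<omega> *
      (Wg t N \<sigma> (\<lambda>j. \<omega> (int l, j)) * Dg t N \<sigma>)))"
  proof (rule sum.reindex_bij_witness[where i="\<lambda>(\<sigma>, \<omega>). ?c \<omega> \<sigma>" and
      j="\<lambda>\<omega>. (\<lambda>j. \<omega> (int l + 1, j), \<lambda>(x, y). if x = int l + 1 then 1 else \<omega> (x, y))"])
    fix \<omega> assume w: "\<omega> \<in> spins (strip (Suc l) N)"
    let ?w = "\<lambda>(x, y). if x = int l + 1 then 1 else \<omega> (x, y)"
    let ?s = "\<lambda>j. \<omega> (int l + 1, j)"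
    have *: "?c ?w ?s = \<omega>" by (auto simp: fun_eq_iff)
    then show "(case (?s, ?w) of (\<sigma>, \<omega>) \<Rightarrow> ?c \<omega> \<sigma>) = \<omega>" by simp
    have "?P ?w = ?P \<omega>" using P[where \<omega>="?w" and \<sigma>="?s"] unfolding * by simp
    then show "(case (?s, ?w) of (\<sigma>, \<omega>) \<Rightarrow> g \<sigma> * f (\<lambda>j. \<omega> (0, j)) * (?P \<omega> *
      (Wg t N \<sigma> (\<lambda>j. \<omega> (int l, j)) * Dg t N \<sigma>))) = g (\<lambda>j. \<omega> (int l + 1, j)) * f (\<lambda>j. \<omega> (0, j)) * (?P \<omega> *
      (Wg t N (\<lambda>j. \<omega> (int l + 1, j)) (\<lambda>j. \<omega> (int l, j)) * Dg t N (\<lambda>j. \<omega> (int l + 1, j))))" by simp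
    show "(?s, ?w) \<in> spins ?J \<times> spins (strip l N)" using w by (auto simp: spins_def strip_def)
  next
    fix p assume p: "p \<in> spins ?J \<times> spins (strip l N)"
    obtain \<sigma> \<omega> where so: "p = (\<sigma>, \<omega>)" "\<sigma> \<in> spins ?J" "\<omega> \<in> spins (strip l N)" using p by blast
    have c: "\<sigma> v = 1 \<or> \<sigma> v = -1" "\<omega> w = 1 \<or> \<omega> w = -1" for v w
      using spin_cases[OF so(2)] spin_cases[OF so(3)] by auto
    have o: "v \<notin> ?J \<Longrightarrow> \<sigma> v = 1" "w \<notin> strip l N \<Longrightarrow> \<omega> w = 1" for v w
      using so(2,3) unfolding spins_def mem_Collect_eq by metis+
    have "?c \<omega> \<sigma> v = 1" if "v \<notin> strip (Suc l) N" for v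
      using that o(1)[of "snd v"] o(2)[of v] by (cases v) (auto simp: strip_def)
    moreover have "?c \<omega> \<sigma> v = 1 \<or> ?c \<omega> \<sigma> v = -1" for v
      using c(1)[of "snd v"] c(2)[of v] by (cases v) auto
    ultimately have "?c \<omega> \<sigma> \<in> spins (strip (Suc l) N)"
      unfolding spins_def by blast
    then show "(case p of (\<sigma>, \<omega>) \<Rightarrow> ?c \<omega> \<sigma>) \<in> spins (strip (Suc l) N)"
      unfolding so(1) by simp
    from p show "(\<lambda>j. (case p of (\<sigma>, \<omega>) \<Rightarrow> ?c \<omega> \<sigma>) (int l + 1, j),
        \<lambda>(x, y). if x = int l + 1 then 1 else (case p of (\<sigma>, \<omega>) \<Rightarrow> ?c \<omega> \<sigma>) (x, y)) = p"
      by (auto simp: spins_def strip_def fun_eq_iff)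
  qed
  also have "\<dots> = (\<Sum>\<sigma>\<in>spins ?J. g \<sigma> * Dg t N \<sigma> * (\<Sum>\<omega>\<in>spins (strip l N). Wg t N \<sigma> (\<lambda>j. \<omega> (int l, j)) *
     f (\<lambda>j. \<omega> (0, j)) * ?P \<omega>))"
    by (simp add: sum.cartesian_product[symmetric] sum_distrib_left mult_ac)
  also have "\<dots> = (\<Sum>\<sigma>\<in>spins ?J. g \<sigma> * hf t N f (Suc l) \<sigma>)"
    unfolding Suc.IH using t by (simp add: hf.simps Dop_def Wop_def mult_ac)
  finally show ?case .
qed

definition Zc :: "real \<Rightarrow> nat \<Rightarrow> nat \<Rightarrow> real" where
  "Zc t l N = 2 ^ card (strip l N) * Hsum t (gridE (strip l N)) {}"

definition cX :: "real \<Rightarrow> nat \<Rightarrow> nat \<Rightarrow> int \<Rightarrow> real" where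
  "cX t l N j = cor t (gridE (strip l N)) (0, 0) (int l, j)"

definition cY :: "real \<Rightarrow> nat \<Rightarrow> nat \<Rightarrow> int \<Rightarrow> real" where
  "cY t l N j = cor t (gridE (strip l N)) (0, 0) (0, j)"

lemma Zc_pos: "0 < t \<Longrightarrow> 0 < Zc t l N"
  using Hsum_empty_ge[OF gridE_graph[of "strip l N"], of t] unfolding Zc_def by simp

lemma cor_sum:
  assumes "0 < t" "u \<in> strip l N" "v \<in> strip l N"
  shows "Zc t l N * cor t (gridE (strip l N)) u v =
    (\<Sum>\<omega>\<in>spins (strip l N). \<omega> u * \<omega> v * (\<Prod>e\<in>gridE (strip l N). 1 + t * bond \<omega> e))"
proof -
  have g: "graph (gridE (strip l N))" by (rule gridE_graph) simp
  have "Zc t l N * cor t (gridE (strip l N)) u v = 2 ^ card (strip l N) * Hsum t (gridE (strip l N)) (pr u v)"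
    using Hsum_empty_ge[OF g, of t] assms(1) unfolding Zc_def cor_def by simp
  also have "\<dots> = (\<Sum>s\<in>spins (strip l N). (\<Prod>w\<in>pr u v. s w) * (\<Prod>e\<in>gridE (strip l N). 1 + t * bond s e))"
    using g assms pr_subset[of u "strip l N" v] gridE_sub unfolding graph_def by (intro sum_spins[symmetric]) auto
  finally show ?thesis by (simp add: prod_pr)
qed

text \<open>In the last column nothing acts after the fermion, so its string is removed by
  substituting the flipped configuration in the sum. The string of \<open>Gam'\<close> contains
  \<open>j\<close> itself, hence the sign.\<close>

lemma xx_left:
  assumes t: "0 < t" "t < 1" and j: "\<bar>j\<bar> \<le> int N"
  shows "xx t N 0 l j = Zc t l N * cX t l N j" "xx' t N 0 l j = - (Zc t l N * cX t l N j)"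
proof -
  have *: "Zc t l N * cX t l N j = (\<Sum>\<sigma>\<in>spins {- int N..int N}. \<sigma> j * hf t N s0 l \<sigma>)"
    unfolding cX_def using j t
    by (subst cor_sum) (auto simp: strip_def grid_sum[OF t, where N=N and l=l and g="\<lambda>\<sigma>. \<sigma> j" and f=s0, unfolded strip_def, symmetric] s0_def mult_ac)
  have "{- int N..<j} \<subseteq> {- int N..int N}" "{- int N..j} \<subseteq> {- int N..int N}" using j by auto
  note f = sum_flip[OF this(1), of "\<lambda>\<sigma>. \<sigma> j * hf t N s0 l \<sigma>"] sum_flip[OF this(2), of "\<lambda>\<sigma>. \<sigma> j * hf t N s0 l \<sigma>"]
  show "xx t N 0 l j = Zc t l N * cX t l N j"
    unfolding * f(1)[symmetric] xx_def Gf.simps Gam_def by (simp add: flip_def)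
  show "xx' t N 0 l j = - (Zc t l N * cX t l N j)"
    unfolding * f(2)[symmetric] xx'_def Gf.simps Gam'_def
    using j by (simp add: flip_def sum_negf abs_le_iff)
qed

text \<open>At the source the string acts only on the spin at height 0 and contributes a sign
  according to whether 0 belongs to it; \<open>Gam\<close> and \<open>Gam'\<close> differ exactly at
  \<open>j = 0\<close>.\<close>

lemma yy_right:
  assumes t: "0 < t" "t < 1" and j: "\<bar>j\<bar> \<le> int N"
  shows "yy t N l j = Zc t l N * (if 0 < j then - cY t l N j else cY t l N j)"
    "yy' t N l j = Zc t l N * (if 0 \<le> j then - cY t l N j else cY t l N j)"
proof -
  let ?J = "{- int N..int N}"
  have *: "Gf t N l (Dop t N f) = (\<Sum>\<omega>\<in>spins (strip l N). f (\<lambda>j. \<omega> (0, j)) * (\<Prod>e\<in>gridE (strip l N). 1 + t * bond \<omega> e))" for f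
  proof -
    have "Gf t N l (Dop t N f) = Gf t N l (hf t N f 0)" by simp
    also have "\<dots> = (\<Sum>\<sigma>\<in>spins ?J. 1 * hf t N f l \<sigma>)" by (subst Gf_hf[OF t]) simp
    finally show ?thesis unfolding grid_sum[OF t, where g="\<lambda>_. 1", symmetric] by simp
  qed
  have Z: "Zc t l N * cY t l N j = (\<Sum>\<omega>\<in>spins (strip l N). \<omega> (0, 0) * \<omega> (0, j) * (\<Prod>e\<in>gridE (strip l N). 1 + t * bond \<omega> e))"
    unfolding cY_def using t j by (intro cor_sum) (auto simp: strip_def)
  have "yy t N l j = (\<Sum>\<omega>\<in>spins (strip l N). (if 0 < j then -1 else 1) *
      (\<omega> (0, 0) * \<omega> (0, j) * (\<Prod>e\<in>gridE (strip l N). 1 + t * bond \<omega> e)))"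
    unfolding yy_def * using j by (intro sum.cong) (auto simp: Gam_def s0_def flip_def)
  then show "yy t N l j = Zc t l N * (if 0 < j then - cY t l N j else cY t l N j)"
    unfolding sum_distrib_left[symmetric] Z[symmetric] by simp
  have "yy' t N l j = (\<Sum>\<omega>\<in>spins (strip l N). (if 0 \<le> j then -1 else 1) *
      (\<omega> (0, 0) * \<omega> (0, j) * (\<Prod>e\<in>gridE (strip l N). 1 + t * bond \<omega> e)))"
    unfolding yy'_def * using j by (intro sum.cong) (auto simp: Gam'_def s0_def flip_def)
  then show "yy' t N l j = Zc t l N * (if 0 \<le> j then - cY t l N j else cY t l N j)"
    unfolding sum_distrib_left[symmetric] Z[symmetric] by simp
qed

section \<open>Generating functions in the vertical coordinate\<close>

lemma exp_int_summable:
  assumes "0 < (a::real)"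
  shows "(\<lambda>j::int. exp (- a * \<bar>real_of_int j\<bar>)) summable_on UNIV"
proof -
  have "summable (\<lambda>n::nat. exp (- a) ^ n)" using assms by (intro summable_geometric) auto
  then have "(\<lambda>n::nat. exp (- a) ^ n) summable_on UNIV"
    by (intro norm_summable_imp_summable_on) simp
  moreover have "exp (- a) ^ n = exp (- a * real n)" for n by (simp add: exp_of_nat_mult[symmetric] mult.commute)
  ultimately have s: "(\<lambda>n::nat. exp (- a * real n)) summable_on UNIV" by simp
  have "(\<lambda>j::int. exp (- a * \<bar>real_of_int j\<bar>)) summable_on range int"
    using s by (subst summable_on_reindex) (auto simp: o_def)
  moreover have "(\<lambda>j::int. exp (- a * \<bar>real_of_int j\<bar>)) summable_on range (\<lambda>n. - int n)"
    using s by (subst summable_on_reindex) (auto simp: o_def inj_def)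
  ultimately have "(\<lambda>j::int. exp (- a * \<bar>real_of_int j\<bar>)) summable_on (range int \<union> range (\<lambda>n. - int n))"
    by (rule summable_on_union)
  moreover have "range int \<union> range (\<lambda>n. - int n) = UNIV"
  proof -
    have "j = int (nat j) \<or> j = - int (nat (- j))" for j by auto
    then have "j \<in> range int \<union> range (\<lambda>n. - int n)" for j by blast
    then show ?thesis by blast
  qed
  ultimately show ?thesis by simp
qed

lemma has_sum_diff_real:
  fixes f g :: "'a \<Rightarrow> real"
  assumes "(f has_sum a) A" "(g has_sum b) A"
  shows "((\<lambda>x. f x - g x) has_sum (a - b)) A"
  using has_sum_add[OF assms(1), of "\<lambda>x. - g x" "- b"] assms(2) by (simp add: has_sum_uminus)

lemma has_sum_shift:
  assumes "((\<lambda>j::int. exp (s * real_of_int j) * f j) has_sum a) UNIV"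
  shows "((\<lambda>j. exp (s * real_of_int j) * f (j + c)) has_sum (exp (- s * real_of_int c) * a)) UNIV"
proof -
  have "((\<lambda>j. exp (- s * real_of_int c) * (exp (s * real_of_int j) * f j)) has_sum (exp (- s * real_of_int c) * a)) UNIV"
    by (rule has_sum_cmult_right[OF assms])
  then have "((\<lambda>j. exp (- s * real_of_int c) * (exp (s * real_of_int j) * f j)) \<circ> (\<lambda>j. j + c) has_sum (exp (- s * real_of_int c) * a)) UNIV"
    by (subst has_sum_reindex[symmetric]) (auto simp: inj_def)
  moreover have "((\<lambda>j. exp (- s * real_of_int c) * (exp (s * real_of_int j) * f j)) \<circ> (\<lambda>j. j + c)) =
     (\<lambda>j. exp (s * real_of_int j) * f (j + c))"
    by (auto simp: fun_eq_iff exp_add[symmetric] algebra_simps)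
  ultimately show ?thesis by simp
qed

text \<open>\<open>(ep, eq)\<close> is the transfer matrix of the tilt \<open>s\<close> applied to the vector \<open>(1, 1)\<close>.\<close>

fun ep :: "real \<Rightarrow> real \<Rightarrow> nat \<Rightarrow> real \<times> real" where
  "ep t s 0 = (cC t - cS t * exp s, cC t - cS t * exp (- s))"
| "ep t s (Suc k) = (case ep t s k of (p, q) \<Rightarrow>
     (cC t * (cc t * p + cd t * q) - cS t * exp s * (cc t * q + cd t * p),
      cC t * (cc t * q + cd t * p) - cS t * exp (- s) * (cc t * p + cd t * q)))"

text \<open>Both vectors undergo the same linear map, of determinant
  \<open>(C^2 - S^2 * (e * f)) * (c^2 - d^2) = 1\<close>.\<close>

lemma wedge_step:
  fixes a b p q C S c d e f :: real
  assumes "e * f = 1" "C^2 - S^2 = 1" "c^2 - d^2 = 1"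
  shows "(C * (c * a + d * b) - S * e * (c * b + d * a)) * (C * (c * q + d * p) - S * f * (c * p + d * q)) -
     (C * (c * b + d * a) - S * f * (c * a + d * b)) * (C * (c * p + d * q) - S * e * (c * q + d * p)) = a * q - b * p"
proof -
  have *: "(C * x - S * e * y) * (C * w - S * f * z) - (C * y - S * f * x) * (C * z - S * e * w) =
    (C^2 - S^2 * (e * f)) * (x * w - y * z)" for x y z w
    by (simp add: power2_eq_square algebra_simps)
  have "(c * a + d * b) * (c * q + d * p) - (c * b + d * a) * (c * p + d * q) = (c^2 - d^2) * (a * q - b * p)"
    by (simp add: power2_eq_square algebra_simps)
  then show ?thesis unfolding * using assms by simp
qed

text \<open>The diagonal factor alone, applied to \<open>(a, b)\<close> and to
  \<open>(1, 1)\<close>, whose wedge is \<open>a - b\<close>.\<close>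

lemma wedge_step0:
  fixes a b C S e f :: real
  assumes "e * f = 1" "C^2 - S^2 = 1" "a - b = 2"
  shows "(C * a - S * e * b) * (C - S * f) - (C * b - S * f * a) * (C - S * e) = 2"
proof -
  have "(C * a - S * e * b) * (C - S * f) - (C * b - S * f * a) * (C - S * e) = (C^2 - S^2 * (e * f)) * (a - b)"
    by (simp add: power2_eq_square algebra_simps)
  then show ?thesis using assms by simp
qed

lemma CS_det:
  assumes "0 < t" "t < 1"
  shows "(cC t)^2 - (cS t)^2 = 1" "(cc t)^2 - (cd t)^2 = 1"
proof -
  have "(cC t)^2 - (cS t)^2 = (cC t - cS t) * (cC t + cS t)" by (simp add: power2_eq_square algebra_simps)
  then show "(cC t)^2 - (cS t)^2 = 1" unfolding CS[OF assms] using assms by simp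
  have "(cc t)^2 - (cd t)^2 = (cc t - cd t) * (cc t + cd t)" by (simp add: power2_eq_square algebra_simps)
  moreover have "cc t - cd t = t" "cc t + cd t = 1 / t" unfolding cc_def cd_def by (auto simp: field_simps)
  ultimately show "(cc t)^2 - (cd t)^2 = 1" using assms by simp
qed

text \<open>The generating function of the boundary-to-boundary correlations of the infinite strip: the wedge
  product of the fermionic pair with \<^const>\<open>ep\<close> is preserved by every transfer step, equals \<open>2\<close> at
  the boundary of the source and is the generating function times \<open>p + q\<close> at the other boundary.\<close>

theorem strip_generating:
  assumes t: "0 < t" "t < 1" and k: "0 < \<kappa>" "\<bar>s\<bar> < \<kappa>"
    and X: "\<And>j. (\<lambda>N. cX t l N j) \<longlonglongrightarrow> X j" and Y: "\<And>j. (\<lambda>N. cY t l N j) \<longlonglongrightarrow> Y j"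
    and Yb: "\<And>j. \<bar>Y j\<bar> \<le> A * exp (- \<kappa> * \<bar>real_of_int j\<bar>)"
  shows "\<exists>\<Phi>. ((\<lambda>j. exp (s * real_of_int j) * X j) has_sum \<Phi>) UNIV \<and> \<Phi> * (fst (ep t s l) + snd (ep t s l)) = 2"
proof -
  let ?e = "\<lambda>j. exp (s * real_of_int j)"
  let ?hs = "\<lambda>f a. ((\<lambda>j. ?e j * f j) has_sum a) UNIV"
  have ev: "eventually (\<lambda>N. \<bar>j\<bar> < int N) sequentially" for j :: int
    by (rule eventually_sequentiallyI[of "nat \<bar>j\<bar> + 1"]) auto
  define y y' where "y j = (if 0 < j then - Y j else Y j)" and "y' j = (if 0 \<le> j then - Y j else Y j)" for j
  have yl: "(\<lambda>N. yy t N l j / Zc t l N) \<longlonglongrightarrow> y j" "(\<lambda>N. yy' t N l j / Zc t l N) \<longlonglongrightarrow> y' j" for j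
  proof -
    have "(\<lambda>N. if 0 < j then - cY t l N j else cY t l N j) \<longlonglongrightarrow> y j"
      "(\<lambda>N. if 0 \<le> j then - cY t l N j else cY t l N j) \<longlonglongrightarrow> y' j"
      unfolding y_def y'_def using Y[of j] by (auto intro: tendsto_minus)
    then show "(\<lambda>N. yy t N l j / Zc t l N) \<longlonglongrightarrow> y j" "(\<lambda>N. yy' t N l j / Zc t l N) \<longlonglongrightarrow> y' j"
      using eventually_mono[OF ev[of j]] yy_right[OF t, of j _ l] Zc_pos[OF t(1), of l]
      by (auto elim!: Lim_transform_eventually intro!: eventually_mono[OF ev[of j]] simp: less_imp_neq[symmetric])
  qed
  have Y0: "Y 0 = 1"
  proof -
    have "cY t l N 0 = 1" for N unfolding cY_def using t by (intro cor_self gridE_graph) auto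
    then show ?thesis using Y[of 0] by (simp add: LIMSEQ_const_iff)
  qed
  have sy: "(\<lambda>j. ?e j * y j) summable_on UNIV"
  proof (rule Infinite_Sum.abs_summable_summable, rule Infinite_Sum.abs_summable_on_comparison_test')
    show "(\<lambda>j::int. A * exp (- (\<kappa> - \<bar>s\<bar>) * \<bar>real_of_int j\<bar>)) summable_on UNIV"
      using k by (intro summable_on_cmult_right exp_int_summable) auto
    fix j :: int
    have "\<bar>y j\<bar> \<le> A * exp (- \<kappa> * \<bar>real_of_int j\<bar>)" using Yb[of j] unfolding y_def by auto
    moreover have "?e j \<le> exp (\<bar>s\<bar> * \<bar>real_of_int j\<bar>)" by (simp add: abs_mult[symmetric])
    ultimately have "?e j * \<bar>y j\<bar> \<le> exp (\<bar>s\<bar> * \<bar>real_of_int j\<bar>) * (A * exp (- \<kappa> * \<bar>real_of_int j\<bar>))"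
      by (intro mult_mono) auto
    also have "\<dots> = A * exp (- (\<kappa> - \<bar>s\<bar>) * \<bar>real_of_int j\<bar>)"
      by (simp add: exp_add[symmetric] algebra_simps)
    finally show "norm (?e j * y j) \<le> A * exp (- (\<kappa> - \<bar>s\<bar>) * \<bar>real_of_int j\<bar>)" by (simp add: abs_mult)
  qed
  then obtain r where r: "?hs y r" by (auto simp: summable_on_def)
  \<comment> \<open>\<open>y\<close> and \<open>y'\<close> agree except at 0, where they are 1 and
    -1; this jump is the origin of the value 2 of the wedge.\<close>
  have "((\<lambda>j. if j = 0 then 2 else 0::real) has_sum 2) (UNIV::int set)"
    by (rule has_sum_finite_neutralI[of "{0}"]) auto
  from has_sum_diff_real[OF r this] have "((\<lambda>j. ?e j * y j - (if j = 0 then 2 else 0)) has_sum (r - 2)) UNIV" .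
  moreover have "(\<lambda>j. ?e j * y j - (if j = 0 then 2 else 0)) = (\<lambda>j. ?e j * y' j)"
    unfolding y_def y'_def using Y0 by auto
  ultimately have r': "?hs y' (r - 2)" by simp
  have ef: "exp s * exp (- s) = 1" by (simp add: exp_add[symmetric])
  have step: "?hs (\<lambda>j. a1 * f j + b1 * g j - c1 * (a2 * f' (j + c) + b2 * g' (j + c)))
      (a1 * \<Phi> + b1 * \<Psi> - c1 * (exp (- s * real_of_int c) * (a2 * \<Phi>' + b2 * \<Psi>')))"
    if "?hs f \<Phi>" "?hs g \<Psi>" "?hs f' \<Phi>'" "?hs g' \<Psi>'"
    for a1 b1 c1 a2 b2 c f g f' g' \<Phi> \<Psi> \<Phi>' \<Psi>'
  proof -
    have "?hs (\<lambda>j. a2 * f' j + b2 * g' j) (a2 * \<Phi>' + b2 * \<Psi>')"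
      using has_sum_add[OF has_sum_cmult_right[OF that(3), of a2] has_sum_cmult_right[OF that(4), of b2]]
      by (simp add: algebra_simps)
    from has_sum_cmult_right[OF has_sum_shift[OF this, of c], of c1]
      has_sum_add[OF has_sum_cmult_right[OF that(1), of a1] has_sum_cmult_right[OF that(2), of b1]]
    show ?thesis using has_sum_diff_real by (fastforce simp: algebra_simps)
  qed
  \<comment> \<open>The recursion holds in finite volume for \<open>\<bar>j\<bar> < N\<close> only,
    so the limit in \<open>N\<close> is taken at each fixed \<open>j\<close> and the generating
    functions are formed afterwards.\<close>
  have main: "\<exists>x x' \<Phi> \<Phi>'. (\<forall>j. (\<lambda>N. xx t N (l - k) k j / Zc t l N) \<longlonglongrightarrow> x j) \<and>
      (\<forall>j. (\<lambda>N. xx' t N (l - k) k j / Zc t l N) \<longlonglongrightarrow> x' j) \<and> ?hs x \<Phi> \<and> ?hs x' \<Phi>' \<and>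
      \<Phi> * snd (ep t s k) - \<Phi>' * fst (ep t s k) = 2" if "k \<le> l" for k
    using that
  proof (induction k)
    case 0
    let ?x = "\<lambda>j. cC t * y j - cS t * y' (j - 1)" and ?x' = "\<lambda>j. cC t * y' j - cS t * y (j + 1)"
    have "(\<lambda>N. xx t N l 0 j / Zc t l N) \<longlonglongrightarrow> ?x j" for j
    proof (rule Lim_transform_eventually)
      show "(\<lambda>N. cC t * (yy t N l j / Zc t l N) - cS t * (yy' t N l (j - 1) / Zc t l N)) \<longlonglongrightarrow> ?x j"
        by (intro tendsto_intros yl)
      show "\<forall>\<^sub>F N in sequentially. cC t * (yy t N l j / Zc t l N) - cS t * (yy' t N l (j - 1) / Zc t l N) = xx t N l 0 j / Zc t l N"
        using ev[of j] by (rule eventually_mono) (simp add: xx_end[OF t] diff_divide_distrib)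
    qed
    moreover have "(\<lambda>N. xx' t N l 0 j / Zc t l N) \<longlonglongrightarrow> ?x' j" for j
    proof (rule Lim_transform_eventually)
      show "(\<lambda>N. cC t * (yy' t N l j / Zc t l N) - cS t * (yy t N l (j + 1) / Zc t l N)) \<longlonglongrightarrow> ?x' j"
        by (intro tendsto_intros yl)
      show "\<forall>\<^sub>F N in sequentially. cC t * (yy' t N l j / Zc t l N) - cS t * (yy t N l (j + 1) / Zc t l N) = xx' t N l 0 j / Zc t l N"
        using ev[of j] by (rule eventually_mono) (simp add: xx_end[OF t] diff_divide_distrib)
    qed
    moreover have "?hs ?x (cC t * r - cS t * exp s * (r - 2))"
      using step[OF r r r' r', of "cC t" 0 "cS t" 1 "-1" 0] by (simp add: mult.assoc)
    moreover have "?hs ?x' (cC t * (r - 2) - cS t * exp (- s) * r)"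
      using step[OF r' r' r r, of "cC t" 0 "cS t" 1 1 0] by (simp add: mult.assoc)
    moreover have "(cC t * r - cS t * exp s * (r - 2)) * snd (ep t s 0) - (cC t * (r - 2) - cS t * exp (- s) * r) * fst (ep t s 0) = 2"
      using wedge_step0[OF ef CS_det(1)[OF t], of r "r - 2"] by simp
    ultimately show ?case unfolding diff_zero
      by (intro exI[of _ ?x] exI[of _ ?x'] exI[of _ "cC t * r - cS t * exp s * (r - 2)"]
          exI[of _ "cC t * (r - 2) - cS t * exp (- s) * r"] conjI allI)
  next
    case (Suc k)
    then obtain x x' \<Phi> \<Phi>' where IH: "\<And>j. (\<lambda>N. xx t N (l - k) k j / Zc t l N) \<longlonglongrightarrow> x j"
      "\<And>j. (\<lambda>N. xx' t N (l - k) k j / Zc t l N) \<longlonglongrightarrow> x' j" "?hs x \<Phi>" "?hs x' \<Phi>'"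
      "\<Phi> * snd (ep t s k) - \<Phi>' * fst (ep t s k) = 2" by auto
    have lk: "Suc (l - Suc k) = l - k" using Suc.prems by simp
    let ?x = "\<lambda>j. cC t * (cc t * x j + cd t * x' j) - cS t * (cc t * x' (j - 1) + cd t * x (j - 1))"
    let ?x' = "\<lambda>j. cC t * (cc t * x' j + cd t * x j) - cS t * (cc t * x (j + 1) + cd t * x' (j + 1))"
    let ?u = "\<lambda>N j. xx t N (l - k) k j / Zc t l N" and ?u' = "\<lambda>N j. xx' t N (l - k) k j / Zc t l N"
    have 1: "(\<lambda>N. xx t N (l - Suc k) (Suc k) j / Zc t l N) \<longlonglongrightarrow> ?x j" for j
    proof (rule Lim_transform_eventually)
      show "(\<lambda>N. cC t * (cc t * ?u N j + cd t * ?u' N j) - cS t * (cc t * ?u' N (j - 1) + cd t * ?u N (j - 1))) \<longlonglongrightarrow> ?x j"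
        by (intro tendsto_intros IH)
      show "\<forall>\<^sub>F N in sequentially. cC t * (cc t * ?u N j + cd t * ?u' N j) - cS t * (cc t * ?u' N (j - 1) + cd t * ?u N (j - 1)) =
        xx t N (l - Suc k) (Suc k) j / Zc t l N"
        using ev[of j] by (rule eventually_mono) (simp add: xx_step[OF t] lk divide_inverse algebra_simps)
    qed
    have 2: "(\<lambda>N. xx' t N (l - Suc k) (Suc k) j / Zc t l N) \<longlonglongrightarrow> ?x' j" for j
    proof (rule Lim_transform_eventually)
      show "(\<lambda>N. cC t * (cc t * ?u' N j + cd t * ?u N j) - cS t * (cc t * ?u N (j + 1) + cd t * ?u' N (j + 1))) \<longlonglongrightarrow> ?x' j"
        by (intro tendsto_intros IH)
      show "\<forall>\<^sub>F N in sequentially. cC t * (cc t * ?u' N j + cd t * ?u N j) - cS t * (cc t * ?u N (j + 1) + cd t * ?u' N (j + 1)) =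
        xx' t N (l - Suc k) (Suc k) j / Zc t l N"
        using ev[of j] by (rule eventually_mono) (simp add: xx_step[OF t] lk divide_inverse algebra_simps)
    qed
    let ?F = "cC t * (cc t * \<Phi> + cd t * \<Phi>') - cS t * exp s * (cc t * \<Phi>' + cd t * \<Phi>)"
    let ?F' = "cC t * (cc t * \<Phi>' + cd t * \<Phi>) - cS t * exp (- s) * (cc t * \<Phi> + cd t * \<Phi>')"
    have 3: "?hs ?x ?F"
      using step[OF IH(3,4,4,3), of "cC t * cc t" "cC t * cd t" "cS t" "cc t" "-1" "cd t"]
      by (simp add: mult.assoc distrib_left)
    have 4: "?hs ?x' ?F'"
      using step[OF IH(4,3,3,4), of "cC t * cc t" "cC t * cd t" "cS t" "cc t" 1 "cd t"]
      by (simp add: mult.assoc distrib_left)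
    obtain p q where pq: "ep t s k = (p, q)" by force
    have 5: "?F * snd (ep t s (Suc k)) - ?F' * fst (ep t s (Suc k)) = 2"
      using wedge_step[OF ef CS_det[OF t], of \<Phi> \<Phi>' q p] IH(5) by (simp add: pq)
    show ?case using 1 2 3 4 5
      by (intro exI[of _ ?x] exI[of _ ?x'] exI[of _ ?F] exI[of _ ?F'] conjI allI)
  qed
  from main[of l] obtain x x' \<Phi> \<Phi>' where m: "\<And>j. (\<lambda>N. xx t N 0 l j / Zc t l N) \<longlonglongrightarrow> x j"
      "\<And>j. (\<lambda>N. xx' t N 0 l j / Zc t l N) \<longlonglongrightarrow> x' j" "?hs x \<Phi>" "?hs x' \<Phi>'"
      "\<Phi> * snd (ep t s l) - \<Phi>' * fst (ep t s l) = 2" by auto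
  \<comment> \<open>At the far side \<open>Gam'\<close> gives the negative of \<open>Gam\<close>, so
    \<open>\<Phi>' = - \<Phi>\<close> and the wedge becomes the generating function times the sum of
    the two components of \<open>ep\<close>.\<close>
  have "x j = X j" "x' j = - X j" for j
  proof -
    have "(\<lambda>N. xx t N 0 l j / Zc t l N) \<longlonglongrightarrow> X j"
    proof (rule Lim_transform_eventually[OF X])
      show "\<forall>\<^sub>F N in sequentially. cX t l N j = xx t N 0 l j / Zc t l N"
        using ev[of j] by (rule eventually_mono) (use xx_left[OF t, of j _ l] Zc_pos[OF t(1), of l] in \<open>simp add: less_imp_neq[symmetric]\<close>)
    qed
    then show "x j = X j" using m(1) LIMSEQ_unique by blast
    have "(\<lambda>N. xx' t N 0 l j / Zc t l N) \<longlonglongrightarrow> - X j"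
    proof (rule Lim_transform_eventually[OF tendsto_minus[OF X]])
      show "\<forall>\<^sub>F N in sequentially. - cX t l N j = xx' t N 0 l j / Zc t l N"
        using ev[of j] by (rule eventually_mono) (use xx_left[OF t, of j _ l] Zc_pos[OF t(1), of l] in \<open>simp add: less_imp_neq[symmetric]\<close>)
    qed
    then show "x' j = - X j" using m(2) LIMSEQ_unique by blast
  qed
  then have x: "x = X" "x' = (\<lambda>j. - X j)" by auto
  have "?hs X \<Phi>" using m(3) unfolding x .
  have "((\<lambda>j. - (?e j * X j)) has_sum \<Phi>') UNIV" using m(4) unfolding x by simp
  then have "?hs X (- \<Phi>')" by (simp only: has_sum_uminus)
  then have "- \<Phi>' = \<Phi>" using \<open>?hs X \<Phi>\<close> by (rule has_sum_unique)
  then have "\<Phi>' = - \<Phi>" by simp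
  then show ?thesis using m(5) \<open>?hs X \<Phi>\<close> by (auto simp: algebra_simps)
qed

section \<open>Duality\<close>

definition dE :: "site set \<Rightarrow> dual_edge set" where
  "dE S = {dual u v | u v. nn u v \<and> {u, v} \<inter> S \<noteq> {}}"

lemma nn_commute: "nn u v \<longleftrightarrow> nn v u"
  unfolding nn_def by (auto simp: abs_minus_commute)

lemma nn_h [simp]: "nn (x, y) (x + 1, y)" and nn_v [simp]: "nn (x, y) (x, y + 1)"
  unfolding nn_def by auto

lemma nn_cases:
  assumes "nn u v"
  obtains x y where "{u, v} = {(x, y), (x + 1, y)}" | x y where "{u, v} = {(x, y), (x, y + 1)}"
proof -
  have "{u, v} \<in> gridE UNIV" using assms unfolding gridE_def by blast
  then show ?thesis using that unfolding gridE_iff by blast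
qed

lemma dual_set: "{u, v} = {u', v'} \<Longrightarrow> dual u v = dual u' v'"
  unfolding dual_def by simp

lemma dual_inj:
  assumes "nn u v" "nn u' v'" "dual u v = dual u' v'"
  shows "{u, v} = {u', v'}"
proof -
  have h: "dual u v = {(x, y - 1), (x, y)}" if "{u, v} = {(x, y), (x + 1, y)}" for u v x y
    using dual_set[OF that] dual_horizontal by simp
  have w: "dual u v = {(x - 1, y), (x, y)}" if "{u, v} = {(x, y), (x, y + 1)}" for u v x y
    using dual_set[OF that] dual_vertical by simp
  from assms(1) show ?thesis
  proof (rule nn_cases)
    fix x y assume 1: "{u, v} = {(x, y), (x + 1, y)}"
    from assms(2) show ?thesis
    proof (rule nn_cases)
      fix x' y' assume 2: "{u', v'} = {(x', y'), (x' + 1, y')}"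
      have "{(x, y - 1), (x, y)} = {(x', y' - 1), (x', y')}" using assms(3) h[OF 1] h[OF 2] by simp
      then have "x = x'" "y = y'" by (auto simp: doubleton_eq_iff)
      then show ?thesis using 1 2 by simp
    next
      fix x' y' assume 2: "{u', v'} = {(x', y'), (x', y' + 1)}"
      have "{(x, y - 1), (x, y)} = {(x' - 1, y'), (x', y')}" using assms(3) h[OF 1] w[OF 2] by simp
      then show ?thesis by (auto simp: doubleton_eq_iff)
    qed
  next
    fix x y assume 1: "{u, v} = {(x, y), (x, y + 1)}"
    from assms(2) show ?thesis
    proof (rule nn_cases)
      fix x' y' assume 2: "{u', v'} = {(x', y'), (x' + 1, y')}"
      have "{(x - 1, y), (x, y)} = {(x', y' - 1), (x', y')}" using assms(3) w[OF 1] h[OF 2] by simp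
      then show ?thesis by (auto simp: doubleton_eq_iff)
    next
      fix x' y' assume 2: "{u', v'} = {(x', y'), (x', y' + 1)}"
      have "{(x - 1, y), (x, y)} = {(x' - 1, y'), (x', y')}" using assms(3) w[OF 1] w[OF 2] by simp
      then have "x = x'" "y = y'" by (auto simp: doubleton_eq_iff)
      then show ?thesis using 1 2 by simp
    qed
  qed
qed

lemma dual_mem:
  assumes "nn u v" "\<And>u v. P u v \<Longrightarrow> P v u"
  shows "dual u v \<in> {dual u v | u v. nn u v \<and> P u v} \<longleftrightarrow> P u v"
proof
  assume "dual u v \<in> {dual u v | u v. nn u v \<and> P u v}"
  then obtain u' v' where *: "dual u v = dual u' v'" "nn u' v'" "P u' v'" by blast
  have "{u, v} = {u', v'}" using dual_inj[OF assms(1) *(2,1)] .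
  then have "u = u' \<and> v = v' \<or> u = v' \<and> v = u'" by (auto simp: doubleton_eq_iff)
  then show "P u v" using *(3) assms(2) by blast
qed (use assms(1) in blast)

lemma dual_dirs:
  "west (i, j) = dual (i, j) (i, j + 1)" "east (i, j) = dual (i + 1, j) (i + 1, j + 1)"
  "south (i, j) = dual (i, j) (i + 1, j)" "north (i, j) = dual (i, j + 1) (i + 1, j + 1)"
  unfolding dual_vertical dual_horizontal west_def east_def south_def north_def
  by (auto simp: dual_horizontal[of i "j + 1"])

lemma dirs_distinct:
  "west w \<noteq> east w" "west w \<noteq> south w" "west w \<noteq> north w" "east w \<noteq> south w" "east w \<noteq> north w" "south w \<noteq> north w"
  unfolding west_def east_def south_def north_def by (cases w; auto simp: doubleton_eq_iff)+

lemma dual_at: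
  assumes "nn u v" "w \<in> dual u v"
  shows "dual u v \<in> {west w, east w, south w, north w}"
  using assms(1)
proof (rule nn_cases)
  fix x y assume "{u, v} = {(x, y), (x + 1, y)}"
  then have e: "dual u v = {(x, y - 1), (x, y)}" using dual_set dual_horizontal by metis
  then have "w = (x, y - 1) \<or> w = (x, y)" using assms(2) by blast
  moreover have "south (x, y) = {(x, y - 1), (x, y)}" "north (x, y - 1) = {(x, y - 1), (x, y)}"
    unfolding south_def north_def by (auto simp: insert_commute)
  ultimately show ?thesis using e by blast
next
  fix x y assume "{u, v} = {(x, y), (x, y + 1)}"
  then have e: "dual u v = {(x - 1, y), (x, y)}" using dual_set dual_vertical by metis
  then have "w = (x - 1, y) \<or> w = (x, y)" using assms(2) by blast
  moreover have "west (x, y) = {(x - 1, y), (x, y)}" "east (x - 1, y) = {(x - 1, y), (x, y)}"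
    unfolding west_def east_def by (auto simp: insert_commute)
  ultimately show ?thesis using e by blast
qed

abbreviation "allD \<equiv> {dual u v | u v. nn u v}"

lemma allD_eq:
  assumes "A \<subseteq> allD" "B \<subseteq> allD" "\<And>u v. nn u v \<Longrightarrow> dual u v \<in> A \<longleftrightarrow> dual u v \<in> B"
  shows "A = B"
proof -
  have "e \<in> A \<longleftrightarrow> e \<in> B" if e: "e \<in> allD" for e
  proof -
    obtain u v where "e = dual u v" "nn u v" using e by blast
    then show ?thesis using assms(3) by simp
  qed
  note * = this
  show ?thesis
  proof (intro equalityI subsetI)
    fix e assume e: "e \<in> A"
    then show "e \<in> B" using *[OF subsetD[OF assms(1) e]] by simp
  next
    fix e assume e: "e \<in> B"
    then show "e \<in> A" using *[OF subsetD[OF assms(2) e]] by simp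
  qed
qed

lemma star_set:
  assumes "F \<subseteq> allD"
  shows "{e\<in>F. w \<in> e} = {west w, east w, south w, north w} \<inter> F"
proof -
  have "e \<in> {west w, east w, south w, north w}" if "e \<in> F" "w \<in> e" for e
    using that assms dual_at by blast
  moreover have "w \<in> west w" "w \<in> east w" "w \<in> south w" "w \<in> north w"
    unfolding west_def east_def south_def north_def by auto
  ultimately show ?thesis by blast
qed

lemma card_star:
  assumes "F \<subseteq> allD"
  shows "card {e\<in>F. w \<in> e} = of_bool (west w \<in> F) + of_bool (east w \<in> F) + of_bool (south w \<in> F) + of_bool (north w \<in> F)"
  unfolding star_set[OF assms] using dirs_distinct[of w]
  by (cases "west w \<in> F"; cases "east w \<in> F"; cases "south w \<in> F"; cases "north w \<in> F") auto

text \<open>Four directions exhaust the dual edges at \<open>w\<close>, so the parity of the degree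
  is an exclusive or.\<close>

lemma bd_star:
  assumes "F \<subseteq> allD"
  shows "w \<in> bd F \<longleftrightarrow> ((west w \<in> F) \<noteq> (east w \<in> F)) \<noteq> ((south w \<in> F) \<noteq> (north w \<in> F))"
  unfolding bd_def mem_Collect_eq card_star[OF assms] by auto

lemma dis_sub: "disagreement_edges S \<sigma> \<subseteq> dE S" and dE_sub: "dE S \<subseteq> allD"
  unfolding disagreement_edges_def dE_def by blast+

lemma dE_mem: "nn u v \<Longrightarrow> dual u v \<in> dE S \<longleftrightarrow> u \<in> S \<or> v \<in> S"
  unfolding dE_def by (subst dual_mem) auto

lemma dis_mem: "nn u v \<Longrightarrow> dual u v \<in> disagreement_edges S \<sigma> \<longleftrightarrow> (u \<in> S \<or> v \<in> S) \<and> \<sigma> u \<noteq> \<sigma> v"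
proof -
  assume n: "nn u v"
  have "disagreement_edges S \<sigma> = {dual u v | u v. nn u v \<and> ((u \<in> S \<or> v \<in> S) \<and> \<sigma> u \<noteq> \<sigma> v)}"
    unfolding disagreement_edges_def by blast
  then show ?thesis using dual_mem[OF n, of "\<lambda>u v. (u \<in> S \<or> v \<in> S) \<and> \<sigma> u \<noteq> \<sigma> v"] by metis
qed

lemma finite_edges:
  assumes "finite S"
  shows "finite {e \<in> lattice_edges. e \<inter> S \<noteq> {}}"
proof -
  let ?N = "\<Union>v\<in>S. {v, (fst v + 1, snd v), (fst v - 1, snd v), (fst v, snd v + 1), (fst v, snd v - 1)}"
  have "v \<in> {u, (fst u + 1, snd u), (fst u - 1, snd u), (fst u, snd u + 1), (fst u, snd u - 1)}" if "nn u v" for u v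
    using that by (rule nn_cases) (auto simp: doubleton_eq_iff)
  note nb = this
  have "e \<in> Pow ?N" if e: "e \<in> lattice_edges" "e \<inter> S \<noteq> {}" for e
  proof -
    obtain u v where uv: "e = {u, v}" "nn u v" using e(1) unfolding lattice_edges_def by blast
    have "u \<in> S \<or> v \<in> S" using e(2) uv(1) by blast
    then show ?thesis
    proof
      assume "u \<in> S"
      then show ?thesis using nb[OF uv(2)] uv(1) by blast
    next
      assume "v \<in> S"
      moreover have "nn v u" using uv(2) nn_commute by blast
      ultimately show ?thesis using nb[of v u] uv(1) by blast
    qed
  qed
  then have "{e \<in> lattice_edges. e \<inter> S \<noteq> {}} \<subseteq> Pow ?N" by blast
  moreover have "finite (Pow ?N)" using assms by simp
  ultimately show ?thesis by (rule finite_subset)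
qed

definition de :: "site set \<Rightarrow> dual_edge" where
  "de e = {w. e \<subseteq> plaquette w}"

lemma de_dual: "de {u, v} = dual u v" unfolding de_def dual_def by simp

lemma dE_image: "dE S = de ` {e \<in> lattice_edges. e \<inter> S \<noteq> {}}"
proof (intro equalityI subsetI)
  fix f assume "f \<in> dE S"
  then obtain u v where f: "f = dual u v" "nn u v" "{u, v} \<inter> S \<noteq> {}" unfolding dE_def by blast
  then have "{u, v} \<in> {e \<in> lattice_edges. e \<inter> S \<noteq> {}}" unfolding lattice_edges_def by blast
  then show "f \<in> de ` {e \<in> lattice_edges. e \<inter> S \<noteq> {}}" unfolding f(1) de_dual[symmetric] by (rule imageI)
next
  fix f assume "f \<in> de ` {e \<in> lattice_edges. e \<inter> S \<noteq> {}}"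
  then obtain e where e: "f = de e" "e \<in> lattice_edges" "e \<inter> S \<noteq> {}" by blast
  then obtain u v where "e = {u, v}" "nn u v" unfolding lattice_edges_def by blast
  moreover from this have "f = dual u v" "{u, v} \<inter> S \<noteq> {}" using e by (simp_all add: de_dual)
  ultimately show "f \<in> dE S" unfolding dE_def by blast
qed

lemma de_inj: "inj_on de lattice_edges"
proof (rule inj_onI)
  fix e f assume ef: "e \<in> lattice_edges" "f \<in> lattice_edges" "de e = de f"
  then obtain u v u' v' where "e = {u, v}" "nn u v" "f = {u', v'}" "nn u' v'" unfolding lattice_edges_def by blast
  then show "e = f" using dual_inj[of u v u' v'] ef(3) by (simp add: de_dual)
qed

lemma graph_dE:
  assumes "finite S"
  shows "graph (dE S)"
proof -
  have "card e = 2" if eS: "e \<in> dE S" for e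
  proof -
    obtain u v where e: "e = dual u v" "nn u v" using eS unfolding dE_def by blast
    from e(2) show ?thesis
    proof (rule nn_cases)
      fix x y assume "{u, v} = {(x, y), (x + 1, y)}"
      then have "e = {(x, y - 1), (x, y)}" using dual_set dual_horizontal e(1) by metis
      then show ?thesis by simp
    next
      fix x y assume "{u, v} = {(x, y), (x, y + 1)}"
      then have "e = {(x - 1, y), (x, y)}" using dual_set dual_vertical e(1) by metis
      then show ?thesis by simp
    qed
  qed
  moreover have "finite (dE S)" unfolding dE_image using finite_edges[OF assms] by (rule finite_imageI)
  ultimately show ?thesis unfolding graph_def by blast
qed

definition nE :: "site set \<Rightarrow> nat" where
  "nE S = card {e \<in> lattice_edges. e \<inter> S \<noteq> {}}"

text \<open>An agreeing edge contributes \<open>exp \<beta>\<close> and a disagreeing one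
  \<open>exp (- \<beta>)\<close>. The factor \<open>exp (\<beta> * nE S)\<close> does not depend on
  the spins and cancels in ratios.\<close>

lemma boltzmann_dual:
  assumes "finite S" "\<And>v. \<sigma> v = 1 \<or> \<sigma> v = -1"
  shows "boltzmann \<beta> S \<sigma> = exp (\<beta> * nE S) * exp (- 2 * \<beta>) ^ card (disagreement_edges S \<sigma>)"
proof -
  let ?E = "{e \<in> lattice_edges. e \<inter> S \<noteq> {}}"
  let ?D = "{e \<in> ?E. (\<Prod>v\<in>e. \<sigma> v) = -1}"
  have pr: "(\<Prod>v\<in>e. \<sigma> v) = 1 \<or> (\<Prod>v\<in>e. \<sigma> v) = -1" for e
  proof (cases "finite e")
    case True
    then show ?thesis
    proof (induction e rule: finite_induct)
      case (insert x e)
      then show ?case using assms(2)[of x] by auto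
    qed simp
  qed simp
  have "(\<Prod>v\<in>e. \<sigma> v) = 1 - 2 * (if (\<Prod>v\<in>e. \<sigma> v) = -1 then 1 else 0)" for e
    using pr[of e] by (elim disjE) simp_all
  then have "(\<Sum>e\<in>?E. \<Prod>v\<in>e. \<sigma> v) = (\<Sum>e\<in>?E. 1 - 2 * (if (\<Prod>v\<in>e. \<sigma> v) = -1 then 1 else 0))"
    by (intro sum.cong refl)
  also have "\<dots> = real (nE S) - 2 * real (card ?D)"
    using finite_edges[OF assms(1)]
    by (simp add: sum_subtractf nE_def sum_distrib_left[symmetric] sum.inter_filter[symmetric])
  also have "card ?D = card (disagreement_edges S \<sigma>)"
  proof -
    have "disagreement_edges S \<sigma> = de ` ?D"
    proof (intro equalityI subsetI)
      fix f assume "f \<in> disagreement_edges S \<sigma>"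
      then obtain u v where f: "f = dual u v" "nn u v" "{u, v} \<inter> S \<noteq> {}" "\<sigma> u \<noteq> \<sigma> v"
        unfolding disagreement_edges_def by blast
      then have "u \<noteq> v" by auto
      then have "(\<Prod>v\<in>{u, v}. \<sigma> v) = -1" using f(4) assms(2)[of u] assms(2)[of v] by auto
      then have "{u, v} \<in> ?D" using f unfolding lattice_edges_def by blast
      then show "f \<in> de ` ?D" unfolding f(1) de_dual[symmetric] by (rule imageI)
    next
      fix f assume "f \<in> de ` ?D"
      then obtain e where e: "f = de e" "e \<in> lattice_edges" "e \<inter> S \<noteq> {}" "(\<Prod>v\<in>e. \<sigma> v) = -1" by blast
      then obtain u v where uv: "e = {u, v}" "nn u v" unfolding lattice_edges_def by blast
      then have f: "f = dual u v" "nn u v" "{u, v} \<inter> S \<noteq> {}" "(\<Prod>v\<in>{u, v}. \<sigma> v) = -1"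
        using e by (simp_all add: de_dual)
      then have "\<sigma> u \<noteq> \<sigma> v" using assms(2)[of u] by (cases "u = v") (auto simp: nn_def)
      then show "f \<in> disagreement_edges S \<sigma>" using f unfolding disagreement_edges_def by blast
    qed
    moreover have "inj_on de ?D" using de_inj by (rule inj_on_subset) auto
    ultimately show ?thesis by (simp add: card_image)
  qed
  finally have X: "(\<Sum>e\<in>?E. \<Prod>v\<in>e. \<sigma> v) = real (nE S) - 2 * real (card (disagreement_edges S \<sigma>))" .
  have "- \<beta> * hamiltonian S \<sigma> = \<beta> * nE S + real (card (disagreement_edges S \<sigma>)) * (- 2 * \<beta>)"
    unfolding hamiltonian_def X by (simp add: algebra_simps)
  then show ?thesis unfolding boltzmann_def by (simp only: exp_add exp_of_nat_mult)
qed

section \<open>Edge sets without odd vertices as disagreement sets\<close>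

lemma integrate_1d: "\<exists>g::int \<Rightarrow> bool. \<not> g 0 \<and> (\<forall>x. g (x + 1) = (g x \<noteq> f x))"
proof -
  define g where "g x = (if 0 \<le> x then odd (card {i\<in>{0..<x}. f i}) else odd (card {i\<in>{x..<0}. f i}))" for x :: int
  have ins: "odd (card (if c then insert x B else B)) = (odd (card B) \<noteq> c)" if "finite B" "x \<notin> B" for B c and x :: int
    using that by simp
  have "g (x + 1) = (g x \<noteq> f x)" for x
  proof (cases "0 \<le> x")
    case True
    then have eq: "{i\<in>{0..<x+1}. f i} = (if f x then insert x {i\<in>{0..<x}. f i} else {i\<in>{0..<x}. f i})"
      by (auto simp: less_le)
    have fin: "finite {i\<in>{0..<x}. f i}" "x \<notin> {i\<in>{0..<x}. f i}"
      by (auto intro: finite_subset[of _ "{0..<x}"])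
    have "odd (card {i\<in>{0..<x+1}. f i}) = (odd (card {i\<in>{0..<x}. f i}) \<noteq> f x)"
      unfolding eq by (rule ins[OF fin])
    moreover have "g (x + 1) = odd (card {i\<in>{0..<x+1}. f i})" "g x = odd (card {i\<in>{0..<x}. f i})"
      using True unfolding g_def by simp_all
    ultimately show ?thesis by blast
  next
    case False
    then have eq: "{i\<in>{x..<0}. f i} = (if f x then insert x {i\<in>{x+1..<0}. f i} else {i\<in>{x+1..<0}. f i})"
      by (auto simp: add1_zle_eq less_le)
    have fin: "finite {i\<in>{x+1..<0}. f i}" "x \<notin> {i\<in>{x+1..<0}. f i}"
      by (auto intro: finite_subset[of _ "{x+1..<0}"])
    have "odd (card {i\<in>{x..<0}. f i}) = (odd (card {i\<in>{x+1..<0}. f i}) \<noteq> f x)"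
      unfolding eq by (rule ins[OF fin])
    moreover have "g (x + 1) = odd (card {i\<in>{x+1..<0}. f i})" "g x = odd (card {i\<in>{x..<0}. f i})"
    proof -
      show "g (x + 1) = odd (card {i\<in>{x+1..<0}. f i})"
        using False unfolding g_def by (cases "x = -1") simp_all
    qed (use False in \<open>simp add: g_def\<close>)
    ultimately show ?thesis by blast
  qed
  moreover have "\<not> g 0" unfolding g_def by simp
  ultimately show ?thesis by blast
qed

text \<open>A closed 1-form modulo 2 on the square lattice is exact: a primitive is built along row
  0 and then vertically, and closedness carries the horizontal relation from row to row.\<close>

lemma integrate_2d:
  fixes H W :: "int \<Rightarrow> int \<Rightarrow> bool"
  assumes "\<And>x y. (H x y \<noteq> H x (y + 1)) = (W x y \<noteq> W (x + 1) y)"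
  shows "\<exists>g::int \<Rightarrow> int \<Rightarrow> bool. (\<forall>x y. g (x + 1) y = (g x y \<noteq> H x y)) \<and> (\<forall>x y. g x (y + 1) = (g x y \<noteq> W x y))"
proof -
  obtain h where h: "\<And>x. h (x + 1) = (h x \<noteq> H x 0)" using integrate_1d[of "\<lambda>x. H x 0"] by blast
  have "\<forall>x. \<exists>k. \<not> k 0 \<and> (\<forall>y. k (y + 1) = (k y \<noteq> W x y))" using integrate_1d by blast
  then obtain k where k: "\<And>x. \<not> k x 0" "\<And>x y. k x (y + 1) = (k x y \<noteq> W x y)" by metis
  define g where "g x y = (h x \<noteq> k x y)" for x y
  have "\<forall>x. g (x + 1) y = (g x y \<noteq> H x y)" for y
  proof (induction y rule: int_induct[where k=0])
    case base
    show ?case unfolding g_def using h k(1) by auto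
  next
    case (step1 y)
    show ?case
    proof
      fix x
      show "g (x + 1) (y + 1) = (g x (y + 1) \<noteq> H x (y + 1))"
        using step1(2)[rule_format, of x] assms[of x y] k(2)[of x y] k(2)[of "x + 1" y] unfolding g_def by argo
    qed
  next
    case (step2 y)
    show ?case
    proof
      fix x
      show "g (x + 1) (y - 1) = (g x (y - 1) \<noteq> H x (y - 1))"
        using step2(2)[rule_format, of x] assms[of x "y - 1"] k(2)[of x "y - 1"] k(2)[of "x + 1" "y - 1"] unfolding g_def
        by (simp add: algebra_simps) argo
    qed
  qed
  moreover have "g x (y + 1) = (g x y \<noteq> W x y)" for x y unfolding g_def k(2) by auto
  ultimately show ?thesis by blast
qed

text \<open>Even degree at the dual site \<open>(x, y)\<close> says that the form sums to zero
  around the unit square centred there, so it is the differential of a sign function.\<close>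

lemma even_disagreement:
  assumes "F \<subseteq> allD" "bd F = {}"
  shows "\<exists>\<sigma>::config. (\<forall>v. \<sigma> v = 1 \<or> \<sigma> v = -1) \<and> (\<forall>u v. nn u v \<longrightarrow> (\<sigma> u \<noteq> \<sigma> v \<longleftrightarrow> dual u v \<in> F))"
proof -
  let ?H = "\<lambda>x y. dual (x, y) (x + 1, y) \<in> F" and ?W = "\<lambda>x y. dual (x, y) (x, y + 1) \<in> F"
  have "(?H x y \<noteq> ?H x (y + 1)) = (?W x y \<noteq> ?W (x + 1) y)" for x y
    using bd_star[OF assms(1), of "(x, y)"] assms(2) unfolding dual_dirs by auto
  from integrate_2d[of ?H ?W, OF this] obtain g where
    g: "\<And>x y. g (x + 1) y = (g x y \<noteq> ?H x y)" "\<And>x y. g x (y + 1) = (g x y \<noteq> ?W x y)" by blast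
  define \<sigma> :: config where "\<sigma> v = (if g (fst v) (snd v) then 1 else -1)" for v
  have "\<sigma> u \<noteq> \<sigma> v \<longleftrightarrow> dual u v \<in> F" if "nn u v" for u v
    using that
  proof (rule nn_cases)
    fix x y assume e: "{u, v} = {(x, y), (x + 1, y)}"
    have "\<sigma> (x, y) \<noteq> \<sigma> (x + 1, y) \<longleftrightarrow> ?H x y" unfolding \<sigma>_def using g(1)[of x y] by auto
    moreover have "\<sigma> u \<noteq> \<sigma> v \<longleftrightarrow> \<sigma> (x, y) \<noteq> \<sigma> (x + 1, y)" using e by (auto simp: doubleton_eq_iff)
    ultimately show ?thesis using dual_set[OF e] by simp
  next
    fix x y assume e: "{u, v} = {(x, y), (x, y + 1)}"
    have "\<sigma> (x, y) \<noteq> \<sigma> (x, y + 1) \<longleftrightarrow> ?W x y" unfolding \<sigma>_def using g(2)[of x y] by auto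
    moreover have "\<sigma> u \<noteq> \<sigma> v \<longleftrightarrow> \<sigma> (x, y) \<noteq> \<sigma> (x, y + 1)" using e by (auto simp: doubleton_eq_iff)
    ultimately show ?thesis using dual_set[OF e] by simp
  qed
  moreover have "\<forall>v. \<sigma> v = 1 \<or> \<sigma> v = -1" unfolding \<sigma>_def by simp
  ultimately show ?thesis by blast
qed

lemma bd_full:
  assumes "\<And>v. \<sigma> v = 1 \<or> \<sigma> v = (-1::real)"
  shows "bd (disagreement_edges UNIV \<sigma>) = {}"
proof -
  have "w \<notin> bd (disagreement_edges UNIV \<sigma>)" for w
  proof -
    obtain i j where w: "w = (i, j)" by force
    have par: "\<not> (((a \<noteq> c) \<noteq> (b \<noteq> d)) \<noteq> ((a \<noteq> b) \<noteq> (c \<noteq> d)))"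
      if "a = 1 \<or> a = -1" "b = 1 \<or> b = -1" "c = 1 \<or> c = -1" "d = 1 \<or> d = -1" for a b c d :: real
      using that by (elim disjE) simp_all
    show ?thesis
      unfolding bd_star[OF order_trans[OF dis_sub dE_sub]] w dual_dirs dis_mem[OF nn_h] dis_mem[OF nn_v]
      using par[OF assms[of "(i, j)"] assms[of "(i + 1, j)"] assms[of "(i, j + 1)"] assms[of "(i + 1, j + 1)"]] by simp
  qed
  then show ?thesis by blast
qed

lemma bd_Un_disjoint:
  assumes "F \<subseteq> allD" "G \<subseteq> allD" "F \<inter> G = {}"
  shows "w \<in> bd (F \<union> G) \<longleftrightarrow> (w \<in> bd F) \<noteq> (w \<in> bd G)"
proof -
  have ne: "\<not> (e \<in> F \<and> e \<in> G)" for e using assms(3) by blast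
  have "F \<union> G \<subseteq> allD" using assms(1,2) by (rule Un_least)
  from bd_star[OF this] show ?thesis
    unfolding bd_star[OF assms(1)] bd_star[OF assms(2)] Un_iff
    using ne[of "west w"] ne[of "east w"] ne[of "south w"] ne[of "north w"] by blast
qed

text \<open>Disagreements between two frozen spins, which \<open>disagreement_edges\<close> does not
  record; they continue the open contour outside \<open>S\<close>.\<close>

definition oE :: "site set \<Rightarrow> config \<Rightarrow> dual_edge set" where
  "oE S \<eta> = {dual u v | u v. nn u v \<and> u \<notin> S \<and> v \<notin> S \<and> \<eta> u \<noteq> \<eta> v}"

lemma oE_mem: "nn u v \<Longrightarrow> dual u v \<in> oE S \<eta> \<longleftrightarrow> u \<notin> S \<and> v \<notin> S \<and> \<eta> u \<noteq> \<eta> v"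
  unfolding oE_def by (rule dual_mem) auto

lemma oE_sub: "oE S \<eta> \<subseteq> allD" "oE S \<eta> \<inter> dE S = {}"
proof -
  show "oE S \<eta> \<subseteq> allD" unfolding oE_def by blast
  have "e \<notin> dE S" if e: "e \<in> oE S \<eta>" for e
  proof -
    obtain u v where "e = dual u v" "nn u v" "u \<notin> S" "v \<notin> S" using e unfolding oE_def by blast
    then show ?thesis using dE_mem by blast
  qed
  then show "oE S \<eta> \<inter> dE S = {}" by blast
qed

text \<open>All disagreement edges of a sign function together have no odd vertex, so the recorded
  and the unrecorded ones have the same odd vertices, and these depend on the boundary condition
  only.\<close>

lemma bd_dis:
  assumes "\<And>v. \<sigma> v = 1 \<or> \<sigma> v = (-1::real)" "\<And>v. v \<notin> S \<Longrightarrow> \<sigma> v = \<eta> v"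
  shows "bd (disagreement_edges S \<sigma>) = bd (oE S \<eta>)"
proof -
  have 1: "disagreement_edges UNIV \<sigma> = disagreement_edges S \<sigma> \<union> oE S \<eta>"
  proof -
    have eq: "dual u v \<in> disagreement_edges UNIV \<sigma> \<longleftrightarrow> dual u v \<in> disagreement_edges S \<sigma> \<union> oE S \<eta>" if uv: "nn u v" for u v
    proof -
      have "u \<notin> S \<Longrightarrow> v \<notin> S \<Longrightarrow> (\<sigma> u \<noteq> \<sigma> v) = (\<eta> u \<noteq> \<eta> v)" using assms(2) by simp
      then show ?thesis unfolding Un_iff dis_mem[OF uv] oE_mem[OF uv] by blast
    qed
    show ?thesis
      by (rule allD_eq[OF order_trans[OF dis_sub dE_sub] Un_least[OF order_trans[OF dis_sub dE_sub] oE_sub(1)] eq])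
  qed
  have "disagreement_edges S \<sigma> \<inter> oE S \<eta> = {}" using dis_sub[of S \<sigma>] oE_sub by blast
  from bd_Un_disjoint[OF order_trans[OF dis_sub dE_sub] oE_sub(1) this] bd_full[of \<sigma>, OF assms(1)]
  show ?thesis unfolding 1 by blast
qed

definition conn_compl :: "site set \<Rightarrow> bool" where
  "conn_compl S \<longleftrightarrow> (\<forall>u v. u \<notin> S \<longrightarrow> v \<notin> S \<longrightarrow> (\<lambda>p q. nn p q \<and> p \<notin> S \<and> q \<notin> S)\<^sup>*\<^sup>* u v)"

text \<open>The sign function with disagreement set \<open>F \<union> oE S \<eta>\<close> agrees
  with \<open>\<eta>\<close> outside \<open>S\<close> up to a sign, which is the same everywhere
  because the complement is connected.\<close>

lemma dis_surj:
  assumes "conn_compl S" "\<And>v. \<eta> v = 1 \<or> \<eta> v = (-1::real)" "F \<subseteq> dE S" "bd F = bd (oE S \<eta>)"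
  shows "\<exists>\<sigma>\<in>configs S \<eta>. disagreement_edges S \<sigma> = F"
proof -
  let ?G = "F \<union> oE S \<eta>"
  have F: "F \<subseteq> allD" "F \<inter> oE S \<eta> = {}" using assms(3) dE_sub[of S] oE_sub(2)[of S \<eta>] by blast+
  have "?G \<subseteq> allD" using F(1) oE_sub(1) by blast
  moreover have "bd ?G = {}" using bd_Un_disjoint[OF F(1) oE_sub(1) F(2)] assms(4) by blast
  ultimately have "\<exists>\<sigma>::config. (\<forall>v. \<sigma> v = 1 \<or> \<sigma> v = -1) \<and> (\<forall>u v. nn u v \<longrightarrow> (\<sigma> u \<noteq> \<sigma> v \<longleftrightarrow> dual u v \<in> ?G))"
    by (rule even_disagreement)
  then obtain \<sigma> :: config where s0: "\<forall>v. \<sigma> v = 1 \<or> \<sigma> v = -1"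
    "\<forall>u v. nn u v \<longrightarrow> (\<sigma> u \<noteq> \<sigma> v \<longleftrightarrow> dual u v \<in> ?G)" by (elim exE conjE)
  note s = s0(1)[rule_format] s0(2)[rule_format]
  have out: "\<sigma> u * \<eta> u = \<sigma> v * \<eta> v" if "nn u v" "u \<notin> S" "v \<notin> S" for u v
  proof -
    have "dual u v \<notin> F" using that assms(3) dE_mem by blast
    then have "\<sigma> u \<noteq> \<sigma> v \<longleftrightarrow> \<eta> u \<noteq> \<eta> v" using s(2)[OF that(1)] oE_mem[OF that(1)] that by auto
    then show ?thesis using s(1)[of u] s(1)[of v] assms(2)[of u] assms(2)[of v] by auto
  qed
  have out2: "\<sigma> u * \<eta> u = \<sigma> v * \<eta> v" if "u \<notin> S" "v \<notin> S" for u v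
  proof -
    have "(\<lambda>p q. nn p q \<and> p \<notin> S \<and> q \<notin> S)\<^sup>*\<^sup>* u v" using assms(1) that unfolding conn_compl_def by blast
    then show ?thesis by (induction rule: rtranclp_induct) (use out in auto)
  qed
  obtain c where c: "c = 1 \<or> c = -1" "\<And>v. v \<notin> S \<Longrightarrow> \<sigma> v * \<eta> v = c"
  proof (cases "S = UNIV")
    case False
    then obtain u where u: "u \<notin> S" by blast
    have "\<sigma> u * \<eta> u = 1 \<or> \<sigma> u * \<eta> u = -1" using s(1)[of u] assms(2)[of u] by (elim disjE) simp_all
    then show ?thesis using out2[OF _ u] by (rule that)
  qed (auto intro: that)
  define \<sigma>' :: config where "\<sigma>' v = c * \<sigma> v" for v
  have "\<sigma>' \<in> configs S \<eta>"
  proof -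
    have "\<sigma>' v = \<eta> v" if "v \<notin> S" for v
      using c(2)[OF that] assms(2)[of v] s(1)[of v] unfolding \<sigma>'_def by auto
    moreover have "\<sigma>' v \<in> {-1, 1}" for v using c(1) s(1)[of v] unfolding \<sigma>'_def by auto
    ultimately show ?thesis unfolding configs_def by blast
  qed
  moreover have "disagreement_edges S \<sigma>' = F"
  proof -
    have ne: "\<sigma>' u \<noteq> \<sigma>' v \<longleftrightarrow> \<sigma> u \<noteq> \<sigma> v" for u v using c(1) unfolding \<sigma>'_def by auto
    have *: "dual u v \<in> disagreement_edges S \<sigma>' \<longleftrightarrow> dual u v \<in> F" if "nn u v" for u v
    proof -
      have "dual u v \<in> F \<Longrightarrow> u \<in> S \<or> v \<in> S" using assms(3) dE_mem[OF that] by blast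
      moreover have "(\<sigma> u \<noteq> \<sigma> v) = (dual u v \<in> F \<or> (u \<notin> S \<and> v \<notin> S \<and> \<eta> u \<noteq> \<eta> v))"
        unfolding s(2)[OF that] Un_iff oE_mem[OF that] ..
      ultimately show ?thesis unfolding dis_mem[OF that] ne by blast
    qed
    show ?thesis by (rule allD_eq[OF order_trans[OF dis_sub dE_sub] F(1) *])
  qed
  ultimately show ?thesis by blast
qed

lemma configs_val:
  assumes "\<sigma> \<in> configs S \<eta>" "\<And>v. \<eta> v = 1 \<or> \<eta> v = (-1::real)"
  shows "\<sigma> v = 1 \<or> \<sigma> v = -1" "v \<notin> S \<Longrightarrow> \<sigma> v = \<eta> v"
proof -
  have *: "v \<in> S \<Longrightarrow> \<sigma> v \<in> {-1, 1}" "v \<notin> S \<Longrightarrow> \<sigma> v = \<eta> v" using assms(1) unfolding configs_def by blast+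
  then show "v \<notin> S \<Longrightarrow> \<sigma> v = \<eta> v" by blast
  show "\<sigma> v = 1 \<or> \<sigma> v = -1" using * assms(2)[of v] by (cases "v \<in> S") auto
qed

text \<open>Equal disagreements make agreement at a site equivalent to agreement at its neighbour;
  walking right from any site leaves the finite set \<open>S\<close>, and there both configurations
  are frozen.\<close>

lemma dis_inj:
  assumes "finite S" "\<And>v. \<eta> v = 1 \<or> \<eta> v = (-1::real)"
  shows "inj_on (disagreement_edges S) (configs S \<eta>)"
proof (rule inj_onI)
  fix \<sigma> \<tau> assume st: "\<sigma> \<in> configs S \<eta>" "\<tau> \<in> configs S \<eta>" "disagreement_edges S \<sigma> = disagreement_edges S \<tau>"
  have v: "\<sigma> v = 1 \<or> \<sigma> v = -1" "\<tau> v = 1 \<or> \<tau> v = -1" "v \<notin> S \<Longrightarrow> \<sigma> v = \<tau> v" for v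
    using configs_val[OF st(1) assms(2), of v] configs_val[OF st(2) assms(2), of v] by auto
  have step: "\<sigma> u = \<tau> u \<longleftrightarrow> \<sigma> w = \<tau> w" if "nn u w" for u w
  proof (cases "u \<in> S \<or> w \<in> S")
    case True
    then have "(\<sigma> u \<noteq> \<sigma> w) = (\<tau> u \<noteq> \<tau> w)"
      using st(3) dis_mem[OF that, of S \<sigma>] dis_mem[OF that, of S \<tau>] by blast
    then show ?thesis using v(1)[of u] v(1)[of w] v(2)[of u] v(2)[of w] by (elim disjE) simp_all
  next
    case False
    then show ?thesis using v(3) by blast
  qed
  have eq: "\<sigma> (x, y) = \<tau> (x, y)" if "(x + int n, y) \<notin> S" for x y n
    using that
  proof (induction n arbitrary: x)
    case 0
    then show ?case using v(3) by simp
  next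
    case (Suc n)
    have "\<sigma> (x + 1, y) = \<tau> (x + 1, y)" using Suc.IH[of "x + 1"] Suc.prems by (simp add: algebra_simps)
    then show ?case using step[OF nn_h[of x y]] by simp
  qed
  have "\<sigma> (x, y) = \<tau> (x, y)" for x y
  proof -
    have "finite (fst ` S)" using assms(1) by simp
    then obtain m where m: "\<forall>z\<in>fst ` S. z \<le> m" using finite_has_maximal2 by (metis bdd_above_finite bdd_above_def)
    have "(x + int (nat (m + 1 - x)), y) \<notin> S"
    proof
      assume "(x + int (nat (m + 1 - x)), y) \<in> S"
      then have "x + int (nat (m + 1 - x)) \<in> fst ` S" by force
      then have "x + int (nat (m + 1 - x)) \<le> m" by (rule m[rule_format])
      then show False by linarith
    qed
    then show ?thesis by (rule eq)
  qed
  then show "\<sigma> = \<tau>" by auto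
qed

text \<open>Configurations correspond bijectively to the edge sets whose odd vertices are those of
  the boundary condition; \<open>P\<close> transports contour events through the bijection.\<close>

theorem duality:
  assumes "finite S" "conn_compl S" "\<And>v. \<eta> v = 1 \<or> \<eta> v = (-1::real)"
  shows "(\<Sum>\<sigma>\<in>{\<sigma>\<in>configs S \<eta>. P (disagreement_edges S \<sigma>)}. boltzmann \<beta> S \<sigma>) =
    exp (\<beta> * nE S) * (\<Sum>F\<in>{F\<in>Pow (dE S). P F \<and> bd F = bd (oE S \<eta>)}. exp (- 2 * \<beta>) ^ card F)"
proof -
  have v: "\<sigma> v = 1 \<or> \<sigma> v = -1" "v \<notin> S \<Longrightarrow> \<sigma> v = \<eta> v" if "\<sigma> \<in> configs S \<eta>" for \<sigma> v
    using configs_val[OF that assms(3), of v] by blast+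
  have "(\<Sum>\<sigma>\<in>{\<sigma>\<in>configs S \<eta>. P (disagreement_edges S \<sigma>)}. boltzmann \<beta> S \<sigma>) =
     (\<Sum>\<sigma>\<in>{\<sigma>\<in>configs S \<eta>. P (disagreement_edges S \<sigma>)}. exp (\<beta> * nE S) * exp (- 2 * \<beta>) ^ card (disagreement_edges S \<sigma>))"
    using v(1) by (intro sum.cong boltzmann_dual[OF assms(1)]) auto
  also have "\<dots> = (\<Sum>F\<in>{F\<in>Pow (dE S). P F \<and> bd F = bd (oE S \<eta>)}. exp (\<beta> * nE S) * exp (- 2 * \<beta>) ^ card F)"
  proof (rule sum.reindex_cong[where l="the_inv_into (configs S \<eta>) (disagreement_edges S)"])
    let ?A = "{F\<in>Pow (dE S). P F \<and> bd F = bd (oE S \<eta>)}"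
    note inj = dis_inj[OF assms(1,3)]
    have ex: "\<exists>\<sigma>\<in>configs S \<eta>. disagreement_edges S \<sigma> = F" if "F \<in> ?A" for F
    proof -
      have "F \<subseteq> dE S" "bd F = bd (oE S \<eta>)" using that by blast+
      then show ?thesis by (rule dis_surj[OF assms(2,3)])
    qed
    have im: "?A \<subseteq> disagreement_edges S ` configs S \<eta>" using ex by blast
    show "inj_on (the_inv_into (configs S \<eta>) (disagreement_edges S)) ?A"
      using inj_on_the_inv_into[OF inj] im by (rule inj_on_subset)
    have bd: "bd (disagreement_edges S \<sigma>) = bd (oE S \<eta>)" if "\<sigma> \<in> configs S \<eta>" for \<sigma>
      using v[OF that] by (intro bd_dis) auto
    show "{\<sigma>\<in>configs S \<eta>. P (disagreement_edges S \<sigma>)} = the_inv_into (configs S \<eta>) (disagreement_edges S) ` ?A"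
    proof (intro equalityI subsetI)
      fix \<sigma> assume "\<sigma> \<in> {\<sigma>\<in>configs S \<eta>. P (disagreement_edges S \<sigma>)}"
      then have s: "\<sigma> \<in> configs S \<eta>" "P (disagreement_edges S \<sigma>)" by simp_all
      then have "disagreement_edges S \<sigma> \<in> ?A" using bd[OF s(1)] dis_sub[of S \<sigma>] by (simp only: mem_Collect_eq Pow_iff simp_thms)
      moreover have "the_inv_into (configs S \<eta>) (disagreement_edges S) (disagreement_edges S \<sigma>) = \<sigma>"
        using s(1) by (rule the_inv_into_f_f[OF inj])
      ultimately show "\<sigma> \<in> the_inv_into (configs S \<eta>) (disagreement_edges S) ` ?A" by (rule image_eqI[OF sym, rotated])
    next
      fix \<sigma> assume "\<sigma> \<in> the_inv_into (configs S \<eta>) (disagreement_edges S) ` ?A"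
      then obtain F where F: "F \<in> ?A" "\<sigma> = the_inv_into (configs S \<eta>) (disagreement_edges S) F" by blast
      obtain \<tau> where t: "\<tau> \<in> configs S \<eta>" "disagreement_edges S \<tau> = F" using ex[OF F(1)] by blast
      have "\<sigma> = \<tau>" unfolding F(2) t(2)[symmetric] by (rule the_inv_into_f_f[OF inj t(1)])
      then show "\<sigma> \<in> {\<sigma>\<in>configs S \<eta>. P (disagreement_edges S \<sigma>)}" using t F(1) by auto
    qed
    fix F assume "F \<in> ?A"
    then have "F \<in> disagreement_edges S ` configs S \<eta>" using im by blast
    then show "exp (\<beta> * nE S) * exp (- 2 * \<beta>) ^ card (disagreement_edges S (the_inv_into (configs S \<eta>) (disagreement_edges S) F)) =
      exp (\<beta> * nE S) * exp (- 2 * \<beta>) ^ card F"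
      using f_the_inv_into_f[OF inj] by simp
  qed
  finally show ?thesis by (simp add: sum_distrib_left)
qed

corollary duality_Z:
  assumes "finite S" "conn_compl S" "\<And>v. \<eta> v = 1 \<or> \<eta> v = (-1::real)"
  shows "partition_function \<beta> S \<eta> = exp (\<beta> * nE S) * Hsum (exp (- 2 * \<beta>)) (dE S) (bd (oE S \<eta>))"
  using duality[OF assms, where P="\<lambda>_. True" and \<beta>=\<beta>] unfolding partition_function_def Hsum_def by simp

section \<open>Connected complements, and dual edge sets in grid form\<close>

lemma walk_line:
  assumes "\<And>k. 0 \<le> k \<Longrightarrow> k \<le> int n \<Longrightarrow> (x + k * dx, y + k * dy) \<notin> S" "\<bar>dx\<bar> + \<bar>dy\<bar> = 1"
  shows "(\<lambda>p q. nn p q \<and> p \<notin> S \<and> q \<notin> S)\<^sup>*\<^sup>* (x, y) (x + int n * dx, y + int n * dy)"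
  using assms(1)
proof (induction n)
  case (Suc n)
  let ?p = "(x + int n * dx, y + int n * dy)" and ?q = "(x + int (Suc n) * dx, y + int (Suc n) * dy)"
  have "nn ?p ?q" using assms(2) unfolding nn_def by (simp add: algebra_simps abs_minus_commute)
  moreover have "?p \<notin> S" "?q \<notin> S" using Suc.prems[of "int n"] Suc.prems[of "int (Suc n)"] by auto
  moreover have "(\<lambda>p q. nn p q \<and> p \<notin> S \<and> q \<notin> S)\<^sup>*\<^sup>* (x, y) ?p" using Suc by simp
  ultimately show ?case by (auto intro: rtranclp.rtrancl_into_rtrancl)
qed simp

lemma doubleton_set: "{u, v} = {u', v'} \<Longrightarrow> u = u' \<and> v = v' \<or> u = v' \<and> v = u'"
  by (auto simp: doubleton_eq_iff)

lemma gridE_mem: "nn u v \<Longrightarrow> {u, v} \<in> gridE S \<longleftrightarrow> u \<in> S \<and> v \<in> S"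
proof
  assume "{u, v} \<in> gridE S"
  then have "{u, v} \<subseteq> S" by (rule gridE_sub)
  then show "u \<in> S \<and> v \<in> S" by simp
next
  assume "nn u v" "u \<in> S \<and> v \<in> S"
  then show "{u, v} \<in> gridE S" unfolding gridE_def by blast
qed

lemma gridE_allD: "gridE S \<subseteq> allD"
proof
  fix e assume "e \<in> gridE S"
  then obtain x y where "e = {(x, y), (x + 1, y)} \<or> e = {(x, y), (x, y + 1)}" unfolding gridE_iff by blast
  moreover have "{(x, y), (x + 1, y)} = dual (x + 1, y) (x + 1, y + 1)" "{(x, y), (x, y + 1)} = dual (x, y + 1) (x + 1, y + 1)"
    using dual_vertical[of "x + 1" y] dual_horizontal[of x "y + 1"] by simp_all
  ultimately show "e \<in> allD" using nn_h nn_v by blast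
qed

lemma dE_eq_gridE:
  assumes "\<And>x y. (x, y) \<in> S \<or> (x + 1, y) \<in> S \<longleftrightarrow> (x, y - 1) \<in> T \<and> (x, y) \<in> T"
    "\<And>x y. (x, y) \<in> S \<or> (x, y + 1) \<in> S \<longleftrightarrow> (x - 1, y) \<in> T \<and> (x, y) \<in> T"
  shows "dE S = gridE T"
proof (rule allD_eq[OF dE_sub gridE_allD])
  fix u v assume uv: "nn u v"
  from uv show "dual u v \<in> dE S \<longleftrightarrow> dual u v \<in> gridE T"
  proof (rule nn_cases)
    fix x y assume e: "{u, v} = {(x, y), (x + 1, y)}"
    have n: "nn (x, y - 1) (x, y)" unfolding nn_def by simp
    have "dual u v = {(x, y - 1), (x, y)}" using dual_set[OF e] dual_horizontal by simp
    then have "dual u v \<in> gridE T \<longleftrightarrow> (x, y - 1) \<in> T \<and> (x, y) \<in> T" using gridE_mem[OF n] by simp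
    moreover have "dual u v \<in> dE S \<longleftrightarrow> (x, y) \<in> S \<or> (x + 1, y) \<in> S"
      unfolding dual_set[OF e] by (rule dE_mem[OF nn_h])
    ultimately show ?thesis using assms(1) by simp
  next
    fix x y assume e: "{u, v} = {(x, y), (x, y + 1)}"
    have n: "nn (x - 1, y) (x, y)" unfolding nn_def by simp
    have "dual u v = {(x - 1, y), (x, y)}" using dual_set[OF e] dual_vertical by simp
    then have "dual u v \<in> gridE T \<longleftrightarrow> (x - 1, y) \<in> T \<and> (x, y) \<in> T" using gridE_mem[OF n] by simp
    moreover have "dual u v \<in> dE S \<longleftrightarrow> (x, y) \<in> S \<or> (x, y + 1) \<in> S"
      unfolding dual_set[OF e] by (rule dE_mem[OF nn_v])
    ultimately show ?thesis using assms(2) by simp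
  qed
qed

abbreviation walk :: "site set \<Rightarrow> site \<Rightarrow> site \<Rightarrow> bool" where
  "walk S \<equiv> (\<lambda>p q. nn p q \<and> p \<notin> S \<and> q \<notin> S)\<^sup>*\<^sup>*"

lemma walk_sym: "walk S u v \<Longrightarrow> walk S v u"
proof -
  have "symp (\<lambda>p q. nn p q \<and> p \<notin> S \<and> q \<notin> S)" unfolding symp_def using nn_commute by blast
  then show "walk S u v \<Longrightarrow> walk S v u" by (rule sympD[OF symp_rtranclp])
qed

lemma walk_h:
  assumes "\<And>z. min x x' \<le> z \<Longrightarrow> z \<le> max x x' \<Longrightarrow> (z, y) \<notin> S"
  shows "walk S (x, y) (x', y)"
proof -
  have *: "walk S (x, y) (x', y)" if "x \<le> x'" "\<And>z. x \<le> z \<Longrightarrow> z \<le> x' \<Longrightarrow> (z, y) \<notin> S" for x x'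
    using walk_line[of "nat (x' - x)" x 1 y 0 S] that by auto
  show ?thesis
  proof (cases "x \<le> x'")
    case True then show ?thesis using assms by (intro *) auto
  next
    case False then show ?thesis using assms by (intro walk_sym[OF *]) auto
  qed
qed

lemma walk_v:
  assumes "\<And>z. min y y' \<le> z \<Longrightarrow> z \<le> max y y' \<Longrightarrow> (x, z) \<notin> S"
  shows "walk S (x, y) (x, y')"
proof -
  have *: "walk S (x, y) (x, y')" if "y \<le> y'" "\<And>z. y \<le> z \<Longrightarrow> z \<le> y' \<Longrightarrow> (x, z) \<notin> S" for y y'
    using walk_line[of "nat (y' - y)" x 0 y 1 S] that by auto
  show ?thesis
  proof (cases "y \<le> y'")
    case True then show ?thesis using assms by (intro *) auto
  next
    case False then show ?thesis using assms by (intro walk_sym[OF *]) auto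
  qed
qed

lemma walk_out:
  assumes "S \<subseteq> {x1..x2} \<times> {y1..y2}" "(x, y) \<notin> {x1..x2} \<times> {y1..y2}"
  shows "walk S (x, y) (x1 - 1, y1 - 1)"
proof -
  have L: "(z, w) \<notin> S" if "z < x1 \<or> z > x2 \<or> w < y1 \<or> w > y2" for z w using that assms(1) by auto
  consider "x < x1 \<or> x > x2" | "y < y1" | "y > y2" using assms(2) by fastforce
  then show ?thesis
  proof cases
    case 1
    have "walk S (x, y) (x, y1 - 1)" by (rule walk_v) (use 1 L in auto)
    moreover have "walk S (x, y1 - 1) (x1 - 1, y1 - 1)" by (rule walk_h) (use L in auto)
    ultimately show ?thesis by (rule rtranclp_trans)
  next
    case 2
    have "walk S (x, y) (x1 - 1, y)" by (rule walk_h) (use 2 L in auto)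
    moreover have "walk S (x1 - 1, y) (x1 - 1, y1 - 1)" by (rule walk_v) (use L in auto)
    ultimately show ?thesis by (rule rtranclp_trans)
  next
    case 3
    have "walk S (x, y) (x1 - 1, y)" by (rule walk_h) (use 3 L in auto)
    moreover have "walk S (x1 - 1, y) (x1 - 1, y1 - 1)" by (rule walk_v) (use L in auto)
    ultimately show ?thesis by (rule rtranclp_trans)
  qed
qed

text \<open>Outside the bounding box every site can walk to the corner
  \<open>(x1 - 1, y1 - 1)\<close>, so it remains to find a way out for the sites of the box that are
  missing from \<open>S\<close>.\<close>

lemma conn_complI:
  assumes "S \<subseteq> {x1..x2} \<times> {y1..y2}"
    "\<And>x y. (x, y) \<in> {x1..x2} \<times> {y1..y2} - S \<Longrightarrow> \<exists>w. w \<notin> {x1..x2} \<times> {y1..y2} \<and> walk S (x, y) w"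
  shows "conn_compl S"
proof -
  have *: "walk S u (x1 - 1, y1 - 1)" if "u \<notin> S" for u
  proof -
    obtain x y where u: "u = (x, y)" by force
    show ?thesis
    proof (cases "u \<in> {x1..x2} \<times> {y1..y2}")
      case True
      then have "(x, y) \<in> {x1..x2} \<times> {y1..y2} - S" using that u by simp
      from assms(2)[OF this] obtain w where w: "w \<notin> {x1..x2} \<times> {y1..y2}" "walk S u w" unfolding u by blast
      obtain x' y' where w': "w = (x', y')" by force
      have "walk S w (x1 - 1, y1 - 1)" unfolding w' by (rule walk_out[OF assms(1)]) (use w(1) w' in simp)
      with w(2) show ?thesis by (rule rtranclp_trans)
    next
      case False
      then show ?thesis unfolding u by (intro walk_out[OF assms(1)])
    qed
  qed
  show ?thesis unfolding conn_compl_def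
  proof (intro allI impI)
    fix u v assume uv: "u \<notin> S" "v \<notin> S"
    show "walk S u v" by (rule rtranclp_trans[OF *[OF uv(1)] walk_sym[OF *[OF uv(2)]]])
  qed
qed

section \<open>Boxes with a sloped boundary condition\<close>

text \<open>The dual sites of \<open>bx M\<close>; the shift by 1/2 in the encoding makes the square
  asymmetric.\<close>

definition sq :: "nat \<Rightarrow> site set" where
  "sq M = {- int M - 1..int M} \<times> {- int M - 1..int M}"

definition bx :: "nat \<Rightarrow> site set" where
  "bx M = {- int M..int M} \<times> {- int M..int M}"

lemma box_bx: "box L = bx (L div 2)"
  unfolding box_def bx_def by simp

lemma finite_bx [simp]: "finite (bx M)" and finite_sq [simp]: "finite (sq M)"
  unfolding bx_def sq_def by auto

lemma dE_bx: "dE (bx M) = gridE (sq M)"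
  by (rule dE_eq_gridE) (auto simp: bx_def sq_def)

lemma conn_bx: "conn_compl (bx M)"
  by (rule conn_complI[of _ "- int M" "int M" "- int M" "int M"]) (auto simp: bx_def)

definition eta_pq :: "int \<Rightarrow> int \<Rightarrow> config" where
  "eta_pq p q v = (if 0 < fst v * p + snd v * q then 1 else -1)"

text \<open>In row \<open>y\<close> the spins of \<open>eta_pq p q\<close> are -1 up to this column
  and 1 beyond it (\<open>eta_cut\<close>). The condition \<open>\<bar>q\<bar> \<le> p\<close> makes
  the interface at least as steep as a diagonal.\<close>

definition cut :: "int \<Rightarrow> int \<Rightarrow> int \<Rightarrow> int" where
  "cut p q y = (- (y * q)) div p"

lemma eta_cut: "0 < p \<Longrightarrow> eta_pq p q (x, y) = (if cut p q y < x then 1 else -1)"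
proof -
  assume p: "0 < p"
  let ?a = "- (y * q)"
  have m: "?a = (?a div p) * p + ?a mod p" "0 \<le> ?a mod p" "?a mod p < p" using p by auto
  have "cut p q y < x \<longleftrightarrow> - (y * q) < x * p" unfolding cut_def
  proof
    assume "?a div p < x"
    then have "(?a div p) * p \<le> (x - 1) * p" using p by (intro mult_right_mono) auto
    then have "(?a div p) * p \<le> x * p - p" by (simp only: left_diff_distrib mult_1)
    then show "?a < x * p" using m by linarith
  next
    assume *: "?a < x * p"
    show "?a div p < x"
    proof (rule ccontr)
      assume "\<not> ?a div p < x"
      then have "x * p \<le> (?a div p) * p" using p by (intro mult_right_mono) auto
      then show False using * m by linarith
    qed
  qed
  then show ?thesis unfolding eta_pq_def by (simp add: algebra_simps)
qed

lemma cut_bound: "0 < p \<Longrightarrow> \<bar>q\<bar> \<le> p \<Longrightarrow> \<bar>cut p q y\<bar> \<le> \<bar>y\<bar>"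
proof -
  assume p: "0 < p" "\<bar>q\<bar> \<le> p"
  have "\<bar>- (y * q)\<bar> \<le> \<bar>y\<bar> * p" using p by (simp add: abs_mult mult_left_mono)
  then have "- (\<bar>y\<bar> * p) \<le> - (y * q)" "- (y * q) \<le> \<bar>y\<bar> * p" by linarith+
  then have "(- (\<bar>y\<bar> * p)) div p \<le> cut p q y" "cut p q y \<le> (\<bar>y\<bar> * p) div p"
    unfolding cut_def using p by (intro zdiv_mono1; simp)+
  moreover have "(- (\<bar>y\<bar> * p)) div p = - \<bar>y\<bar>" using p
    by (metis less_irrefl minus_mult_left nonzero_mult_div_cancel_right)
  ultimately show ?thesis using p by simp
qed

text \<open>Where the sloped interface meets the top and the bottom of the box. In the rows just
  outside, \<open>cut\<close> can equal \<open>M + 1\<close>, one beyond the last dual column, hence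
  the minimum.\<close>

definition utop :: "int \<Rightarrow> int \<Rightarrow> nat \<Rightarrow> site" where
  "utop p q M = (min (int M) (cut p q (int M + 1)), int M)"
definition ubot :: "int \<Rightarrow> int \<Rightarrow> nat \<Rightarrow> site" where
  "ubot p q M = (min (int M) (cut p q (- int M - 1)), - int M - 1)"

lemma bd_eta:
  assumes p: "0 < p" "\<bar>q\<bar> \<le> p"
  shows "bd (oE (bx M) (eta_pq p q)) = pr (utop p q M) (ubot p q M)"
proof -
  have "utop p q M \<noteq> ubot p q M" unfolding utop_def ubot_def by simp
  then have pr: "pr (utop p q M) (ubot p q M) = {utop p q M, ubot p q M}" unfolding pr_def by simp
  define c where "c = cut p q"
  have c: "\<bar>c y\<bar> \<le> \<bar>y\<bar>" for y unfolding c_def by (rule cut_bound[OF p])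
  have e: "eta_pq p q (x, y) \<noteq> eta_pq p q (x', y') \<longleftrightarrow> (c y < x) \<noteq> (c y' < x')" for x y x' y'
    unfolding eta_cut[OF p(1)] c_def by simp
  have b: "(x, y) \<notin> bx M \<longleftrightarrow> \<not> (\<bar>x\<bar> \<le> int M \<and> \<bar>y\<bar> \<le> int M)" for x y unfolding bx_def by auto
  have "(i, j) \<in> bd (oE (bx M) (eta_pq p q)) \<longleftrightarrow> (i, j) = utop p q M \<or> (i, j) = ubot p q M" for i j
  proof -
    have star: "(i, j) \<in> bd (oE (bx M) (eta_pq p q)) \<longleftrightarrow>
      ((\<not> (\<bar>i\<bar> \<le> int M \<and> \<bar>j\<bar> \<le> int M) \<and> \<not> (\<bar>i\<bar> \<le> int M \<and> \<bar>j + 1\<bar> \<le> int M) \<and> (c j < i) \<noteq> (c (j + 1) < i)) \<noteq>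
       (\<not> (\<bar>i + 1\<bar> \<le> int M \<and> \<bar>j\<bar> \<le> int M) \<and> \<not> (\<bar>i + 1\<bar> \<le> int M \<and> \<bar>j + 1\<bar> \<le> int M) \<and> (c j < i + 1) \<noteq> (c (j + 1) < i + 1))) \<noteq>
      ((\<not> (\<bar>i\<bar> \<le> int M \<and> \<bar>j\<bar> \<le> int M) \<and> \<not> (\<bar>i + 1\<bar> \<le> int M \<and> \<bar>j\<bar> \<le> int M) \<and> (c j < i) \<noteq> (c j < i + 1)) \<noteq>
       (\<not> (\<bar>i\<bar> \<le> int M \<and> \<bar>j + 1\<bar> \<le> int M) \<and> \<not> (\<bar>i + 1\<bar> \<le> int M \<and> \<bar>j + 1\<bar> \<le> int M) \<and> (c (j + 1) < i) \<noteq> (c (j + 1) < i + 1)))"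
      unfolding bd_star[OF oE_sub(1)] dual_dirs oE_mem[OF nn_h] oE_mem[OF nn_v] e b ..
    have goal: "(i, j) = utop p q M \<or> (i, j) = ubot p q M \<longleftrightarrow>
       (j = int M \<and> i = min (int M) (c (int M + 1))) \<or> (j = - int M - 1 \<and> i = min (int M) (c (- int M - 1)))"
      unfolding utop_def ubot_def c_def by auto
    have f: "\<bar>c j\<bar> \<le> \<bar>j\<bar>" "\<bar>c (j + 1)\<bar> \<le> \<bar>j + 1\<bar>" using c by auto
    show ?thesis
    proof (cases "\<bar>i\<bar> \<le> int M \<and> \<bar>j\<bar> \<le> int M \<or> \<bar>i\<bar> \<le> int M \<and> \<bar>j + 1\<bar> \<le> int M \<or>
        \<bar>i + 1\<bar> \<le> int M \<and> \<bar>j\<bar> \<le> int M \<or> \<bar>i + 1\<bar> \<le> int M \<and> \<bar>j + 1\<bar> \<le> int M")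
      case False
      have g: "- int M - 1 \<le> min (int M) (c (int M + 1))" "- int M - 1 \<le> min (int M) (c (- int M - 1))"
        using c[of "int M + 1"] c[of "- int M - 1"] by auto
      have "\<not> (i, j) \<in> bd (oE (bx M) (eta_pq p q))" unfolding star using False by argo
      moreover have "\<not> ((j = int M \<and> i = min (int M) (c (int M + 1))) \<or> (j = - int M - 1 \<and> i = min (int M) (c (- int M - 1))))"
        using False g by auto
      ultimately show ?thesis unfolding goal by blast
    next
      case True
      then have r: "- int M - 1 \<le> i" "i \<le> int M" "- int M - 1 \<le> j" "j \<le> int M" by auto
      consider "j = int M" | "j = - int M - 1" | "- int M \<le> j" "j < int M" using r by linarith
      then show ?thesis
      proof cases
        case 1
        have *: "(- int M - 1 \<le> i \<and> i \<le> int M)" using r by simp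
        have cj: "\<bar>c (int M)\<bar> \<le> int M" "\<bar>c (int M + 1)\<bar> \<le> int M + 1" using c[of "int M"] c[of "int M + 1"] by auto
        show ?thesis unfolding star goal unfolding 1 using * cj by (smt (verit))
      next
        case 2
        have *: "(- int M - 1 \<le> i \<and> i \<le> int M)" using r by simp
        have cj: "\<bar>c (- int M)\<bar> \<le> int M" "\<bar>c (- int M - 1)\<bar> \<le> int M + 1" using c[of "- int M"] c[of "- int M - 1"] by auto
        have j1: "- int M - 1 + 1 = - int M" by simp
        show ?thesis unfolding star goal unfolding 2 j1 using * cj by (smt (verit))
      next
        case 3
        then show ?thesis unfolding star goal using r f by (smt (verit))
      qed
    qed
  qed
  then show ?thesis unfolding pr by auto
qed

definition RM :: "real \<Rightarrow> int \<Rightarrow> int \<Rightarrow> nat \<Rightarrow> real" where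
  "RM t p q M = cor t (gridE (sq M)) (utop p q M) (ubot p q M)"

lemma ratio_RM:
  assumes "0 < p" "\<bar>q\<bar> \<le> p"
  shows "partition_function \<beta> (box L) (eta_pq p q) / partition_function \<beta> (box L) (\<lambda>_. 1) = RM (exp (- 2 * \<beta>)) p q (L div 2)"
proof -
  have "oE S (\<lambda>_. 1) = {}" for S unfolding oE_def by auto
  then have "bd (oE (bx M) (\<lambda>_. 1)) = {}" for M by simp
  moreover have "eta_pq p q v = 1 \<or> eta_pq p q v = -1" for v unfolding eta_pq_def by auto
  ultimately show ?thesis unfolding box_bx RM_def cor_def bd_eta[OF assms, symmetric]
    by (subst (1 2) duality_Z) (auto simp: conn_bx dE_bx)
qed

section \<open>Surface tension and correlations\<close>

definition shift :: "site \<Rightarrow> site \<Rightarrow> site" where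
  "shift a v = (fst a + fst v, snd a + snd v)"

lemma gridE_image:
  assumes "\<And>u v. nn (f u) (f v) \<longleftrightarrow> nn u v"
  shows "(`) f ` gridE S = gridE (f ` S)"
proof (intro equalityI subsetI)
  fix e assume "e \<in> (`) f ` gridE S"
  then obtain e' where "e = f ` e'" "e' \<in> gridE S" by blast
  moreover from this(2) obtain u v where "e' = {u, v}" "nn u v" "u \<in> S" "v \<in> S" unfolding gridE_def by blast
  ultimately have "e = {f u, f v}" "nn (f u) (f v)" "f u \<in> f ` S" "f v \<in> f ` S" using assms by auto
  then show "e \<in> gridE (f ` S)" unfolding gridE_def by blast
next
  fix e assume "e \<in> gridE (f ` S)"
  then obtain u v where "e = {f u, f v}" "nn (f u) (f v)" "u \<in> S" "v \<in> S" unfolding gridE_def by blast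
  moreover from this have "nn u v" using assms by simp
  ultimately have "{u, v} \<in> gridE S" "e = f ` {u, v}" unfolding gridE_def by (blast, simp)
  then show "e \<in> (`) f ` gridE S" by blast
qed

lemma cor_grid_image:
  assumes "\<And>u v. nn (f u) (f v) \<longleftrightarrow> nn u v" "inj f"
  shows "cor t (gridE (f ` S)) (f u) (f v) = cor t (gridE S) u v"
  unfolding gridE_image[OF assms(1), symmetric] by (rule cor_image[OF assms(2)])

lemma nn_shift: "nn (shift a u) (shift a v) \<longleftrightarrow> nn u v"
  unfolding nn_def shift_def by simp

lemma inj_shift: "inj (shift a)"
  unfolding shift_def by (rule injI) (auto simp: prod_eq_iff)

lemma cor_le_one: "graph E \<Longrightarrow> 0 \<le> t \<Longrightarrow> t \<le> 1 \<Longrightarrow> cor t E u v \<le> 1"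
proof -
  assume *: "graph E" "0 \<le> t" "t \<le> 1"
  have "cor t E u v * cor t E v u \<le> cor t E u u" by (rule cor_triangle[OF *])
  then have "(cor t E u v)^2 \<le> 1" using cor_self[OF *(1,2)] cor_commute[of t E v u] by (simp add: power2_eq_square)
  then show ?thesis by (simp add: abs_square_le_1)
qed

lemma cor_chain:
  assumes "graph E" "0 \<le> t" "t \<le> 1" "0 \<le> c" "\<And>k. k < n \<Longrightarrow> c \<le> cor t E (z k) (z (Suc k))"
  shows "c ^ n \<le> cor t E (z 0) (z n)"
  using assms(5)
proof (induction n)
  case 0
  then show ?case using cor_self[OF assms(1,2)] by simp
next
  case (Suc n)
  have "c ^ Suc n = c ^ n * c" by simp
  also have "\<dots> \<le> cor t E (z 0) (z n) * cor t E (z n) (z (Suc n))"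
    using Suc.IH Suc.prems assms(4) by (intro mult_mono cor_nonneg assms(2)) auto
  also have "\<dots> \<le> cor t E (z 0) (z (Suc n))" by (rule cor_triangle[OF assms(1-3)])
  finally show ?case .
qed

definition rect :: "int \<Rightarrow> int \<Rightarrow> int \<Rightarrow> int \<Rightarrow> site set" where
  "rect x1 x2 y1 y2 = {x1..x2} \<times> {y1..y2}"

lemma finite_rect [simp]: "finite (rect x1 x2 y1 y2)" unfolding rect_def by simp

text \<open>Single-edge bounds are chained along an L-shaped path by
  \<open>cor_triangle\<close>.\<close>

lemma cor_path:
  assumes t: "0 < t" "t < 1" and uv: "(x, y) \<in> rect x1 x2 y1 y2" "(x', y') \<in> rect x1 x2 y1 y2"
  shows "t ^ nat (\<bar>x - x'\<bar> + \<bar>y - y'\<bar>) \<le> cor t (gridE (rect x1 x2 y1 y2)) (x, y) (x', y')"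
proof -
  let ?R = "rect x1 x2 y1 y2"
  let ?c = "cor t (gridE ?R)"
  have g: "graph (gridE ?R)" by (rule gridE_graph) simp
  have e: "t \<le> ?c u v" if "nn u v" "u \<in> ?R" "v \<in> ?R" for u v
  proof -
    have "u \<noteq> v" using that(1) unfolding nn_def by auto
    then show ?thesis using that gridE_mem[OF that(1)] t by (intro cor_edge g) auto
  qed
  have h: "t ^ nat (x' - x) \<le> ?c (x, y) (x', y)" if "x \<le> x'" "(x, y) \<in> ?R" "(x', y) \<in> ?R" for x x' y
  proof -
    have "t ^ nat (x' - x) \<le> ?c (x + int 0, y) (x + int (nat (x' - x)), y)"
    proof (rule cor_chain[where z="\<lambda>k. (x + int k, y)", OF g])
      fix k assume "k < nat (x' - x)"
      then show "t \<le> ?c (x + int k, y) (x + int (Suc k), y)"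
        using that by (intro e) (auto simp: nn_def rect_def)
    qed (use t in auto)
    then show ?thesis using that(1) by simp
  qed
  have w: "t ^ nat (y' - y) \<le> ?c (x, y) (x, y')" if "y \<le> y'" "(x, y) \<in> ?R" "(x, y') \<in> ?R" for x y y'
  proof -
    have "t ^ nat (y' - y) \<le> ?c (x, y + int 0) (x, y + int (nat (y' - y)))"
    proof (rule cor_chain[where z="\<lambda>k. (x, y + int k)", OF g])
      fix k assume "k < nat (y' - y)"
      then show "t \<le> ?c (x, y + int k) (x, y + int (Suc k))"
        using that by (intro e) (auto simp: nn_def rect_def)
    qed (use t in auto)
    then show ?thesis using that(1) by simp
  qed
  have m: "(x', y) \<in> ?R" using uv unfolding rect_def by auto
  have 1: "t ^ nat \<bar>x - x'\<bar> \<le> ?c (x, y) (x', y)"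
  proof (cases "x \<le> x'")
    case True
    then have "\<bar>x - x'\<bar> = x' - x" by simp
    then show ?thesis using h[OF True uv(1) m] by simp
  next
    case False
    then have "\<bar>x - x'\<bar> = x - x'" by simp
    then show ?thesis using h[of x' x y] uv(1) m False cor_commute[of t _ "(x, y)"] by simp
  qed
  have 2: "t ^ nat \<bar>y - y'\<bar> \<le> ?c (x', y) (x', y')"
  proof (cases "y \<le> y'")
    case True
    then have "\<bar>y - y'\<bar> = y' - y" by simp
    then show ?thesis using w[OF True m uv(2)] by simp
  next
    case False
    then have "\<bar>y - y'\<bar> = y - y'" by simp
    then show ?thesis using w[of y' y x'] uv(2) m False cor_commute[of t _ "(x', y)"] by simp
  qed
  have "t ^ nat (\<bar>x - x'\<bar> + \<bar>y - y'\<bar>) = t ^ nat \<bar>x - x'\<bar> * t ^ nat \<bar>y - y'\<bar>"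
    by (simp add: nat_add_distrib power_add)
  also have "\<dots> \<le> ?c (x, y) (x', y) * ?c (x', y) (x', y')"
    using t by (intro mult_mono 1 2 cor_nonneg) auto
  also have "\<dots> \<le> ?c (x, y) (x', y')" using t by (intro cor_triangle g) auto
  finally show ?thesis .
qed

lemma sq_rect: "sq M = rect (- int M - 1) (int M) (- int M - 1) (int M)"
  unfolding sq_def rect_def by simp

lemma cut_real:
  assumes "0 < p"
  shows "real_of_int (cut p q y) \<le> - (real_of_int y * (q / p))" "- (real_of_int y * (q / p)) < real_of_int (cut p q y) + 1"
proof -
  have "cut p q y = \<lfloor>real_of_int (- (y * q)) / real_of_int p\<rfloor>"
    unfolding cut_def by (simp only: floor_divide_of_int_eq)
  then have c: "cut p q y = \<lfloor>- (real_of_int y * (q / p))\<rfloor>" by simp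
  show "real_of_int (cut p q y) \<le> - (real_of_int y * (q / p))" "- (real_of_int y * (q / p)) < real_of_int (cut p q y) + 1"
    unfolding c by linarith+
qed

text \<open>Subadditivity: \<open>2 * n\<close> translates of \<open>S0\<close> are strung along the
  interface through the points \<open>z k\<close>. In each step a path of length at most
  \<open>K\<close> mends the mismatch between \<open>(dx, dy)\<close> and the rounded line, and a
  longer path at each end reaches \<open>ubot\<close> and \<open>utop\<close>.\<close>

lemma RM_lower:
  assumes p: "0 < p" "\<bar>q\<bar> \<le> p" and t: "0 < t" "t < 1"
    and S0: "S0 \<subseteq> rect (- int B) (int B) (- int B) (int B)" "(0, 0) \<in> S0" "(dx, dy) \<in> S0" "1 \<le> dy"
    and K: "\<And>y. \<bar>cut p q (y + dy) - cut p q y - dx\<bar> \<le> int K" and M: "B \<le> M"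
  defines "n \<equiv> nat ((int M - int B) div dy)"
  shows "t ^ nat (4 * (int B + dy) + 8) * (cor t (gridE S0) (0, 0) (dx, dy) * t ^ K) ^ (2 * n) \<le> RM t p q M"
proof -
  let ?cz = "cor t (gridE S0) (0, 0) (dx, dy)"
  let ?c = "cor t (gridE (sq M))"
  have g: "graph (gridE (sq M))" by (rule gridE_graph) simp
  have t01: "0 \<le> t" "t \<le> 1" using t by auto
  have nd: "int n * dy \<le> int M - int B" "int M - int B < int n * dy + dy"
  proof -
    have "0 \<le> (int M - int B) div dy" using M S0(4) by (simp add: pos_imp_zdiv_nonneg_iff)
    then have n: "int n = (int M - int B) div dy" unfolding n_def by simp
    have "(int M - int B) = ((int M - int B) div dy) * dy + (int M - int B) mod dy" by simp
    moreover have "0 \<le> (int M - int B) mod dy" "(int M - int B) mod dy < dy" using S0(4) by auto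
    ultimately show "int n * dy \<le> int M - int B" "int M - int B < int n * dy + dy" unfolding n by linarith+
  qed
  \<comment> \<open>The rows are centred, and \<open>n\<close> is the largest number that keeps the
    points \<open>z k\<close> at height at most \<open>M - B\<close>; the translates, of radius
    \<open>B\<close>, then stay in the box.\<close>
  define y where "y k = (int k - int n) * dy" for k
  define z where "z k = (cut p q (y k), y k)" for k
  have yb: "\<bar>y k\<bar> \<le> int n * dy" if "k \<le> 2 * n" for k
  proof -
    have "\<bar>int k - int n\<bar> \<le> int n" using that by auto
    then show ?thesis unfolding y_def using S0(4) by (simp add: abs_mult mult_right_mono)
  qed
  have zb: "\<bar>fst (z k)\<bar> \<le> int M - int B" "\<bar>snd (z k)\<bar> \<le> int M - int B" if "k \<le> 2 * n" for k
    using yb[OF that] nd(1) cut_bound[OF p, of "y k"] unfolding z_def by auto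
  have zin: "z k \<in> sq M" if "k \<le> 2 * n" for k
    using zb[OF that] unfolding sq_def by (cases "z k") auto
  have sh: "shift (z k) ` S0 \<subseteq> sq M" if "k \<le> 2 * n" for k
  proof
    fix w assume "w \<in> shift (z k) ` S0"
    then obtain v where v: "w = shift (z k) v" "v \<in> S0" by blast
    then have "v \<in> rect (- int B) (int B) (- int B) (int B)" using S0(1) by blast
    then have "\<bar>fst v\<bar> \<le> int B" "\<bar>snd v\<bar> \<le> int B" unfolding rect_def by auto
    then show "w \<in> sq M" using zb[OF that] unfolding v(1) shift_def sq_def by auto
  qed
  have step: "?cz * t ^ K \<le> ?c (z k) (z (Suc k))" if k: "k < 2 * n" for k
  proof -
    let ?w = "shift (z k) (dx, dy)"
    have w: "?w \<in> sq M" using sh[of k] k S0(3) by auto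
    have "?cz = cor t (gridE (shift (z k) ` S0)) (shift (z k) (0, 0)) ?w"
      by (rule cor_grid_image[OF nn_shift inj_shift, symmetric])
    also have "\<dots> \<le> ?c (shift (z k) (0, 0)) ?w"
      using sh[of k] k t01 by (intro cor_mono g gridE_mono) auto
    also have "shift (z k) (0, 0) = z k" unfolding shift_def by simp
    finally have 1: "?cz \<le> ?c (z k) ?w" .
    have ys: "y (Suc k) = y k + dy" unfolding y_def by (simp add: algebra_simps)
    have d: "nat (\<bar>fst ?w - fst (z (Suc k))\<bar> + \<bar>snd ?w - snd (z (Suc k))\<bar>) \<le> K"
      using K[of "y k"] unfolding z_def shift_def ys by auto
    have "t ^ K \<le> t ^ nat (\<bar>fst ?w - fst (z (Suc k))\<bar> + \<bar>snd ?w - snd (z (Suc k))\<bar>)"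
      using d t01 by (intro power_decreasing) auto
    also have "\<dots> \<le> ?c (fst ?w, snd ?w) (fst (z (Suc k)), snd (z (Suc k)))"
      unfolding sq_rect using w zin[of "Suc k"] k t unfolding sq_rect by (intro cor_path) auto
    finally have 2: "t ^ K \<le> ?c ?w (z (Suc k))" by simp
    have "?cz * t ^ K \<le> ?c (z k) ?w * ?c ?w (z (Suc k))"
      using t01 by (intro mult_mono 1 2 cor_nonneg) auto
    also have "\<dots> \<le> ?c (z k) (z (Suc k))" by (rule cor_triangle[OF g t01])
    finally show ?thesis .
  qed
  have mid: "(?cz * t ^ K) ^ (2 * n) \<le> ?c (z 0) (z (2 * n))"
    using step t01 by (intro cor_chain g mult_nonneg_nonneg cor_nonneg zero_le_power) auto
  let ?r = "real_of_int q / real_of_int p"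
  have r: "\<bar>?r\<bar> \<le> 1" using p by (simp add: field_simps)
  define D where "D = nat (2 * (int B + dy) + 4)"
  have cd: "\<bar>cut p q y1 - cut p q y2\<bar> \<le> \<bar>y1 - y2\<bar> + 1" for y1 y2
  proof -
    define P Q where "P = real_of_int y1 * ?r" and "Q = real_of_int y2 * ?r"
    have "\<bar>P - Q\<bar> = \<bar>real_of_int y1 - real_of_int y2\<bar> * \<bar>?r\<bar>"
      unfolding P_def Q_def by (simp only: left_diff_distrib[symmetric] abs_mult)
    also have "\<dots> \<le> \<bar>real_of_int y1 - real_of_int y2\<bar>" using r by (intro mult_left_le) auto
    finally have "\<bar>real_of_int (cut p q y1) - real_of_int (cut p q y2)\<bar> < \<bar>real_of_int y1 - real_of_int y2\<bar> + 2"
      using cut_real[OF p(1), where q=q and y=y1, folded P_def] cut_real[OF p(1), where q=q and y=y2, folded Q_def] by linarith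
    then show ?thesis by linarith
  qed
  have bot: "t ^ D \<le> ?c (ubot p q M) (z 0)"
  proof -
    have "\<bar>cut p q (- int M - 1) - cut p q (- (int n * dy))\<bar> \<le> int B + dy + 1"
      using cd[of "- int M - 1" "- (int n * dy)"] nd by linarith
    moreover have "\<bar>cut p q (- int M - 1)\<bar> \<le> int M + 1" using cut_bound[OF p, of "- int M - 1"] by simp
    moreover have "z 0 = (cut p q (- (int n * dy)), - (int n * dy))" unfolding z_def y_def by simp
    ultimately have d: "nat (\<bar>fst (ubot p q M) - fst (z 0)\<bar> + \<bar>snd (ubot p q M) - snd (z 0)\<bar>) \<le> D"
      "ubot p q M \<in> sq M"
      using nd unfolding D_def ubot_def sq_def by auto
    have "t ^ D \<le> t ^ nat (\<bar>fst (ubot p q M) - fst (z 0)\<bar> + \<bar>snd (ubot p q M) - snd (z 0)\<bar>)"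
      using d(1) t01 by (intro power_decreasing) auto
    also have "\<dots> \<le> ?c (fst (ubot p q M), snd (ubot p q M)) (fst (z 0), snd (z 0))"
      unfolding sq_rect using d(2) zin[of 0] t unfolding sq_rect by (intro cor_path) auto
    finally show ?thesis by simp
  qed
  have top: "t ^ D \<le> ?c (z (2 * n)) (utop p q M)"
  proof -
    have "\<bar>cut p q (int M + 1) - cut p q (int n * dy)\<bar> \<le> int B + dy + 1"
      using cd[of "int M + 1" "int n * dy"] nd by linarith
    moreover have "\<bar>cut p q (int M + 1)\<bar> \<le> int M + 1" using cut_bound[OF p, of "int M + 1"] by simp
    moreover have "z (2 * n) = (cut p q (int n * dy), int n * dy)" unfolding z_def y_def by simp
    ultimately have d: "nat (\<bar>fst (z (2 * n)) - fst (utop p q M)\<bar> + \<bar>snd (z (2 * n)) - snd (utop p q M)\<bar>) \<le> D"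
      "utop p q M \<in> sq M"
      using nd unfolding D_def utop_def sq_def by auto
    have "t ^ D \<le> t ^ nat (\<bar>fst (z (2 * n)) - fst (utop p q M)\<bar> + \<bar>snd (z (2 * n)) - snd (utop p q M)\<bar>)"
      using d(1) t01 by (intro power_decreasing) auto
    also have "\<dots> \<le> ?c (fst (z (2 * n)), snd (z (2 * n))) (fst (utop p q M), snd (utop p q M))"
      unfolding sq_rect using d(2) zin[of "2 * n"] t unfolding sq_rect by (intro cor_path) auto
    finally show ?thesis by simp
  qed
  have DD: "nat (4 * (int B + dy) + 8) = D + D" using S0(4) unfolding D_def by auto
  have "t ^ nat (4 * (int B + dy) + 8) * (?cz * t ^ K) ^ (2 * n) = t ^ D * (?cz * t ^ K) ^ (2 * n) * t ^ D"
    unfolding DD by (simp add: power_add)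
  also have "\<dots> \<le> ?c (ubot p q M) (z 0) * ?c (z 0) (z (2 * n)) * ?c (z (2 * n)) (utop p q M)"
    using t01 by (intro mult_mono bot top mid mult_nonneg_nonneg zero_le_power cor_nonneg)
  also have "\<dots> \<le> ?c (ubot p q M) (z (2 * n)) * ?c (z (2 * n)) (utop p q M)"
    using t01 by (intro mult_right_mono cor_triangle g cor_nonneg)
  also have "\<dots> \<le> ?c (ubot p q M) (utop p q M)" by (rule cor_triangle[OF g t01])
  finally show ?thesis unfolding RM_def by (subst cor_commute)
qed

lemma RM_pos: "0 < p \<Longrightarrow> \<bar>q\<bar> \<le> p \<Longrightarrow> 0 < t \<Longrightarrow> t < 1 \<Longrightarrow> 0 < RM t p q M"
proof -
  assume p: "0 < p" "\<bar>q\<bar> \<le> p" and t: "0 < t" "t < 1"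
  have "utop p q M \<in> sq M" "ubot p q M \<in> sq M"
    using cut_bound[OF p, of "int M + 1"] cut_bound[OF p, of "- int M - 1"] unfolding utop_def ubot_def sq_def by auto
  then have "t ^ nat (\<bar>fst (utop p q M) - fst (ubot p q M)\<bar> + \<bar>snd (utop p q M) - snd (ubot p q M)\<bar>) \<le>
    cor t (gridE (sq M)) (fst (utop p q M), snd (utop p q M)) (fst (ubot p q M), snd (ubot p q M))"
    unfolding sq_rect using t by (intro cor_path) auto
  then show ?thesis using t unfolding RM_def by (auto intro: less_le_trans[OF zero_less_power])
qed

text \<open>The boundary cost \<open>D\<close> does not depend on \<open>M\<close>, so it disappears
  after division by \<open>2 * M + 1\<close>.\<close>

lemma RM_upper_ln:
  assumes p: "0 < p" "\<bar>q\<bar> \<le> p" and t: "0 < t" "t < 1"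
    and S0: "finite S0" "(0, 0) \<in> S0" "(dx, dy) \<in> S0" "1 \<le> dy" "0 < cor t (gridE S0) (0, 0) (dx, dy)"
    and K: "\<And>y. \<bar>cut p q (y + dy) - cut p q y - dx\<bar> \<le> int K"
  shows "\<exists>D. eventually (\<lambda>M. - ln (RM t p q M) \<le> D + (2 * real M + 1) / real_of_int dy *
     (- ln (cor t (gridE S0) (0, 0) (dx, dy)) + real K * (- ln t))) sequentially"
proof -
  let ?cz = "cor t (gridE S0) (0, 0) (dx, dy)"
  obtain B where B: "S0 \<subseteq> rect (- int B) (int B) (- int B) (int B)"
  proof -
    define b where "b = Max ((\<lambda>v. \<bar>fst v\<bar> + \<bar>snd v\<bar>) ` S0)"
    have "\<bar>fst v\<bar> + \<bar>snd v\<bar> \<le> b" if "v \<in> S0" for v unfolding b_def using S0(1) that by (intro Max_ge) auto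
    then have "S0 \<subseteq> rect (- int (nat b)) (int (nat b)) (- int (nat b)) (int (nat b))"
      unfolding rect_def by fastforce
    then show ?thesis by (rule that)
  qed
  let ?D = "real (nat (4 * (int B + dy) + 8)) * (- ln t)"
  have c0: "?cz \<le> 1" using t by (intro cor_le_one gridE_graph S0) auto
  have nn0: "0 \<le> - ln ?cz + real K * (- ln t)" using c0 S0(5) t by (intro add_nonneg_nonneg mult_nonneg_nonneg) auto
  have "- ln (RM t p q M) \<le> ?D + (2 * real M + 1) / real_of_int dy * (- ln ?cz + real K * (- ln t))" if M: "B \<le> M" for M
  proof -
    define n where "n = nat ((int M - int B) div dy)"
    have "ln (t ^ nat (4 * (int B + dy) + 8) * (?cz * t ^ K) ^ (2 * n)) \<le> ln (RM t p q M)"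
      using RM_lower[OF p t B S0(2-4) K M] RM_pos[OF p t, of M] S0(5) t unfolding n_def by (subst ln_le_cancel_iff) auto
    then have "- ln (RM t p q M) \<le> ?D + real (2 * n) * (- ln ?cz + real K * (- ln t))"
      using S0(5) t by (simp add: ln_mult ln_realpow algebra_simps)
    also have "real (2 * n) * (- ln ?cz + real K * (- ln t)) \<le> (2 * real M + 1) / real_of_int dy * (- ln ?cz + real K * (- ln t))"
    proof (rule mult_right_mono[OF _ nn0])
      have "0 \<le> (int M - int B) div dy" using M S0(4) by (simp add: pos_imp_zdiv_nonneg_iff)
      then have n: "int n = (int M - int B) div dy" unfolding n_def by simp
      have "int n * dy \<le> int M - int B" unfolding n using S0(4) by (simp add: minus_mod_eq_div_mult[symmetric])
      then have "real_of_int (int n * dy) \<le> real_of_int (int M - int B)" by (simp only: of_int_le_iff)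
      then have "real n * real_of_int dy \<le> real M" by simp
      then show "real (2 * n) \<le> (2 * real M + 1) / real_of_int dy" using S0(4) by (simp add: field_simps)
    qed
    finally show ?thesis by simp
  qed
  then show ?thesis by (intro exI[of _ ?D] eventually_sequentiallyI[of B]) auto
qed

text \<open>Fekete's argument: the box of size \<open>M0\<close>, moved so that its lower endpoint
  becomes the origin, serves as \<open>S0\<close>. Adding the cost \<open>K\<close> of mending one
  step makes the sequence subadditive up to boundary terms, and the limit is the infimum of
  \<open>b\<close>.\<close>

lemma RM_limit:
  assumes p: "0 < p" "\<bar>q\<bar> \<le> p" and t: "0 < t" "t < 1"
  shows "\<exists>tau. (\<lambda>M. - ln (RM t p q M) / (2 * real M + 1)) \<longlonglongrightarrow> tau"
proof -
  define f where "f M = - ln (RM t p q M)" for M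
  define K where "K = 5 * (- ln t)"
  have K: "0 \<le> K" using t unfolding K_def by simp
  have f0: "0 \<le> f M" for M
  proof -
    have "RM t p q M \<le> 1" unfolding RM_def using t by (intro cor_le_one gridE_graph) auto
    then show ?thesis unfolding f_def using RM_pos[OF p t, of M] by simp
  qed
  have sub: "\<exists>D. eventually (\<lambda>M. f M \<le> D + (2 * real M + 1) / (2 * real M0 + 1) * (f M0 + K)) sequentially" for M0
  proof -
    let ?v = "ubot p q M0" and ?u = "utop p q M0"
    let ?a = "(- fst ?v, - snd ?v)"
    let ?S = "shift ?a ` sq M0"
    let ?d = "(fst ?u - fst ?v, 2 * int M0 + 1)"
    have uv: "?u \<in> sq M0" "?v \<in> sq M0"
      using cut_bound[OF p, of "int M0 + 1"] cut_bound[OF p, of "- int M0 - 1"] unfolding utop_def ubot_def sq_def by auto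
    have s: "shift ?a ?v = (0, 0)" "shift ?a ?u = ?d" unfolding shift_def utop_def ubot_def by auto
    have c: "cor t (gridE ?S) (0, 0) ?d = RM t p q M0"
      using cor_grid_image[OF nn_shift inj_shift, of t ?a "sq M0" ?v ?u] unfolding s RM_def by (simp add: cor_commute)
    \<comment> \<open>With \<open>r = q / p\<close> and \<open>Q = M0 * r\<close>, the line moves by
      \<open>2 * Q + r\<close> over the step and by \<open>2 * Q + 2 * r\<close> between the two
      endpoints. Together with the integer parts and the minima in \<open>utop\<close> and
      \<open>ubot\<close> the error is an integer below 6.\<close>
    have "\<bar>cut p q (y + (2 * int M0 + 1)) - cut p q y - (fst ?u - fst ?v)\<bar> \<le> int 5" for y
    proof -
      define r where "r = real_of_int q / real_of_int p"
      have r: "\<bar>r\<bar> \<le> 1" using p unfolding r_def by (simp add: field_simps)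
      note cr = cut_real[OF p(1), where q=q, folded r_def]
      have "\<bar>fst ?u - cut p q (int M0 + 1)\<bar> \<le> 1" "\<bar>fst ?v - cut p q (- int M0 - 1)\<bar> \<le> 1"
        using cut_bound[OF p, of "int M0 + 1"] cut_bound[OF p, of "- int M0 - 1"] unfolding utop_def ubot_def by auto
      then have "\<bar>real_of_int (fst ?u) - real_of_int (cut p q (int M0 + 1))\<bar> \<le> 1" "\<bar>real_of_int (fst ?v) - real_of_int (cut p q (- int M0 - 1))\<bar> \<le> 1"
        by linarith+
      note du = this
      define P Q where "P = real_of_int y * r" and "Q = real M0 * r"
      have e: "real_of_int (y + (2 * int M0 + 1)) * r = P + 2 * Q + r"
        "real_of_int (int M0 + 1) * r = Q + r" "real_of_int (- int M0 - 1) * r = - Q - r" "real_of_int y * r = P"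
        unfolding P_def Q_def by (simp_all add: algebra_simps)
      have "\<bar>real_of_int (cut p q (y + (2 * int M0 + 1))) - real_of_int (cut p q y) - (real_of_int (fst ?u) - real_of_int (fst ?v))\<bar> < 6"
        using r du cr[of "y + (2 * int M0 + 1)", unfolded e] cr[of y, unfolded e] cr[of "int M0 + 1", unfolded e] cr[of "- int M0 - 1", unfolded e]
        by linarith
      then show ?thesis by linarith
    qed
    note K5 = this
    have "\<exists>D. eventually (\<lambda>M. - ln (RM t p q M) \<le> D + (2 * real M + 1) / real_of_int (2 * int M0 + 1) *
      (- ln (cor t (gridE ?S) (0, 0) ?d) + real 5 * (- ln t))) sequentially"
    proof (rule RM_upper_ln[OF p t _ _ _ _ _ K5])
      show "(0, 0) \<in> ?S" using s(1) uv(2) by (intro image_eqI[where x="?v"]) auto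
      show "?d \<in> ?S" using s(2) uv(1) by (intro image_eqI[where x="?u"]) auto
      show "0 < cor t (gridE ?S) (0, 0) ?d" unfolding c by (rule RM_pos[OF p t])
    qed simp_all
    then show ?thesis unfolding c f_def K_def by simp
  qed
  define b where "b M = (f M + K) / (2 * real M + 1)" for M
  define tau where "tau = Inf (range b)"
  have b0: "0 \<le> b M" for M unfolding b_def using f0[of M] K by simp
  have bl: "tau \<le> b M" for M unfolding tau_def using b0 by (intro cInf_lower bdd_belowI[of _ 0]) auto
  have inv: "(\<lambda>M. c / (2 * real M + 1)) \<longlonglongrightarrow> 0" for c :: real by real_asymp
  have "(\<lambda>M. f M / (2 * real M + 1)) \<longlonglongrightarrow> tau"
  proof (rule order_tendstoI)
    fix a assume a: "a < tau"
    have "eventually (\<lambda>M. K / (2 * real M + 1) < tau - a) sequentially"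
      using a by (intro order_tendstoD(2)[OF inv[of K]]) auto
    then show "eventually (\<lambda>M. a < f M / (2 * real M + 1)) sequentially"
    proof (rule eventually_mono)
      fix M assume "K / (2 * real M + 1) < tau - a"
      then show "a < f M / (2 * real M + 1)" using bl[of M] unfolding b_def by (simp add: add_divide_distrib)
    qed
  next
    fix a assume a: "tau < a"
    then obtain M0 where M0: "b M0 < a" unfolding tau_def using cInf_lessD[of "range b" a] by auto
    obtain D where D: "eventually (\<lambda>M. f M \<le> D + (2 * real M + 1) / (2 * real M0 + 1) * (f M0 + K)) sequentially"
      using sub by blast
    have "eventually (\<lambda>M. D / (2 * real M + 1) < a - b M0) sequentially"
      using M0 by (intro order_tendstoD(2)[OF inv[of D]]) auto
    with D show "eventually (\<lambda>M. f M / (2 * real M + 1) < a) sequentially"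
    proof (rule eventually_elim2)
      fix M assume 1: "f M \<le> D + (2 * real M + 1) / (2 * real M0 + 1) * (f M0 + K)" and 2: "D / (2 * real M + 1) < a - b M0"
      have "f M / (2 * real M + 1) \<le> (D + (2 * real M + 1) * b M0) / (2 * real M + 1)"
        using 1 unfolding b_def by (intro divide_right_mono) auto
      also have "\<dots> = D / (2 * real M + 1) + b M0" by (simp add: add_divide_distrib)
      finally show "f M / (2 * real M + 1) < a" using 2 by simp
    qed
  qed
  then show ?thesis unfolding f_def by blast
qed

lemma mult_pos_iff_aux: "0 < (c::real) \<Longrightarrow> 0 < c * x \<longleftrightarrow> 0 < x"
  by (simp add: zero_less_mult_iff)

text \<open>A rational tangent \<open>q / p\<close> turns \<open>eta_angle\<close> into
  \<open>eta_pq\<close>, and with \<open>M = L div 2\<close> the length \<open>2 * M + 1\<close> is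
  asymptotic to \<open>L\<close>.\<close>

lemma tau_base_eq:
  assumes p: "0 < p" "\<bar>q\<bar> \<le> p" and b: "0 < \<beta>" and th: "0 < cos \<theta>" "sin \<theta> = cos \<theta> * (q / p)"
    and lim: "(\<lambda>M. - ln (RM (exp (- 2 * \<beta>)) p q M) / (2 * real M + 1)) \<longlonglongrightarrow> tau"
  shows "tau_base \<beta> \<theta> = cos \<theta> * tau"
proof -
  let ?t = "exp (- 2 * \<beta>)"
  have "eta_angle \<theta> v = eta_pq p q v" for v
  proof -
    have "real_of_int (fst v) * cos \<theta> + real_of_int (snd v) * sin \<theta> = cos \<theta> / p * real_of_int (fst v * p + snd v * q)"
      using p(1) unfolding th(2) by (simp add: field_simps)
    moreover have "0 < cos \<theta> / p * real_of_int (fst v * p + snd v * q) \<longleftrightarrow> 0 < fst v * p + snd v * q"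
    proof -
      have "0 < cos \<theta> / p" using th(1) p(1) by simp
      then show ?thesis by (simp only: mult_pos_iff_aux of_int_0_less_iff)
    qed
    ultimately show ?thesis unfolding eta_angle_def eta_pq_def by simp
  qed
  then have e: "eta_angle \<theta> = eta_pq p q" by (rule ext)
  define a where "a M = - ln (RM ?t p q M) / (2 * real M + 1)" for M
  have half: "filterlim (\<lambda>L::nat. L div 2) sequentially sequentially"
    unfolding filterlim_at_top eventually_sequentially
  proof
    fix Z :: nat
    show "\<exists>N. \<forall>n\<ge>N. Z \<le> n div 2" by (rule exI[of _ "2 * Z"]) auto
  qed
  have l1: "(\<lambda>L::nat. a (L div 2)) \<longlonglongrightarrow> tau"
    by (rule filterlim_compose[OF _ half]) (use lim in \<open>simp add: a_def\<close>)
  have l2: "(\<lambda>L::nat. (2 * real (L div 2) + 1) / real L) \<longlonglongrightarrow> 1"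
  proof (rule tendsto_sandwich)
    have "real L - 1 \<le> 2 * real (L div 2)" "2 * real (L div 2) \<le> real L" for L
    proof -
      have "L \<le> 2 * (L div 2) + 1" "2 * (L div 2) \<le> L" by auto
      then show "real L - 1 \<le> 2 * real (L div 2)" "2 * real (L div 2) \<le> real L" by linarith+
    qed
    note h = this
    show "eventually (\<lambda>L. real L / real L \<le> (2 * real (L div 2) + 1) / real L) sequentially"
      by (intro always_eventually allI divide_right_mono) (use h in \<open>auto simp: algebra_simps\<close>)
    show "eventually (\<lambda>L. (2 * real (L div 2) + 1) / real L \<le> (real L + 1) / real L) sequentially"
      by (intro always_eventually allI divide_right_mono) (use h in auto)
    show "(\<lambda>L::nat. real L / real L) \<longlonglongrightarrow> 1" by real_asymp
    show "(\<lambda>L::nat. (real L + 1) / real L) \<longlonglongrightarrow> 1" by real_asymp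
  qed
  have "(\<lambda>L. - (cos \<theta> * (a (L div 2) * ((2 * real (L div 2) + 1) / real L)))) \<longlonglongrightarrow> - (cos \<theta> * (tau * 1))"
    by (intro tendsto_intros l1 l2)
  moreover have "- (cos \<theta> * (a (L div 2) * ((2 * real (L div 2) + 1) / real L))) = cos \<theta> / real L *
              ln (partition_function \<beta> (box L) (eta_angle \<theta>) / partition_function \<beta> (box L) (\<lambda>_. 1))" for L
  proof -
    have "2 * real (L div 2) + 1 \<noteq> 0" by linarith
    then have "a (L div 2) * (2 * real (L div 2) + 1) = - ln (RM ?t p q (L div 2))" unfolding a_def by simp
    then show ?thesis unfolding e ratio_RM[OF p] by (simp add: field_simps)
  qed
  ultimately have "(\<lambda>L. cos \<theta> / real L *
              ln (partition_function \<beta> (box L) (eta_angle \<theta>) / partition_function \<beta> (box L) (\<lambda>_. 1))) \<longlonglongrightarrow> - (cos \<theta> * tau)" by simp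
  then show ?thesis unfolding tau_base_def by (simp add: limI)
qed

text \<open>The vector \<open>(- q, p)\<close> is a period of the rounded line, so the mismatch is
  \<open>K = 0\<close> and no error survives the limit.\<close>

lemma RM_limit_le:
  assumes p: "0 < p" "\<bar>q\<bar> \<le> p" and t: "0 < t" "t < 1"
    and lim: "(\<lambda>M. - ln (RM t p q M) / (2 * real M + 1)) \<longlonglongrightarrow> tau"
    and S0: "finite S0" "(0, 0) \<in> S0" "(- q, p) \<in> S0" "0 < cor t (gridE S0) (0, 0) (- q, p)"
  shows "tau * p \<le> - ln (cor t (gridE S0) (0, 0) (- q, p))"
proof -
  let ?c = "- ln (cor t (gridE S0) (0, 0) (- q, p))"
  have cut: "\<bar>cut p q (y + p) - cut p q y - (- q)\<bar> \<le> int 0" for y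
  proof -
    have "- ((y + p) * q) = - (y * q) + (- q) * p" by (simp add: algebra_simps)
    moreover have "(- (y * q) + (- q) * p) div p = (- q) + (- (y * q)) div p"
      using p(1) by (intro div_mult_self1) simp
    ultimately have "cut p q (y + p) = cut p q y + (- q)" unfolding cut_def by simp
    then show ?thesis by simp
  qed
  have "\<exists>D. eventually (\<lambda>M. - ln (RM t p q M) \<le> D + (2 * real M + 1) / real_of_int p *
     (?c + real 0 * (- ln t))) sequentially"
    by (rule RM_upper_ln[OF p t S0(1-3) _ S0(4) cut]) (use p in simp)
  then obtain D where D: "eventually (\<lambda>M. - ln (RM t p q M) \<le> D + (2 * real M + 1) / real_of_int p * ?c) sequentially" by auto
  have "tau \<le> 0 + ?c / p"
  proof (rule tendsto_le[OF _ _ lim])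
    show "(\<lambda>M. D / (2 * real M + 1) + ?c / p) \<longlonglongrightarrow> 0 + ?c / p" by (intro tendsto_intros) real_asymp
    show "eventually (\<lambda>M. - ln (RM t p q M) / (2 * real M + 1) \<le> D / (2 * real M + 1) + ?c / p) sequentially"
      using D
    proof (rule eventually_mono)
      fix M assume "- ln (RM t p q M) \<le> D + (2 * real M + 1) / real_of_int p * ?c"
      then have "- ln (RM t p q M) / (2 * real M + 1) \<le> (D + (2 * real M + 1) * (?c / p)) / (2 * real M + 1)"
        by (intro divide_right_mono) auto
      also have "\<dots> = D / (2 * real M + 1) + ?c / p"
      proof -
        have n: "2 * real M + 1 \<noteq> 0" by linarith
        show ?thesis by (simp only: add_divide_distrib nonzero_mult_div_cancel_left[OF n])
      qed
      finally show "- ln (RM t p q M) / (2 * real M + 1) \<le> D / (2 * real M + 1) + ?c / p" .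
    qed
  qed simp
  then show ?thesis using p(1) by (simp add: field_simps)
qed

text \<open>\<open>tau_angle\<close> reduces the angle of \<open>(m, k)\<close> by quarter turns to
  one with tangent \<open>q / p\<close>, where \<open>\<bar>q\<bar> \<le> p\<close>. The interface
  with normal \<open>(p, q)\<close> runs along \<open>(- q, p)\<close>, and a rotation
  \<open>f\<close> of the lattice maps \<open>(m, k)\<close> to that vector; the three cases are the
  three possible numbers of quarter turns.\<close>

lemma surface_le:
  assumes m: "0 < m" and b: "0 < \<beta>" and S: "finite S" "(0, 0) \<in> S" "(m, k) \<in> S"
    and c: "0 < cor (exp (- 2 * \<beta>)) (gridE S) (0, 0) (m, k)"
  shows "surface_tension \<beta> (real_of_int m, real_of_int k) \<le> - ln (cor (exp (- 2 * \<beta>)) (gridE S) (0, 0) (m, k))"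
proof -
  let ?t = "exp (- 2 * \<beta>)"
  have t: "0 < ?t" "?t < 1" using b by auto
  let ?A = "arctan (real_of_int k / real_of_int m)"
  let ?n = "sqrt ((real_of_int m)^2 + (real_of_int k)^2)"
  have sq: "sqrt (1 + (real_of_int k / real_of_int m)\<^sup>2) = ?n / m"
  proof -
    have "1 + (real_of_int k / real_of_int m)\<^sup>2 = ((real_of_int m)^2 + (real_of_int k)^2) / (real_of_int m)^2"
      using m by (simp add: field_simps)
    then show ?thesis using m by (simp add: real_sqrt_divide)
  qed
  have Arg: "Arg (Complex m k) = ?A"
  proof (rule cis_Arg_unique)
    have n: "?n > 0" using m by (simp add: add_pos_nonneg)
    show "sgn (Complex m k) = cis ?A"
      unfolding sgn_eq cis.ctr cos_arctan sin_arctan sq complex_norm using m n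
      by (auto simp: complex_eq_iff)
    show "- pi < ?A" "?A \<le> pi" using arctan_bounded[of "real_of_int k / real_of_int m"] pi_gt_zero by linarith+
  qed
  have main: "surface_tension \<beta> (real_of_int m, real_of_int k) \<le> - ln (cor ?t (gridE S) (0, 0) (m, k))"
    if pq: "0 < p" "\<bar>q\<bar> \<le> p" and th: "?A - of_int (round (?A / (pi / 2))) * (pi / 2) = arctan (q / p)"
      and nrm: "p^2 + q^2 = m^2 + k^2" and f: "\<And>u v. nn (f u) (f v) \<longleftrightarrow> nn u v" "inj f" "f (0, 0) = (0, 0)" "f (m, k) = (- q, p)"
    for p q :: int and f
  proof -
    obtain tau where l: "(\<lambda>M. - ln (RM ?t p q M) / (2 * real M + 1)) \<longlonglongrightarrow> tau" using RM_limit[OF pq t] by blast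
    let ?th = "arctan (q / p)"
    have cos: "0 < cos ?th" by (simp add: cos_arctan add_pos_nonneg)
    have "sin ?th = cos ?th * (q / p)" by (simp add: sin_arctan cos_arctan)
    from tau_base_eq[OF pq b cos this l] have tb: "tau_base \<beta> ?th = cos ?th * tau" .
    have cs: "cos ?th * ?n = p"
    proof -
      have "1 + (real_of_int q / real_of_int p)\<^sup>2 = ((real_of_int p)^2 + (real_of_int q)^2) / (real_of_int p)^2"
        using pq by (simp add: field_simps)
      also have "(real_of_int p)^2 + (real_of_int q)^2 = real_of_int (p^2 + q^2)" by simp
      also have "\<dots> = (real_of_int m)^2 + (real_of_int k)^2" unfolding nrm by simp
      finally have "sqrt (1 + (real_of_int q / real_of_int p)\<^sup>2) = ?n / p" using pq by (simp add: real_sqrt_divide)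
      moreover have "?n \<noteq> 0" using m by (simp add: sum_power2_eq_zero_iff)
      ultimately show ?thesis unfolding cos_arctan using pq by simp
    qed
    have "surface_tension \<beta> (real_of_int m, real_of_int k) = tau_base \<beta> ?th * ?n"
      unfolding surface_tension_def tau_angle_def fst_conv snd_conv Arg th by (simp add: norm_prod_def)
    also have "\<dots> = tau * p" unfolding tb using cs by (simp add: mult.commute mult.left_commute)
    also have "\<dots> \<le> - ln (cor ?t (gridE (f ` S)) (0, 0) (- q, p))"
    proof (rule RM_limit_le[OF pq t l])
      show "(0, 0) \<in> f ` S" "(- q, p) \<in> f ` S" using S(2,3) f(3,4) by force+
      show "0 < cor ?t (gridE (f ` S)) (0, 0) (- q, p)"
        using c cor_grid_image[OF f(1,2), of ?t S "(0,0)" "(m,k)"] unfolding f(3,4) by simp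
    qed (use S in simp)
    also have "cor ?t (gridE (f ` S)) (0, 0) (- q, p) = cor ?t (gridE S) (0, 0) (m, k)"
      using cor_grid_image[OF f(1,2), of ?t S "(0,0)" "(m,k)"] unfolding f(3,4) by simp
    finally show ?thesis .
  qed
  have ab: "- (pi / 2) < ?A" "?A < pi / 2" using arctan_bounded by auto
  have rnd: "round (?A / (pi / 2)) = r" if "of_int r * (pi / 2) - pi / 4 \<le> ?A" "?A < of_int r * (pi / 2) + pi / 4" for r :: int
  proof -
    have "of_int r - 1/2 \<le> ?A / (pi / 2)" "?A / (pi / 2) < of_int r + 1/2"
      using that pi_gt_zero by (simp_all add: field_simps)
    then show ?thesis unfolding round_def by linarith
  qed
  consider "- m \<le> k" "k < m" | "m \<le> k" | "k < - m" by linarith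
  then show ?thesis
  proof cases
    case 1
    have "- 1 \<le> real_of_int k / real_of_int m" "real_of_int k / real_of_int m < 1" using 1 m by (auto simp: field_simps)
    then have "arctan (- 1) \<le> ?A" "?A < arctan 1" by (simp_all only: arctan_le_iff arctan_less_iff)
    then have "- (pi / 4) \<le> ?A" "?A < pi / 4" unfolding arctan_minus arctan_one .
    then have "round (?A / (pi / 2)) = 0" by (intro rnd) simp_all
    then show ?thesis using 1 m
      by (intro main[of m k "\<lambda>(x, y). (- y, x)"]) (auto simp: nn_def inj_def)
  next
    case 2
    have "1 \<le> real_of_int k / real_of_int m" using 2 m by (auto simp: field_simps)
    then have "arctan 1 \<le> ?A" by (simp only: arctan_le_iff)
    then have "pi / 4 \<le> ?A" unfolding arctan_one .
    then have "round (?A / (pi / 2)) = 1" using pi_gt_zero ab(2) by (intro rnd; simp?; linarith?)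
    moreover have "arctan (real_of_int (- m) / real_of_int k) = ?A - pi / 2"
    proof -
      have "arctan (1 / (real_of_int k / real_of_int m)) = sgn (real_of_int k / real_of_int m) * pi / 2 - ?A"
        using 2 m by (subst Transcendental.arctan_inverse) auto
      then show ?thesis using 2 m by (simp add: arctan_minus)
    qed
    ultimately show ?thesis using 2 m
      by (intro main[of k "- m" id]) (auto simp: nn_def)
  next
    case 3
    have "real_of_int k / real_of_int m < - 1" using 3 m by (auto simp: field_simps)
    then have "?A < arctan (- 1)" by (simp only: arctan_less_iff)
    then have "?A < - (pi / 4)" unfolding arctan_minus arctan_one .
    then have "round (?A / (pi / 2)) = -1" using pi_gt_zero ab(1) by (intro rnd; simp?; linarith?)
    moreover have "arctan (real_of_int m / real_of_int (- k)) = ?A + pi / 2"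
    proof -
      have "arctan (1 / (real_of_int k / real_of_int m)) = sgn (real_of_int k / real_of_int m) * pi / 2 - ?A"
        using 3 m by (subst Transcendental.arctan_inverse) auto
      moreover have "sgn (real_of_int k / real_of_int m) = -1" using 3 m by (simp add: sgn_divide)
      ultimately show ?thesis using 3 m by (simp add: arctan_minus)
    qed
    ultimately show ?thesis using 3 m
      by (intro main[of "- k" m "\<lambda>(x, y). (- x, - y)"]) (auto simp: nn_def inj_def)
  qed
qed

section \<open>Reflection in a horizontal line\<close>

definition refl :: "int \<Rightarrow> site \<Rightarrow> site" where
  "refl h v = (fst v, 2 * h - snd v)"

lemma refl_refl [simp]: "refl h (refl h v) = v"
  unfolding refl_def by simp

lemma refl_fix: "refl h v = v \<longleftrightarrow> snd v = h"
  unfolding refl_def by (cases v) auto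

lemma nn_refl: "nn (refl h u) (refl h v) \<longleftrightarrow> nn u v"
  unfolding nn_def refl_def by (simp add: abs_minus_commute)

lemma inj_refl: "inj (refl h)"
  by (metis injI refl_refl)

text \<open>A one-sided symmetry: the images of edges below level \<open>h\<close> must be present,
  while the part above may be larger.\<close>

locale reflected_graph =
  fixes t :: real and E :: "site set set" and h :: int
  assumes t: "0 \<le> t" "t \<le> 1" and g: "graph E"
    and up: "\<And>e. e \<in> E \<Longrightarrow> (\<And>v. v \<in> e \<Longrightarrow> snd v \<le> h) \<Longrightarrow> refl h ` e \<in> E"
begin

text \<open>Edges inside the mirror line are excluded, as they coincide with their own
  images.\<close>

definition "low = {e \<in> E. (\<forall>v\<in>e. snd v \<le> h) \<and> (\<exists>v\<in>e. snd v < h)}"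
definition "rest = E - low - (`) (refl h) ` low"
definition "vert W = (\<Union>E \<union> W) \<union> refl h ` (\<Union>E \<union> W)"

lemma mirror: "finite W \<Longrightarrow> mirror t low rest (vert W) {v \<in> vert W. snd v \<le> h} (refl h)"
proof unfold_locales
  assume W: "finite W"
  show "0 \<le> t" "t \<le> 1" by (rule t)+
  show "finite low" "finite rest" using g unfolding graph_def low_def rest_def by auto
  show "finite (vert W)" unfolding vert_def using graph_vertices[OF g] W by simp
  show "card e = 2" if "e \<in> low \<union> rest" for e using that g unfolding graph_def low_def rest_def by blast
  show "e \<subseteq> {v \<in> vert W. snd v \<le> h}" if "e \<in> low" for e using that unfolding low_def vert_def by blast
  show "e \<subseteq> vert W" if "e \<in> rest" for e using that unfolding rest_def vert_def by blast
  show "{v \<in> vert W. snd v \<le> h} \<subseteq> vert W" by blast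
  show "refl h (refl h v) = v" for v by simp
  show "refl h ` vert W \<subseteq> vert W" unfolding vert_def by (auto simp: image_Un image_image)
  have "e \<notin> low" if el: "e \<in> (`) (refl h) ` low" for e
  proof -
    obtain f v where f: "e = refl h ` f" "v \<in> f" "snd v < h" using el unfolding low_def by blast
    then have "refl h v \<in> e" "h < snd (refl h v)" unfolding refl_def by auto
    then show ?thesis unfolding low_def by (auto simp: not_le intro!: bexI[of _ "refl h v"])
  qed
  then show "low \<inter> (`) (refl h) ` low = {}" by blast
  show "low \<inter> rest = {}" "(`) (refl h) ` low \<inter> rest = {}" unfolding rest_def by auto
qed

lemma Etot: "low \<union> ((`) (refl h) ` low \<union> rest) = E"
proof -
  have "(`) (refl h) ` low \<subseteq> E" using up unfolding low_def by blast
  then show ?thesis unfolding rest_def low_def by blast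
qed

lemma touch_bound:
  "(\<Sum>F\<in>{F\<in>Pow E. (\<exists>p. snd p = h \<and> conn (F \<inter> low) b p) \<and> bd F = pr a b}. t ^ card F) \<le> Hsum t E (pr a (refl h b))"
proof -
  interpret m: mirror t low rest "vert {a, b}" "{v \<in> vert {a, b}. snd v \<le> h}" "refl h" by (rule mirror) simp
  have e: "m.Etot = E" unfolding m.Etot_def by (rule Etot)
  have "(\<Sum>F\<in>{F\<in>Pow m.Etot. (\<exists>p. snd p = h \<and> conn (F \<inter> low) b p) \<and> bd F = pr a b}. t ^ card F) \<le> Hsum t m.Etot (pr a (refl h b))"
  proof (rule m.reflection_principle)
    show "a \<in> vert {a, b}" "b \<in> vert {a, b}" unfolding vert_def by auto
    show "\<exists>p. snd p = h \<and> conn Q b p" if FQ: "\<exists>p. snd p = h \<and> conn F b p" "F \<subseteq> Q" for F Q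
    proof -
      obtain p where "snd p = h" "conn F b p" using FQ(1) by blast
      then show ?thesis using conn_mono[OF _ FQ(2)] by blast
    qed
    show "\<exists>p. refl h p = p \<and> conn Q b p" if "\<exists>p. snd p = h \<and> conn Q b p" for Q
      using that by (simp add: refl_fix)
  qed
  then show ?thesis unfolding e .
qed

lemma decreasing:
  assumes "snd a \<le> h" "snd b \<le> h" "\<And>e. e \<in> E \<Longrightarrow> refl h ` e \<in> E"
    "\<And>e. e \<in> E \<Longrightarrow> (\<forall>v\<in>e. snd v \<le> h) \<or> (\<forall>v\<in>e. h \<le> snd v)"
  shows "cor t E a (refl h b) \<le> cor t E a b"
proof -
  interpret m: mirror t low rest "vert {a, b}" "{v \<in> vert {a, b}. snd v \<le> h}" "refl h" by (rule mirror) simp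
  have e: "m.Etot = E" unfolding m.Etot_def by (rule Etot)
  have "Hsum t m.Etot (pr a (refl h b)) \<le> Hsum t m.Etot (pr a b)"
  proof (rule m.messager_miracle)
    show "a \<in> {v \<in> vert {a, b}. snd v \<le> h}" "b \<in> {v \<in> vert {a, b}. snd v \<le> h}" using assms(1,2) unfolding vert_def by auto
    show "refl h v = v" if "v \<in> {v \<in> vert {a, b}. snd v \<le> h}" "refl h v \<in> {v \<in> vert {a, b}. snd v \<le> h}" for v
      using that unfolding refl_fix by (auto simp: refl_def)
    show "refl h v = v" if ev: "e \<in> rest" "v \<in> e" for e v
    proof (rule ccontr)
      assume "refl h v \<noteq> v"
      then have nv: "snd v \<noteq> h" by (simp add: refl_fix)
      have eE: "e \<in> E" "e \<notin> low" "e \<notin> (`) (refl h) ` low" using ev(1) unfolding rest_def by auto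
      have "\<not> (\<forall>v\<in>e. snd v \<le> h)" using eE(1,2) nv ev(2) unfolding low_def by force
      then have ge: "\<forall>v\<in>e. h \<le> snd v" using assms(4)[OF eE(1)] by blast
      have "refl h ` e \<in> low" unfolding low_def
        using assms(3)[OF eE(1)] ge nv ev(2) by (force simp: refl_def)
      then have "refl h ` (refl h ` e) \<in> (`) (refl h) ` low" by (rule imageI)
      then show False using eE(3) by (simp add: image_image)
    qed
  qed
  then show ?thesis unfolding e cor_def using Hsum_empty_ge[OF g t(1)] by (intro divide_right_mono) auto
qed

end

lemma gridE_level: "e \<in> gridE S \<Longrightarrow> (\<forall>v\<in>e. snd v \<le> h) \<or> (\<forall>v\<in>e. h \<le> snd v)"
proof -
  assume "e \<in> gridE S"
  then obtain x y where "e = {(x, y), (x + 1, y)} \<or> e = {(x, y), (x, y + 1)}" unfolding gridE_iff by blast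
  then show ?thesis by (cases "y < h") auto
qed

section \<open>Correlations in infinite strips\<close>

text \<open>Correlations grow with the height of the strip, so the supremum is also the limit
  (\<open>cX_lim\<close>).\<close>

definition Xs :: "real \<Rightarrow> nat \<Rightarrow> int \<Rightarrow> real" where
  "Xs t l j = (SUP N. cX t l N j)"

definition Ys :: "real \<Rightarrow> nat \<Rightarrow> int \<Rightarrow> real" where
  "Ys t l j = (SUP N. cY t l N j)"

lemma strip_mono: "N \<le> M \<Longrightarrow> gridE (strip l N) \<subseteq> gridE (strip l M)"
  by (rule gridE_mono) (auto simp: strip_def)

lemma cX_mono:
  assumes "0 \<le> t" "t \<le> 1"
  shows "incseq (\<lambda>N. cX t l N j)" "incseq (\<lambda>N. cY t l N j)"
proof -
  have "cor t (gridE (strip l N)) u v \<le> cor t (gridE (strip l M)) u v" if "N \<le> M" for N M u v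
    by (rule cor_mono[OF gridE_graph[OF finite_strip] strip_mono[OF that] assms])
  then show "incseq (\<lambda>N. cX t l N j)" "incseq (\<lambda>N. cY t l N j)"
    unfolding cX_def cY_def incseq_def by simp_all
qed

lemma cX_lim: "0 \<le> t \<Longrightarrow> t \<le> 1 \<Longrightarrow> (\<lambda>N. cX t l N j) \<longlonglongrightarrow> Xs t l j"
  and cY_lim: "0 \<le> t \<Longrightarrow> t \<le> 1 \<Longrightarrow> (\<lambda>N. cY t l N j) \<longlonglongrightarrow> Ys t l j"
proof -
  assume t: "0 \<le> t" "t \<le> 1"
  have "bdd_above (range (\<lambda>N. cX t l N j))" "bdd_above (range (\<lambda>N. cY t l N j))"
    unfolding cX_def cY_def using t by (auto intro!: bdd_aboveI[of _ 1] cor_le_one gridE_graph)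
  then show "(\<lambda>N. cX t l N j) \<longlonglongrightarrow> Xs t l j" "(\<lambda>N. cY t l N j) \<longlonglongrightarrow> Ys t l j"
    unfolding Xs_def Ys_def by (auto intro!: LIMSEQ_incseq_SUP cX_mono t)
qed

lemma cX_le: "0 \<le> t \<Longrightarrow> t \<le> 1 \<Longrightarrow> cX t l N j \<le> Xs t l j"
  by (rule incseq_le[OF cX_mono(1) cX_lim])

lemma Xs_nonneg: "0 \<le> t \<Longrightarrow> t \<le> 1 \<Longrightarrow> 0 \<le> Xs t l j"
  by (rule order_trans[OF _ cX_le[of t l 0 j]]) (auto simp: cX_def cor_nonneg)

lemma cor_le_Xs:
  assumes t: "0 \<le> t" "t \<le> 1" and S: "finite S" "\<And>v. v \<in> S \<Longrightarrow> 0 \<le> fst v \<and> fst v \<le> int l"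
  shows "cor t (gridE S) (0, k1) (int l, k2) \<le> Xs t l (k2 - k1)"
proof -
  let ?f = "shift (0, - k1)"
  obtain N where N: "?f ` S \<subseteq> strip l N"
  proof -
    define b where "b = Max ((\<lambda>v. \<bar>snd (?f v)\<bar>) ` S)"
    have b: "\<bar>snd (?f v)\<bar> \<le> b" if "v \<in> S" for v unfolding b_def using S(1) that by (intro Max_ge) auto
    have "?f v \<in> strip l (nat b)" if "v \<in> S" for v
      using b[OF that] S(2)[OF that] unfolding strip_def shift_def by (cases v) auto
    then show ?thesis by (intro that[of "nat b"]) blast
  qed
  have "cor t (gridE S) (0, k1) (int l, k2) = cor t (gridE (?f ` S)) (?f (0, k1)) (?f (int l, k2))"
    by (rule cor_grid_image[OF nn_shift inj_shift, symmetric])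
  also have "\<dots> = cor t (gridE (?f ` S)) (0, 0) (int l, k2 - k1)" unfolding shift_def by simp
  also have "\<dots> \<le> cX t l N (k2 - k1)" unfolding cX_def using N t
    by (intro cor_mono gridE_mono gridE_graph) auto
  also have "\<dots> \<le> Xs t l (k2 - k1)" by (rule cX_le[OF t])
  finally show ?thesis .
qed

lemma Xs_sym: "0 \<le> t \<Longrightarrow> t \<le> 1 \<Longrightarrow> Xs t l (- j) = Xs t l j"
proof -
  have "cX t l N (- j) = cX t l N j" for N j
  proof -
    have "refl 0 ` strip l N = strip l N"
      unfolding strip_def refl_def by (auto simp: image_iff) (metis minus_le_iff neg_le_iff_le minus_minus atLeastAtMost_iff)+
    then show ?thesis
      using cor_grid_image[OF nn_refl inj_refl, of t 0 "strip l N" "(0,0)" "(int l, j)"] unfolding cX_def refl_def by simp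
  qed
  then show ?thesis unfolding Xs_def by simp
qed

text \<open>Reflection in row \<open>j + 1\<close> exchanges the heights \<open>j\<close> and
  \<open>j + 2\<close>. The truncated strip is first enlarged to a box symmetric about that row, so
  that the Messager-Miracle-Sole inequality applies. Reflections in rows relate only heights of
  equal parity.\<close>

lemma Xs_step2:
  assumes t: "0 \<le> t" "t \<le> 1" and j: "0 \<le> j"
  shows "Xs t l (j + 2) \<le> Xs t l j"
proof (rule LIMSEQ_le_const2[OF cX_lim[OF t]])
  let ?h = "j + 1"
  show "\<exists>N0. \<forall>N\<ge>N0. cX t l N (j + 2) \<le> Xs t l j"
  proof (intro exI allI impI)
    fix N :: nat assume N: "0 \<le> N"
    let ?S = "{0..int l} \<times> {- int N..2 * ?h + int N}"
    have rS: "refl ?h ` ?S = ?S"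
    proof -
      have "refl ?h v \<in> ?S" if "v \<in> ?S" for v using that unfolding refl_def by auto
      then have "refl ?h ` ?S \<subseteq> ?S" by blast
      moreover from this have "refl ?h ` (refl ?h ` ?S) \<subseteq> refl ?h ` ?S" by (rule image_mono)
      ultimately show ?thesis by (simp add: image_image)
    qed
    have refl_e: "refl ?h ` e \<in> gridE ?S" if "e \<in> gridE ?S" for e
      using gridE_image[OF nn_refl, of ?h ?S] that unfolding rS by blast
    interpret r: reflected_graph t "gridE ?S" ?h
      using t refl_e by unfold_locales (auto intro: gridE_graph)
    have "cX t l N (j + 2) \<le> cor t (gridE ?S) (0, 0) (int l, j + 2)"
      unfolding cX_def using t j by (intro cor_mono gridE_graph gridE_mono) (auto simp: strip_def)
    also have "(int l, j + 2) = refl ?h (int l, j)" unfolding refl_def by simp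
    also have "cor t (gridE ?S) (0, 0) (refl ?h (int l, j)) \<le> cor t (gridE ?S) (0, 0) (int l, j)"
      using j refl_e gridE_level by (intro r.decreasing) auto
    also have "\<dots> \<le> Xs t l (j - 0)" by (rule cor_le_Xs[OF t]) auto
    finally show "cX t l N (j + 2) \<le> Xs t l j" by simp
  qed
qed

lemma Xs_mono_even:
  assumes t: "0 \<le> t" "t \<le> 1" and j: "0 \<le> j"
  shows "Xs t l (j + 2 * int n) \<le> Xs t l j"
proof (induction n)
  case (Suc n)
  have "Xs t l (j + 2 * int n + 2) \<le> Xs t l (j + 2 * int n)" using j by (intro Xs_step2 t) auto
  then show ?case using Suc by (simp add: algebra_simps)
qed simp

text \<open>Odd heights are reduced to height 1, and one vertical edge, at the cost of a factor
  \<open>t\<close>, leads from there to height 0.\<close>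

lemma Xs_max:
  assumes t: "0 < t" "t < 1"
  shows "Xs t l j \<le> Xs t l 0 / t"
proof -
  have t': "0 \<le> t" "t \<le> 1" using t by auto
  have 1: "t * Xs t l 1 \<le> Xs t l 0"
  proof (rule LIMSEQ_le_const2[OF tendsto_mult_left[OF cX_lim[OF t']]])
    show "\<exists>N0. \<forall>N\<ge>N0. t * cX t l N 1 \<le> Xs t l 0"
    proof (intro exI[of _ 1] allI impI)
      fix N :: nat assume N: "1 \<le> N"
      have g: "graph (gridE (strip l N))" by (rule gridE_graph) simp
      have e: "{(int l, 1), (int l, 0)} \<in> gridE (strip l N)"
        using gridE_v[of "int l" 0 "strip l N"] N unfolding strip_def by (auto simp: insert_commute)
      have "cX t l N 1 * t \<le> cX t l N 1 * cor t (gridE (strip l N)) (int l, 1) (int l, 0)"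
        using t' e unfolding cX_def by (intro mult_left_mono cor_edge g cor_nonneg) auto
      also have "\<dots> \<le> cX t l N 0" unfolding cX_def by (rule cor_triangle[OF g t'])
      also have "\<dots> \<le> Xs t l 0" by (rule cX_le[OF t'])
      finally show "t * cX t l N 1 \<le> Xs t l 0" by (simp add: mult.commute)
    qed
  qed
  have 2: "Xs t l j \<le> Xs t l 0 / t" if "0 \<le> j" for j
  proof (cases "even j")
    case True
    then obtain n where n: "j = 2 * n" by blast
    have "Xs t l j \<le> Xs t l 0" using Xs_mono_even[OF t', of 0 l "nat n"] n that by simp
    also have "\<dots> \<le> Xs t l 0 / t"
      using t mult_left_le_one_le[OF Xs_nonneg[OF t', of l 0], of t] by (simp add: field_simps)
    finally show ?thesis .
  next
    case False
    then obtain n where n: "j = 2 * n + 1" by (blast elim: oddE)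
    have "Xs t l j \<le> Xs t l 1" using Xs_mono_even[OF t', of 1 l "nat n"] n that by (simp add: add.commute)
    also have "\<dots> \<le> Xs t l 0 / t" using 1 t by (simp add: field_simps)
    finally show ?thesis .
  qed
  show ?thesis using 2[of j] 2[of "- j"] Xs_sym[OF t', of l j] by (cases "0 \<le> j") auto
qed

section \<open>Exponential decay from the sharp triangle inequality\<close>

locale low_temp =
  fixes \<beta> \<kappa> :: real
  assumes bc: "\<beta> > beta_c" and H: "sharp_triangle_constant \<beta> \<kappa>"
begin

definition "t = exp (- 2 * \<beta>)"
definition "tau0 = tau_base \<beta> 0"

lemma kap: "0 < \<kappa>" using H unfolding sharp_triangle_constant_def by blast

lemma tri: "surface_tension \<beta> x + surface_tension \<beta> y - surface_tension \<beta> (x + y) \<ge> \<kappa> * (norm x + norm y - norm (x + y))"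
  using H unfolding sharp_triangle_constant_def by blast

lemma beta_pos: "0 < \<beta>"
proof -
  have "0 < ln (1 + sqrt 2)" by (intro ln_gt_zero) auto
  then show ?thesis using bc unfolding beta_c_def by simp
qed

lemma t: "0 < t" "t < 1" "0 \<le> t" "t \<le> 1" using beta_pos unfolding t_def by auto

text \<open>This is \<open>t < sqrt 2 - 1\<close>, the condition \<open>\<beta> > beta_c\<close> for
  the dual weight; it yields \<open>lam0 > 1\<close>, hence a positive decay rate.\<close>

lemma t_sqrt: "t * (1 + t) < 1 - t"
proof -
  have "ln (1 + sqrt 2) < 2 * \<beta>" using bc unfolding beta_c_def by simp
  then have "exp (ln (1 + sqrt 2)) < exp (2 * \<beta>)" by (simp only: exp_less_cancel_iff)
  moreover have "0 < 1 + sqrt 2" by (simp add: add_pos_pos)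
  ultimately have "1 + sqrt 2 < exp (2 * \<beta>)" by simp
  moreover have "exp (2 * \<beta>) * t = 1" unfolding t_def by (simp add: exp_add[symmetric])
  ultimately have "(1 + sqrt 2) * t < 1" using t(1) by (metis mult_strict_right_mono)
  then have "((1 + sqrt 2) * t) * (sqrt 2 - 1) < 1 * (sqrt 2 - 1)" by (intro mult_strict_right_mono) auto
  moreover have "((1 + sqrt 2) * t) * (sqrt 2 - 1) = (sqrt 2 * sqrt 2 - 1) * t" by (simp only: algebra_simps)
  ultimately have "t + 1 < sqrt 2" by simp
  then have "(t + 1)^2 < (sqrt 2)^2" using t(1) by (intro power_strict_mono) auto
  then show ?thesis by (simp add: power2_eq_square algebra_simps)
qed

lemma surf_axis: "0 < m \<Longrightarrow> surface_tension \<beta> (m, 0) = m * tau0" "0 < m \<Longrightarrow> surface_tension \<beta> (- m, 0) = m * tau0"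
proof -
  assume m: "0 < m"
  have c: "Complex m 0 = of_real m" "Complex (- m) 0 = - of_real m" by (simp_all add: complex_eq_iff)
  have "Arg (Complex m 0) = 0" unfolding c using m by (simp add: Arg_of_real)
  then show "surface_tension \<beta> (m, 0) = m * tau0" using m unfolding surface_tension_def tau_angle_def tau0_def by (simp add: norm_prod_def)
  have "Arg (Complex (- m) 0) = pi" using Arg_of_real[of "- m"] m by (simp add: c)
  moreover have "round (pi / (pi / 2)) = 2" using pi_gt_zero by (simp add: field_simps round_def)
  ultimately show "surface_tension \<beta> (- m, 0) = m * tau0" using m unfolding surface_tension_def tau_angle_def tau0_def by (simp add: norm_prod_def)
qed

text \<open>The sharp triangle inequality for \<open>(1, 0)\<close> and \<open>(- 1, 0)\<close>,
  whose sum is the zero vector.\<close>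

lemma kap_tau0: "\<kappa> \<le> tau0"
proof -
  have "surface_tension \<beta> (1, 0) + surface_tension \<beta> (- 1, 0) - surface_tension \<beta> ((1, 0) + (- 1, 0)) \<ge>
     \<kappa> * (norm (1::real, 0::real) + norm (- 1::real, 0::real) - norm ((1::real, 0::real) + (- 1, 0)))" by (rule tri)
  moreover have "surface_tension \<beta> (0, 0) = 0" unfolding surface_tension_def by (simp add: norm_prod_def)
  ultimately show ?thesis using surf_axis[of 1] by (simp add: norm_prod_def)
qed

text \<open>Reflecting \<open>S\<close> in row 0 bounds the surface tension of
  \<open>(m, - k)\<close> by the same correlation, so both summands of the triangle inequality are
  controlled by one quantity and the sum \<open>(2 * m, 0)\<close> lies on the axis.\<close>

lemma cor_decay:
  assumes m: "0 < m" and S: "finite S" "(0, 0) \<in> S" "(m, k) \<in> S"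
  shows "cor t (gridE S) (0, 0) (m, k) \<le> exp (- m * tau0 - \<kappa> * (sqrt ((real_of_int m)^2 + (real_of_int k)^2) - m))"
proof (cases "cor t (gridE S) (0, 0) (m, k) = 0")
  case False
  let ?c = "cor t (gridE S) (0, 0) (m, k)"
  have c: "0 < ?c" using False cor_nonneg[OF t(3)] by (simp add: less_le)
  have 1: "surface_tension \<beta> (real_of_int m, real_of_int k) \<le> - ln ?c"
    using surface_le[OF m beta_pos S] c unfolding t_def by blast
  have r: "cor t (gridE (refl 0 ` S)) (0, 0) (m, - k) = ?c"
    using cor_grid_image[OF nn_refl inj_refl, of t 0 S "(0,0)" "(m,k)"] unfolding refl_def by simp
  have "(0, 0) \<in> refl 0 ` S" "(m, - k) \<in> refl 0 ` S"
    using S(2,3) by (force simp: refl_def)+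
  then have 2: "surface_tension \<beta> (real_of_int m, real_of_int (- k)) \<le> - ln ?c"
    using surface_le[OF m beta_pos, of "refl 0 ` S" "- k"] S(1) c r unfolding t_def by simp
  have "surface_tension \<beta> (m, k) + surface_tension \<beta> (m, - k) - surface_tension \<beta> ((m, k) + (m, - k)) \<ge>
     \<kappa> * (norm (real_of_int m, real_of_int k) + norm (real_of_int m, - real_of_int k) - norm ((real_of_int m, real_of_int k) + (real_of_int m, - real_of_int k)))"
    using tri[of "(real_of_int m, real_of_int k)" "(real_of_int m, - real_of_int k)"] by simp
  moreover have "surface_tension \<beta> ((real_of_int m, real_of_int k) + (real_of_int m, - real_of_int k)) = 2 * m * tau0"
    using surf_axis(1)[of "2 * real_of_int m"] m by simp
  moreover have "norm ((real_of_int m, real_of_int k) + (real_of_int m, - real_of_int k)) = 2 * m"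
    using m by (simp add: norm_prod_def real_sqrt_mult)
  ultimately have "2 * (- ln ?c) \<ge> 2 * m * tau0 + \<kappa> * (2 * sqrt ((real_of_int m)^2 + (real_of_int k)^2) - 2 * m)"
    using 1 2 by (simp add: norm_prod_def)
  then have "ln ?c \<le> - m * tau0 - \<kappa> * (sqrt ((real_of_int m)^2 + (real_of_int k)^2) - m)" by (simp add: algebra_simps)
  then have "exp (ln ?c) \<le> exp (- m * tau0 - \<kappa> * (sqrt ((real_of_int m)^2 + (real_of_int k)^2) - m))" by simp
  then show ?thesis using c by simp
qed simp

text \<open>A quarter turn makes the column an axis direction; the rate \<open>tau0\<close> is then
  weakened to \<open>\<kappa>\<close>.\<close>

lemma cor_decay_column:
  assumes "finite S" "(0, 0) \<in> S" "(0, j) \<in> S"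
  shows "cor t (gridE S) (0, 0) (0, j) \<le> exp (- \<kappa> * \<bar>real_of_int j\<bar>)"
proof (cases "j = 0")
  case True
  then show ?thesis using cor_self[OF gridE_graph[OF assms(1)] t(3)] by simp
next
  case False
  define f where "f v = (if 0 < j then (snd v, fst v) else (- snd v, fst v))" for v :: site
  have f: "nn (f u) (f v) \<longleftrightarrow> nn u v" for u v unfolding f_def nn_def by auto
  have i: "inj f" unfolding f_def by (rule injI) (auto simp: prod_eq_iff split: if_splits)
  have e: "f (0, 0) = (0, 0)" "f (0, j) = (\<bar>j\<bar>, 0)" unfolding f_def by auto
  have "cor t (gridE S) (0, 0) (0, j) = cor t (gridE (f ` S)) (0, 0) (\<bar>j\<bar>, 0)"
    using cor_grid_image[OF f i, of t S "(0,0)" "(0,j)"] unfolding e by simp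
  also have "\<dots> \<le> exp (- real_of_int \<bar>j\<bar> * tau0 - \<kappa> * (sqrt ((real_of_int \<bar>j\<bar>)^2 + (real_of_int 0)^2) - real_of_int \<bar>j\<bar>))"
  proof (rule cor_decay)
    show "(0, 0) \<in> f ` S" "(\<bar>j\<bar>, 0) \<in> f ` S" using assms(2,3) e by (metis image_eqI)+
  qed (use False assms in auto)
  also have "\<dots> = exp (- \<bar>real_of_int j\<bar> * tau0)" by simp
  also have "\<dots> \<le> exp (- \<kappa> * \<bar>real_of_int j\<bar>)" using kap_tau0 by (simp add: mult.commute mult_right_mono)
  finally show ?thesis .
qed

lemma Ys_decay: "\<bar>Ys t l j\<bar> \<le> 1 * exp (- \<kappa> * \<bar>real_of_int j\<bar>)"
proof -
  have "cY t l N j \<le> exp (- \<kappa> * \<bar>real_of_int j\<bar>)" if "nat \<bar>j\<bar> \<le> N" for N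
    unfolding cY_def using that by (intro cor_decay_column) (auto simp: strip_def)
  then have "Ys t l j \<le> exp (- \<kappa> * \<bar>real_of_int j\<bar>)"
    by (intro LIMSEQ_le_const2[OF cY_lim[OF t(3,4)]]) blast
  moreover have "0 \<le> Ys t l j"
    by (rule LIMSEQ_le_const[OF cY_lim[OF t(3,4)]]) (auto simp: cY_def intro: cor_nonneg t)
  ultimately show ?thesis by simp
qed

lemma Xs_decay:
  assumes "0 < l"
  shows "Xs t l j \<le> exp (- real l * tau0 - \<kappa> * (sqrt ((real l)^2 + (real_of_int j)^2) - l))"
proof (rule LIMSEQ_le_const2[OF cX_lim[OF t(3,4)]], intro exI allI impI)
  fix N assume "nat \<bar>j\<bar> \<le> N"
  then have "(0, 0) \<in> strip l N" "(int l, j) \<in> strip l N" unfolding strip_def by auto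
  from cor_decay[OF _ finite_strip this] assms
  show "cX t l N j \<le> exp (- real l * tau0 - \<kappa> * (sqrt ((real l)^2 + (real_of_int j)^2) - l))"
    unfolding cX_def by simp
qed

section \<open>The generating function of the strip correlations and its growth rate\<close>

definition "Ph l s = 2 / (fst (ep t s l) + snd (ep t s l))"

lemma generating:
  assumes "\<bar>s\<bar> < \<kappa>"
  shows "((\<lambda>j. exp (s * real_of_int j) * Xs t l j) has_sum Ph l s) UNIV"
proof -
  obtain F where F: "((\<lambda>j. exp (s * real_of_int j) * Xs t l j) has_sum F) UNIV"
    "F * (fst (ep t s l) + snd (ep t s l)) = 2"
    using strip_generating[OF t(1,2) kap assms cX_lim[OF t(3,4)] cY_lim[OF t(3,4)] Ys_decay, of l] by blast
  then have "fst (ep t s l) + snd (ep t s l) \<noteq> 0" by auto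
  with F(2) have "F = Ph l s" unfolding Ph_def by (metis nonzero_eq_divide_eq)
  then show ?thesis using F(1) by simp
qed

lemma Ph_ge_sum:
  assumes "\<bar>s\<bar> < \<kappa>" "finite A"
  shows "(\<Sum>j\<in>A. exp (s * real_of_int j) * Xs t l j) \<le> Ph l s"
  using has_sum_finite[OF assms(2)] generating[OF assms(1)]
  by (rule has_sum_mono2) (auto intro!: mult_nonneg_nonneg Xs_nonneg t(3,4))

end

context low_temp
begin

text \<open>\<open>av l s\<close> is the denominator of the generating function; \<open>lam s\<close> and \<open>mu s\<close> are the eigenvalues of
  the transfer matrix, which has trace \<open>tr s\<close> and determinant \<open>1\<close>.\<close>

definition "av l s = fst (ep t s l) + snd (ep t s l)"
definition "tr s = 2 * (cC t * cc t) - cS t * cd t * (exp s + exp (- s))"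
definition "lam s = (tr s + sqrt ((tr s)^2 - 4)) / 2"
definition "mu s = (tr s - sqrt ((tr s)^2 - 4)) / 2"
text \<open>The coefficients of \<open>lam s ^ l\<close> and \<open>mu s ^ l\<close> in
  \<open>av l s\<close>, fixed by the values at \<open>l = 0\<close> and
  \<open>l = 1\<close>.\<close>

definition "al s = (av 1 s - av 0 s * mu s) / (lam s - mu s)"
definition "al' s = av 0 s - al s"
text \<open>Equal to \<open>exp (2 * \<beta>) * tanh \<beta>\<close>, so \<open>ln lam0\<close> is
  Onsager's value for the surface tension along an axis.\<close>

definition "lam0 = (1 - t) / (t * (1 + t))"

lemma lam0: "1 < lam0"
  using t_sqrt t unfolding lam0_def by (simp add: less_divide_eq_1_pos)

text \<open>Cayley-Hamilton for a transfer matrix of determinant 1.\<close>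

lemma av_rec: "av (Suc (Suc l)) s = tr s * av (Suc l) s - av l s"
proof -
  let ?e = "exp s" and ?f = "exp (- s)"
  have ef: "?e * ?f = 1" by (simp add: exp_add[symmetric])
  define m11 m12 m21 m22 where "m11 = cC t * cc t - cS t * ?e * cd t" and "m12 = cC t * cd t - cS t * ?e * cc t"
    and "m21 = cC t * cd t - cS t * ?f * cc t" and "m22 = cC t * cc t - cS t * ?f * cd t"
  obtain p q where pq: "ep t s l = (p, q)" by force
  have e1: "ep t s (Suc l) = (m11 * p + m12 * q, m21 * p + m22 * q)"
    unfolding m11_def m12_def m21_def m22_def by (simp add: pq algebra_simps)
  have e2: "ep t s (Suc (Suc l)) = (m11 * (m11 * p + m12 * q) + m12 * (m21 * p + m22 * q),
     m21 * (m11 * p + m12 * q) + m22 * (m21 * p + m22 * q))"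
    unfolding ep.simps(2)[of t s "Suc l"] e1 m11_def m12_def m21_def m22_def by (simp add: algebra_simps)
  have "m11 * m22 - m12 * m21 = ((cC t)^2 - (cS t)^2 * (?e * ?f)) * ((cc t)^2 - (cd t)^2)"
    unfolding m11_def m12_def m21_def m22_def by (simp add: power2_eq_square algebra_simps)
  then have det: "m11 * m22 - m12 * m21 = 1" unfolding ef CS_det(2)[OF t(1,2)] using CS_det(1)[OF t(1,2)] by simp
  have tr: "tr s = m11 + m22" unfolding tr_def m11_def m22_def by (simp add: algebra_simps)
  have gen: "m11 * (m11 * p + m12 * q) + m12 * (m21 * p + m22 * q) = (m11 + m22) * (m11 * p + m12 * q) - (m11 * m22 - m12 * m21) * p"
    "m21 * (m11 * p + m12 * q) + m22 * (m21 * p + m22 * q) = (m11 + m22) * (m21 * p + m22 * q) - (m11 * m22 - m12 * m21) * q"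
    by (simp_all add: algebra_simps)
  show ?thesis unfolding av_def e1 e2 pq fst_conv snd_conv gen det tr by (simp add: algebra_simps)
qed

lemma lam_mu: "2 < tr s \<Longrightarrow> lam s + mu s = tr s" "2 < tr s \<Longrightarrow> lam s * mu s = 1"
  "2 < tr s \<Longrightarrow> 1 < lam s" "2 < tr s \<Longrightarrow> 0 < mu s" "2 < tr s \<Longrightarrow> mu s < 1"
proof -
  show "lam s + mu s = tr s" unfolding lam_def mu_def by (simp add: add_divide_distrib[symmetric])
  assume tr: "2 < tr s"
  then have sq: "0 < (tr s)^2 - 4" using power_strict_mono[OF tr, of 2] by simp
  then have ss: "sqrt ((tr s)^2 - 4) * sqrt ((tr s)^2 - 4) = (tr s)^2 - 4" by simp
  show 1: "lam s * mu s = 1" unfolding lam_def mu_def using ss by (simp add: power2_eq_square algebra_simps)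
  have "0 < sqrt ((tr s)^2 - 4)" using sq by (rule real_sqrt_gt_zero)
  moreover have "1 < (x + w) / 2" if "2 < x" "0 < w" for x w :: real using that by simp
  ultimately show 2: "1 < lam s" unfolding lam_def using tr by blast
  show 3: "0 < mu s" using 1 2 by (metis less_trans zero_less_mult_pos zero_less_one)
  show "mu s < 1"
  proof (rule ccontr)
    assume "\<not> mu s < 1"
    then have "lam s * 1 \<le> lam s * mu s" using 2 by (intro mult_left_mono) auto
    then show False using 1 2 by simp
  qed
qed

lemma av_closed:
  assumes "2 < tr s"
  shows "av l s = al s * lam s ^ l + al' s * mu s ^ l"
proof -
  note lm = lam_mu[OF assms]
  have d: "lam s - mu s \<noteq> 0" using lm by simp
  have 0: "av 0 s = al s + al' s" unfolding al'_def by simp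
  have "al s * (lam s - mu s) = av 1 s - av 0 s * mu s" unfolding al_def using d by simp
  then have 1: "av 1 s = al s * lam s + al' s * mu s" unfolding al'_def by (simp add: algebra_simps)
  have l2: "lam s * lam s = tr s * lam s - 1" "mu s * mu s = tr s * mu s - 1"
    unfolding lm(1)[symmetric] using lm(2) by (simp_all add: algebra_simps)
  have "av l s = al s * lam s ^ l + al' s * mu s ^ l \<and> av (Suc l) s = al s * lam s ^ Suc l + al' s * mu s ^ Suc l"
  proof (induction l)
    case (Suc l)
    have "av (Suc (Suc l)) s = al s * lam s ^ l * (tr s * lam s - 1) + al' s * mu s ^ l * (tr s * mu s - 1)"
      unfolding av_rec using Suc by (simp add: algebra_simps)
    then show ?case using Suc unfolding l2[symmetric] by (simp add: mult_ac)
  qed (use 0 1 in simp)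
  then show ?thesis by blast
qed

definition "A0 = 2 * ((1 - t) / (1 + t))"

lemma A0: "0 < A0" unfolding A0_def using t by simp

text \<open>Without tilt, \<open>(1, 1)\<close> is an eigenvector of the transfer matrix with
  eigenvalue \<open>lam0\<close>, so the second coefficient vanishes.\<close>

lemma at_zero: "tr 0 = lam0 + 1 / lam0" "2 < tr 0" "lam 0 = lam0" "al 0 = A0" "al' 0 = 0"
proof -
  have C: "cC t - cS t = (1 - t) / (1 + t)" "cC t + cS t = (1 + t) / (1 - t)" by (rule CS[OF t(1,2)])+
  have c: "cc t - cd t = t" "cc t + cd t = 1 / t" unfolding cc_def cd_def by (auto simp: field_simps)
  have l0: "(cC t - cS t) * (cc t + cd t) = lam0" "(cC t + cS t) * (cc t - cd t) = 1 / lam0"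
    unfolding C c lam0_def using t by (auto simp: field_simps)
  have "tr 0 = (cC t - cS t) * (cc t + cd t) + (cC t + cS t) * (cc t - cd t)" unfolding tr_def by (simp add: algebra_simps)
  then show tr: "tr 0 = lam0 + 1 / lam0" unfolding l0 .
  have "0 < (lam0 - 1)^2 / lam0" using lam0 by simp
  also have "(lam0 - 1)^2 / lam0 = lam0 + 1 / lam0 - 2" using lam0 by (simp add: power2_eq_square field_simps)
  finally show tr2: "2 < tr 0" unfolding tr by simp
  have "(tr 0)^2 - 4 = (lam0 - 1 / lam0)^2" unfolding tr using lam0 by (simp add: power2_eq_square field_simps)
  moreover have "0 < lam0 - 1 / lam0" using lam0 less_trans[of "1 / lam0" 1 lam0] by (simp add: field_simps)
  ultimately have "sqrt ((tr 0)^2 - 4) = lam0 - 1 / lam0" by simp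
  then show l: "lam 0 = lam0" unfolding lam_def tr by simp
  have a0: "av 0 0 = A0" unfolding av_def A0_def using C(1) by simp
  have "fst (ep t 0 1) = (cC t - cS t) * (cc t + cd t) * (cC t - cS t)" "snd (ep t 0 1) = (cC t - cS t) * (cc t + cd t) * (cC t - cS t)"
    by (simp_all add: algebra_simps)
  note this[unfolded l0(1), unfolded C]
  then have a1: "av 1 0 = lam0 * A0" unfolding av_def A0_def by simp
  have "lam 0 - mu 0 \<noteq> 0" using lam_mu[OF tr2] by simp
  then show al: "al 0 = A0" unfolding al_def a0 a1 l by (simp add: field_simps)
  show "al' 0 = 0" unfolding al'_def a0 al by simp
qed

text \<open>Continuity at 0: the \<open>mu\<close> term stays a small perturbation of the
  \<open>lam\<close> term, which keeps the denominator of \<open>Ph\<close> away from 0 for every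
  \<open>l\<close>.\<close>

lemma near_zero:
  obtains d where "0 < d" "d < \<kappa>" "\<And>s. \<bar>s\<bar> < d \<Longrightarrow> 2 < tr s \<and> A0 / 2 < al s \<and> al s < 2 * A0 \<and> \<bar>al' s\<bar> < A0 / 4"
proof -
  have tr: "isCont tr 0" unfolding tr_def[abs_def] by (intro continuous_intros)
  have lam: "isCont lam 0" "isCont mu 0" unfolding lam_def[abs_def] mu_def[abs_def] using tr by (auto intro!: continuous_intros)
  have av0: "isCont (av 0) 0" unfolding av_def[abs_def] by simp
  have av1: "isCont (av 1) 0" unfolding av_def[abs_def] One_nat_def ep.simps by (auto intro!: continuous_intros)
  note av = av0 av1
  have "lam 0 - mu 0 \<noteq> 0" using lam_mu[OF at_zero(2)] by simp
  then have al: "isCont al 0" unfolding al_def[abs_def] using lam av by (intro continuous_intros)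
  then have al': "isCont al' 0" unfolding al'_def[abs_def] using av by (intro continuous_intros)
  have T: "(f \<longlongrightarrow> f 0) (nhds 0)" if "isCont f 0" for f :: "real \<Rightarrow> real"
    using that unfolding isCont_def by (simp add: tendsto_at_iff_tendsto_nhds)
  have "eventually (\<lambda>s. 2 < tr s) (nhds 0)" using at_zero(2) by (intro order_tendstoD(1)[OF T[OF tr]])
  moreover have "eventually (\<lambda>s. A0 / 2 < al s) (nhds 0)" using at_zero(4) A0 by (intro order_tendstoD(1)[OF T[OF al]]) auto
  moreover have "eventually (\<lambda>s. al s < 2 * A0) (nhds 0)" using at_zero(4) A0 by (intro order_tendstoD(2)[OF T[OF al]]) auto
  moreover have "eventually (\<lambda>s. al' s < A0 / 4) (nhds 0)" using at_zero(5) A0 by (intro order_tendstoD(2)[OF T[OF al']]) auto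
  moreover have "eventually (\<lambda>s. - (A0 / 4) < al' s) (nhds 0)" using at_zero(5) A0 by (intro order_tendstoD(1)[OF T[OF al']]) auto
  ultimately have "eventually (\<lambda>s. 2 < tr s \<and> A0 / 2 < al s \<and> al s < 2 * A0 \<and> \<bar>al' s\<bar> < A0 / 4) (nhds 0)"
    by eventually_elim auto
  then obtain d where d: "0 < d" "\<And>s. dist s 0 < d \<Longrightarrow> 2 < tr s \<and> A0 / 2 < al s \<and> al s < 2 * A0 \<and> \<bar>al' s\<bar> < A0 / 4"
    unfolding eventually_nhds_metric by blast
  show ?thesis
    by (rule that[of "min d (\<kappa> / 2)"]) (use d kap in auto)
qed

text \<open>Chosen once and for all, so that the constants built on it depend on
  \<open>\<beta>\<close> and \<open>\<kappa>\<close> only.\<close>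

definition "d0 = (SOME d. 0 < d \<and> d < \<kappa> \<and> (\<forall>s. \<bar>s\<bar> < d \<longrightarrow> 2 < tr s \<and> A0 / 2 < al s \<and> al s < 2 * A0 \<and> \<bar>al' s\<bar> < A0 / 4))"

lemma d0: "0 < d0" "d0 < \<kappa>" "\<bar>s\<bar> < d0 \<Longrightarrow> 2 < tr s" "\<bar>s\<bar> < d0 \<Longrightarrow> A0 / 2 < al s" "\<bar>s\<bar> < d0 \<Longrightarrow> al s < 2 * A0"
  "\<bar>s\<bar> < d0 \<Longrightarrow> \<bar>al' s\<bar> < A0 / 4"
proof -
  have "\<exists>d. 0 < d \<and> d < \<kappa> \<and> (\<forall>s. \<bar>s\<bar> < d \<longrightarrow> 2 < tr s \<and> A0 / 2 < al s \<and> al s < 2 * A0 \<and> \<bar>al' s\<bar> < A0 / 4)"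
    by (rule near_zero) blast
  from someI_ex[OF this, folded d0_def]
  show "0 < d0" "d0 < \<kappa>" "\<bar>s\<bar> < d0 \<Longrightarrow> 2 < tr s" "\<bar>s\<bar> < d0 \<Longrightarrow> A0 / 2 < al s" "\<bar>s\<bar> < d0 \<Longrightarrow> al s < 2 * A0"
    "\<bar>s\<bar> < d0 \<Longrightarrow> \<bar>al' s\<bar> < A0 / 4" by blast+
qed

text \<open>The \<open>mu\<close> term is at most \<open>A0 / 4 * lam s ^ l\<close> in absolute
  value, so \<open>av l s\<close> lies between 1/4 and 9/4 times \<open>A0 * lam s ^ l\<close>;
  inversion gives 8 and 8/9, and the latter is lowered to 2/3.\<close>

lemma Ph_bounds:
  assumes "\<bar>s\<bar> < d0"
  shows "Ph l s \<le> 8 / A0 / lam s ^ l" "2 / (3 * A0) / lam s ^ l \<le> Ph l s"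
proof -
  note d = d0(3-6)[OF assms]
  note lm = lam_mu[OF d(1)]
  have L: "0 < lam s ^ l" using lm by simp
  have "mu s ^ l \<le> 1" "1 \<le> lam s ^ l" using lm by (auto intro: power_le_one one_le_power)
  then have "mu s ^ l \<le> lam s ^ l" by linarith
  moreover have "0 \<le> mu s ^ l" using lm by simp
  ultimately have ml: "mu s ^ l \<le> lam s ^ l" "0 \<le> mu s ^ l" by blast+
  have "\<bar>al' s * mu s ^ l\<bar> \<le> A0 / 4 * lam s ^ l"
    unfolding abs_mult using d(4) ml A0 by (intro mult_mono) auto
  moreover have "A0 / 2 * lam s ^ l \<le> al s * lam s ^ l" "al s * lam s ^ l \<le> 2 * A0 * lam s ^ l"
    using d L by (auto intro: mult_right_mono)
  ultimately have b: "A0 / 4 * lam s ^ l \<le> av l s" "av l s \<le> 9 / 4 * A0 * lam s ^ l"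
    unfolding av_closed[OF d(1)] by (auto simp: algebra_simps abs_le_iff)
  have p: "0 < A0 / 4 * lam s ^ l" using A0 L by simp
  have pa: "0 < av l s" using b(1) p by linarith
  have "Ph l s = 2 / av l s" unfolding Ph_def av_def ..
  moreover have "2 / av l s \<le> 2 / (A0 / 4 * lam s ^ l)" using b(1) p pa A0 L by (intro divide_left_mono mult_pos_pos) auto
  moreover have "2 / (9 / 4 * A0 * lam s ^ l) \<le> 2 / av l s" using b(2) pa A0 L by (intro divide_left_mono mult_pos_pos) auto
  moreover have "2 / (3 * A0) / lam s ^ l \<le> 2 / (9 / 4 * A0 * lam s ^ l)" using A0 L by (simp add: field_simps)
  ultimately show "Ph l s \<le> 8 / A0 / lam s ^ l" "2 / (3 * A0) / lam s ^ l \<le> Ph l s" by (simp_all add: field_simps)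
qed

lemma Xs_le_Ph: "Xs t l j \<le> Ph l 0"
  using Ph_ge_sum[of 0 "{j}" l] kap by simp

text \<open>The box with a flat interface, turned by a quarter, lies in a strip of width
  \<open>l = 2 * M + 1\<close>, whose correlations are at most \<open>Ph l 0\<close>, of order
  \<open>1 / lam0 ^ l\<close>.\<close>

lemma tau0_lam0: "ln lam0 \<le> tau0"
proof -
  have p: "0 < (1::int)" "\<bar>0::int\<bar> \<le> 1" by simp_all
  obtain T where T: "(\<lambda>M. - ln (RM t 1 0 M) / (2 * real M + 1)) \<longlonglongrightarrow> T" using RM_limit[OF p t(1,2)] by blast
  have T0: "tau0 = T" unfolding tau0_def
    using tau_base_eq[OF p beta_pos, of 0 T] T unfolding t_def by simp
  have RMb: "RM t 1 0 M \<le> 8 / A0 / lam0 ^ (2 * M + 1)" for M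
  proof -
    define f where "f v = (snd v + int M + 1, - fst v)" for v :: site
    have f: "nn (f u) (f v) \<longleftrightarrow> nn u v" for u v unfolding f_def nn_def by (auto simp: abs_minus_commute)
    have i: "inj f" unfolding f_def by (rule injI) (auto simp: prod_eq_iff)
    have uv: "utop 1 0 M = (0, int M)" "ubot 1 0 M = (0, - int M - 1)" unfolding utop_def ubot_def cut_def by auto
    have fuv: "f (0, - int M - 1) = (0, 0)" "f (0, int M) = (int (2 * M + 1), 0)" unfolding f_def by auto
    have "RM t 1 0 M = cor t (gridE (f ` sq M)) (0, 0) (int (2 * M + 1), 0)"
      unfolding RM_def uv using cor_grid_image[OF f i, of t "sq M" "(0, - int M - 1)" "(0, int M)"]
      unfolding fuv by (simp add: cor_commute)
    also have "\<dots> \<le> Xs t (2 * M + 1) (0 - 0)"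
      by (rule cor_le_Xs[OF t(3,4)]) (auto simp: f_def sq_def)
    also have "\<dots> \<le> Ph (2 * M + 1) 0" by (rule Xs_le_Ph)
    also have "\<dots> \<le> 8 / A0 / lam0 ^ (2 * M + 1)" using Ph_bounds(1)[of 0 "2 * M + 1"] d0(1) unfolding at_zero(3) by simp
    finally show ?thesis .
  qed
  have "ln lam0 + 0 \<le> T"
  proof (rule tendsto_le[OF _ T])
    show "(\<lambda>M. ln lam0 + - ln (8 / A0) / (2 * real M + 1)) \<longlonglongrightarrow> ln lam0 + 0"
      by (intro tendsto_intros) real_asymp
    show "eventually (\<lambda>M. ln lam0 + - ln (8 / A0) / (2 * real M + 1) \<le> - ln (RM t 1 0 M) / (2 * real M + 1)) sequentially"
    proof (intro always_eventually allI)
      fix M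
      have "ln (RM t 1 0 M) \<le> ln (8 / A0 / lam0 ^ (2 * M + 1))"
        using RMb[of M] RM_pos[OF p t(1,2), of M] by (intro ln_mono) auto
      also have "\<dots> = ln (8 / A0) - real (2 * M + 1) * ln lam0"
      proof -
        have "ln (8 / A0 / lam0 ^ (2 * M + 1)) = ln (8 / A0) - ln (lam0 ^ (2 * M + 1))"
          using A0 lam0 ln_divide_pos[of "8 / A0" "lam0 ^ (2 * M + 1)"] by simp
        also have "ln (lam0 ^ (2 * M + 1)) = real (2 * M + 1) * ln lam0" by (rule ln_realpow)
        finally show ?thesis .
      qed
      finally have "(2 * real M + 1) * ln lam0 - ln (8 / A0) \<le> - ln (RM t 1 0 M)" by (simp add: algebra_simps)
      then have "((2 * real M + 1) * ln lam0 - ln (8 / A0)) / (2 * real M + 1) \<le> - ln (RM t 1 0 M) / (2 * real M + 1)"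
        by (intro divide_right_mono) auto
      moreover have "((2 * real M + 1) * ln lam0 - ln (8 / A0)) / (2 * real M + 1) = ln lam0 + - ln (8 / A0) / (2 * real M + 1)"
      proof -
        have n: "2 * real M + 1 \<noteq> 0" by linarith
        show ?thesis by (simp add: diff_divide_distrib nonzero_mult_div_cancel_left[OF n])
      qed
      ultimately show "ln lam0 + - ln (8 / A0) / (2 * real M + 1) \<le> - ln (RM t 1 0 M) / (2 * real M + 1)" by simp
    qed
  qed simp
  then show ?thesis using T0 by simp
qed

lemma cauchy2: "0 \<le> (a::real) \<Longrightarrow> 0 \<le> b \<Longrightarrow> a * x + b * y \<le> sqrt (a^2 + b^2) * sqrt (x^2 + y^2)"
proof -
  have "(a * x + b * y)^2 + (a * y - b * x)^2 = (a^2 + b^2) * (x^2 + y^2)" by (simp add: power2_eq_square algebra_simps)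
  then have "(a * x + b * y)^2 \<le> (a^2 + b^2) * (x^2 + y^2)" by (smt (verit) zero_le_power2)
  then have "sqrt ((a * x + b * y)^2) \<le> sqrt ((a^2 + b^2) * (x^2 + y^2))" by (rule real_sqrt_le_mono)
  then show ?thesis by (simp add: real_sqrt_mult)
qed

text \<open>Removes constant factors when two exponential rates are compared.\<close>

lemma power_bounded:
  assumes "0 \<le> x" "\<And>l. 0 < l \<Longrightarrow> x ^ l \<le> (C::real)"
  shows "x \<le> 1"
proof (rule ccontr)
  assume "\<not> x \<le> 1"
  then obtain n where n: "max C x < x ^ n" using real_arch_pow[of x "max C x"] by auto
  then have "0 < n" using \<open>\<not> x \<le> 1\<close> by (cases n) auto
  then show False using assms(2)[of n] n by simp
qed

text \<open>The bound \<open>3/10 * \<kappa>\<close> makes \<open>6/5 * s1\<close> at most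
  \<open>36/100 * \<kappa>\<close>, as the numerical estimate in \<open>lam_lower\<close> requires;
  \<open>d0 / 2\<close> keeps the tilt in the perturbative range.\<close>

definition "s1 = min (d0 / 2) (3/10 * \<kappa>)"

lemma s1: "0 < s1" "s1 < d0" "s1 \<le> 3/10 * \<kappa>" using d0 kap unfolding s1_def by auto

text \<open>Both sides compare with the exponential decay rate in the width of the generating function,
  which the sharp triangle inequality controls through the decay of the correlations.\<close>

lemma lam_lower:
  assumes "\<bar>s\<bar> \<le> s1"
  shows "lam0 * exp (- (3/4) * s^2 / \<kappa>) \<le> lam s"
proof (cases "s = 0")
  case True
  then show ?thesis using at_zero(3) by simp
next
  case False
  have sd: "\<bar>s\<bar> < d0" and sk: "\<bar>s\<bar> < \<kappa>" using assms s1 d0 by auto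
  \<comment> \<open>\<open>(u, r)\<close> has norm \<open>\<kappa>\<close>, so by Cauchy-Schwarz
    \<open>u * \<bar>j\<bar> + r * l\<close> is at most \<open>\<kappa>\<close> times the norm of
    \<open>(l, j)\<close>. Choosing \<open>u\<close> a fifth above \<open>\<bar>s\<bar>\<close>
    leaves a remainder that is summable in \<open>j\<close>.\<close>
  define u where "u = 6/5 * \<bar>s\<bar>"
  have u: "0 < u" "\<bar>s\<bar> < u" "u \<le> 36/100 * \<kappa>" using False assms s1(3) unfolding u_def by auto
  define r where "r = sqrt (\<kappa>^2 - u^2)"
  have u2: "u^2 \<le> (36/100 * \<kappa>)^2" using u by (intro power_mono) auto
  have r2: "r^2 = \<kappa>^2 - u^2" "0 \<le> r"
  proof -
    have "u^2 \<le> \<kappa>^2" using u kap by (intro power_mono) auto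
    then show "r^2 = \<kappa>^2 - u^2" "0 \<le> r" unfolding r_def by auto
  qed
  have rk: "93/100 * \<kappa> \<le> r"
  proof -
    have "(93/100 * \<kappa>)^2 \<le> r^2" 
    proof -
      have "u^2 \<le> 1296/10000 * \<kappa>^2" using u2 by (simp add: power_mult_distrib power_divide)
      moreover have "(93/100 * \<kappa>)^2 = 8649/10000 * \<kappa>^2" by (simp add: power_mult_distrib power_divide)
      ultimately show ?thesis unfolding r2(1) using zero_le_power2[of \<kappa>] by linarith
    qed
    then show ?thesis using r2(2) by (rule power2_le_imp_le)
  qed
  \<comment> \<open>\<open>\<kappa> - r = u^2 / (\<kappa> + r)\<close> with
    \<open>u^2 = 1.44 * s^2\<close> and \<open>r \<ge> 0.93 * \<kappa>\<close>; the ratio 144/193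
    lies just below 3/4.\<close>
  have kr: "\<kappa> - r \<le> 3/4 * s^2 / \<kappa>"
  proof -
    have "(\<kappa> - r) * (\<kappa> + r) = u^2" using r2(1) by (simp add: power2_eq_square algebra_simps)
    moreover have "(\<kappa> - r) * (193/100 * \<kappa>) \<le> (\<kappa> - r) * (\<kappa> + r)"
    proof (rule mult_left_mono)
      show "193/100 * \<kappa> \<le> \<kappa> + r" using rk by simp
      have "r^2 \<le> \<kappa>^2" using r2(1) by simp
      then show "0 \<le> \<kappa> - r" using kap power2_le_imp_le[of r \<kappa>] by simp
    qed
    ultimately have "(\<kappa> - r) * (193/100 * \<kappa>) \<le> u^2" by simp
    also have "u^2 = 144/100 * s^2" unfolding u_def by (simp add: power_mult_distrib power2_eq_square)
    finally have "(\<kappa> - r) * \<kappa> \<le> 144/193 * s^2" by (simp add: algebra_simps)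
    also have "\<dots> \<le> 3/4 * s^2" by simp
    finally show ?thesis using kap by (simp add: field_simps)
  qed
  define B where "B = infsum (\<lambda>j::int. exp (- (u - \<bar>s\<bar>) * \<bar>real_of_int j\<bar>)) UNIV"
  have B: "((\<lambda>j::int. exp (- (u - \<bar>s\<bar>) * \<bar>real_of_int j\<bar>)) has_sum B) UNIV"
    unfolding B_def using u by (intro has_sum_infsum exp_int_summable) auto
  define y where "y = exp (- tau0 + \<kappa> - r)"
  have Phu: "Ph l s \<le> y ^ l * B" if l: "0 < l" for l
  proof (rule has_sum_mono[OF generating[OF sk] has_sum_cmult_right[OF B]])
    fix j :: int
    have "u * \<bar>real_of_int j\<bar> + r * real l \<le> sqrt (u^2 + r^2) * sqrt (\<bar>real_of_int j\<bar>^2 + (real l)^2)"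
      using u r2 by (intro cauchy2) auto
    also have "sqrt (u^2 + r^2) = \<kappa>" unfolding r2 using kap by simp
    also have "\<bar>real_of_int j\<bar>^2 + (real l)^2 = (real l)^2 + (real_of_int j)^2" by simp
    finally have c: "u * \<bar>real_of_int j\<bar> + r * real l \<le> \<kappa> * sqrt ((real l)^2 + (real_of_int j)^2)" .
    have "s * real_of_int j \<le> \<bar>s\<bar> * \<bar>real_of_int j\<bar>" by (simp add: abs_mult[symmetric])
    then have e: "s * real_of_int j + (- real l * tau0 - \<kappa> * (sqrt ((real l)^2 + (real_of_int j)^2) - l)) \<le>
       real l * (- tau0 + \<kappa> - r) + - (u - \<bar>s\<bar>) * \<bar>real_of_int j\<bar>"
      using c by (simp add: algebra_simps)
    have "exp (s * real_of_int j) * Xs t l j \<le> exp (s * real_of_int j) * exp (- real l * tau0 - \<kappa> * (sqrt ((real l)^2 + (real_of_int j)^2) - l))"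
      by (intro mult_left_mono Xs_decay[OF l]) auto
    also have "\<dots> = exp (s * real_of_int j + (- real l * tau0 - \<kappa> * (sqrt ((real l)^2 + (real_of_int j)^2) - l)))" by (rule exp_add[symmetric])
    also have "\<dots> \<le> exp (real l * (- tau0 + \<kappa> - r) + - (u - \<bar>s\<bar>) * \<bar>real_of_int j\<bar>)" using e by (simp only: exp_le_cancel_iff)
    also have "\<dots> = y ^ l * exp (- (u - \<bar>s\<bar>) * \<bar>real_of_int j\<bar>)" unfolding y_def exp_add exp_of_nat_mult ..
    finally show "exp (s * real_of_int j) * Xs t l j \<le> y ^ l * exp (- (u - \<bar>s\<bar>) * \<bar>real_of_int j\<bar>)" .
  qed
  have L: "1 < lam s" using lam_mu(3)[OF d0(3)[OF sd]] .
  have y: "0 < y" unfolding y_def by simp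
  \<comment> \<open>The two bounds on \<open>Ph l s\<close> hold for all \<open>l > 0\<close>, so
    their constants drop out and the rates remain.\<close>
  have "1 / (lam s * y) \<le> 1"
  proof (rule power_bounded[where C="B * (3 * A0) / 2"])
    fix l :: nat assume l: "0 < l"
    have "2 / (3 * A0) / lam s ^ l \<le> y ^ l * B" using Ph_bounds(2)[OF sd, of l] Phu[OF l] by linarith
    then show "(1 / (lam s * y)) ^ l \<le> B * (3 * A0) / 2"
      using L y A0 by (simp add: power_divide power_mult_distrib field_simps)
  qed (use L y in simp)
  then have "1 / y \<le> lam s" using L y by (simp add: field_simps)
  moreover have "1 / y = exp (tau0 - \<kappa> + r)" unfolding y_def by (simp add: exp_minus[symmetric] inverse_eq_divide[symmetric] algebra_simps)
  moreover have "exp (ln lam0 - 3/4 * s^2 / \<kappa>) \<le> exp (tau0 - \<kappa> + r)" using tau0_lam0 kr by simp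
  moreover have "exp (ln lam0 - 3/4 * s^2 / \<kappa>) = lam0 * exp (- (3/4) * s^2 / \<kappa>)"
  proof -
    have "exp (ln lam0 - 3/4 * s^2 / \<kappa>) = exp (ln lam0) * exp (- (3/4) * s^2 / \<kappa>)" by (simp flip: exp_add)
    then show ?thesis using lam0 by simp
  qed
  ultimately show ?thesis by linarith
qed

lemma Ph_upper:
  assumes "\<bar>s\<bar> \<le> s1"
  shows "Ph l s \<le> 8 / A0 / lam0 ^ l * exp (real l * (3/4 * s^2 / \<kappa>))"
proof -
  have "Ph l s \<le> 8 / A0 / lam s ^ l" using assms s1 by (intro Ph_bounds) auto
  also have "\<dots> \<le> 8 / A0 / (lam0 * exp (- (3/4) * s^2 / \<kappa>)) ^ l"
    using lam_lower[OF assms] lam0 A0 lam_mu(3)[OF d0(3), of s] assms s1 by (intro divide_left_mono power_mono mult_pos_pos zero_less_power) auto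
  also have "(lam0 * exp (- (3/4) * s^2 / \<kappa>)) ^ l = lam0 ^ l * exp (- (real l * (3/4 * s^2 / \<kappa>)))"
    by (simp add: power_mult_distrib exp_of_nat_mult[symmetric])
  also have "8 / A0 / \<dots> = 8 / A0 / lam0 ^ l * exp (real l * (3/4 * s^2 / \<kappa>))"
    by (simp add: exp_minus field_simps)
  finally show ?thesis .
qed

text \<open>With tilts of size \<open>s1 / sqrt l\<close>, the heights beyond
  \<open>M1 * sqrt l\<close> carry at most \<open>16 / 48 = 1/3\<close> of
  \<open>1 / (A0 * lam0 ^ l)\<close>, half of the lower bound 2/3 for the whole sum.\<close>

definition "M1 = (ln 48 + 3/4 * s1^2 / \<kappa>) / s1"
definition "c_axis = t / (3 * A0 * (2 * M1 + 1))"

lemma M1: "0 < M1" unfolding M1_def using s1 kap by (intro divide_pos_pos add_pos_nonneg) auto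
lemma c_axis: "0 < c_axis" unfolding c_axis_def using t A0 M1 by (intro divide_pos_pos mult_pos_pos) auto

text \<open>The tilts \<open>s\<close> and \<open>- s\<close> show that a sum of order
  \<open>1 / lam0 ^ l\<close> comes from the heights up to \<open>M1 * sqrt l\<close>. None of these
  at most \<open>(2 * M1 + 1) * sqrt l\<close> terms exceeds \<open>Xs t l 0 / t\<close>, which
  bounds the axis term from below.\<close>

lemma Xs_lower:
  assumes l: "0 < l"
  shows "c_axis / (sqrt (real l) * lam0 ^ l) \<le> Xs t l 0"
proof -
  define s where "s = s1 / sqrt (real l)"
  define R where "R = M1 * sqrt (real l)"
  have rl: "1 \<le> sqrt (real l)" using l by simp
  have s: "0 < s" "s \<le> s1" using s1 rl unfolding s_def by (auto simp: field_simps)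
  have sd: "\<bar>s\<bar> \<le> s1" "\<bar>- s\<bar> \<le> s1" using s by auto
  have sk: "\<bar>s\<bar> < \<kappa>" "\<bar>- s\<bar> < \<kappa>" "\<bar>0\<bar> < \<kappa>" using s s1 d0 kap by auto
  have R: "0 \<le> R" unfolding R_def using M1 by simp
  let ?n = "\<lfloor>R\<rfloor>"
  have g1: "((\<lambda>j. if \<bar>real_of_int j\<bar> \<le> R then Xs t l 0 / t else 0) has_sum ((2 * real_of_int ?n + 1) * (Xs t l 0 / t))) UNIV"
  proof (rule has_sum_finite_neutralI[of "{- ?n..?n}"])
    have iff: "\<bar>real_of_int j\<bar> \<le> R \<longleftrightarrow> j \<in> {- ?n..?n}" for j
    proof -
      have "\<bar>real_of_int j\<bar> \<le> R \<longleftrightarrow> \<bar>j\<bar> \<le> ?n" by (simp add: le_floor_iff)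
      then show ?thesis by auto
    qed
    show "(if \<bar>real_of_int j\<bar> \<le> R then Xs t l 0 / t else 0) = 0" if "j \<in> UNIV - {- ?n..?n}" for j using that iff by auto
    have "(\<Sum>j\<in>{- ?n..?n}. if \<bar>real_of_int j\<bar> \<le> R then Xs t l 0 / t else 0) = (\<Sum>j\<in>{- ?n..?n}. Xs t l 0 / t)"
      using iff by (intro sum.cong) auto
    also have "\<dots> = (2 * real_of_int ?n + 1) * (Xs t l 0 / t)" using R by (simp add: of_nat_nat)
    finally show "(2 * real_of_int ?n + 1) * (Xs t l 0 / t) = (\<Sum>j\<in>{- ?n..?n}. if \<bar>real_of_int j\<bar> \<le> R then Xs t l 0 / t else 0)" ..
  qed auto
  have g2: "((\<lambda>j. exp (- s * R) * (exp (s * real_of_int j) * Xs t l j + exp (- s * real_of_int j) * Xs t l j)) has_sum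
      (exp (- s * R) * (Ph l s + Ph l (- s)))) UNIV"
    by (intro has_sum_cmult_right has_sum_add generating sk)
  have "Ph l 0 \<le> (2 * real_of_int ?n + 1) * (Xs t l 0 / t) + exp (- s * R) * (Ph l s + Ph l (- s))"
  proof (rule has_sum_mono[OF generating[OF sk(3)] has_sum_add[OF g1 g2]])
    fix j :: int
    have X0: "0 \<le> Xs t l j" "0 \<le> Xs t l 0" by (auto intro: Xs_nonneg t)
    show "exp (0 * real_of_int j) * Xs t l j \<le> (if \<bar>real_of_int j\<bar> \<le> R then Xs t l 0 / t else 0) +
        exp (- s * R) * (exp (s * real_of_int j) * Xs t l j + exp (- s * real_of_int j) * Xs t l j)"
    proof (cases "\<bar>real_of_int j\<bar> \<le> R")
      case True
      have "0 \<le> exp (- s * R) * (exp (s * real_of_int j) * Xs t l j + exp (- s * real_of_int j) * Xs t l j)"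
        using X0 by (intro mult_nonneg_nonneg add_nonneg_nonneg) auto
      then show ?thesis using Xs_max[OF t(1,2), of l j] True by simp
    next
      case False
      have "1 \<le> exp (- s * R) * (exp (s * real_of_int j) + exp (- s * real_of_int j))"
      proof -
        have "s * R \<le> s * \<bar>real_of_int j\<bar>" using False s by (intro mult_left_mono) auto
        then have "exp (s * R) \<le> exp (s * \<bar>real_of_int j\<bar>)" by simp
        also have "\<dots> \<le> exp (s * real_of_int j) + exp (- s * real_of_int j)"
          by (cases "0 \<le> j") auto
        finally have "exp (- s * R) * exp (s * R) \<le> exp (- s * R) * (exp (s * real_of_int j) + exp (- s * real_of_int j))"
          by (intro mult_left_mono) auto
        then show ?thesis by (simp add: exp_add[symmetric])
      qed
      then have "1 * Xs t l j \<le> exp (- s * R) * (exp (s * real_of_int j) + exp (- s * real_of_int j)) * Xs t l j"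
        using X0 by (intro mult_right_mono) auto
      then show ?thesis using False by (simp add: algebra_simps)
    qed
  qed
  moreover have "2 / (3 * A0) / lam0 ^ l \<le> Ph l 0" using Ph_bounds(2)[of 0 l] d0(1) unfolding at_zero(3) by simp
  moreover have "exp (- s * R) * (Ph l s + Ph l (- s)) \<le> 1 / (3 * A0) / lam0 ^ l"
  proof -
    have ls: "real l * (3/4 * s^2 / \<kappa>) = 3/4 * s1^2 / \<kappa>" unfolding s_def using l by (simp add: power_divide)
    have sR: "- s * R = - ln 48 - 3/4 * s1^2 / \<kappa>"
      unfolding s_def R_def M1_def using s1 l by (simp add: field_simps)
    have "Ph l s + Ph l (- s) \<le> 16 / A0 / lam0 ^ l * exp (3/4 * s1^2 / \<kappa>)"
    proof -
      define K where "K = 8 / A0 / lam0 ^ l * exp (3/4 * s1^2 / \<kappa>)"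
      have "Ph l s \<le> K" using Ph_upper[OF sd(1), of l] unfolding ls K_def .
      moreover have "Ph l (- s) \<le> K" using Ph_upper[OF sd(2), of l] unfolding power2_minus ls K_def .
      moreover have "2 * K = 16 / A0 / lam0 ^ l * exp (3/4 * s1^2 / \<kappa>)" unfolding K_def by simp
      ultimately show ?thesis by linarith
    qed
    then have "exp (- s * R) * (Ph l s + Ph l (- s)) \<le> exp (- s * R) * (16 / A0 / lam0 ^ l * exp (3/4 * s1^2 / \<kappa>))"
      by (intro mult_left_mono) auto
    also have "\<dots> = exp (- ln 48) * (16 / A0 / lam0 ^ l)" unfolding sR by (simp add: exp_diff exp_minus field_simps)
    also have "exp (- ln (48::real)) = 1 / 48" by (simp add: exp_minus)
    finally show ?thesis by simp
  qed
  moreover have "2 / (3 * A0) / lam0 ^ l - 1 / (3 * A0) / lam0 ^ l = 1 / (3 * A0 * lam0 ^ l)" using A0 lam0 by (simp add: field_simps)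
  ultimately have 1: "1 / (3 * A0 * lam0 ^ l) \<le> (2 * real_of_int ?n + 1) * (Xs t l 0 / t)" by linarith
  have "2 * real_of_int ?n + 1 \<le> (2 * M1 + 1) * sqrt (real l)"
  proof -
    have "real_of_int ?n \<le> M1 * sqrt (real l)" using of_int_floor_le[of R] unfolding R_def .
    moreover have "(2 * M1 + 1) * sqrt (real l) = 2 * (M1 * sqrt (real l)) + sqrt (real l)" by (simp add: algebra_simps)
    ultimately show ?thesis using rl by linarith
  qed
  then have "(2 * real_of_int ?n + 1) * (Xs t l 0 / t) \<le> (2 * M1 + 1) * sqrt (real l) * (Xs t l 0 / t)"
    using t Xs_nonneg[OF t(3,4)] by (intro mult_right_mono) auto
  with 1 have "1 / (3 * A0 * lam0 ^ l) \<le> (2 * M1 + 1) * sqrt (real l) * (Xs t l 0 / t)" by linarith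
  moreover have "t / (a * q) / (r * L) \<le> X" if "1 / (a * L) \<le> q * r * (X / t)" "0 < a" "0 < L" "0 < q" "0 < r" for a q r L X :: real
    using that t by (simp add: field_simps)
  ultimately show ?thesis using A0 lam0 M1 l unfolding c_axis_def by simp
qed

end

section \<open>Tilted pointwise bounds and correlations in the plane\<close>

context low_temp
begin

definition "C_tilt = exp (2/3 * \<kappa>) * (1 / t + 16 / (A0 * c_axis))"
definition "Binf = infsum (\<lambda>j::int. exp (- (\<kappa> - s1) * \<bar>real_of_int j\<bar>)) UNIV"

lemma C_tilt: "0 < C_tilt" unfolding C_tilt_def using t A0 c_axis by (intro mult_pos_pos add_pos_pos divide_pos_pos) auto

lemma Xs_pos: "0 < m \<Longrightarrow> 0 < Xs t m 0"
  by (rule less_le_trans[OF _ Xs_lower]) (use c_axis lam0 in auto)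

text \<open>\<open>s\<close> minimises \<open>3/4 * m * s^2 / \<kappa> - s * k\<close>. The bound on
  the sum becomes pointwise by monotonicity: the heights \<open>j, j - 2, ...\<close> down to about
  \<open>j - w\<close> carry at least as much correlation as \<open>j\<close>, and the tilt varies
  by a bounded factor over them. Their number, of order \<open>m / k\<close>, turns the factor
  \<open>sqrt m\<close> from \<open>Xs_lower\<close> into \<open>k / sqrt m\<close>.\<close>

lemma tilt:
  fixes k :: real
  assumes m: "0 < m" and k: "sqrt (real m) \<le> k" "k \<le> 3/2 * s1 / \<kappa> * real m"
  defines "s \<equiv> 2/3 * \<kappa> * k / real m"
  shows "Xs t m j \<le> C_tilt * (k / sqrt (real m)) * exp (- s * real_of_int j) * exp (\<kappa> * k^2 / (3 * real m)) * Xs t m 0"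
proof -
  let ?r = "sqrt (real m)"
  have rm: "0 < real m" "1 \<le> ?r" using m by auto
  have kp: "0 < k" using k(1) rm by linarith
  have s: "0 < s" "s \<le> s1" unfolding s_def using kp kap rm k(2) by (auto simp: field_simps)
  define w where "w = real m / k"
  have sw: "s * w = 2/3 * \<kappa>" unfolding s_def w_def using rm kp by simp
  have "k \<le> 45/100 * real m"
  proof -
    have "3/2 * s1 / \<kappa> \<le> 45/100" using s1 kap by (simp add: field_simps)
    then show ?thesis using k(2) rm mult_right_mono[of "3/2 * s1 / \<kappa>" "45/100" "real m"] by linarith
  qed
  then have w: "1 \<le> w" unfolding w_def using kp rm by simp
  have kr: "1 \<le> k / ?r" using k(1) rm by simp
  have X0: "0 < Xs t m 0" by (rule Xs_pos[OF m])
  have Xn: "0 \<le> Xs t m j" by (rule Xs_nonneg[OF t(3,4)])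
  define G where "G = exp (\<kappa> * k^2 / (3 * real m))"
  have G: "1 \<le> G" unfolding G_def using kap rm by simp
  have Geq: "exp (real m * (3/4 * s^2 / \<kappa>)) = G"
  proof -
    have "real m * (3/4 * s^2 / \<kappa>) = \<kappa> * k^2 / (3 * real m)" unfolding s_def using rm kap
      by (simp add: power2_eq_square field_simps)
    then show ?thesis unfolding G_def by simp
  qed
  have "Xs t m j \<le> C_tilt * (k / ?r) * exp (- s * real_of_int j) * G * Xs t m 0"
  proof (cases "real_of_int j \<le> w")
    \<comment> \<open>Up to \<open>w\<close> the factor \<open>exp (- s * j)\<close> is at least
      \<open>exp (- 2/3 * \<kappa>)\<close> and the bound \<open>Xs_max\<close> is enough. Beyond
      \<open>w\<close> all the shifted heights are positive, as the monotonicity requires.\<close>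
    case True
    have "s * real_of_int j \<le> s * w" using True s by (intro mult_left_mono) auto
    then have "1 \<le> exp (2/3 * \<kappa>) * exp (- s * real_of_int j)" unfolding sw by (simp flip: exp_add)
    then have "1 * 1 * 1 \<le> (k / ?r) * (exp (2/3 * \<kappa>) * exp (- s * real_of_int j)) * G"
    proof -
      have "1 * 1 * 1 \<le> y * e * G" if "1 \<le> y" "1 \<le> e" for y e :: real
        using that G by (intro mult_mono) auto
      then show ?thesis using kr \<open>1 \<le> exp (2/3 * \<kappa>) * exp (- s * real_of_int j)\<close> by blast
    qed
    then have "1 * (1 / t * Xs t m 0) \<le> (k / ?r) * (exp (2/3 * \<kappa>) * exp (- s * real_of_int j)) * G * (1 / t * Xs t m 0)"
      using t X0 by (intro mult_right_mono) auto
    also have "\<dots> = (exp (2/3 * \<kappa>) * (1 / t)) * ((k / ?r) * exp (- s * real_of_int j) * G * Xs t m 0)" by (simp add: mult_ac)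
    also have "\<dots> \<le> C_tilt * ((k / ?r) * exp (- s * real_of_int j) * G * Xs t m 0)"
      unfolding C_tilt_def using A0 c_axis kr G X0 by (intro mult_right_mono mult_left_mono mult_nonneg_nonneg) auto
    finally show ?thesis using Xs_max[OF t(1,2), of m j] by (simp add: mult_ac)
  next
    case False
    define n where "n = nat (\<lfloor>w\<rfloor> div 2)"
    have fw: "0 \<le> \<lfloor>w\<rfloor> div 2" using w by (simp add: pos_imp_zdiv_nonneg_iff)
    have n1: "w / 2 \<le> real n + 1"
    proof -
      have "z + 1 \<le> 2 * (z div 2 + 1)" for z :: int by presburger
      then have "\<lfloor>w\<rfloor> + 1 \<le> 2 * (\<lfloor>w\<rfloor> div 2 + 1)" .
      then have "real_of_int (\<lfloor>w\<rfloor> + 1) \<le> real_of_int (2 * (\<lfloor>w\<rfloor> div 2 + 1))" by (simp only: of_int_le_iff)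
      moreover have "real n = real_of_int (\<lfloor>w\<rfloor> div 2)" unfolding n_def using fw by simp
      ultimately show ?thesis using real_of_int_floor_add_one_gt[of w] by (simp only: of_int_add of_int_mult of_int_numeral of_int_1)
    qed
    have n2: "2 * real n \<le> w"
    proof -
      have "2 * (z div 2) \<le> z" for z :: int by presburger
      then have "2 * (\<lfloor>w\<rfloor> div 2) \<le> \<lfloor>w\<rfloor>" .
      then have "real_of_int (2 * (\<lfloor>w\<rfloor> div 2)) \<le> real_of_int \<lfloor>w\<rfloor>" by (simp only: of_int_le_iff)
      moreover have "real n = real_of_int (\<lfloor>w\<rfloor> div 2)" unfolding n_def using fw by simp
      ultimately show ?thesis using of_int_floor_le[of w] by (simp only: of_int_mult of_int_numeral, linarith?)
    qed
    have sk: "\<bar>s\<bar> < \<kappa>" "\<bar>s\<bar> \<le> s1" using s s1 d0 by auto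
    define f where "f r = j - 2 * int r" for r
    have inj: "inj_on f {..n}" unfolding f_def by (rule inj_onI) simp
    have "(real n + 1) * (exp (s * real_of_int j - 2/3 * \<kappa>) * Xs t m j) = (\<Sum>r\<in>{..n}. exp (s * real_of_int j - 2/3 * \<kappa>) * Xs t m j)" by simp
    also have "\<dots> \<le> (\<Sum>r\<in>{..n}. exp (s * real_of_int (f r)) * Xs t m (f r))"
    proof (rule sum_mono)
      fix r assume "r \<in> {..n}"
      then have "real r \<le> real n" by simp
      then have r: "2 * real r \<le> w" using n2 by linarith
      have "s * (2 * real r) \<le> s * w" using r s by (intro mult_left_mono) auto
      then have e: "s * real_of_int j - 2/3 * \<kappa> \<le> s * real_of_int (f r)" unfolding sw f_def by (simp add: algebra_simps)
      have "0 < real_of_int j - 2 * real r" using False r by linarith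
      then have "0 < real_of_int (f r)" unfolding f_def by simp
      then have fp: "0 \<le> f r" by simp
      have "Xs t m j \<le> Xs t m (f r)" using Xs_mono_even[OF t(3,4) fp, of m r] unfolding f_def by simp
      then show "exp (s * real_of_int j - 2/3 * \<kappa>) * Xs t m j \<le> exp (s * real_of_int (f r)) * Xs t m (f r)"
        using e Xn by (intro mult_mono) auto
    qed
    also have "\<dots> = (\<Sum>i\<in>f ` {..n}. exp (s * real_of_int i) * Xs t m i)" using inj by (simp add: sum.reindex)
    also have "\<dots> \<le> Ph m s" by (rule Ph_ge_sum[OF sk(1)]) simp
    also have "\<dots> \<le> 8 / A0 / lam0 ^ m * G" using Ph_upper[OF sk(2), of m] unfolding Geq .
    also have "\<dots> \<le> 8 / A0 * (?r * Xs t m 0 / c_axis) * G"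
    proof -
      have "1 / lam0 ^ m \<le> ?r * Xs t m 0 / c_axis" using Xs_lower[OF m] c_axis lam0 rm by (simp add: field_simps)
      then have "8 / A0 * (1 / lam0 ^ m) * G \<le> 8 / A0 * (?r * Xs t m 0 / c_axis) * G" using A0 G by (intro mult_right_mono mult_left_mono) auto
      then show ?thesis by simp
    qed
    finally have 1: "(real n + 1) * (exp (s * real_of_int j - 2/3 * \<kappa>) * Xs t m j) \<le> 8 / A0 * (?r * Xs t m 0 / c_axis) * G" .
    have "w / 2 * (exp (s * real_of_int j - 2/3 * \<kappa>) * Xs t m j) \<le> (real n + 1) * (exp (s * real_of_int j - 2/3 * \<kappa>) * Xs t m j)"
      using n1 Xn by (intro mult_right_mono) auto
    with 1 have 2: "w / 2 * (exp (s * real_of_int j - 2/3 * \<kappa>) * Xs t m j) \<le> 8 / A0 * (?r * Xs t m 0 / c_axis) * G" by linarith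
    define e where "e = exp (s * real_of_int j - 2/3 * \<kappa>)"
    have e: "0 < e" "inverse e = exp (2/3 * \<kappa>) * exp (- s * real_of_int j)" unfolding e_def by (simp_all flip: exp_minus exp_add)
    have "Xs t m j = (2 / w * inverse e) * (w / 2 * (e * Xs t m j))" using w e(1) by simp
    also have "\<dots> \<le> (2 / w * inverse e) * (8 / A0 * (?r * Xs t m 0 / c_axis) * G)"
      using 2 w e(1) unfolding e_def[symmetric] by (intro mult_left_mono) auto
    also have "\<dots> = (exp (2/3 * \<kappa>) * (16 / (A0 * c_axis))) * ((?r / w) * exp (- s * real_of_int j) * G * Xs t m 0)"
      unfolding e(2) by (simp add: field_simps)
    also have "?r / w = k / ?r" unfolding w_def using rm kp by (simp add: field_simps flip: power2_eq_square)
    also have "(exp (2/3 * \<kappa>) * (16 / (A0 * c_axis))) * ((k / ?r) * exp (- s * real_of_int j) * G * Xs t m 0) \<le>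
       C_tilt * ((k / ?r) * exp (- s * real_of_int j) * G * Xs t m 0)"
      unfolding C_tilt_def using t kr G X0 by (intro mult_right_mono mult_left_mono mult_nonneg_nonneg) auto
    finally show ?thesis by (simp add: mult_ac)
  qed
  then show ?thesis unfolding G_def .
qed

lemma Binf: "finite A \<Longrightarrow> (\<Sum>j\<in>A. exp (- (\<kappa> - s1) * \<bar>real_of_int j\<bar>)) \<le> Binf" "0 \<le> Binf"
proof -
  have h: "((\<lambda>j::int. exp (- (\<kappa> - s1) * \<bar>real_of_int j\<bar>)) has_sum Binf) UNIV"
    unfolding Binf_def using s1 kap by (intro has_sum_infsum exp_int_summable) auto
  show 1: "(\<Sum>j\<in>A. exp (- (\<kappa> - s1) * \<bar>real_of_int j\<bar>)) \<le> Binf" if "finite A" for A :: "int set"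
    using has_sum_finite[OF that] h by (rule has_sum_mono2) auto
  show "0 \<le> Binf" using 1[of "{}"] by simp
qed

lemma cor_column_shift:
  assumes "finite S" "(m, k) \<in> S" "(m, i) \<in> S"
  shows "cor t (gridE S) (m, k) (m, i) \<le> exp (- \<kappa> * \<bar>real_of_int (i - k)\<bar>)"
proof -
  let ?f = "shift (- m, - k)"
  have f: "?f (m, k) = (0, 0)" "?f (m, i) = (0, i - k)" unfolding shift_def by auto
  have "cor t (gridE S) (m, k) (m, i) = cor t (gridE (?f ` S)) (?f (m, k)) (?f (m, i))"
    by (rule cor_grid_image[OF nn_shift inj_shift, symmetric])
  also have "\<dots> \<le> exp (- \<kappa> * \<bar>real_of_int (i - k)\<bar>)" unfolding f
  proof (rule cor_decay_column)
    show "(0, 0) \<in> ?f ` S" "(0, i - k) \<in> ?f ` S" using assms(2,3) f by (metis image_eqI)+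
  qed (use assms in auto)
  finally show ?thesis .
qed

text \<open>The path is cut at its last visit to the first column and its first later visit to the last one.\<close>

lemma cor_two_columns:
  assumes S: "finite S"
  obtains B where "cor t (gridE S) (0, 0) (int m, k) \<le> (\<Sum>j\<in>{- int B..int B}. \<Sum>i\<in>{- int B..int B}.
    exp (- \<kappa> * \<bar>real_of_int j\<bar>) * (exp (- \<kappa> * \<bar>real_of_int (i - k)\<bar>) * Xs t m (i - j)))"
proof -
  obtain B where B: "S \<subseteq> rect (- int B) (int B) (- int B) (int B)" "int m \<le> int B" "\<bar>k\<bar> \<le> int B"
  proof -
    define b where "b = Max (insert (max (int m) \<bar>k\<bar>) ((\<lambda>v. max \<bar>fst v\<bar> \<bar>snd v\<bar>) ` S))"
    have "max (int m) \<bar>k\<bar> \<le> b" unfolding b_def using S by (intro Max_ge) auto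
    moreover have "max \<bar>fst v\<bar> \<bar>snd v\<bar> \<le> b" if "v \<in> S" for v unfolding b_def using S that by (intro Max_ge) auto
    ultimately show ?thesis by (intro that[of "nat b"]) (force simp: rect_def)+
  qed
  define R where "R = rect (- int B) (int B) (- int B) (int B)"
  define T1 where "T1 = rect 0 (int B) (- int B) (int B)"
  define T2 where "T2 = rect 0 (int m) (- int B) (int B)"
  let ?J = "{- int B..int B}"
  define c1 c2 where "c1 = Pair (0::int) ` ?J" and "c2 = Pair (int m) ` ?J"
  have gR: "graph (gridE R)" and gT: "graph (gridE T1)" by (auto intro: gridE_graph simp: R_def T1_def)
  have T1R: "T1 \<subseteq> R" "T2 \<subseteq> T1" using B unfolding T1_def T2_def R_def rect_def by auto
  have inT: "(0, 0) \<in> R" "(int m, k) \<in> T1" "(int m, k) \<in> T2" using B unfolding R_def T1_def T2_def rect_def by auto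
  have col: "p \<in> T2 \<and> p \<in> T1 \<and> p \<in> R" if "p \<in> c1 \<or> p \<in> c2" for p
    using that B unfolding c1_def c2_def R_def T1_def T2_def rect_def by auto
  have "cor t (gridE S) (0, 0) (int m, k) \<le> cor t (gridE R) (0, 0) (int m, k)"
    using B t by (intro cor_mono gR gridE_mono) (auto simp: R_def)
  also have "\<dots> \<le> (\<Sum>p\<in>c1. cor t (gridE R) (0, 0) p * cor t (gridE T1) p (int m, k))"
  proof (rule cor_simon_lieb[where T=T1])
    show "gridE T1 \<subseteq> gridE R" by (rule gridE_mono[OF T1R(1)])
    show "(0, 0) \<in> c1" if "(0, 0) \<in> T1" unfolding c1_def by auto
    show "e \<subseteq> T1" if "e \<in> gridE T1" for e using that unfolding gridE_iff by auto
    show "e \<inter> T1 \<subseteq> c1" if e: "e \<in> gridE R - gridE T1" for e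
    proof -
      obtain x y where xy: "e = {(x, y), (x + 1, y)} \<or> e = {(x, y), (x, y + 1)}" using DiffD1[OF e] unfolding gridE_iff by blast
      have n: "\<not> e \<subseteq> T1" using e xy gridE_h[of x y T1] gridE_v[of x y T1] by auto
      have "e \<subseteq> R" using DiffD1[OF e] unfolding gridE_iff by auto
      then show ?thesis using xy n unfolding R_def T1_def c1_def rect_def by (elim disjE) auto
    qed
  qed (use gR t inT in \<open>auto simp: c1_def\<close>)
  \<comment> \<open>The second cut is made from the other end, with \<open>(int m, k)\<close> as
    base point and \<open>p\<close> as the far point, so that the innermost factor lives in the
    strip \<open>T2\<close> between the two columns.\<close>
  also have "\<dots> \<le> (\<Sum>p\<in>c1. cor t (gridE R) (0, 0) p * (\<Sum>q\<in>c2. cor t (gridE T1) (int m, k) q * cor t (gridE T2) q p))"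
  proof (intro sum_mono mult_left_mono cor_nonneg t(3))
    fix p assume p: "p \<in> c1"
    have "cor t (gridE T1) (int m, k) p \<le> (\<Sum>q\<in>c2. cor t (gridE T1) (int m, k) q * cor t (gridE T2) q p)"
    proof (rule cor_simon_lieb[where T=T2])
      show "gridE T2 \<subseteq> gridE T1" by (rule gridE_mono[OF T1R(2)])
      show "(int m, k) \<in> c2" if "(int m, k) \<in> T2" unfolding c2_def using B by (intro image_eqI[of _ _ k]) auto
      show "e \<subseteq> T2" if "e \<in> gridE T2" for e using that unfolding gridE_iff by auto
      show "e \<inter> T2 \<subseteq> c2" if e: "e \<in> gridE T1 - gridE T2" for e
      proof -
        obtain x y where xy: "e = {(x, y), (x + 1, y)} \<or> e = {(x, y), (x, y + 1)}" using DiffD1[OF e] unfolding gridE_iff by blast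
        have n: "\<not> e \<subseteq> T2" using e xy gridE_h[of x y T2] gridE_v[of x y T2] by auto
        have "e \<subseteq> T1" using DiffD1[OF e] unfolding gridE_iff by auto
        then show ?thesis using xy n unfolding T1_def T2_def c2_def rect_def by (elim disjE) auto
      qed
    qed (use gT t inT p col in \<open>auto simp: c2_def\<close>)
    then show "cor t (gridE T1) p (int m, k) \<le> (\<Sum>q\<in>c2. cor t (gridE T1) (int m, k) q * cor t (gridE T2) q p)"
      by (simp add: cor_commute)
  qed
  also have "\<dots> = (\<Sum>j\<in>?J. \<Sum>i\<in>?J. cor t (gridE R) (0, 0) (0, j) * (cor t (gridE T1) (int m, k) (int m, i) * cor t (gridE T2) (int m, i) (0, j)))"
    unfolding c1_def c2_def sum_distrib_left by (simp add: sum.reindex inj_on_def)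
  also have "\<dots> \<le> (\<Sum>j\<in>?J. \<Sum>i\<in>?J. exp (- \<kappa> * \<bar>real_of_int j\<bar>) * (exp (- \<kappa> * \<bar>real_of_int (i - k)\<bar>) * Xs t m (i - j)))"
  proof (intro sum_mono mult_mono mult_nonneg_nonneg cor_nonneg t(3) Xs_nonneg t(4))
    fix i j assume ij: "j \<in> ?J" "i \<in> ?J"
    show "cor t (gridE R) (0, 0) (0, j) \<le> exp (- \<kappa> * \<bar>real_of_int j\<bar>)"
      using ij col[of "(0, j)"] inT by (intro cor_decay_column) (auto simp: c1_def R_def)
    show "cor t (gridE T1) (int m, k) (int m, i) \<le> exp (- \<kappa> * \<bar>real_of_int (i - k)\<bar>)"
      using ij col[of "(int m, i)"] inT by (intro cor_column_shift) (auto simp: c2_def T1_def)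
    show "cor t (gridE T2) (int m, i) (0, j) \<le> Xs t m (i - j)"
      unfolding cor_commute[of t _ "(int m, i)"] by (rule cor_le_Xs) (auto simp: t T2_def rect_def)
  qed auto
  finally show ?thesis by (rule that)
qed

definition "C_moderate = C_tilt * Binf^2"
definition "C_far = 1 / c_axis"

lemma C_nonneg: "0 \<le> C_moderate" "0 < C_far" unfolding C_moderate_def C_far_def using C_tilt Binf c_axis by auto

text \<open>\<open>tilt\<close> is used at height \<open>i - j\<close>; its deviation from height
  \<open>k\<close> costs at most \<open>exp (s1 * (\<bar>j\<bar> + \<bar>i - k\<bar>))\<close>,
  which the decay at rate \<open>\<kappa>\<close> along the columns absorbs since
  \<open>s1 < \<kappa>\<close>. The exponents combine to \<open>\<kappa> * k^2 / (3 * m) - s * k = -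
  \<kappa> * k^2 / (3 * m)\<close>.\<close>

lemma cor_moderate:
  assumes m: "0 < m" and k: "sqrt (real m) \<le> real_of_int k" "real_of_int k \<le> 3/2 * s1 / \<kappa> * real m" and S: "finite S"
  shows "cor t (gridE S) (0, 0) (int m, k) \<le> C_moderate * (k / sqrt (real m)) * exp (- \<kappa> * (real_of_int k)^2 / (3 * real m)) * Xs t m 0"
proof -
  let ?k = "real_of_int k"
  have rm: "0 < real m" using m by simp
  have "0 < sqrt (real m)" using m by simp
  then have kp: "0 < ?k" using k(1) by linarith
  define s where "s = 2/3 * \<kappa> * ?k / real m"
  have s: "0 \<le> s" "s \<le> s1" unfolding s_def using kp kap rm k(2) by (auto simp: field_simps)
  define D where "D = C_tilt * (?k / sqrt (real m)) * exp (\<kappa> * ?k^2 / (3 * real m)) * Xs t m 0"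
  have D0: "0 \<le> D" unfolding D_def using C_tilt kp rm Xs_nonneg[OF t(3,4)] by simp
  have X: "Xs t m j \<le> D * exp (- s * real_of_int j)" for j
    using tilt[OF m k, of j] unfolding D_def s_def by (simp add: mult_ac)
  obtain B where B: "cor t (gridE S) (0, 0) (int m, k) \<le> (\<Sum>j\<in>{- int B..int B}. \<Sum>i\<in>{- int B..int B}.
    exp (- \<kappa> * \<bar>real_of_int j\<bar>) * (exp (- \<kappa> * \<bar>real_of_int (i - k)\<bar>) * Xs t m (i - j)))" by (rule cor_two_columns[OF S])
  let ?J = "{- int B..int B}"
  let ?g = "\<lambda>j. exp (- (\<kappa> - s1) * \<bar>real_of_int j\<bar>)"
  note B
  also have "(\<Sum>j\<in>?J. \<Sum>i\<in>?J. exp (- \<kappa> * \<bar>real_of_int j\<bar>) * (exp (- \<kappa> * \<bar>real_of_int (i - k)\<bar>) * Xs t m (i - j))) \<le>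
     (\<Sum>j\<in>?J. \<Sum>i\<in>?J. (D * exp (- s * ?k)) * (?g j * ?g (i - k)))"
  proof (intro sum_mono)
    fix i j
    have "exp (- \<kappa> * \<bar>real_of_int j\<bar>) * (exp (- \<kappa> * \<bar>real_of_int (i - k)\<bar>) * Xs t m (i - j)) \<le>
      exp (- \<kappa> * \<bar>real_of_int j\<bar>) * (exp (- \<kappa> * \<bar>real_of_int (i - k)\<bar>) * (D * exp (- s * real_of_int (i - j))))"
      by (intro mult_left_mono X) auto
    also have "\<dots> = D * exp (- \<kappa> * \<bar>real_of_int j\<bar> + (- \<kappa> * \<bar>real_of_int (i - k)\<bar> + - s * real_of_int (i - j)))"
      by (simp only: exp_add mult_ac)
    also have "\<dots> \<le> D * exp (- s * ?k + (- (\<kappa> - s1) * \<bar>real_of_int j\<bar> + - (\<kappa> - s1) * \<bar>real_of_int (i - k)\<bar>))"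
    proof -
      have a: "s * x \<le> s1 * \<bar>x\<bar>" for x
        using s mult_left_mono[of x "\<bar>x\<bar>" s] mult_right_mono[of s s1 "\<bar>x\<bar>"] by linarith
      have "- s * real_of_int (i - j) = - s * ?k + s * real_of_int j + s * (- real_of_int (i - k))" by (simp add: algebra_simps)
      also have "\<dots> \<le> - s * ?k + s1 * \<bar>real_of_int j\<bar> + s1 * \<bar>real_of_int (i - k)\<bar>"
      proof -
        have "s * (- x) \<le> s1 * \<bar>x\<bar>" for x using a[of "- x"] by simp
        from this[of "real_of_int (i - k)"] a[of "real_of_int j"] show ?thesis by linarith
      qed
      finally show ?thesis using D0 by (intro mult_left_mono) (simp_all add: algebra_simps)
    qed
    also have "\<dots> = (D * exp (- s * ?k)) * (?g j * ?g (i - k))" by (simp only: exp_add mult_ac)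
    finally show "exp (- \<kappa> * \<bar>real_of_int j\<bar>) * (exp (- \<kappa> * \<bar>real_of_int (i - k)\<bar>) * Xs t m (i - j)) \<le>
      (D * exp (- s * ?k)) * (?g j * ?g (i - k))" .
  qed
  also have "\<dots> = (D * exp (- s * ?k)) * ((\<Sum>j\<in>?J. ?g j) * (\<Sum>i\<in>?J. ?g (i - k)))"
    by (subst sum_product, simp only: sum_distrib_left)
  also have "\<dots> \<le> (D * exp (- s * ?k)) * (Binf * Binf)"
  proof (intro mult_left_mono mult_mono Binf)
    have "(\<Sum>i\<in>?J. ?g (i - k)) = (\<Sum>i\<in>(\<lambda>i. i - k) ` ?J. ?g i)" by (subst sum.reindex) (auto simp: inj_on_def)
    then show "(\<Sum>i\<in>?J. ?g (i - k)) \<le> Binf" using Binf(1)[of "(\<lambda>i. i - k) ` ?J"] by simp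
  qed (auto intro!: sum_nonneg mult_nonneg_nonneg D0)
  also have "\<dots> = C_moderate * (?k / sqrt (real m)) * (exp (\<kappa> * ?k^2 / (3 * real m)) * exp (- s * ?k)) * Xs t m 0"
    unfolding D_def C_moderate_def by (simp add: power2_eq_square)
  also have "exp (\<kappa> * ?k^2 / (3 * real m)) * exp (- s * ?k) = exp (- \<kappa> * ?k^2 / (3 * real m))"
  proof -
    have "\<kappa> * ?k^2 / (3 * real m) + - s * ?k = - \<kappa> * ?k^2 / (3 * real m)"
      unfolding s_def using rm by (simp add: power2_eq_square field_simps)
    then show ?thesis by (simp only: exp_add[symmetric])
  qed
  finally show ?thesis .
qed

text \<open>The factor \<open>sqrt m\<close> lost against the axis correlation is kept; for large
  \<open>k / m\<close> the exponential absorbs it later.\<close>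

lemma cor_far:
  assumes m: "0 < m" and S: "finite S"
  shows "cor t (gridE S) (0, 0) (int m, k) \<le> C_far * sqrt (real m) * exp (- \<kappa> * (sqrt ((real m)^2 + (real_of_int k)^2) - real m)) * Xs t m 0"
proof -
  let ?S = "insert (0, 0) (insert (int m, k) S)"
  let ?e = "exp (- \<kappa> * (sqrt ((real m)^2 + (real_of_int k)^2) - real m))"
  have "cor t (gridE S) (0, 0) (int m, k) \<le> cor t (gridE ?S) (0, 0) (int m, k)"
    using S t by (intro cor_mono gridE_graph gridE_mono) auto
  also have "\<dots> \<le> exp (- real m * tau0 - \<kappa> * (sqrt ((real m)^2 + (real_of_int k)^2) - real m))"
    using cor_decay[of "int m" ?S k] m S by simp
  also have "\<dots> \<le> exp (- (real m * ln lam0) + - \<kappa> * (sqrt ((real m)^2 + (real_of_int k)^2) - real m))"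
    using mult_left_mono[OF tau0_lam0, of "real m"] by simp
  also have "\<dots> = 1 / lam0 ^ m * ?e"
    unfolding exp_add exp_minus[of "real m * ln lam0"] exp_of_nat_mult using lam0 by (simp add: inverse_eq_divide)
  also have "\<dots> \<le> (C_far * sqrt (real m) * Xs t m 0) * ?e"
  proof (rule mult_right_mono)
    show "1 / lam0 ^ m \<le> C_far * sqrt (real m) * Xs t m 0"
      using Xs_lower[OF m] c_axis lam0 m unfolding C_far_def by (simp add: field_simps)
  qed simp
  finally show ?thesis by (simp add: mult_ac)
qed

end

section \<open>From the two regimes to the stated bounds\<close>

text \<open>The excess of the hypotenuse over a leg shrinks as the leg grows, which permits passing
  from the width \<open>m\<close> to \<open>l\<close> or \<open>h\<close>.\<close>

lemma excess_mono:
  assumes "0 \<le> m" "m \<le> (l::real)"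
  shows "sqrt (l^2 + k^2) - l \<le> sqrt (m^2 + k^2) - m"
proof -
  let ?s = "sqrt (m^2 + k^2)"
  have "m \<le> ?s" using assms(1) by (intro real_le_rsqrt) auto
  then have "m * (l - m) \<le> ?s * (l - m)" using assms by (intro mult_right_mono) auto
  moreover have "(?s + (l - m))^2 = m^2 + k^2 + 2 * (?s * (l - m)) + (l - m)^2"
    by (simp add: power2_sum)
  moreover have "m^2 + k^2 + 2 * (m * (l - m)) + (l - m)^2 = l^2 + k^2" by (simp add: power2_eq_square algebra_simps)
  ultimately have "l^2 + k^2 \<le> (?s + (l - m))^2" by linarith
  moreover have "0 \<le> ?s" by simp
  ultimately have "sqrt (l^2 + k^2) \<le> ?s + (l - m)" using assms by (intro real_le_lsqrt) auto
  then show ?thesis by simp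
qed

text \<open>\<open>(1 + 6/5 * w)^2 \<le> 1 + 4 * w\<close> on \<open>[0, 1]\<close>, with
  \<open>w = (g / l)^2\<close>. The factor 6/5 leaves a sixth of the exponent for polynomial
  factors.\<close>

lemma excess_quadratic:
  assumes "0 \<le> g" "g \<le> (l::real)" "0 < l"
  shows "6/5 * (g^2 / l) \<le> sqrt (l^2 + (2 * g)^2) - l"
proof -
  define u where "u = g / l"
  have u: "0 \<le> u" "u \<le> 1" "g = u * l" unfolding u_def using assms by auto
  have u2: "u^2 \<le> 1" "0 \<le> u^2" using u by (auto intro: power_le_one)
  have "(1 + 6/5 * w)^2 \<le> 1 + 4 * w" if w: "0 \<le> w" "w \<le> 1" for w :: real
  proof -
    have "w * w \<le> 1 * w" using w by (intro mult_right_mono) auto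
    moreover have "(1 + 6/5 * w)^2 = 1 + 12/5 * w + 36/25 * (w * w)" by (simp add: power2_eq_square algebra_simps)
    ultimately show ?thesis using w by linarith
  qed
  from this[OF u2(2,1)] have "(1 + 6/5 * u^2)^2 \<le> 1 + 4 * u^2" .
  then have "l^2 * (1 + 6/5 * u^2)^2 \<le> l^2 * (1 + 4 * u^2)" by (intro mult_left_mono) auto
  moreover have "(l + 6/5 * (g^2 / l))^2 = l^2 * (1 + 6/5 * u^2)^2" 
  proof -
    have "l + 6/5 * (g^2 / l) = l * (1 + 6/5 * u^2)" unfolding u(3) using assms(3) by (simp add: power2_eq_square algebra_simps)
    then show ?thesis by (simp add: power_mult_distrib)
  qed
  moreover have "l^2 * (1 + 4 * u^2) = l^2 + (2 * g)^2" unfolding u(3) by (simp add: power2_eq_square algebra_simps)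
  ultimately have "l + 6/5 * (g^2 / l) \<le> sqrt (l^2 + (2 * g)^2)" by (intro real_le_rsqrt) linarith
  then show ?thesis by simp
qed

text \<open>\<open>g\<close> stands for the integer part of \<open>h\<close> and may fall short of
  it by 1; the constant 3 absorbs this.\<close>

lemma excess_linear:
  assumes "1 \<le> h" "h - 1 \<le> (g::real)" "0 \<le> g"
  shows "6/5 * h - 3 \<le> sqrt (h^2 + (2 * g)^2) - h"
proof -
  have "(h - 1)^2 \<le> g^2" using assms by (intro power_mono) auto
  moreover have "1 \<le> h^2" using assms by simp
  moreover have "(11/5 * h - 3)^2 = 121/25 * h^2 - 66/5 * h + 9" "(h - 1)^2 = h^2 - 2 * h + 1"
    by (simp_all add: power2_eq_square algebra_simps)
  moreover have "(2 * g)^2 = 4 * g^2" by simp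
  ultimately have "(11/5 * h - 3)^2 \<le> h^2 + (2 * g)^2" using assms(1) by linarith
  then have "11/5 * h - 3 \<le> sqrt (h^2 + (2 * g)^2)" by (rule real_le_rsqrt)
  then show ?thesis by simp
qed

lemma le_exp_mult: "0 < c \<Longrightarrow> x \<le> exp (c * x) / (c::real)"
proof -
  assume c: "0 < c"
  have "c * x \<le> exp (c * x)" using exp_ge_add_one_self[of "c * x"] by linarith
  then show ?thesis using c by (simp add: field_simps)
qed

context low_temp
begin

text \<open>\<open>delta\<close> is the ratio \<open>k / m\<close> up to which \<open>tilt\<close>
  applies; beyond it, the excess is at least \<open>c_slope * k\<close>.\<close>

definition "delta = 3/2 * s1 / \<kappa>"
definition "c_slope = 1 / (1 + 2 / delta)"
text \<open>One summand for each regime of \<open>k\<close>: below \<open>sqrt m\<close>, moderate,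
  and of order at least \<open>m\<close>.\<close>

definition "Cfin = exp \<kappa> + C_moderate * (12 / \<kappa>) * exp (2 * \<kappa>) + C_far * (6 / (delta * (\<kappa> * c_slope))) * exp (5/2 * \<kappa>)"

lemma delta: "0 < delta" "delta \<le> 9/20" "0 < c_slope"
  unfolding delta_def c_slope_def using s1 kap by (auto simp: field_simps add_pos_pos)

lemma Cfin: "exp \<kappa> \<le> Cfin" "C_moderate * (12 / \<kappa>) * exp (2 * \<kappa>) \<le> Cfin" "C_far * (6 / (delta * (\<kappa> * c_slope))) * exp (5/2 * \<kappa>) \<le> Cfin"
proof -
  have "0 \<le> C_moderate * (12 / \<kappa>) * exp (2 * \<kappa>)" "0 \<le> C_far * (6 / (delta * (\<kappa> * c_slope))) * exp (5/2 * \<kappa>)"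
    using C_nonneg delta kap by (auto intro!: mult_nonneg_nonneg)
  moreover have "0 \<le> exp \<kappa>" by simp
  ultimately show "exp \<kappa> \<le> Cfin" "C_moderate * (12 / \<kappa>) * exp (2 * \<kappa>) \<le> Cfin"
    "C_far * (6 / (delta * (\<kappa> * c_slope))) * exp (5/2 * \<kappa>) \<le> Cfin" unfolding Cfin_def by linarith+
qed

text \<open>\<open>PX\<close> says that any bound on the numerator, uniform in the finite graph,
  bounds \<open>P\<close> times the axis correlation; this separates the probabilistic part from the
  analysis of the three regimes of \<open>k\<close>.\<close>

lemma final_estimate:
  fixes P h l :: real
  assumes P: "P \<le> 1" and m: "0 < m" "real m \<le> l" and h: "1 \<le> \<lfloor>h\<rfloor>"
    and PX: "\<And>Q. (\<And>S. finite S \<Longrightarrow> cor t (gridE S) (0, 0) (int m, 2 * \<lfloor>h\<rfloor>) \<le> Q) \<Longrightarrow> P * Xs t m 0 \<le> Q"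
  shows "h \<le> l \<Longrightarrow> P \<le> Cfin * exp (- \<kappa> * (h^2 / l))" "l \<le> h \<Longrightarrow> P \<le> Cfin * exp (- \<kappa> * h)"
proof -
  define H where "H = real_of_int \<lfloor>h\<rfloor>"
  have H: "1 \<le> H" "H \<le> h" "h - 1 \<le> H" unfolding H_def using h floor_correct[of h] by linarith+
  have h1: "1 \<le> h" using H by linarith
  define k where "k = 2 * H"
  have kH: "real_of_int (2 * \<lfloor>h\<rfloor>) = k" unfolding k_def H_def by simp
  have rm: "1 \<le> real m" "0 < l" "1 \<le> l" using m by auto
  have X0: "0 < Xs t m 0" by (rule Xs_pos[OF m(1)])
  have H2: "h^2 - 2 * h \<le> H^2"
  proof -
    have "(h - 1)^2 \<le> H^2" using h1 H by (intro power_mono) auto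
    then show ?thesis by (simp add: power2_eq_square algebra_simps)
  qed
  have hl2: "h^2 / l - 2 \<le> H^2 / l" if "h \<le> l"
  proof -
    have "(h^2 - 2 * h) / l \<le> H^2 / l" using H2 rm by (intro divide_right_mono) auto
    moreover have "2 * h / l \<le> 2" using that rm by (simp add: pos_divide_le_eq)
    ultimately show ?thesis by (simp add: diff_divide_distrib)
  qed
  consider "k < sqrt (real m)" | "sqrt (real m) \<le> k" "k \<le> delta * real m" | "delta * real m < k" by linarith
  then have "(h \<le> l \<longrightarrow> P \<le> Cfin * exp (- \<kappa> * (h^2 / l))) \<and> (l \<le> h \<longrightarrow> P \<le> Cfin * exp (- \<kappa> * h))"
  proof cases
    case 1
    \<comment> \<open>In this regime \<open>h^2 < l\<close>, so the exponent is at most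
      \<open>\<kappa>\<close> and \<open>P \<le> 1\<close> suffices.\<close>
    have hk: "h \<le> k" unfolding k_def using H by linarith
    have "k^2 < (sqrt (real m))^2" using 1 h1 hk by (intro power_strict_mono) auto
    then have "k^2 < l" using m by simp
    moreover have "h^2 \<le> k^2" using hk h1 by (intro power_mono) auto
    ultimately have hl: "h^2 < l" by linarith
    have "h * 1 \<le> h * h" using h1 by (intro mult_left_mono) auto
    then have "h < l" using hl by (simp add: power2_eq_square)
    moreover have "P \<le> Cfin * exp (- \<kappa> * (h^2 / l))"
    proof -
      have "h^2 / l \<le> 1" using hl rm by simp
      then have "\<kappa> * (h^2 / l) \<le> \<kappa> * 1" using kap by (intro mult_left_mono) auto
      then have "1 \<le> exp \<kappa> * exp (- \<kappa> * (h^2 / l))" by (simp flip: exp_add)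
      also have "\<dots> \<le> Cfin * exp (- \<kappa> * (h^2 / l))" by (intro mult_right_mono Cfin) auto
      finally show ?thesis using P by linarith
    qed
    ultimately show ?thesis by auto
  next
    case 2
    define y where "y = k / sqrt (real m)"
    have y: "1 \<le> y" "y^2 = k^2 / real m" unfolding y_def using 2(1) rm by (auto simp: power_divide)
    have "P * Xs t m 0 \<le> C_moderate * y * exp (- \<kappa> * k^2 / (3 * real m)) * Xs t m 0"
      using cor_moderate[OF m(1), of "2 * \<lfloor>h\<rfloor>"] 2 unfolding kH delta_def y_def by (intro PX) auto
    then have "P \<le> C_moderate * y * exp (- \<kappa> * k^2 / (3 * real m))" using X0 by simp
    \<comment> \<open>Of the coefficient 1/3 of \<open>\<kappa> * y^2\<close>, 1/12 is spent on the
      prefactor \<open>y\<close>; the remaining \<open>y^2 / 4\<close> is exactly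
      \<open>H^2 / m\<close>.\<close>
    also have "- \<kappa> * k^2 / (3 * real m) = - (\<kappa> / 3) * y^2" unfolding y(2) by simp
    also have "C_moderate * y * exp (- (\<kappa> / 3) * y^2) \<le> C_moderate * (exp (\<kappa> / 12 * y^2) / (\<kappa> / 12)) * exp (- (\<kappa> / 3) * y^2)"
    proof (intro mult_right_mono mult_left_mono C_nonneg)
      have "y \<le> y^2" using y(1) by (simp add: power2_eq_square)
      also have "\<dots> \<le> exp (\<kappa> / 12 * y^2) / (\<kappa> / 12)" using kap by (intro le_exp_mult) auto
      finally show "y \<le> exp (\<kappa> / 12 * y^2) / (\<kappa> / 12)" .
    qed auto
    also have "\<dots> = C_moderate * (12 / \<kappa>) * (exp (\<kappa> / 12 * y^2) * exp (- (\<kappa> / 3) * y^2))" by simp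
    also have "exp (\<kappa> / 12 * y^2) * exp (- (\<kappa> / 3) * y^2) = exp (- \<kappa> * (y^2 / 4))" by (simp flip: exp_add)
    finally have PP: "P \<le> C_moderate * (12 / \<kappa>) * exp (- \<kappa> * (y^2 / 4))" .
    have Hm: "y^2 / 4 = H^2 / real m" unfolding y(2) k_def by simp
    \<comment> \<open>A moderate \<open>k\<close> forces \<open>h < l\<close>, so the second claim
      is vacuous here.\<close>
    have "k \<le> 9/20 * real m" using 2(2) delta mult_right_mono[of delta "9/20" "real m"] by linarith
    then have "h < l" using H m h1 unfolding k_def by linarith
    moreover have "P \<le> Cfin * exp (- \<kappa> * (h^2 / l))" if hl: "h \<le> l"
    proof -
      have "H^2 / l \<le> H^2 / real m" using m by (intro divide_left_mono) auto
      then have "h^2 / l - 2 \<le> y^2 / 4" using hl2[OF hl] Hm by linarith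
      then have "\<kappa> * (h^2 / l - 2) \<le> \<kappa> * (y^2 / 4)" using kap by (intro mult_left_mono) auto
      then have "exp (- \<kappa> * (y^2 / 4)) \<le> exp (2 * \<kappa> + - \<kappa> * (h^2 / l))" by (simp only: right_diff_distrib exp_le_cancel_iff mult_minus_left, linarith?)
      then have "C_moderate * (12 / \<kappa>) * exp (- \<kappa> * (y^2 / 4)) \<le> C_moderate * (12 / \<kappa>) * exp (2 * \<kappa> + - \<kappa> * (h^2 / l))"
        using C_nonneg kap by (intro mult_left_mono) auto
      also have "\<dots> = C_moderate * (12 / \<kappa>) * exp (2 * \<kappa>) * exp (- \<kappa> * (h^2 / l))" by (simp only: exp_add mult.assoc)
      also have "\<dots> \<le> Cfin * exp (- \<kappa> * (h^2 / l))" by (intro mult_right_mono Cfin) auto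
      finally show ?thesis using PP by linarith
    qed
    ultimately show ?thesis by auto
  next
    case 3
    define A where "A = sqrt ((real m)^2 + k^2) - real m"
    have "P * Xs t m 0 \<le> C_far * sqrt (real m) * exp (- \<kappa> * A) * Xs t m 0"
      using cor_far[OF m(1), of _ "2 * \<lfloor>h\<rfloor>"] unfolding kH A_def by (intro PX) auto
    then have P1: "P \<le> C_far * sqrt (real m) * exp (- \<kappa> * A)" using X0 by simp
    have k0: "0 < k" unfolding k_def using H by simp
    have mk: "real m \<le> k / delta" using 3 delta by (simp add: field_simps)
    \<comment> \<open>\<open>A = k^2 / (sqrt (m^2 + k^2) + m)\<close>, and the denominator is at
      most \<open>k * (1 + 2 / delta)\<close> because \<open>m \<le> k / delta\<close>.\<close>
    have Ak: "c_slope * k \<le> A"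
    proof -
      let ?s = "sqrt ((real m)^2 + k^2)"
      have "?s \<le> real m + k" using k0 by (intro real_le_lsqrt) (auto simp: power2_sum)
      moreover have "k * (1 + 2 / delta) = k + 2 * (k / delta)" by (simp add: algebra_simps)
      ultimately have d: "?s + real m \<le> k * (1 + 2 / delta)" using mk by linarith
      have "(?s - real m) * (?s + real m) = k^2" by (simp add: square_diff_square_factored[symmetric] algebra_simps flip: power2_eq_square)
      moreover have "0 \<le> A" unfolding A_def using real_le_rsqrt[of "real m" "(real m)^2 + k^2"] by simp
      then have "(?s - real m) * (?s + real m) \<le> A * (k * (1 + 2 / delta))" using d unfolding A_def by (intro mult_left_mono) auto
      ultimately have "k * k \<le> k * (A * (1 + 2 / delta))" by (simp add: power2_eq_square mult_ac)
      then have "k \<le> A * (1 + 2 / delta)" using k0 by simp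
      moreover have "0 < 1 + 2 / delta" using delta by (simp add: add_pos_pos)
      ultimately show ?thesis unfolding c_slope_def by (simp add: field_simps)
    qed
    have sm: "sqrt (real m) \<le> 6 / (delta * (\<kappa> * c_slope)) * exp (\<kappa> / 6 * A)"
    proof -
      have c: "0 < \<kappa> / 6 * c_slope" using kap delta by simp
      have "sqrt (real m) \<le> real m" using rm by (intro real_le_lsqrt) (auto simp: power2_eq_square)
      also have "\<dots> \<le> k / delta" by (rule mk)
      also have "\<dots> \<le> (exp (\<kappa> / 6 * c_slope * k) / (\<kappa> / 6 * c_slope)) / delta" using delta le_exp_mult[OF c] by (intro divide_right_mono) auto
      also have "\<dots> = 6 / (delta * (\<kappa> * c_slope)) * exp (\<kappa> / 6 * c_slope * k)" by (simp add: mult_ac)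
      also have "\<dots> \<le> 6 / (delta * (\<kappa> * c_slope)) * exp (\<kappa> / 6 * A)"
      proof (rule mult_left_mono)
        have "\<kappa> / 6 * (c_slope * k) \<le> \<kappa> / 6 * A" using Ak kap by (intro mult_left_mono) auto
        then show "exp (\<kappa> / 6 * c_slope * k) \<le> exp (\<kappa> / 6 * A)" by (simp add: mult.assoc)
      qed (use delta kap in auto)
      finally show ?thesis .
    qed
    have PP: "P \<le> C_far * (6 / (delta * (\<kappa> * c_slope))) * exp (- (5/6) * (\<kappa> * A))"
    proof -
      have "C_far * sqrt (real m) * exp (- \<kappa> * A) \<le> C_far * (6 / (delta * (\<kappa> * c_slope)) * exp (\<kappa> / 6 * A)) * exp (- \<kappa> * A)"
        using sm C_nonneg by (intro mult_right_mono mult_left_mono) auto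
      also have "\<dots> = C_far * (6 / (delta * (\<kappa> * c_slope))) * (exp (\<kappa> / 6 * A) * exp (- \<kappa> * A))" by simp
      also have "exp (\<kappa> / 6 * A) * exp (- \<kappa> * A) = exp (- (5/6) * (\<kappa> * A))" by (simp flip: exp_add)
      finally show ?thesis using P1 by linarith
    qed
    \<comment> \<open>Five sixths of the excess remain after absorbing \<open>sqrt m\<close>; the
      allowance 5/2 covers the rounding of \<open>h\<close> in both claims.\<close>
    have fin: "P \<le> Cfin * exp (- \<kappa> * z)" if z: "z - 5/2 \<le> 5/6 * A" for z
    proof -
      have "\<kappa> * (z - 5/2) \<le> \<kappa> * (5/6 * A)" using z kap by (intro mult_left_mono) auto
      then have "exp (- (5/6) * (\<kappa> * A)) \<le> exp (5/2 * \<kappa> + - \<kappa> * z)" by (simp only: right_diff_distrib exp_le_cancel_iff mult_minus_left, linarith?)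
      then have "C_far * (6 / (delta * (\<kappa> * c_slope))) * exp (- (5/6) * (\<kappa> * A)) \<le> C_far * (6 / (delta * (\<kappa> * c_slope))) * exp (5/2 * \<kappa> + - \<kappa> * z)"
        using C_nonneg delta kap by (intro mult_left_mono) auto
      also have "\<dots> = C_far * (6 / (delta * (\<kappa> * c_slope))) * exp (5/2 * \<kappa>) * exp (- \<kappa> * z)" by (simp only: exp_add mult.assoc)
      also have "\<dots> \<le> Cfin * exp (- \<kappa> * z)" by (intro mult_right_mono Cfin) auto
      finally show ?thesis using PP by linarith
    qed
    have "P \<le> Cfin * exp (- \<kappa> * (h^2 / l))" if hl: "h \<le> l"
    proof (rule fin)
      have "6/5 * (H^2 / l) \<le> sqrt (l^2 + k^2) - l" unfolding k_def using H hl rm by (intro excess_quadratic) auto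
      also have "\<dots> \<le> A" unfolding A_def using m by (intro excess_mono) auto
      finally show "h^2 / l - 5/2 \<le> 5/6 * A" using hl2[OF hl] by linarith
    qed
    moreover have "P \<le> Cfin * exp (- \<kappa> * h)" if hl: "l \<le> h"
    proof (rule fin)
      have "6/5 * h - 3 \<le> sqrt (h^2 + k^2) - h" unfolding k_def using H h1 by (intro excess_linear) auto
      also have "\<dots> \<le> A" unfolding A_def using m hl by (intro excess_mono) auto
      finally show "h - 5/2 \<le> 5/6 * A" by linarith
    qed
    ultimately show ?thesis by blast
  qed
  then show "h \<le> l \<Longrightarrow> P \<le> Cfin * exp (- \<kappa> * (h^2 / l))" "l \<le> h \<Longrightarrow> P \<le> Cfin * exp (- \<kappa> * h)" by blast+
qed

end

section \<open>The open contour\<close>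

lemma joined_sym: "joined E e f \<Longrightarrow> joined E f e"
proof -
  assume j: "joined E e f"
  have c: "{f, e} = {e, f}" by (rule insert_commute)
  show ?thesis using j unfolding joined_def joined_at_def c by blast
qed

lemma partner_unique: "{e, f} \<subseteq> {x, y} \<Longrightarrow> {e, g} \<subseteq> {x, y} \<Longrightarrow> e \<noteq> f \<Longrightarrow> e \<noteq> g \<Longrightarrow> f = g"
  by auto

lemma partner_unique': "{e, f} = {a, b} \<or> {e, f} = {c, d} \<Longrightarrow> {e, g} = {a, b} \<or> {e, g} = {c, d} \<Longrightarrow>
  distinct [a, b, c, d] \<Longrightarrow> f = g"
  by (auto simp: doubleton_eq_iff)

text \<open>Either exactly two edges meet at \<open>w\<close>, or the splitting rule pairs the four
  distinct directions; in both cases an edge has at most one partner there.\<close>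

lemma joined_at_unique:
  assumes "joined_at E w e f" "joined_at E w e g"
  shows "f = g"
proof (cases "card {g \<in> E. w \<in> g} = 2")
  case True
  then obtain x y where "{g \<in> E. w \<in> g} = {x, y}" "x \<noteq> y" unfolding card_2_iff by blast
  moreover have "{e, f} \<subseteq> {g \<in> E. w \<in> g}" "{e, g} \<subseteq> {g \<in> E. w \<in> g}" "e \<noteq> f" "e \<noteq> g"
    using assms unfolding joined_at_def by auto
  ultimately show ?thesis using partner_unique[of e f x y g] by simp
next
  case False
  then have "{e, f} = {north w, east w} \<or> {e, f} = {south w, west w}" "{e, g} = {north w, east w} \<or> {e, g} = {south w, west w}"
    using assms unfolding joined_at_def by auto
  then show ?thesis by (rule partner_unique') (use dirs_distinct[of w] in \<open>simp; metis\<close>)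
qed

lemma allD_doubleton:
  assumes "e \<in> allD"
  obtains p q where "e = {p, q}" "\<bar>snd p - snd q\<bar> \<le> 1"
proof -
  obtain u v where uv: "e = dual u v" "nn u v" using assms by blast
  from uv(2) show ?thesis
  proof (cases rule: nn_cases)
    case (1 x y)
    then have "e = {(x, y - 1), (x, y)}" using dual_set[OF 1] dual_horizontal[of x y] uv(1) by simp
    then show ?thesis by (rule that) simp
  next
    case (2 x y)
    then have "e = {(x - 1, y), (x, y)}" using dual_set[OF 2] dual_vertical[of x y] uv(1) by simp
    then show ?thesis by (rule that) simp
  qed
qed

text \<open>An edge of a loop is joined at both of its endpoints.\<close>

lemma unpaired_not_loop:
  assumes E: "E \<subseteq> allD" and e: "e \<in> E" "w \<in> e" and un: "\<And>f. \<not> joined_at E w e f"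
  shows "\<not> is_loop E {f. (joined E)\<^sup>*\<^sup>* e f}"
proof
  assume "is_loop E {f. (joined E)\<^sup>*\<^sup>* e f}"
  then obtain es where es: "length es \<ge> 3" "distinct es" "set es = {f. (joined E)\<^sup>*\<^sup>* e f}"
    "\<And>i. i < length es \<Longrightarrow> joined E (es ! i) (es ! (Suc i mod length es))" unfolding is_loop_def by blast
  have "e \<in> set es" unfolding es(3) by simp
  then obtain i where i: "i < length es" "es ! i = e" by (metis in_set_conv_nth)
  define n where "n = length es"
  define j where "j = (if i = 0 then n - 1 else i - 1)"
  have j: "j < n" "Suc j mod n = i" "j \<noteq> Suc i mod n" "Suc i mod n < n"
  proof -
    show "j < n" using i es(1) unfolding j_def n_def by auto
    show "Suc j mod n = i" using i es(1) unfolding j_def n_def by (auto simp: Suc_diff_Suc)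
    show "Suc i mod n < n" using es(1) unfolding n_def by (intro mod_less_divisor) auto
    show "j \<noteq> Suc i mod n"
    proof (cases "Suc i = n")
      case True
      then show ?thesis using es(1) unfolding j_def n_def by auto
    next
      case False
      then have "Suc i mod n = Suc i" using i unfolding n_def by simp
      then show ?thesis using es(1) i unfolding j_def n_def by auto
    qed
  qed
  let ?f = "es ! (Suc i mod n)" and ?g = "es ! j"
  have "?f \<noteq> ?g" using j es(2) by (simp add: nth_eq_iff_index_eq n_def)
  have "joined E e ?f" using es(4)[OF i(1)] i(2) by (simp add: n_def)
  moreover have "joined E ?g e" using es(4)[of j] j i(2) by (simp add: n_def)
  then have "joined E e ?g" by (rule joined_sym)
  moreover obtain p q where pq: "e = {p, q}" by (rule allD_doubleton[of e]) (use e E in auto)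
  ultimately obtain y where "joined_at E y e ?f" "joined_at E y e ?g"
  proof -
    assume a: "joined E e ?f" "joined E e ?g"
      and c: "\<And>y. joined_at E y e ?f \<Longrightarrow> joined_at E y e ?g \<Longrightarrow> thesis"
    obtain y1 y2 where y: "joined_at E y1 e ?f" "joined_at E y2 e ?g" using a unfolding joined_def by blast
    have "y1 \<noteq> w" "y2 \<noteq> w" using y un[of ?f] un[of ?g] by metis+
    moreover have "y1 \<in> e" "y2 \<in> e" using y by (simp_all add: joined_at_def)
    ultimately have "y1 \<in> e" "y2 \<in> e" "y1 \<noteq> w" "y2 \<noteq> w" by simp_all
    then have "y1 = y2" using pq e(2) by auto
    then show thesis using c y by blast
  qed
  then show False using joined_at_unique \<open>?f \<noteq> ?g\<close> by blast
qed

lemma contour_connected: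
  assumes E: "E \<subseteq> allD" and e: "e \<in> E" "w \<in> e" and f: "(joined E)\<^sup>*\<^sup>* e f" "v \<in> f"
  shows "conn E w v"
proof -
  have c: "conn E p q" if g: "g \<in> E" "p \<in> g" "q \<in> g" for g p q
  proof -
    obtain x y where "g = {x, y}" by (rule allD_doubleton[of g]) (use g E in auto)
    then have "p = q \<or> {p, q} = g" using g(2,3) by auto
    then show ?thesis using g(1) conn_edge[of p q E] by auto
  qed
  from f(1) have "\<forall>v\<in>f. conn E w v"
  proof (induction rule: rtranclp_induct)
    case base
    then show ?case using c e by blast
  next
    case (step g h)
    then obtain x where x: "x \<in> g" "x \<in> h" "h \<in> E" unfolding joined_def joined_at_def by blast
    have g: "g \<in> E" using connected_in[OF step(1) e(1)] .
    have "conn E w x" using step(3) x(1) by blast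
    then show ?case using c[OF x(3,2)] conn_trans[of E w x] by blast
  qed
  then show ?thesis using f(2) by blast
qed

lemma slit_mem: "(x, y) \<in> slit_strip l a b \<longleftrightarrow> 1 \<le> x \<and> x \<le> l \<and> ((y = 0 \<or> y = 1) \<longrightarrow> a < x \<and> x < b)"
  unfolding slit_strip_def by auto

lemma eta_strip_val: "eta_strip v = 1 \<or> eta_strip v = -1"
  unfolding eta_strip_def by auto

lemma bd_slit:
  assumes ab: "a + 1 < b" and S: "\<And>x. (x, 0) \<in> S \<or> (x, 1) \<in> S \<longleftrightarrow> a < x \<and> x < b"
  shows "bd (oE S eta_strip) = pr (a, 0) (b - 1, 0)"
proof (rule set_eqI)
  fix w :: site
  obtain i j where w: "w = (i, j)" by force
  have v: "dual (x, y) (x, y + 1) \<in> oE S eta_strip \<longleftrightarrow> y = 0 \<and> \<not> (a < x \<and> x < b)" for x y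
    unfolding oE_mem[OF nn_v] eta_strip_def using S[of x] by auto
  have h: "dual (x, y) (x + 1, y) \<notin> oE S eta_strip" for x y
    unfolding oE_mem[OF nn_h] eta_strip_def by auto
  show "w \<in> bd (oE S eta_strip) \<longleftrightarrow> w \<in> pr (a, 0) (b - 1, 0)"
    unfolding w bd_star[OF oE_sub(1)] dual_dirs v pr_def using h ab by auto
qed

text \<open>The southern edge is the unpaired one if three edges meet at the left endpoint, since no
  edge leaves it to the west.\<close>

lemma endpoint_unpaired:
  assumes E: "E \<subseteq> allD" and w: "w \<in> bd E" "west w \<notin> E"
  obtains e where "e \<in> E" "w \<in> e" "\<And>f. \<not> joined_at E w e f"
proof -
  have c: "card {e\<in>E. w \<in> e} = of_bool (east w \<in> E) + of_bool (south w \<in> E) + of_bool (north w \<in> E)"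
    unfolding card_star[OF E] using w(2) by simp
  then have o: "odd (of_bool (east w \<in> E) + of_bool (south w \<in> E) + of_bool (north w \<in> E) :: nat)"
    using w(1) unfolding bd_def by simp
  have n2: "card {e\<in>E. w \<in> e} \<noteq> 2" 
  proof
    assume "card {e\<in>E. w \<in> e} = 2"
    then show False using o unfolding c by simp
  qed
  note d = dirs_distinct[of w]
  define e where "e = (if south w \<in> E then south w else if east w \<in> E then east w else north w)"
  have e: "e \<in> E" "w \<in> e" using o unfolding e_def south_def east_def north_def by (auto split: if_splits)
  show ?thesis
  proof (rule that[OF e])
    fix f
    show "\<not> joined_at E w e f"
    proof
      assume "joined_at E w e f"
      then have f: "{e, f} = {north w, east w} \<or> {e, f} = {south w, west w}" "f \<in> E"
        using n2 unfolding joined_at_def by auto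
      show False
      proof (cases "south w \<in> E")
        case True
        then have "e = south w" unfolding e_def by simp
        then have "f = west w" using f(1) d by (auto simp: doubleton_eq_iff)
        then show False using f(2) w(2) by simp
      next
        case False
        then have "e = east w \<or> e = north w" unfolding e_def by auto
        then have "e \<notin> {south w, west w}" using d by (elim disjE) simp_all
        then have "{e, f} = {north w, east w}" using f(1) by blast
        moreover have "{e, f} \<subseteq> E" using e(1) f(2) by simp
        ultimately have "north w \<in> E" "east w \<in> E" by simp_all
        then show False using o False by simp
      qed
    qed
  qed
qed

text \<open>The contour of the unpaired edge at \<open>(a, 0)\<close> is open, so it is the unique
  open one whenever there is such; otherwise \<open>lambda_sites\<close> is empty and contains no
  \<open>v\<close>.\<close>

lemma lambda_sites_conn:
  assumes ab: "0 \<le> a" "a + 1 < b" "b \<le> l + 1"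
    and om: "\<And>v. \<omega> v = 1 \<or> \<omega> v = (-1::real)" "\<And>v. v \<notin> slit_strip l a b \<Longrightarrow> \<omega> v = eta_strip v"
    and v: "v \<in> lambda_sites l a b (restrict \<omega> (slit_strip l a b))"
  shows "conn (disagreement_edges (slit_strip l a b) \<omega>) (a, 0) v"
proof -
  let ?S = "slit_strip l a b"
  define E where "E = disagreement_edges ?S \<omega>"
  have o: "override_on eta_strip (restrict \<omega> ?S) ?S = \<omega>"
    unfolding override_on_def using om(2) by (auto simp: fun_eq_iff)
  have Es: "E \<subseteq> allD" unfolding E_def using dis_sub dE_sub by blast
  have "bd E = bd (oE ?S eta_strip)" unfolding E_def by (rule bd_dis[OF om])
  also have "\<dots> = pr (a, 0) (b - 1, 0)" using ab by (intro bd_slit) (auto simp: slit_mem)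
  finally have w: "(a, 0) \<in> bd E" using ab unfolding pr_def by auto
  have "west (a, 0) \<notin> E" unfolding E_def dual_dirs dis_mem[OF nn_v] by (simp add: slit_mem)
  from endpoint_unpaired[OF Es w this] obtain e where e: "e \<in> E" "(a, 0) \<in> e" "\<And>f. \<not> joined_at E (a, 0) e f" by blast
  let ?C = "{f. (joined E)\<^sup>*\<^sup>* e f}"
  have C: "?C \<in> open_contours E" unfolding open_contours_def contours_def
    using e(1) unpaired_not_loop[OF Es e] by blast
  have "v \<in> (if \<exists>!C. C \<in> open_contours E then \<Union> (THE C. C \<in> open_contours E) else {})"
    using v ab unfolding lambda_sites_def Let_def o E_def by simp
  then have ex: "\<exists>!C. C \<in> open_contours E" "v \<in> \<Union> (THE C. C \<in> open_contours E)" by (auto split: if_splits)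
  have "(THE C. C \<in> open_contours E) = ?C" by (rule the1_equality[OF ex(1) C])
  then obtain f where "(joined E)\<^sup>*\<^sup>* e f" "v \<in> f" using ex(2) by auto
  then show ?thesis using contour_connected[OF Es e(1,2)] unfolding E_def by blast
qed

definition below :: "int \<Rightarrow> dual_edge set" where
  "below H = {e. (\<forall>v\<in>e. snd v \<le> H) \<and> (\<exists>v\<in>e. snd v < H)}"

text \<open>The connection has to stay below the level, because the reflection principle sees only
  the edges of the lower half.\<close>

definition reach :: "int \<Rightarrow> dual_site \<Rightarrow> dual_edge set \<Rightarrow> bool" where
  "reach H w F \<longleftrightarrow> (\<exists>p. snd p = H \<and> conn (F \<inter> below H) w p)"

text \<open>The path is stopped when it first hits row \<open>H\<close>: a dual edge changes the row
  by at most 1, so until then the path stays in \<open>below H\<close>.\<close>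

lemma reachI:
  assumes E: "E \<subseteq> allD" and c: "conn E w p" and H: "snd w < H" "snd p = H"
  shows "reach H w E"
proof -
  from c have "reach H w E \<or> (snd p < H \<and> conn (E \<inter> below H) w p)"
  proof (induction rule: conn_induct)
    case base
    then show ?case using H(1) by simp
  next
    case (step v u)
    show ?case
    proof (cases "reach H w E")
      case False
      then have v: "snd v < H" "conn (E \<inter> below H) w v" using step by auto
      have "{v, u} \<in> allD" using step(2) E by blast
      then obtain x y where "{v, u} = {x, y}" "\<bar>snd x - snd y\<bar> \<le> 1" by (rule allD_doubleton)
      then have "\<bar>snd v - snd u\<bar> \<le> 1" by (auto simp: doubleton_eq_iff)
      then have u: "snd u \<le> H" using v(1) by linarith
      then have "{v, u} \<in> below H" unfolding below_def using v(1) by auto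
      then have "conn (E \<inter> below H) w u" using step(2) by (intro conn_step[OF v(2)]) auto
      then show ?thesis using u unfolding reach_def by (metis order_le_less)
    qed simp
  qed
  then show ?thesis using H(2) by auto
qed

section \<open>The slit strip in finite volume\<close>

lemma finite_configs:
  assumes "finite \<Lambda>"
  shows "finite (configs \<Lambda> \<eta>)" "card (configs \<Lambda> \<eta>) \<le> 2 ^ card \<Lambda>"
proof -
  let ?f = "\<lambda>T v. if v \<in> \<Lambda> then (if v \<in> T then 1 else -1) else \<eta> v"
  have s: "configs \<Lambda> \<eta> \<subseteq> ?f ` Pow \<Lambda>"
  proof
    fix \<omega> assume w: "\<omega> \<in> configs \<Lambda> \<eta>"
    have "\<omega> = ?f {v\<in>\<Lambda>. \<omega> v = 1}" using w unfolding configs_def by (auto simp: fun_eq_iff)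
    then show "\<omega> \<in> ?f ` Pow \<Lambda>" by blast
  qed
  then show "finite (configs \<Lambda> \<eta>)" by (rule finite_subset) (use assms in auto)
  have "card (configs \<Lambda> \<eta>) \<le> card (?f ` Pow \<Lambda>)" using s assms by (intro card_mono) auto
  also have "\<dots> \<le> card (Pow \<Lambda>)" using assms by (intro card_image_le) auto
  finally show "card (configs \<Lambda> \<eta>) \<le> 2 ^ card \<Lambda>" using assms by (simp add: card_Pow)
qed

locale slit =
  fixes l a b H n :: int
  assumes ab: "0 \<le> a" "a + 1 < b" "b \<le> l + 1" and H: "1 \<le> H" and n: "2 \<le> n"
begin

abbreviation "S \<equiv> slit_strip l a b"
text \<open>The top row is just high enough for the mirror images in row \<open>H\<close> of the
  lowest dual edges; the rows frozen later are \<open>- n\<close> and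
  \<open>rtop + 1\<close>.\<close>

definition "rtop = n + 2 * H + 1"
definition "\<Lambda> = {v \<in> S. - n < snd v \<and> snd v \<le> rtop}"

lemma mem: "(x, y) \<in> \<Lambda> \<longleftrightarrow> - n < y \<and> y \<le> rtop \<and> 1 \<le> x \<and> x \<le> l \<and> ((y = 0 \<or> y = 1) \<longrightarrow> a < x \<and> x < b)"
  unfolding \<Lambda>_def by (auto simp: slit_mem)

lemma sub: "\<Lambda> \<subseteq> {1..l} \<times> {- n + 1..rtop}" by (auto simp: mem)

lemma fin: "finite \<Lambda>" using sub by (rule finite_subset) auto

lemma conn_compl: "conn_compl \<Lambda>"
proof (rule conn_complI[OF sub])
  fix x y assume xy: "(x, y) \<in> {1..l} \<times> {- n + 1..rtop} - \<Lambda>"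
  then have y: "y = 0 \<or> y = 1" and x: "x \<le> a \<or> b \<le> x" by (auto simp: mem)
  from x show "\<exists>w. w \<notin> {1..l} \<times> {- n + 1..rtop} \<and> walk \<Lambda> (x, y) w"
  proof
    assume "x \<le> a"
    then have "walk \<Lambda> (x, y) (0, y)" using y xy by (intro walk_h) (auto simp: mem)
    then show ?thesis by (intro exI[of _ "(0, y)"]) auto
  next
    assume "b \<le> x"
    then have "walk \<Lambda> (x, y) (l + 1, y)" using y xy by (intro walk_h) (auto simp: mem)
    then show ?thesis by (intro exI[of _ "(l + 1, y)"]) auto
  qed
qed

lemma bd_oE: "bd (oE \<Lambda> eta_strip) = pr (a, 0) (b - 1, 0)"
  using ab n H by (intro bd_slit) (auto simp: mem rtop_def)

lemma edge_h: "{(i, j), (i + 1, j)} \<in> dE \<Lambda> \<longleftrightarrow> (i + 1, j) \<in> \<Lambda> \<or> (i + 1, j + 1) \<in> \<Lambda>"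
proof -
  have "{(i, j), (i + 1, j)} = dual (i + 1, j) (i + 1, j + 1)" using dual_vertical[of "i + 1" j] by simp
  then show ?thesis using dE_mem[OF nn_v, of "i + 1" j \<Lambda>] by simp
qed

lemma edge_v: "{(i, j - 1), (i, j)} \<in> dE \<Lambda> \<longleftrightarrow> (i, j) \<in> \<Lambda> \<or> (i + 1, j) \<in> \<Lambda>"
  using dE_mem[OF nn_h, of i j \<Lambda>] dual_horizontal[of i j] by simp

lemma edge_cases:
  assumes "e \<in> dE \<Lambda>"
  obtains i j where "e = {(i, j), (i + 1, j)}" "(i + 1, j) \<in> \<Lambda> \<or> (i + 1, j + 1) \<in> \<Lambda>"
  | i j where "e = {(i, j - 1), (i, j)}" "(i, j) \<in> \<Lambda> \<or> (i + 1, j) \<in> \<Lambda>"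
proof -
  obtain u v where uv: "e = dual u v" "nn u v" using assms unfolding dE_def by blast
  from uv(2) show ?thesis
  proof (cases rule: nn_cases)
    case (1 x y)
    then have "e = {(x, y - 1), (x, y)}" using dual_set[OF 1] dual_horizontal[of x y] uv(1) by simp
    then show ?thesis using that(2) edge_v assms by blast
  next
    case (2 x y)
    then have "e = {(x - 1, y), (x - 1 + 1, y)}" using dual_set[OF 2] dual_vertical[of x y] uv(1) by simp
    then show ?thesis using that(1) edge_h assms by blast
  qed
qed

text \<open>Since \<open>H \<ge> 1\<close>, primal rows \<open>j \<le> H\<close> go to rows
  \<open>2 * H - j + 1 \<ge> 2\<close>. These lie above the slits, where the strip has full width,
  so every image is present.\<close>

lemma reflected:
  assumes "0 \<le> t" "t \<le> 1"
  shows "reflected_graph t (dE \<Lambda>) H"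
proof unfold_locales
  show "graph (dE \<Lambda>)" by (rule graph_dE[OF fin])
  fix e assume e: "e \<in> dE \<Lambda>" and le: "\<And>v. v \<in> e \<Longrightarrow> snd v \<le> H"
  from e show "refl H ` e \<in> dE \<Lambda>"
  proof (cases rule: edge_cases)
    case (1 i j)
    have "j \<le> H" using le[of "(i, j)"] 1 by simp
    moreover have "- n \<le> j" "1 \<le> i + 1" "i + 1 \<le> l" using 1(2) by (auto simp: mem)
    ultimately have "(i + 1, 2 * H - j + 1) \<in> \<Lambda>" using H by (simp add: mem rtop_def)
    then show ?thesis using edge_h[of i "2 * H - j"] unfolding 1(1) by (simp add: refl_def)
  next
    case (2 i j)
    have "j \<le> H" using le[of "(i, j)"] 2 by simp
    moreover have j: "- n < j" and i: "1 \<le> i \<and> i \<le> l \<or> 1 \<le> i + 1 \<and> i + 1 \<le> l" using 2(2) by (auto simp: mem)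
    ultimately have "(i, 2 * H - j + 1) \<in> \<Lambda> \<or> (i + 1, 2 * H - j + 1) \<in> \<Lambda>" using H by (auto simp: mem rtop_def)
    then have "{(i, 2 * H - j + 1 - 1), (i, 2 * H - j + 1)} \<in> dE \<Lambda>" unfolding edge_v .
    moreover have "refl H ` e = {(i, 2 * H - j + 1 - 1), (i, 2 * H - j + 1)}"
      unfolding 2(1) by (auto simp: refl_def)
    ultimately show ?thesis by simp
  qed
qed (use assms in auto)

lemma dE_grid: "dE \<Lambda> \<subseteq> gridE ({0..l} \<times> {- n..rtop})"
proof
  fix e assume "e \<in> dE \<Lambda>"
  then show "e \<in> gridE ({0..l} \<times> {- n..rtop})"
  proof (cases rule: edge_cases)
    case (1 i j)
    then show ?thesis using gridE_h[of i j "{0..l} \<times> {- n..rtop}"] by (auto simp: mem)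
  next
    case (2 i j)
    then show ?thesis using gridE_v[of i "j - 1" "{0..l} \<times> {- n..rtop}"] by (auto simp: mem)
  qed
qed

text \<open>Between the slits the dual graph contains a full strip whose first and last columns
  carry the endpoints of the contour; it bounds the denominator from below.\<close>

lemma grid_dE: "gridE ({a..b - 1} \<times> {- n..rtop}) \<subseteq> dE \<Lambda>"
proof
  fix e assume "e \<in> gridE ({a..b - 1} \<times> {- n..rtop})"
  then obtain x y where xy: "(x, y) \<in> {a..b - 1} \<times> {- n..rtop}"
    "(x + 1, y) \<in> {a..b - 1} \<times> {- n..rtop} \<and> e = {(x, y), (x + 1, y)} \<or>
     (x, y + 1) \<in> {a..b - 1} \<times> {- n..rtop} \<and> e = {(x, y), (x, y + 1)}" unfolding gridE_iff by blast
  from xy(2) show "e \<in> dE \<Lambda>"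
  proof
    assume h: "(x + 1, y) \<in> {a..b - 1} \<times> {- n..rtop} \<and> e = {(x, y), (x + 1, y)}"
    have "(x + 1, y) \<in> \<Lambda> \<or> (x + 1, y + 1) \<in> \<Lambda>" using xy(1) h ab n H by (cases "y = - n") (auto simp: mem rtop_def)
    then show ?thesis using h edge_h by simp
  next
    assume v: "(x, y + 1) \<in> {a..b - 1} \<times> {- n..rtop} \<and> e = {(x, y), (x, y + 1)}"
    have "(x, y + 1) \<in> \<Lambda> \<or> (x + 1, y + 1) \<in> \<Lambda>" using xy(1) v ab n H by (cases "x = a") (auto simp: mem rtop_def)
    then show ?thesis using v edge_v[of x "y + 1"] by simp
  qed
qed

text \<open>A horizontal reflection puts the right endpoint at the origin. The graph may be enlarged
  to a full rectangle because an upper bound is wanted.\<close>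

lemma numerator:
  assumes t: "0 \<le> t" "t \<le> 1"
  shows "\<exists>T. finite T \<and> cor t (dE \<Lambda>) (b - 1, 0) (a, 2 * H) \<le> cor t (gridE T) (0, 0) (b - 1 - a, 2 * H)"
proof -
  let ?T = "{0..l} \<times> {- n..rtop}"
  define f where "f v = (b - 1 - fst v, snd v)" for v :: site
  have f: "nn (f u) (f v) \<longleftrightarrow> nn u v" for u v unfolding f_def nn_def by (simp add: abs_minus_commute)
  have i: "inj f" unfolding f_def by (rule injI) (auto simp: prod_eq_iff)
  have "cor t (dE \<Lambda>) (b - 1, 0) (a, 2 * H) \<le> cor t (gridE ?T) (b - 1, 0) (a, 2 * H)"
    by (intro cor_mono gridE_graph dE_grid t) auto
  also have "\<dots> = cor t (gridE (f ` ?T)) (f (b - 1, 0)) (f (a, 2 * H))" by (rule cor_grid_image[OF f i, symmetric])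
  finally show ?thesis by (intro exI[of _ "f ` ?T"]) (simp add: f_def)
qed

lemma denominator:
  assumes t: "0 \<le> t" "t \<le> 1"
  shows "cX t (nat (b - 1 - a)) (nat n) 0 \<le> cor t (dE \<Lambda>) (b - 1, 0) (a, 0)"
proof -
  let ?f = "shift (a, 0)"
  have "?f ` strip (nat (b - 1 - a)) (nat n) \<subseteq> {a..b - 1} \<times> {- n..rtop}"
    using ab n H unfolding strip_def shift_def by (auto simp: rtop_def)
  then have g: "gridE (?f ` strip (nat (b - 1 - a)) (nat n)) \<subseteq> dE \<Lambda>" using gridE_mono grid_dE by blast
  have "cX t (nat (b - 1 - a)) (nat n) 0 = cor t (gridE (?f ` strip (nat (b - 1 - a)) (nat n))) (?f (0, 0)) (?f (int (nat (b - 1 - a)), 0))"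
    unfolding cX_def by (rule cor_grid_image[OF nn_shift inj_shift, symmetric])
  also have "\<dots> \<le> cor t (dE \<Lambda>) (?f (0, 0)) (?f (int (nat (b - 1 - a)), 0))"
    by (rule cor_mono[OF graph_dE[OF fin] g t])
  also have "\<dots> = cor t (dE \<Lambda>) (a, 0) (b - 1, 0)" using ab unfolding shift_def by simp
  finally show ?thesis by (simp add: cor_commute)
qed

text \<open>The left endpoint is the reflected one. Stated as a product rather than a quotient, so
  that \<open>cX\<close> may vanish.\<close>

lemma touch_ratio:
  assumes t: "0 \<le> t" "t \<le> 1"
    and Q: "\<And>T. finite T \<Longrightarrow> cor t (gridE T) (0, 0) (b - 1 - a, 2 * H) \<le> Q"
  shows "(\<Sum>F\<in>{F\<in>Pow (dE \<Lambda>). reach H (a, 0) F \<and> bd F = pr (a, 0) (b - 1, 0)}. t ^ card F) * cX t (nat (b - 1 - a)) (nat n) 0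
    \<le> Q * Hsum t (dE \<Lambda>) (pr (a, 0) (b - 1, 0))"
proof -
  interpret r: reflected_graph t "dE \<Lambda>" H by (rule reflected[OF t])
  have low: "F \<inter> r.low = F \<inter> below H" if "F \<subseteq> dE \<Lambda>" for F
    using that unfolding r.low_def below_def by blast
  have Z: "0 < Hsum t (dE \<Lambda>) {}" using Hsum_empty_ge[OF graph_dE[OF fin] t(1)] by simp
  have num: "(\<Sum>F\<in>{F\<in>Pow (dE \<Lambda>). reach H (a, 0) F \<and> bd F = pr (a, 0) (b - 1, 0)}. t ^ card F) \<le> Hsum t (dE \<Lambda>) (pr (b - 1, 0) (a, 2 * H))"
    (is "?W \<le> _")
  proof -
    have "?W = (\<Sum>F\<in>{F\<in>Pow (dE \<Lambda>). (\<exists>p. snd p = H \<and> conn (F \<inter> r.low) (a, 0) p) \<and> bd F = pr (b - 1, 0) (a, 0)}. t ^ card F)"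
      using low by (intro sum.cong) (auto simp: reach_def pr_commute)
    also have "\<dots> \<le> Hsum t (dE \<Lambda>) (pr (b - 1, 0) (refl H (a, 0)))" by (rule r.touch_bound)
    finally show ?thesis by (simp add: refl_def)
  qed
  obtain T where T: "finite T" "cor t (dE \<Lambda>) (b - 1, 0) (a, 2 * H) \<le> cor t (gridE T) (0, 0) (b - 1 - a, 2 * H)"
    using numerator[OF t] by blast
  have "cor t (dE \<Lambda>) (b - 1, 0) (a, 2 * H) \<le> Q" using T(2) Q[OF T(1)] by linarith
  then have A: "Hsum t (dE \<Lambda>) (pr (b - 1, 0) (a, 2 * H)) \<le> Q * Hsum t (dE \<Lambda>) {}" using Z unfolding cor_def by (simp add: field_simps)
  have Q0: "0 \<le> Q" by (rule order_trans[OF cor_nonneg[OF t(1)] Q[of "{}"]]) simp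
  have B: "Hsum t (dE \<Lambda>) {} * cX t (nat (b - 1 - a)) (nat n) 0 \<le> Hsum t (dE \<Lambda>) (pr (a, 0) (b - 1, 0))"
    using denominator[OF t] Z unfolding cor_def by (simp add: field_simps pr_commute)
  have X: "0 \<le> cX t (nat (b - 1 - a)) (nat n) 0" unfolding cX_def by (rule cor_nonneg[OF t(1)])
  have "?W * cX t (nat (b - 1 - a)) (nat n) 0 \<le> (Q * Hsum t (dE \<Lambda>) {}) * cX t (nat (b - 1 - a)) (nat n) 0"
    using num A X by (intro mult_right_mono) auto
  also have "\<dots> \<le> Q * Hsum t (dE \<Lambda>) (pr (a, 0) (b - 1, 0))"
    using mult_left_mono[OF B Q0] by (simp add: mult_ac)
  finally show ?thesis .
qed

text \<open>The two frozen rows make the boundary condition of the truncated strip agree with the one of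
  the strip, whatever the spins further away.\<close>

lemma finite_volume:
  assumes be: "0 < \<beta>" and h: "\<lfloor>h\<rfloor> = H" and Q: "\<And>T. finite T \<Longrightarrow> cor (exp (- 2 * \<beta>)) (gridE T) (0, 0) (b - 1 - a, 2 * H) \<le> Q"
    and xi: "\<And>v. \<xi> v = 1 \<or> \<xi> v = (-1::real)" "\<And>v. v \<notin> S \<Longrightarrow> \<xi> v = eta_strip v"
      "\<And>x. 1 \<le> x \<Longrightarrow> x \<le> l \<Longrightarrow> \<xi> (x, - n) = 1" "\<And>x. 1 \<le> x \<Longrightarrow> x \<le> l \<Longrightarrow> \<xi> (x, rtop + 1) = -1"
  shows "finite_gibbs_prob \<beta> \<Lambda> \<xi> {\<omega>. restrict \<omega> S \<in> reaches_event l a b h} * cX (exp (- 2 * \<beta>)) (nat (b - 1 - a)) (nat n) 0 \<le> Q"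
proof -
  let ?t = "exp (- 2 * \<beta>)"
  let ?A = "{\<omega>. restrict \<omega> S \<in> reaches_event l a b h}"
  have t: "0 \<le> ?t" "?t \<le> 1" using be by auto
  have bottom: "\<xi> (x, - n) = 1" for x
  proof (cases "1 \<le> x \<and> x \<le> l")
    case False
    then have "(x, - n) \<notin> S" by (auto simp: slit_mem)
    then show ?thesis using xi(2) n by (simp add: eta_strip_def)
  qed (use xi(3) in blast)
  have topr: "\<xi> (x, rtop + 1) = -1" for x
  proof (cases "1 \<le> x \<and> x \<le> l")
    case False
    then have "(x, rtop + 1) \<notin> S" by (auto simp: slit_mem)
    then show ?thesis using xi(2) n H by (simp add: eta_strip_def rtop_def)
  qed (use xi(4) in blast)
  have near: "\<xi> u = eta_strip u" if u: "u \<notin> \<Lambda>" "v \<in> \<Lambda>" "nn u v" for u v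
  proof (cases "u \<in> S")
    case True
    obtain x y where xy: "u = (x, y)" by force
    have "y = - n \<or> y = rtop + 1" using u True unfolding xy \<Lambda>_def nn_def by auto
    then show ?thesis
    proof
      assume y: "y = - n"
      then show ?thesis using bottom n unfolding xy by (simp add: eta_strip_def)
    next
      assume y: "y = rtop + 1"
      then show ?thesis using topr n H unfolding xy by (simp add: eta_strip_def rtop_def)
    qed
  qed (use xi(2) in blast)
  have bdx: "bd (oE \<Lambda> \<xi>) = pr (a, 0) (b - 1, 0)"
  proof -
    \<comment> \<open>Next to \<open>\<Lambda>\<close> the boundary condition agrees with
      \<open>eta_strip\<close>, so inserting \<open>eta_strip\<close> inside
      \<open>\<Lambda>\<close> reads off the odd vertices, however \<open>\<xi>\<close> behaves
      further away.\<close>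
    define \<zeta> where "\<zeta> v = (if v \<in> \<Lambda> then eta_strip v else \<xi> v)" for v
    have "bd (oE \<Lambda> \<xi>) = bd (disagreement_edges \<Lambda> \<zeta>)"
      using xi(1) eta_strip_val by (intro bd_dis[symmetric]) (auto simp: \<zeta>_def)
    also have "disagreement_edges \<Lambda> \<zeta> = disagreement_edges \<Lambda> eta_strip"
    proof (rule allD_eq)
      show "disagreement_edges \<Lambda> \<zeta> \<subseteq> allD" "disagreement_edges \<Lambda> eta_strip \<subseteq> allD" using dis_sub dE_sub by blast+
      show "dual u v \<in> disagreement_edges \<Lambda> \<zeta> \<longleftrightarrow> dual u v \<in> disagreement_edges \<Lambda> eta_strip" if "nn u v" for u v
        unfolding dis_mem[OF that] \<zeta>_def using near[of u v] near[of v u] that nn_commute[of u v] by auto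
    qed
    also have "bd (disagreement_edges \<Lambda> eta_strip) = bd (oE \<Lambda> eta_strip)"
      by (rule bd_dis) (auto simp: eta_strip_val)
    finally show ?thesis unfolding bd_oE .
  qed
  have ev: "reach H (a, 0) (disagreement_edges \<Lambda> \<omega>)" if w: "\<omega> \<in> configs \<Lambda> \<xi>" "restrict \<omega> S \<in> reaches_event l a b h" for \<omega>
  proof -
    have wv: "\<omega> v = 1 \<or> \<omega> v = -1" "v \<notin> \<Lambda> \<Longrightarrow> \<omega> v = \<xi> v" for v by (rule configs_val[OF w(1) xi(1)])+
    have wS: "\<omega> v = eta_strip v" if "v \<notin> S" for v using wv(2)[of v] xi(2)[OF that] that unfolding \<Lambda>_def by simp
    obtain p where p: "p \<in> lambda_sites l a b (restrict \<omega> S)" "p \<in> H_star l H"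
      using w(2) unfolding reaches_event_def h by blast
    then have p2: "snd p = H" unfolding H_star_def by auto
    have c: "conn (disagreement_edges S \<omega>) (a, 0) p" by (rule lambda_sites_conn[OF ab wv(1) wS p(1)])
    have "reach H (a, 0) (disagreement_edges S \<omega>)"
    proof (rule reachI[OF _ c])
      show "disagreement_edges S \<omega> \<subseteq> allD" using dis_sub dE_sub by (rule order_trans)
    qed (use H p2 in auto)
    then obtain q where q: "snd q = H" "conn (disagreement_edges S \<omega> \<inter> below H) (a, 0) q" unfolding reach_def by blast
    \<comment> \<open>Row \<open>- n\<close> is constant, so no disagreement edge leads below dual
      row \<open>- n\<close>, and the path stays in the part of the dual graph that belongs to
      \<open>\<Lambda>\<close>.\<close>
    from q(2) have "- n \<le> snd q \<and> conn (disagreement_edges \<Lambda> \<omega> \<inter> below H) (a, 0) q"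
    proof (induction rule: conn_induct)
      case base
      then show ?case using n by simp
    next
      case (step v w)
      have e: "{v, w} \<in> disagreement_edges S \<omega>" "{v, w} \<in> below H" using step(2) by auto
      obtain u u' where uu: "{v, w} = dual u u'" "nn u u'" "u \<in> S \<or> u' \<in> S" "\<omega> u \<noteq> \<omega> u'"
        using e(1) unfolding disagreement_edges_def by blast
      have le: "snd v \<le> H" "snd w \<le> H" using e(2) unfolding below_def by auto
      have "- n \<le> snd w \<and> {v, w} \<in> disagreement_edges \<Lambda> \<omega>"
        using uu(2)
      proof (cases rule: nn_cases)
        case (1 x y)
        have d: "{v, w} = {(x, y - 1), (x, y)}" using dual_set[OF 1] dual_horizontal[of x y] uu(1) by simp
        have s: "(x, y) \<in> S \<or> (x + 1, y) \<in> S" "\<omega> (x, y) \<noteq> \<omega> (x + 1, y)" using uu(3,4) 1 by (auto simp: doubleton_eq_iff)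
        have yH: "y \<le> H" using d le by (auto simp: doubleton_eq_iff)
        have "y \<noteq> - n" 
        proof
          assume y: "y = - n"
          have "(z, y) \<notin> \<Lambda>" for z using y by (simp add: mem)
          then have "\<omega> (z, y) = 1" for z using wv(2) bottom unfolding y by simp
          then show False using s(2) by simp
        qed
        moreover have "- n \<le> snd v" using step by simp
        then have "- n \<le> y" using d by (auto simp: doubleton_eq_iff)
        ultimately have y: "- n < y" by simp
        have "(z, y) \<in> \<Lambda>" if "(z, y) \<in> S" for z using that y yH n H unfolding \<Lambda>_def rtop_def by simp
        then have "dual (x, y) (x + 1, y) \<in> disagreement_edges \<Lambda> \<omega>" unfolding dis_mem[OF nn_h] using s by blast
        then have "{v, w} \<in> disagreement_edges \<Lambda> \<omega>" unfolding d dual_horizontal .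
        moreover have "w \<in> {(x, y - 1), (x, y)}" unfolding d[symmetric] by simp
        then have "- n \<le> snd w" using y by auto
        ultimately show ?thesis by blast
      next
        case (2 x y)
        have d: "{v, w} = {(x - 1, y), (x, y)}" using dual_set[OF 2] dual_vertical[of x y] uu(1) by simp
        have s: "(x, y) \<in> S \<or> (x, y + 1) \<in> S" "\<omega> (x, y) \<noteq> \<omega> (x, y + 1)" using uu(3,4) 2 by (auto simp: doubleton_eq_iff)
        have yH: "y \<le> H" using d le by (auto simp: doubleton_eq_iff)
        have "- n \<le> snd v" using step by simp
        then have y: "- n \<le> y" using d by (auto simp: doubleton_eq_iff)
        have "(x, y) \<in> \<Lambda> \<or> (x, y + 1) \<in> \<Lambda>" using s(1) y yH n H ab by (auto simp: mem slit_mem rtop_def)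
        then have "dual (x, y) (x, y + 1) \<in> disagreement_edges \<Lambda> \<omega>" unfolding dis_mem[OF nn_v] using s by blast
        then have "{v, w} \<in> disagreement_edges \<Lambda> \<omega>" unfolding d dual_vertical .
        moreover have "w \<in> {(x - 1, y), (x, y)}" unfolding d[symmetric] by simp
        then have "- n \<le> snd w" using y by auto
        ultimately show ?thesis by blast
      qed
      then have w: "- n \<le> snd w" "{v, w} \<in> disagreement_edges \<Lambda> \<omega> \<inter> below H" using e(2) by simp_all
      have "conn (disagreement_edges \<Lambda> \<omega> \<inter> below H) (a, 0) v" using step by simp
      from conn_step[OF this w(2)] w(1) show ?case by simp
    qed
    then show ?thesis using q(1) unfolding reach_def by blast
  qed
  define K where "K = exp (\<beta> * nE \<Lambda>)"
  define Z where "Z = Hsum ?t (dE \<Lambda>) (pr (a, 0) (b - 1, 0))"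
  define W where "W = (\<Sum>F\<in>{F\<in>Pow (dE \<Lambda>). reach H (a, 0) F \<and> bd F = pr (a, 0) (b - 1, 0)}. ?t ^ card F)"
  have fc: "finite (configs \<Lambda> \<xi>)" by (rule finite_configs[OF fin])
  have "(\<Sum>\<sigma>\<in>configs \<Lambda> \<xi> \<inter> ?A. boltzmann \<beta> \<Lambda> \<sigma>) \<le> (\<Sum>\<sigma>\<in>{\<sigma>\<in>configs \<Lambda> \<xi>. reach H (a, 0) (disagreement_edges \<Lambda> \<sigma>)}. boltzmann \<beta> \<Lambda> \<sigma>)"
    using ev fc by (intro sum_mono2) (auto simp: boltzmann_def)
  also have "\<dots> = K * W" using duality[where S = \<Lambda> and \<eta> = \<xi> and P = "reach H (a, 0)" and \<beta> = \<beta>, OF fin conn_compl xi(1)] unfolding bdx K_def W_def .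
  finally have num: "(\<Sum>\<sigma>\<in>configs \<Lambda> \<xi> \<inter> ?A. boltzmann \<beta> \<Lambda> \<sigma>) \<le> K * W" .
  have den: "partition_function \<beta> \<Lambda> \<xi> = K * Z"
    using duality[where S = \<Lambda> and \<eta> = \<xi> and P = "\<lambda>_. True" and \<beta> = \<beta>, OF fin conn_compl xi(1)] unfolding bdx K_def Z_def partition_function_def Hsum_def by simp
  have K: "0 < K" unfolding K_def by simp
  have Z: "0 \<le> Z" unfolding Z_def by (rule Hsum_nonneg[OF t(1)])
  have X: "0 \<le> cX ?t (nat (b - 1 - a)) (nat n) 0" unfolding cX_def by (rule cor_nonneg[OF t(1)])
  have Q0: "0 \<le> Q" by (rule order_trans[OF cor_nonneg[OF t(1)] Q[of "{}"]]) simp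
  have WX: "W * cX ?t (nat (b - 1 - a)) (nat n) 0 \<le> Q * Z"
    unfolding W_def Z_def by (rule touch_ratio[OF t Q])
  show ?thesis
  proof (cases "Z = 0")
    \<comment> \<open>Division by zero makes the finite-volume probability 0 in this case.\<close>
    case True
    then show ?thesis unfolding finite_gibbs_prob_def den using Q0 by simp
  next
    case False
    then have Zp: "0 < Z" using Z by simp
    have "finite_gibbs_prob \<beta> \<Lambda> \<xi> ?A \<le> (K * W) / (K * Z)"
      unfolding finite_gibbs_prob_def den using num K Zp by (intro divide_right_mono) auto
    also have "\<dots> = W / Z" using K by simp
    finally have "finite_gibbs_prob \<beta> \<Lambda> \<xi> ?A * cX ?t (nat (b - 1 - a)) (nat n) 0 \<le> W / Z * cX ?t (nat (b - 1 - a)) (nat n) 0"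
      using X by (rule mult_right_mono)
    also have "\<dots> \<le> Q" using WX Zp by (simp add: field_simps)
    finally show ?thesis .
  qed
qed

end

section \<open>The DLR equations\<close>

lemma spin_space_val:
  assumes "\<sigma> \<in> space (spin_space S)" "v \<in> S"
  shows "\<sigma> v = 1 \<or> \<sigma> v = -1"
  using assms unfolding spin_space_def space_PiM by auto

locale gibbs =
  fixes \<beta> :: real and S :: "site set" and \<eta> :: config and \<mu> :: "config measure"
  assumes G: "gibbs_measure \<beta> S \<eta> \<mu>" and eta: "\<And>v. \<eta> v = 1 \<or> \<eta> v = (-1::real)"
begin

lemma prob: "prob_space \<mu>" and sets_mu: "sets \<mu> = sets (spin_space S)"
  using G unfolding gibbs_measure_def by auto

sublocale prob_space \<mu> by (rule prob)

lemma space_mu: "space \<mu> = space (spin_space S)" using sets_mu by (rule sets_eq_imp_space_eq)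

lemma dlr: "finite \<Lambda> \<Longrightarrow> \<Lambda> \<subseteq> S \<Longrightarrow> A \<in> sets \<mu> \<Longrightarrow>
  measure \<mu> A = (\<integral>\<sigma>. finite_gibbs_prob \<beta> \<Lambda> (override_on \<eta> \<sigma> S) {\<omega>. restrict \<omega> S \<in> A} \<partial>\<mu>)"
  using G unfolding gibbs_measure_def by blast

lemma restrict_in:
  assumes "\<sigma> \<in> space \<mu>" "\<Lambda> \<subseteq> S" "\<omega> \<in> configs \<Lambda> (override_on \<eta> \<sigma> S)"
  shows "restrict \<omega> S \<in> space \<mu>" "v \<in> S - \<Lambda> \<Longrightarrow> restrict \<omega> S v = \<sigma> v"
proof -
  have c: "\<forall>v. v \<notin> \<Lambda> \<longrightarrow> \<omega> v = override_on \<eta> \<sigma> S v" "\<forall>v\<in>\<Lambda>. \<omega> v \<in> {-1, 1}"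
    using assms(3) unfolding configs_def by blast+
  have wv: "\<omega> v = \<sigma> v" if "v \<in> S" "v \<notin> \<Lambda>" for v using c(1) that by (simp add: override_on_def del: split_paired_All)
  have "\<omega> v \<in> {-1, 1}" if v: "v \<in> S" for v
  proof (cases "v \<in> \<Lambda>")
    case False
    then show ?thesis using wv[OF v] spin_space_val[OF _ v, of \<sigma>] assms(1) unfolding space_mu by auto
  qed (use c(2) in blast)
  then show "restrict \<omega> S \<in> space \<mu>" unfolding space_mu spin_space_def space_PiM by auto
  show "v \<in> S - \<Lambda> \<Longrightarrow> restrict \<omega> S v = \<sigma> v" using wv by simp
qed

text \<open>\<open>D\<close> is decided by the spins outside \<open>\<Lambda>\<close>, so the
  finite-volume kernel vanishes on \<open>A \<inter> D\<close> when started outside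
  \<open>D\<close>; the DLR equation then bounds the probability of \<open>A\<close> given
  \<open>D\<close>.\<close>

lemma conditional_bound:
  assumes L: "finite \<Lambda>" "\<Lambda> \<subseteq> S" and A: "A \<in> sets \<mu>" and D: "D \<in> sets \<mu>" and r: "0 \<le> r"
    and dep: "\<And>\<sigma> \<omega>. \<sigma> \<in> space \<mu> \<Longrightarrow> \<omega> \<in> space \<mu> \<Longrightarrow> (\<And>v. v \<in> S - \<Lambda> \<Longrightarrow> \<omega> v = \<sigma> v) \<Longrightarrow> \<omega> \<in> D \<Longrightarrow> \<sigma> \<in> D"
    and b: "\<And>\<sigma>. \<sigma> \<in> D \<Longrightarrow> finite_gibbs_prob \<beta> \<Lambda> (override_on \<eta> \<sigma> S) {\<omega>. restrict \<omega> S \<in> A} \<le> r"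
  shows "measure \<mu> (A \<inter> D) \<le> r * measure \<mu> D"
proof -
  have "measure \<mu> (A \<inter> D) = (\<integral>\<sigma>. finite_gibbs_prob \<beta> \<Lambda> (override_on \<eta> \<sigma> S) {\<omega>. restrict \<omega> S \<in> A \<inter> D} \<partial>\<mu>)"
    using A D by (intro dlr[OF L]) auto
  also have "\<dots> \<le> (\<integral>\<sigma>. r * indicator D \<sigma> \<partial>\<mu>)"
  proof (rule integral_mono')
    show "integrable \<mu> (\<lambda>\<sigma>. r * indicator D \<sigma>)" using D by (intro integrable_mult_right integrable_real_indicator) (simp_all add: less_top[symmetric])
    fix \<sigma> assume s: "\<sigma> \<in> space \<mu>"
    show "0 \<le> r * indicator D \<sigma>" using r by (simp add: indicator_def)
    let ?c = "configs \<Lambda> (override_on \<eta> \<sigma> S)"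
    have fc: "finite ?c" by (rule finite_configs[OF L(1)])
    have Z: "0 \<le> partition_function \<beta> \<Lambda> (override_on \<eta> \<sigma> S)"
      unfolding partition_function_def by (intro sum_nonneg) (simp add: boltzmann_def)
    show "finite_gibbs_prob \<beta> \<Lambda> (override_on \<eta> \<sigma> S) {\<omega>. restrict \<omega> S \<in> A \<inter> D} \<le> r * indicator D \<sigma>"
    proof (cases "\<sigma> \<in> D")
      case True
      have "finite_gibbs_prob \<beta> \<Lambda> (override_on \<eta> \<sigma> S) {\<omega>. restrict \<omega> S \<in> A \<inter> D} \<le>
        finite_gibbs_prob \<beta> \<Lambda> (override_on \<eta> \<sigma> S) {\<omega>. restrict \<omega> S \<in> A}"
        unfolding finite_gibbs_prob_def using fc Z by (intro divide_right_mono sum_mono2) (auto simp: boltzmann_def)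
      then show ?thesis using b[OF True] True by simp
    next
      case False
      have "restrict \<omega> S \<notin> D" if "\<omega> \<in> ?c" for \<omega>
        using dep[OF s restrict_in(1)[OF s L(2) that] restrict_in(2)[OF s L(2) that]] False by blast
      then have "?c \<inter> {\<omega>. restrict \<omega> S \<in> A \<inter> D} = {}" by blast
      then show ?thesis using False unfolding finite_gibbs_prob_def by simp
    qed
  qed
  also have "\<dots> = r * measure \<mu> D" using D sets.sets_into_space[OF D] by (simp add: Int_absorb2)
  finally show ?thesis .
qed

end

section \<open>Finite energy\<close>

lemma prod_spin:
  assumes "finite e" "\<And>v. \<sigma> v = 1 \<or> \<sigma> v = (-1::real)"
  shows "(\<Prod>v\<in>e. \<sigma> v) \<le> 1" "- 1 \<le> (\<Prod>v\<in>e. \<sigma> v)"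
proof -
  have "\<bar>\<Prod>v\<in>e. \<sigma> v\<bar> = 1" unfolding abs_prod using assms(2) by (intro prod.neutral) (metis abs_1 abs_minus)
  then show "(\<Prod>v\<in>e. \<sigma> v) \<le> 1" "- 1 \<le> (\<Prod>v\<in>e. \<sigma> v)" by linarith+
qed

lemma nE_le: "finite \<Lambda> \<Longrightarrow> nE \<Lambda> \<le> 4 * card \<Lambda>"
proof -
  assume f: "finite \<Lambda>"
  let ?N = "\<lambda>v::site. {{v, (fst v + 1, snd v)}, {v, (fst v - 1, snd v)}, {v, (fst v, snd v + 1)}, {v, (fst v, snd v - 1)}}"
  have "{e \<in> lattice_edges. e \<inter> \<Lambda> \<noteq> {}} \<subseteq> (\<Union>v\<in>\<Lambda>. ?N v)"
  proof
    fix e assume "e \<in> {e \<in> lattice_edges. e \<inter> \<Lambda> \<noteq> {}}"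
    then obtain u v where "e = {u, v}" "nn u v" "u \<in> \<Lambda> \<or> v \<in> \<Lambda>" unfolding lattice_edges_def by blast
    then obtain u v where e: "e = {u, v}" "nn u v" "u \<in> \<Lambda>"
      by (cases "u \<in> \<Lambda>") (metis insert_commute nn_commute)+
    from e(2) have "e \<in> ?N u"
    proof (cases rule: nn_cases)
      case (1 x y)
      from doubleton_set[OF 1] show ?thesis unfolding e(1) by (elim disjE conjE) simp_all
    next
      case (2 x y)
      from doubleton_set[OF 2] show ?thesis unfolding e(1) by (elim disjE conjE) simp_all
    qed
    then show "e \<in> (\<Union>v\<in>\<Lambda>. ?N v)" using e(3) by (rule UN_I[rotated])
  qed
  then have "nE \<Lambda> \<le> card (\<Union>v\<in>\<Lambda>. ?N v)" unfolding nE_def using f by (intro card_mono) auto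
  also have "\<dots> \<le> (\<Sum>v\<in>\<Lambda>. card (?N v))" by (rule card_UN_le[OF f])
  also have "\<dots> \<le> (\<Sum>v\<in>\<Lambda>. 4)"
  proof (rule sum_mono)
    fix v
    show "card (?N v) \<le> 4" by (rule order_trans[OF card_insert_le_m1]) (auto intro!: order_trans[OF card_insert_le_m1])
  qed
  finally show ?thesis by simp
qed

lemma boltzmann_bounds:
  assumes b: "0 < \<beta>" and f: "finite \<Lambda>" and s: "\<And>v. \<sigma> v = 1 \<or> \<sigma> v = (-1::real)"
  shows "boltzmann \<beta> \<Lambda> \<sigma> \<le> exp (\<beta> * (4 * real (card \<Lambda>)))" "exp (- (\<beta> * (4 * real (card \<Lambda>)))) \<le> boltzmann \<beta> \<Lambda> \<sigma>"
proof -
  let ?E = "{e \<in> lattice_edges. e \<inter> \<Lambda> \<noteq> {}}"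
  have fe: "finite e" if "e \<in> ?E" for e using that unfolding lattice_edges_def by auto
  have "(\<Sum>e\<in>?E. \<Prod>v\<in>e. \<sigma> v) \<le> (\<Sum>e\<in>?E. 1)" "(\<Sum>e\<in>?E. - 1) \<le> (\<Sum>e\<in>?E. \<Prod>v\<in>e. \<sigma> v)"
    by (intro sum_mono prod_spin fe s; assumption)+
  moreover have "real (card ?E) \<le> 4 * real (card \<Lambda>)" using nE_le[OF f] unfolding nE_def by linarith
  ultimately have "- hamiltonian \<Lambda> \<sigma> \<le> 4 * real (card \<Lambda>)" "- (4 * real (card \<Lambda>)) \<le> - hamiltonian \<Lambda> \<sigma>"
    unfolding hamiltonian_def by (simp_all add: sum_negf)
  from this[THEN mult_left_mono, of \<beta>] b
  show "boltzmann \<beta> \<Lambda> \<sigma> \<le> exp (\<beta> * (4 * real (card \<Lambda>)))" "exp (- (\<beta> * (4 * real (card \<Lambda>)))) \<le> boltzmann \<beta> \<Lambda> \<sigma>"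
    unfolding boltzmann_def by simp_all
qed

text \<open>A lower bound for the probability of one configuration on \<open>k\<close> sites: its
  weight is at least \<open>exp (- 4 * \<beta> * k)\<close>, and the partition function has at most
  \<open>2 ^ k\<close> terms of size at most \<open>exp (4 * \<beta> * k)\<close>, because
  \<open>k\<close> sites meet at most \<open>4 * k\<close> edges.\<close>

definition min_weight :: "real \<Rightarrow> nat \<Rightarrow> real" where
  "min_weight \<beta> k = exp (- (\<beta> * (8 * real k))) / 2 ^ k"

lemma finite_energy:
  assumes b: "0 < \<beta>" and f: "finite \<Lambda>" and x: "\<And>v. \<xi> v = 1 \<or> \<xi> v = (-1::real)"
    and w: "\<omega> \<in> configs \<Lambda> \<xi>" "\<omega> \<notin> A"
  shows "finite_gibbs_prob \<beta> \<Lambda> \<xi> A \<le> 1 - min_weight \<beta> (card \<Lambda>)"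
proof -
  let ?c = "configs \<Lambda> \<xi>" and ?k = "\<beta> * (4 * real (card \<Lambda>))"
  have fc: "finite ?c" by (rule finite_configs[OF f])
  have s: "\<sigma> v = 1 \<or> \<sigma> v = -1" if "\<sigma> \<in> ?c" for \<sigma> v by (rule configs_val(1)[OF that x])
  define Z where "Z = partition_function \<beta> \<Lambda> \<xi>"
  have "Z \<le> (\<Sum>\<sigma>\<in>?c. exp ?k)" unfolding Z_def partition_function_def
    by (intro sum_mono boltzmann_bounds b f s)
  also have "\<dots> = real (card ?c) * exp ?k" by simp
  also have "\<dots> \<le> 2 ^ card \<Lambda> * exp ?k"
  proof (rule mult_right_mono)
    show "real (card ?c) \<le> 2 ^ card \<Lambda>" using finite_configs(2)[OF f, of \<xi>] by (metis of_nat_le_iff of_nat_numeral of_nat_power)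
  qed simp
  finally have Z1: "Z \<le> 2 ^ card \<Lambda> * exp ?k" .
  have bw: "exp (- ?k) \<le> boltzmann \<beta> \<Lambda> \<omega>" by (rule boltzmann_bounds(2)[OF b f s[OF w(1)]])
  have "boltzmann \<beta> \<Lambda> \<omega> \<le> Z" unfolding Z_def partition_function_def
    using w(1) fc by (intro member_le_sum) (auto simp: boltzmann_def)
  then have Zp: "0 < Z" using bw by (meson exp_gt_zero less_le_trans)
  have "min_weight \<beta> (card \<Lambda>) * (2 ^ card \<Lambda> * exp ?k) = exp (- ?k)"
    unfolding min_weight_def by (simp flip: exp_add)
  moreover have "0 \<le> min_weight \<beta> (card \<Lambda>)" unfolding min_weight_def by simp
  ultimately have fZ: "min_weight \<beta> (card \<Lambda>) * Z \<le> exp (- ?k)" using mult_left_mono[OF Z1, of "min_weight \<beta> (card \<Lambda>)"] by simp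
  have "(\<Sum>\<sigma>\<in>?c \<inter> A. boltzmann \<beta> \<Lambda> \<sigma>) + boltzmann \<beta> \<Lambda> \<omega> = (\<Sum>\<sigma>\<in>insert \<omega> (?c \<inter> A). boltzmann \<beta> \<Lambda> \<sigma>)"
    using w(2) fc by simp
  also have "\<dots> \<le> Z" unfolding Z_def partition_function_def using w(1) fc by (intro sum_mono2) (auto simp: boltzmann_def)
  finally have "(\<Sum>\<sigma>\<in>?c \<inter> A. boltzmann \<beta> \<Lambda> \<sigma>) \<le> Z - min_weight \<beta> (card \<Lambda>) * Z" using bw fZ by linarith
  then show ?thesis unfolding finite_gibbs_prob_def Z_def[symmetric] using Zp by (simp add: field_simps)
qed

section \<open>Passage to infinite volume by conditioning on frozen rows\<close>

locale slit_gibbs =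
  fixes \<beta> :: real and l a b H :: int and \<mu> :: "config measure"
  assumes be: "0 < \<beta>" and ab: "0 \<le> a" "a + 1 < b" "b \<le> l + 1" and H: "1 \<le> H"
    and Gm: "gibbs_measure \<beta> (slit_strip l a b) eta_strip \<mu>"
begin

sublocale gibbs \<beta> "slit_strip l a b" eta_strip \<mu>
  using Gm eta_strip_val by unfold_locales

abbreviation "S \<equiv> slit_strip l a b"

text \<open>The two rows bordering the truncated strip with parameter \<open>n\<close>; different
  parameters give disjoint sets.\<close>

definition rows :: "nat \<Rightarrow> site set" where
  "rows n = {1..l} \<times> {- int n, int n + 2 * H + 2}"

definition good :: "nat \<Rightarrow> config set" where
  "good n = {\<sigma> \<in> space \<mu>. \<forall>v\<in>rows n. \<sigma> v = eta_strip v}"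

definition nogood :: "nat \<Rightarrow> nat \<Rightarrow> config set" where
  "nogood N M = {\<sigma> \<in> space \<mu>. \<forall>n\<in>{N<..M}. \<sigma> \<notin> good n}"

lemma rows_sub: "1 \<le> n \<Longrightarrow> rows n \<subseteq> S" unfolding rows_def using H by (auto simp: slit_mem)
lemma finite_rows: "finite (rows n)" unfolding rows_def by auto
lemma card_rows: "card (rows n) = nat l * 2" unfolding rows_def using H by (simp add: card_cartesian_product)

lemma spin_set:
  assumes "v \<in> S"
  shows "{\<sigma> \<in> space \<mu>. \<sigma> v = c} \<in> sets \<mu>"
proof (cases "c \<in> {-1, 1}")
  case True
  have "(\<lambda>\<sigma>. \<sigma> v) \<in> spin_space S \<rightarrow>\<^sub>M count_space {-1, 1::real}"
    unfolding spin_space_def using assms by (rule measurable_component_singleton)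
  then have "(\<lambda>\<sigma>. \<sigma> v) -` {c} \<inter> space (spin_space S) \<in> sets (spin_space S)" by (rule measurable_sets) (use True in auto)
  moreover have "(\<lambda>\<sigma>. \<sigma> v) -` {c} \<inter> space (spin_space S) = {\<sigma> \<in> space \<mu>. \<sigma> v = c}" unfolding space_mu by auto
  ultimately show ?thesis unfolding sets_mu by simp
next
  case False
  then have e: "{\<sigma> \<in> space \<mu>. \<sigma> v = c} = {}" using spin_space_val[OF _ assms] unfolding space_mu by force
  show ?thesis unfolding e by simp
qed

lemma good_sets: "1 \<le> n \<Longrightarrow> good n \<in> sets \<mu>"
  unfolding good_def using rows_sub by (intro sets.sets_Collect_finite_All spin_set finite_rows) auto

lemma nogood_sets: "nogood N M \<in> sets \<mu>"
proof -
  have "nogood N M = space \<mu> - (\<Union>n\<in>{N<..M}. good n)" unfolding nogood_def by auto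
  then show ?thesis using good_sets by (auto intro!: sets.Diff sets.finite_UN)
qed

lemma xi_val: "\<sigma> \<in> space \<mu> \<Longrightarrow> override_on eta_strip \<sigma> S v = 1 \<or> override_on eta_strip \<sigma> S v = -1"
  using spin_space_val[of \<sigma> S v] eta_strip_val unfolding space_mu override_on_def by auto

lemma good_dep:
  assumes "\<sigma> \<in> space \<mu>" "\<omega> \<in> space \<mu>" "\<And>v. v \<in> rows n \<Longrightarrow> \<omega> v = \<sigma> v"
  shows "\<omega> \<in> good n \<longleftrightarrow> \<sigma> \<in> good n"
  using assms unfolding good_def by auto

lemma rows_disjoint: "n \<noteq> m \<Longrightarrow> v \<in> rows m \<Longrightarrow> v \<notin> rows n" unfolding rows_def using H by auto

text \<open>Given all other spins, a pair of rows agrees with \<open>eta_strip\<close> with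
  probability at least \<open>min_weight\<close>, so the bounds for successive failures
  multiply.\<close>

lemma nogood_decay: "measure \<mu> (nogood N (N + k)) \<le> (1 - min_weight \<beta> (nat l * 2)) ^ k"
proof (induction k)
  case (Suc k)
  let ?n = "N + Suc k" and ?D = "nogood N (N + k)" and ?A = "space \<mu> - good (N + Suc k)"
  have r: "0 \<le> 1 - min_weight \<beta> (nat l * 2)"
  proof -
    have "exp (- (\<beta> * (8 * real (nat l * 2)))) \<le> 2 ^ (nat l * 2)"
      by (rule order_trans[of _ 1]) (use be in auto)
    then show ?thesis unfolding min_weight_def by (simp add: field_simps)
  qed
  have "nogood N ?n = ?A \<inter> ?D"
  proof -
    have "{N<..?n} = insert ?n {N<..N + k}" by auto
    then show ?thesis unfolding nogood_def by auto
  qed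
  also have "measure \<mu> (?A \<inter> ?D) \<le> (1 - min_weight \<beta> (nat l * 2)) * measure \<mu> ?D"
  proof (rule conditional_bound[of "rows ?n"])
    show "finite (rows ?n)" by (rule finite_rows)
    show "rows ?n \<subseteq> S" by (rule rows_sub) simp
    show "?A \<in> sets \<mu>" using good_sets[of ?n] by auto
    show "?D \<in> sets \<mu>" by (rule nogood_sets)
    show "\<sigma> \<in> ?D" if s: "\<sigma> \<in> space \<mu>" "\<omega> \<in> space \<mu>" "\<And>v. v \<in> S - rows ?n \<Longrightarrow> \<omega> v = \<sigma> v" "\<omega> \<in> ?D" for \<sigma> \<omega>
    proof -
      have "\<omega> \<in> good n \<longleftrightarrow> \<sigma> \<in> good n" if n: "n \<in> {N<..N + k}" for n
      proof (rule good_dep[OF s(1,2)])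
        fix v assume "v \<in> rows n"
        then have "v \<in> S - rows ?n" using rows_disjoint[of ?n n v] rows_sub[of n] n by auto
        then show "\<omega> v = \<sigma> v" by (rule s(3))
      qed
      then show ?thesis using s(1,4) unfolding nogood_def by auto
    qed
    fix \<sigma> assume sD: "\<sigma> \<in> ?D"
    then have s: "\<sigma> \<in> space \<mu>" unfolding nogood_def by simp
    let ?xi = "override_on eta_strip \<sigma> S"
    define \<omega> where "\<omega> v = (if v \<in> rows ?n then eta_strip v else ?xi v)" for v
    have w: "\<omega> \<in> configs (rows ?n) ?xi" unfolding configs_def \<omega>_def using eta_strip_val by auto
    have "restrict \<omega> S \<in> space \<mu>" by (rule restrict_in(1)[OF s _ w]) (rule rows_sub, simp)
    then have "restrict \<omega> S \<in> good ?n" unfolding good_def \<omega>_def using rows_sub[of ?n] by auto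
    then have "\<omega> \<notin> {\<omega>. restrict \<omega> S \<in> ?A}" by simp
    from finite_energy[OF be finite_rows xi_val[OF s] w this]
    show "finite_gibbs_prob \<beta> (rows ?n) ?xi {\<omega>. restrict \<omega> S \<in> ?A} \<le> 1 - min_weight \<beta> (nat l * 2)"
      unfolding card_rows .
  qed (rule r)
  also have "\<dots> \<le> (1 - min_weight \<beta> (nat l * 2)) * (1 - min_weight \<beta> (nat l * 2)) ^ k" using r Suc.IH by (rule mult_left_mono[rotated])
  finally show ?case by simp
qed simp

text \<open>The event is split according to the outermost good pair of rows with index in
  \<open>{N<..N + N}\<close>. On each piece the finite-volume estimate applies, and the event that
  there is no good pair has a probability tending to 0 with \<open>N\<close>.\<close>

lemma reach_bound:
  assumes h: "\<lfloor>h\<rfloor> = H"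
    and Q: "\<And>T. finite T \<Longrightarrow> cor (exp (- 2 * \<beta>)) (gridE T) (0, 0) (b - 1 - a, 2 * H) \<le> Q"
  shows "measure \<mu> (reaches_event l a b h) * Xs (exp (- 2 * \<beta>)) (nat (b - 1 - a)) 0 \<le> Q"
proof -
  let ?t = "exp (- 2 * \<beta>)" and ?m = "nat (b - 1 - a)" and ?A = "reaches_event l a b h"
  have t: "0 \<le> ?t" "?t \<le> 1" using be by auto
  have A: "?A \<in> sets \<mu>" unfolding sets_mu by (rule reaches_event_sets)
  have Q0: "0 \<le> Q" by (rule order_trans[OF cor_nonneg[OF t(1)] Q[of "{}"]]) simp
  let ?X = "\<lambda>N. cX ?t ?m N 0"
  have X0: "0 \<le> ?X N" for N unfolding cX_def by (rule cor_nonneg[OF t(1)])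
  have X1: "?X N \<le> 1" for N unfolding cX_def by (rule cor_le_one[OF gridE_graph t]) simp
  have X1': "?X N \<le> ?X n" if "N \<le> n" for N n using cX_mono(1)[OF t] that unfolding incseq_def by blast
  have step: "measure \<mu> ?A * ?X N \<le> Q + (1 - min_weight \<beta> (nat l * 2)) ^ N" for N
  proof (cases "?X N = 0")
    case True
    have "0 \<le> measure \<mu> (nogood N (N + N))" by simp
    then have "0 \<le> (1 - min_weight \<beta> (nat l * 2)) ^ N" using nogood_decay[of N N] by linarith
    then show ?thesis using True Q0 by simp
  next
    case False
    then have Xp: "0 < ?X N" using X0[of N] by simp
    \<comment> \<open>Taking the largest good index makes \<open>L n\<close> depend only on rows
      with index at least \<open>n\<close>. These lie outside the truncated strip with parameter
      \<open>n\<close>, as \<open>conditional_bound\<close> requires.\<close>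
    define L where "L n = good n \<inter> nogood n (N + N)" for n
    have Ls: "L n \<in> sets \<mu>" if "n \<in> {N<..N + N}" for n unfolding L_def using that by (intro sets.Int good_sets nogood_sets) auto
    have disj: "disjoint_family_on L {N<..N + N}"
    proof (unfold disjoint_family_on_def, intro ballI impI)
      have *: "L n \<inter> L m = {}" if "n < m" "m \<le> N + N" for n m
        using that unfolding L_def nogood_def by auto
      show "L m \<inter> L n = {}" if "m \<in> {N<..N + N}" "n \<in> {N<..N + N}" "m \<noteq> n" for m n
        using *[of n m] *[of m n] that by (cases "m < n") auto
    qed
    have cover: "space \<mu> \<subseteq> (\<Union>n\<in>{N<..N + N}. L n) \<union> nogood N (N + N)"
    proof
      fix \<sigma> assume s: "\<sigma> \<in> space \<mu>"
      show "\<sigma> \<in> (\<Union>n\<in>{N<..N + N}. L n) \<union> nogood N (N + N)"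
      proof (cases "\<exists>n\<in>{N<..N + N}. \<sigma> \<in> good n")
        case True
        let ?G = "{n\<in>{N<..N + N}. \<sigma> \<in> good n}"
        define n where "n = Max ?G"
        have ne: "?G \<noteq> {}" "finite ?G" using True by auto
        have n: "n \<in> ?G" unfolding n_def by (rule Max_in[OF ne(2,1)])
        have "\<sigma> \<notin> good m" if "m \<in> {n<..N + N}" for m
        proof
          assume "\<sigma> \<in> good m"
          then have "m \<in> ?G" using that n by auto
          then have "m \<le> n" unfolding n_def using ne(2) by (intro Max_ge)
          then show False using that by simp
        qed
        then have "\<sigma> \<in> L n" using n s unfolding L_def nogood_def by simp
        then show ?thesis using n by blast
      next
        case False
        then show ?thesis using s unfolding nogood_def by blast
      qed
    qed
    have cond: "measure \<mu> (?A \<inter> L n) \<le> Q / ?X N * measure \<mu> (L n)" if n: "n \<in> {N<..N + N}" for n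
    proof -
      interpret s: slit l a b H "int n" using ab H n by unfold_locales auto
      have top: "s.rtop = int n + 2 * H + 1" by (rule s.rtop_def)
      have outside: "rows m \<inter> s.\<Lambda> = {}" if "n \<le> m" for m
        unfolding rows_def s.\<Lambda>_def top using that by auto
      show ?thesis
      proof (rule conditional_bound[of s.\<Lambda>])
        show "finite s.\<Lambda>" by (rule s.fin)
        show "s.\<Lambda> \<subseteq> S" unfolding s.\<Lambda>_def by auto
        show "?A \<in> sets \<mu>" by (rule A)
        show "L n \<in> sets \<mu>" by (rule Ls[OF n])
        show "0 \<le> Q / ?X N" using Q0 X0[of N] by simp
        show "\<sigma> \<in> L n" if s: "\<sigma> \<in> space \<mu>" "\<omega> \<in> space \<mu>" "\<And>v. v \<in> S - s.\<Lambda> \<Longrightarrow> \<omega> v = \<sigma> v" "\<omega> \<in> L n" for \<sigma> \<omega>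
        proof -
          have g: "\<omega> \<in> good m \<longleftrightarrow> \<sigma> \<in> good m" if m: "n \<le> m" for m
          proof (rule good_dep[OF s(1,2)])
            fix v assume "v \<in> rows m"
            then have "v \<in> S - s.\<Lambda>" using outside[OF m] rows_sub[of m] m n by auto
            then show "\<omega> v = \<sigma> v" by (rule s(3))
          qed
          show ?thesis using s(1,4) g unfolding L_def nogood_def by auto
        qed
        fix \<sigma> assume sL: "\<sigma> \<in> L n"
        then have sg: "\<sigma> \<in> space \<mu>" "\<And>v. v \<in> rows n \<Longrightarrow> \<sigma> v = eta_strip v" unfolding L_def good_def by auto
        let ?xi = "override_on eta_strip \<sigma> S"
        have rS: "v \<in> S" if "v \<in> rows n" for v using rows_sub[of n] n that by auto
        have xr: "?xi v = eta_strip v" if "v \<in> rows n" for v using sg(2)[OF that] rS[OF that] by simp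
        have "finite_gibbs_prob \<beta> s.\<Lambda> ?xi {\<omega>. restrict \<omega> S \<in> ?A} * cX ?t ?m (nat (int n)) 0 \<le> Q"
        proof (rule s.finite_volume[OF be h Q xi_val[OF sg(1)]])
          show "?xi v = eta_strip v" if "v \<notin> S" for v using that by simp
          fix x assume x: "1 \<le> x" "x \<le> l"
          have "(x, - int n) \<in> rows n" "(x, s.rtop + 1) \<in> rows n" unfolding rows_def top using x by auto
          from this[THEN xr] show "?xi (x, - int n) = 1" "?xi (x, s.rtop + 1) = -1"
            using n H by (simp_all add: eta_strip_def top)
        qed
        \<comment> \<open>The denominators increase with \<open>n\<close>, so the one for
          \<open>N\<close> serves for all pieces at once.\<close>
        moreover have "?X N \<le> ?X n" using n by (intro X1') auto
        moreover have g0: "0 \<le> finite_gibbs_prob \<beta> s.\<Lambda> ?xi {\<omega>. restrict \<omega> S \<in> ?A}"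
          unfolding finite_gibbs_prob_def partition_function_def boltzmann_def by (intro divide_nonneg_nonneg sum_nonneg) auto
        ultimately have "finite_gibbs_prob \<beta> s.\<Lambda> ?xi {\<omega>. restrict \<omega> S \<in> ?A} * ?X N \<le> Q"
          using mult_left_mono[of "?X N" "?X n" "finite_gibbs_prob \<beta> s.\<Lambda> ?xi {\<omega>. restrict \<omega> S \<in> ?A}"] by simp
        then show "finite_gibbs_prob \<beta> s.\<Lambda> ?xi {\<omega>. restrict \<omega> S \<in> ?A} \<le> Q / ?X N"
          using Xp by (simp add: pos_le_divide_eq)
      qed
    qed
    have "measure \<mu> ?A \<le> measure \<mu> ((\<Union>n\<in>{N<..N + N}. ?A \<inter> L n) \<union> nogood N (N + N))"
      using cover sets.sets_into_space[OF A] A Ls nogood_sets by (intro finite_measure_mono) (auto intro!: sets.Un sets.finite_UN)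
    also have "\<dots> \<le> measure \<mu> (\<Union>n\<in>{N<..N + N}. ?A \<inter> L n) + measure \<mu> (nogood N (N + N))"
      using A Ls nogood_sets by (intro measure_Un_le) (auto intro!: sets.finite_UN)
    also have "measure \<mu> (\<Union>n\<in>{N<..N + N}. ?A \<inter> L n) \<le> (\<Sum>n\<in>{N<..N + N}. measure \<mu> (?A \<inter> L n))"
      using A Ls by (intro finite_measure_subadditive_finite) auto
    also have "\<dots> \<le> (\<Sum>n\<in>{N<..N + N}. Q / ?X N * measure \<mu> (L n))" by (intro sum_mono cond)
    also have "\<dots> = Q / ?X N * measure \<mu> (\<Union>n\<in>{N<..N + N}. L n)"
      using Ls disj by (subst finite_measure_finite_Union) (auto simp: sum_distrib_left)
    also have "\<dots> \<le> Q / ?X N * 1" using Q0 X0[of N] by (intro mult_left_mono) auto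
    finally have "measure \<mu> ?A \<le> Q / ?X N + measure \<mu> (nogood N (N + N))" by simp
    then have "measure \<mu> ?A \<le> Q / ?X N + (1 - min_weight \<beta> (nat l * 2)) ^ N" using nogood_decay[of N N] by linarith
    then have "measure \<mu> ?A * ?X N \<le> (Q / ?X N + (1 - min_weight \<beta> (nat l * 2)) ^ N) * ?X N" by (rule mult_right_mono[OF _ X0])
    also have "\<dots> = Q + (1 - min_weight \<beta> (nat l * 2)) ^ N * ?X N" using Xp by (simp add: distrib_right)
    also have "(1 - min_weight \<beta> (nat l * 2)) ^ N * ?X N \<le> (1 - min_weight \<beta> (nat l * 2)) ^ N * 1"
    proof (rule mult_left_mono[OF X1])
      have "0 \<le> measure \<mu> (nogood N (N + N))" by simp
      then show "0 \<le> (1 - min_weight \<beta> (nat l * 2)) ^ N" using nogood_decay[of N N] by linarith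
    qed
    finally show ?thesis by simp
  qed
  have d: "0 < min_weight \<beta> (nat l * 2)" "min_weight \<beta> (nat l * 2) \<le> 1"
  proof -
    show "0 < min_weight \<beta> (nat l * 2)" unfolding min_weight_def by simp
    have "0 \<le> measure \<mu> (nogood 0 (0 + 1))" by simp
    also have "\<dots> \<le> 1 - min_weight \<beta> (nat l * 2)" using nogood_decay[of 0 1] by (simp only: power_one_right)
    finally show "min_weight \<beta> (nat l * 2) \<le> 1" by simp
  qed
  have "(\<lambda>N. Q + (1 - min_weight \<beta> (nat l * 2)) ^ N) \<longlonglongrightarrow> Q + 0"
    using d by (intro tendsto_intros LIMSEQ_realpow_zero) auto
  moreover have "(\<lambda>N. measure \<mu> ?A * ?X N) \<longlonglongrightarrow> measure \<mu> ?A * Xs ?t ?m 0"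
    by (intro tendsto_mult_left cX_lim t)
  ultimately show ?thesis using LIMSEQ_le[of "\<lambda>N. measure \<mu> ?A * ?X N" _ "\<lambda>N. Q + (1 - min_weight \<beta> (nat l * 2)) ^ N" "Q + 0"] step by simp
qed

end

lemma lambda_trivial:
  assumes "b = a + 1" "lambda_sites l a b \<sigma> \<inter> H_star l i \<noteq> {}"
  shows "i = 0"
  using assms unfolding lambda_sites_def Let_def H_star_def by auto

context low_temp
begin

text \<open>For \<open>h < 1\<close> the right-hand side of the first bound is at least 1 and the
  second cannot occur; for \<open>b = a + 1\<close> the contour is a point at level 0 and misses
  every positive level.\<close>

lemma event_bounds:
  assumes lab: "1 \<le> l" "0 \<le> a" "a < b" "b \<le> l + 1" and G: "gibbs_measure \<beta> (slit_strip l a b) eta_strip \<mu>" and h0: "0 \<le> h"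
  shows "h \<le> real_of_int l \<Longrightarrow> measure \<mu> (reaches_event l a b h) \<le> Cfin * exp (- \<kappa> * (h^2 / l))"
    "real_of_int l \<le> h \<Longrightarrow> measure \<mu> (reaches_event l a b h) \<le> Cfin * exp (- \<kappa> * h)"
proof -
  let ?P = "measure \<mu> (reaches_event l a b h)"
  interpret p: prob_space \<mu> using G unfolding gibbs_measure_def by blast
  have P1: "?P \<le> 1" by simp
  have C0: "0 \<le> Cfin" using Cfin(1) exp_gt_zero[of \<kappa>] by linarith
  have l1: "1 \<le> real_of_int l" using lab by simp
  have "(h \<le> real_of_int l \<longrightarrow> ?P \<le> Cfin * exp (- \<kappa> * (h^2 / l))) \<and> (real_of_int l \<le> h \<longrightarrow> ?P \<le> Cfin * exp (- \<kappa> * h))"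
  proof (cases "1 \<le> \<lfloor>h\<rfloor>")
    case False
    then have h: "h < 1" by simp
    have "?P \<le> Cfin * exp (- \<kappa> * (h^2 / l))"
    proof -
      have "h^2 \<le> 1" using h h0 by (intro power_le_one) auto
      then have "h^2 / l \<le> 1" using l1 by simp
      then have "\<kappa> * (h^2 / l) \<le> \<kappa> * 1" using kap by (intro mult_left_mono) auto
      then have "1 \<le> exp \<kappa> * exp (- \<kappa> * (h^2 / l))" by (simp flip: exp_add)
      also have "\<dots> \<le> Cfin * exp (- \<kappa> * (h^2 / l))" by (intro mult_right_mono Cfin) auto
      finally show ?thesis using P1 by linarith
    qed
    then show ?thesis using h l1 by auto
  next
    case True
    show ?thesis
    proof (cases "b = a + 1")
      case b: True
      have "reaches_event l a b h = {}" using lambda_trivial[OF b, of l _ "\<lfloor>h\<rfloor>"] True unfolding reaches_event_def by auto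
      then show ?thesis using C0 by simp
    next
      case False
      interpret s: slit_gibbs \<beta> l a b "\<lfloor>h\<rfloor>" \<mu>
        using lab False True beta_pos G by unfold_locales auto
      define m where "m = nat (b - 1 - a)"
      have m: "0 < m" "real m \<le> real_of_int l" "int m = b - 1 - a" unfolding m_def using lab False by auto
      have PX: "?P * Xs t m 0 \<le> Q" if "\<And>S. finite S \<Longrightarrow> cor t (gridE S) (0, 0) (int m, 2 * \<lfloor>h\<rfloor>) \<le> Q" for Q
        using s.reach_bound[OF refl, of Q] that unfolding t_def[symmetric] m(3) m_def[symmetric] by blast
      show ?thesis using final_estimate[OF P1 m(1,2) True PX] by blast
    qed
  qed
  then show "h \<le> real_of_int l \<Longrightarrow> ?P \<le> Cfin * exp (- \<kappa> * (h^2 / l))" "real_of_int l \<le> h \<Longrightarrow> ?P \<le> Cfin * exp (- \<kappa> * h)" by blast+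
qed

end

theorem theorem5p3:
  fixes \<beta> \<kappa> :: real
  assumes "\<beta> > beta_c"
    and "sharp_triangle_constant \<beta> \<kappa>"
  shows "\<exists>C>0. \<forall>l a b :: int. 1 \<le> l \<longrightarrow> 0 \<le> a \<longrightarrow> a < b \<longrightarrow> b \<le> l + 1 \<longrightarrow>
    (\<forall>\<mu>. gibbs_measure \<beta> (slit_strip l a b) eta_strip \<mu> \<longrightarrow>
      (\<forall>x::real. 0 \<le> x \<longrightarrow> x \<le> sqrt (of_int l) \<longrightarrow>
         measure \<mu> (reaches_event l a b (x * sqrt (of_int l))) \<le> C * exp (- \<kappa> * x\<^sup>2)) \<and>
      (\<forall>h::real. h \<ge> of_int l \<longrightarrow>
         measure \<mu> (reaches_event l a b h) \<le> C * exp (- \<kappa> * h)))"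
proof -
  interpret low_temp \<beta> \<kappa> using assms by unfold_locales
  show ?thesis
  proof (intro exI[of _ Cfin] conjI allI impI)
    show "0 < Cfin" using Cfin(1) exp_gt_zero[of \<kappa>] by linarith
    fix l a b \<mu>
    assume lab: "1 \<le> l" "0 \<le> a" "a < b" "b \<le> l + 1" and G: "gibbs_measure \<beta> (slit_strip l a b) eta_strip \<mu>"
    have l0: "0 < real_of_int l" using lab by simp
    show "measure \<mu> (reaches_event l a b (x * sqrt (of_int l))) \<le> Cfin * exp (- \<kappa> * x\<^sup>2)"
      if x: "0 \<le> x" "x \<le> sqrt (of_int l)" for x
    proof -
      let ?h = "x * sqrt (real_of_int l)"
      have "?h \<le> sqrt (of_int l) * sqrt (of_int l)" using x l0 by (intro mult_right_mono) auto
      then have "?h \<le> real_of_int l" using l0 by simp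
      moreover have "?h^2 / l = x^2" using l0 by (simp add: power_mult_distrib)
      ultimately show ?thesis using event_bounds(1)[OF lab G, of ?h] x l0 by simp
    qed
    show "measure \<mu> (reaches_event l a b h) \<le> Cfin * exp (- \<kappa> * h)" if "of_int l \<le> h" for h
      using event_bounds(2)[OF lab G, of h] that l0 by simp
  qed
qed

end
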